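(* There is a universal constant $C_{\mathcal K}\le192$ such that the following holds. Let $(M,\mu)$ be an ergodic $d$-state Markov chain with stationary distribution $\pi$, minimum stationary probability $\pi_\star$ and pseudo-spectral gap $\gamma_{\mathsf{ps}}$, let $X_1,\dots,X_m\sim(M,\mu)$, and let $\delta\in(0,1)$, $\alpha>0$ and $K\in\{1,2,\dots\}$. Let $$\tau_{\delta,m}=\inf\left\{t>0:\left(1+\lceil\ln(2m/t)\rceil_+\right)(d+1)e^{-t}\le\delta\right\}.$$ Then $\tau_{\delta,m}=O\left(\ln\left(\frac{d\ln m}{\delta}\right)\right)$, and: (1) With probability at least $1-\delta$, $$\left|\hat\gamma^{(\alpha)}_{\mathsf{ps}[K]}-\gamma_{\mathsf{ps}}\right|\le\frac1K+2\max_{1\le k\le K}\left\{\frac{1}{k^2}\sum_{r=0}^{k-1}\left(\hat a^{(k,r,\alpha)}+2\hat c^{(k,r,\alpha)}+\left(\hat c^{(k,r,\alpha)}\right)^2\right)\right\},$$ where, with $n_{k,r}=\lfloor(m-r)/k\rfloor$, $$\hat d^{(k,r,\alpha)}=4\tau_{\delta/d,\,n_{k,r}}\sqrt{\frac{d}{N_{\min}^{(k,r)}+d\alpha}}+\frac{2\alpha d}{N_{\min}^{(k,r)}+d\alpha},\qquad \hat a^{(k,r,\alpha)}=\sqrt d\,\frac{N_{\max}^{(k,r)}+d\alpha}{N_{\min}^{(k,r)}+d\alpha}\,\hat d^{(k,r,\alpha)},$$ $$\hat b^{(k,r,\alpha)}=\frac{C_{\mathcal K}}{\gamma_{\mathsf{ps}}\left(\widehat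 M^{(k,r,\alpha)}\right)}\ln\left(2\sqrt{\frac{2(n_{k,r}+d^2\alpha)}{N_{\min}^{(k,r)}+d\alpha}}\right)\hat d^{(k,r,\alpha)},$$ $$\hat c^{(k,r,\alpha)}=\frac12\max_{i\in[d]}\max\left\{\frac{\hat b^{(k,r,\alpha)}}{\hat\pi_i^{(k,r,\alpha)}},\ \frac{\hat b^{(k,r,\alpha)}}{\left[\hat\pi_i^{(k,r,\alpha)}-\hat b^{(k,r,\alpha)}\right]_+}\right\},\qquad \hat\pi_i^{(k,r,\alpha)}=\frac{N_i^{(k,r)}+d\alpha}{n_{k,r}+d^2\alpha}.$$ As $m\to\infty$, the interval widths (the interval for $\pi_\star$ being the one centered at $\hat\pi_\star^{(\alpha)}$ with half-width $\hat b^{(1,0,\alpha)}$, and the interval for $\gamma_{\mathsf{ps}}$ being given by the right-hand side above) asymptotically behave as $$\left|\hat\pi_\star^{(\alpha)}-\pi_\star\right|=\tilde O\left(\frac{\sqrt d}{\gamma_{\mathsf{ps}}\sqrt{\pi_\star m}}\right),\qquad \left|\hat\gamma_{\mathsf{ps}[K]}^{(\alpha)}-\gamma_{\mathsf{ps}}\right|=\tilde O\left(\frac1K+\sqrt{\frac{d}{\pi_\star m}}\left(\sqrt d\,\|M\|_\pi+\frac{1}{\gamma_{\mathsf{ps}}\pi_\star}\right)\right).$$ (2) If moreover $M$ is reversible, with absolute spectral gap $\gamma_\star$, then with probability at least $1-\delta$, $$\left|\hat\gamma_\star^{(\alpha)}-\gamma_\star\right|\le\hat a^{(\alpha)}+2\hat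 c^{(\alpha)}+\left(\hat c^{(\alpha)}\right)^2,\qquad\left|\hat\pi_\star^{(\alpha)}-\pi_\star\right|\le\hat b^{(\alpha)},$$ where $$\hat d^{(\alpha)}=4\tau_{\delta/d,m}\sqrt{\frac{d}{N_{\min}+d\alpha}}+\frac{2\alpha d}{N_{\min}+d\alpha},\qquad\hat a^{(\alpha)}=\sqrt d\,\frac{N_{\max}+d\alpha}{N_{\min}+d\alpha}\,\hat d^{(\alpha)},$$ $$\hat b^{(\alpha)}=\frac{C_{\mathcal K}}{\hat\gamma_\star^{(\alpha)}}\ln\left(2\sqrt{\frac{2(m+d^2\alpha)}{N_{\min}+d\alpha}}\right)\hat d^{(\alpha)},\qquad \hat c^{(\alpha)}=\frac12\max_{i\in[d]}\max\left\{\frac{\hat b^{(\alpha)}}{\frac{N_i+d\alpha}{m+d^2\alpha}},\ \frac{\hat b^{(\alpha)}}{\left[\frac{N_i+d\alpha}{m+d^2\alpha}-\hat b^{(\alpha)}\right]_+}\right\},$$ and as $m\to\infty$ the interval widths asymptotically behave as $$\left|\hat\pi_\star^{(\alpha)}-\pi_\star\right|=\tilde O\left(\frac{\sqrt d}{\gamma_\star\sqrt{\pi_\star m}}\right),\qquad\left|\hat\gamma_\star^{(\alpha)}-\gamma_\star\right|=\tilde O\left(\sqrt{\frac{d}{\pi_\star m}}\left(\sqrt d\,\|M\|_\pi+\frac{1}{\gamma_\star\pi_\star}\right)\right).$$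
   Context: Chains. $[d]=\{1,\dots,d\}$. A $d$-state Markov chain $(M,\mu)$ has a $d\times d$ row-stochastic transition matrix $M$ and initial distribution $\mu$. It is ergodic if $M^k$ is entry-wise positive for some $k\ge1$; then $\pi$ denotes its unique stationary distribution, $\pi_\star=\min_i\pi_i>0$, and $\|M\|_\pi=\max_{i,j}\pi_i/\pi_j$. Time reversal: $M^\dagger(i,j)=\pi(j)M(j,i)/\pi(i)$; $M$ is reversible if $M^\dagger=M$. For a matrix with real eigenvalues $\lambda_1\ge\lambda_2\ge\dots\ge\lambda_d$ (with multiplicity), the spectral gap is $\gamma=1-\lambda_2$ and the absolute spectral gap is $\gamma_\star=1-\max\{\lambda_2,|\lambda_d|\}$. The pseudo-spectral gap of an ergodic $M$ is $\gamma_{\mathsf{ps}}(M)=\max_{k\ge1}\gamma((M^\dagger)^kM^k)/k$. Counts. For $k\ge1$ and $0\le r\le k-1$, the $k$-skipped $r$-offset trajectory is $X_t^{(k,r)}=X_{r+tk}$, $1\le t\le\lfloor(m-r)/k\rfloor$. Put $N_i^{(k,r)}=|\{1\le t\le\lfloor(m-r)/k\rfloor-1:X_t^{(k,r)}=i\}|$, $N_{ij}^{(k,r)}=|\{1\le t\le\lfloor(m-r)/k\rfloor-1:X_t^{(k,r)}=i,\,X_{t+1}^{(k,r)}=j\}|$, $N_{\max}^{(k,r)}=\max_iN_i^{(k,r)}$, $N_{\min}^{(k,r)}=\min_iN_i^{(k,r)}$; $N_i,N_{ij},N_{\max},N_{\min}$ are the same quantities for $k=1,r=0$. Estimators. $\widehat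 M^{(k,r,\alpha)}(i,j)=\frac{N_{ij}^{(k,r)}+\alpha}{N_i^{(k,r)}+d\alpha}$. Let $\widehat L^{(k,r,\alpha)}$ be the matrix with $(i,j)$ entry $\frac{N_{ij}^{(k,r)}+\alpha}{\sqrt{(N_i^{(k,r)}+d\alpha)(N_j^{(k,r)}+d\alpha)}}$, and set $$\hat\gamma^\dagger_{k,r,\alpha}=\gamma\left((\widehat L^{(k,r,\alpha)})^{\top}\widehat L^{(k,r,\alpha)}\right),\qquad\tilde\gamma^\dagger_{k,\alpha}=\frac1k\sum_{r=0}^{k-1}\hat\gamma^\dagger_{k,r,\alpha},\qquad\hat\gamma_{\mathsf{ps}[K]}^{(\alpha)}=\max_{1\le k\le K}\frac{\tilde\gamma^\dagger_{k,\alpha}}{k}.$$ Also $\hat\pi_\star^{(\alpha)}=\min_{i\in[d]}\frac{N_i+d\alpha}{m+d^2\alpha}$. In the reversible case $\hat\gamma_\star^{(\alpha)}$ is the absolute spectral gap of the $\alpha$-smoothed version of the additive reversiblization $\frac12(\widehat M^\dagger+\widehat M)$, i.e. of the matrix with $(i,j)$ entry $\frac{N_{ij}+N_{ji}+2\alpha}{2(N_i+d\alpha)}$ (similar to a symmetric matrix, hence with real eigenvalues). Conventions. $[x]_+=\max\{x,0\}$, $\lceil x\rceil_+=\max\{\lceil x\rceil,0\}$, and $b/0=+\infty$ for $b>0$. $\ln$ is the natural logarithm; $\tilde O$ suppresses logarithmic factors in any of the variables ($m,d,1/\delta,1/\pi_\star,1/\gamma_{\mathsf{ps}}$, etc.).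 The asymptotic statements are for the displayed data-dependent interval widths as $m\to\infty$ with $M,\delta,\alpha,K$ fixed, and hold almost surely.
   Formalization: If the estimated absolute gap is negative, the half-width b (negative as written, making the claim in (2) false) is taken as +∞, as for gap 0; n_{k,r} is taken as 0 when m<r, where the floor is −1 and τ is undefined; d≥2 so that λ_2 exists. *)

theory Defs
  imports "HOL-Probability.Probability" "Jordan_Normal_Form.Char_Poly"
begin

text \<open>
  The state space of a \<open>d\<close>-state chain is \<open>{0,...,d-1}\<close>, following the indexing of the type
  \<open>real mat\<close>; the number of states of a transition matrix is its dimension.
\<close>

section \<open>Markov chains\<close>

definition stochastic_mat :: "nat \<Rightarrow> real mat \<Rightarrow> bool" where
  "stochastic_mat d M \<longleftrightarrow> M \<in> carrier_mat d d \<and>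
     (\<forall>i<d. \<forall>j<d. 0 \<le> M $$ (i, j)) \<and> (\<forall>i<d. (\<Sum>j<d. M $$ (i, j)) = 1)"

text \<open>Distributions vanish outside \<open>{0,...,d-1}\<close>, so that they are determined as functions.\<close>

definition distribution :: "nat \<Rightarrow> (nat \<Rightarrow> real) \<Rightarrow> bool" where
  "distribution d p \<longleftrightarrow> (\<forall>i<d. 0 \<le> p i) \<and> (\<forall>i\<ge>d. p i = 0) \<and> (\<Sum>i<d. p i) = 1"

definition ergodic :: "nat \<Rightarrow> real mat \<Rightarrow> bool" where
  "ergodic d M \<longleftrightarrow> stochastic_mat d M \<and>
     (\<exists>k\<ge>1. \<forall>i<d. \<forall>j<d. 0 < (M ^\<^sub>m k) $$ (i, j))"

text \<open>\<open>X 1, X 2, ...\<close> is a Markov chain with transition matrix \<open>M\<close> and initial distribution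
  \<open>\<mu>\<close>; time starts at 1, and \<open>X 0\<close> plays no role. The sample space type is arbitrary here. A constant
  that is to be the same for all chains has to be quantified outside a fixed sample space type;
  \<open>nat \<Rightarrow> nat\<close>, the type of trajectories, is large enough to carry the law of every chain.\<close>

definition markov_chain ::
    "'w measure \<Rightarrow> (nat \<Rightarrow> 'w \<Rightarrow> nat) \<Rightarrow> real mat \<Rightarrow> (nat \<Rightarrow> real) \<Rightarrow> bool" where
  "markov_chain P X M \<mu> \<longleftrightarrow> prob_space P \<and>
     (\<forall>t\<ge>1. X t \<in> measurable P (count_space UNIV)) \<and>
     (\<forall>n\<ge>1. \<forall>x. (\<forall>t\<in>{1..n}. x t < dim_row M) \<longrightarrow>
        measure P {\<omega> \<in> space P. \<forall>t\<in>{1..n}. X t \<omega> = x t} =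
          \<mu> (x 1) * (\<Prod>t\<in>{1..<n}. M $$ (x t, x (Suc t))))"

definition stationary :: "real mat \<Rightarrow> nat \<Rightarrow> real" where
  "stationary M = (THE p. distribution (dim_row M) p \<and>
     (\<forall>j<dim_row M. (\<Sum>i<dim_row M. p i * M $$ (i, j)) = p j))"

definition pi_star :: "real mat \<Rightarrow> real" where
  "pi_star M = Min (stationary M ` {..<dim_row M})"

definition norm_pi :: "real mat \<Rightarrow> real" where
  "norm_pi M = Max ((\<lambda>(i, j). stationary M i / stationary M j) `
     ({..<dim_row M} \<times> {..<dim_row M}))"

definition time_reversal :: "real mat \<Rightarrow> real mat" where
  "time_reversal M = Matrix.mat (dim_row M) (dim_row M)
     (\<lambda>(i, j). stationary M j * M $$ (j, i) / stationary M i)"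

definition reversible :: "real mat \<Rightarrow> bool" where
  "reversible M \<longleftrightarrow> time_reversal M = M"


section \<open>Spectral gaps\<close>

text \<open>The eigenvalues with algebraic multiplicity, in decreasing order; meaningful for square
  matrices all of whose eigenvalues are real.\<close>

definition eigvals :: "real mat \<Rightarrow> real list" where
  "eigvals A = (THE l. sorted_wrt (\<ge>) l \<and> char_poly A = (\<Prod>a\<leftarrow>l. [:- a, 1:]))"

definition spectral_gap :: "real mat \<Rightarrow> real" where
  "spectral_gap A = 1 - eigvals A ! 1"

definition abs_spectral_gap :: "real mat \<Rightarrow> real" where
  "abs_spectral_gap A = 1 - max (eigvals A ! 1) \<bar>last (eigvals A)\<bar>"

text \<open>For ergodic \<open>M\<close> the gaps lie in \<open>[0,1]\<close> and are not all zero, so the supremum is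
  a maximum.\<close>

definition pseudo_gap :: "real mat \<Rightarrow> real" where
  "pseudo_gap M = (SUP k\<in>{1..}. spectral_gap (time_reversal M ^\<^sub>m k * M ^\<^sub>m k) / real k)"


section \<open>Counts and estimators\<close>

text \<open>Below, \<open>x\<close> is a trajectory \<open>x 1, x 2, ...\<close>, of which the first \<open>m\<close> states are observed.
  The subtraction in \<open>sublen\<close> truncates: if \<open>m < r\<close>, the skipped trajectory has length 0.\<close>

definition sublen :: "nat \<Rightarrow> nat \<Rightarrow> nat \<Rightarrow> nat" where
  "sublen m k r = (m - r) div k"

definition skipped :: "nat \<Rightarrow> nat \<Rightarrow> (nat \<Rightarrow> nat) \<Rightarrow> nat \<Rightarrow> nat" where
  "skipped k r x t = x (r + t * k)"

definition visits :: "nat \<Rightarrow> nat \<Rightarrow> nat \<Rightarrow> (nat \<Rightarrow> nat) \<Rightarrow> nat \<Rightarrow> nat" where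
  "visits m k r x i = card {t \<in> {1..sublen m k r - 1}. skipped k r x t = i}"

definition transitions :: "nat \<Rightarrow> nat \<Rightarrow> nat \<Rightarrow> (nat \<Rightarrow> nat) \<Rightarrow> nat \<Rightarrow> nat \<Rightarrow> nat" where
  "transitions m k r x i j =
     card {t \<in> {1..sublen m k r - 1}. skipped k r x t = i \<and> skipped k r x (t + 1) = j}"

definition visits_max :: "nat \<Rightarrow> nat \<Rightarrow> nat \<Rightarrow> nat \<Rightarrow> (nat \<Rightarrow> nat) \<Rightarrow> nat" where
  "visits_max d m k r x = Max (visits m k r x ` {..<d})"

definition visits_min :: "nat \<Rightarrow> nat \<Rightarrow> nat \<Rightarrow> nat \<Rightarrow> (nat \<Rightarrow> nat) \<Rightarrow> nat" where
  "visits_min d m k r x = Min (visits m k r x ` {..<d})"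

definition M_hat :: "nat \<Rightarrow> real \<Rightarrow> nat \<Rightarrow> nat \<Rightarrow> nat \<Rightarrow> (nat \<Rightarrow> nat) \<Rightarrow> real mat" where
  "M_hat d \<alpha> m k r x = Matrix.mat d d (\<lambda>(i, j).
     (real (transitions m k r x i j) + \<alpha>) / (real (visits m k r x i) + real d * \<alpha>))"

definition L_hat :: "nat \<Rightarrow> real \<Rightarrow> nat \<Rightarrow> nat \<Rightarrow> nat \<Rightarrow> (nat \<Rightarrow> nat) \<Rightarrow> real mat" where
  "L_hat d \<alpha> m k r x = Matrix.mat d d (\<lambda>(i, j).
     (real (transitions m k r x i j) + \<alpha>) /
     sqrt ((real (visits m k r x i) + real d * \<alpha>) * (real (visits m k r x j) + real d * \<alpha>)))"

definition gap_dagger_hat :: "nat \<Rightarrow> real \<Rightarrow> nat \<Rightarrow> nat \<Rightarrow> nat \<Rightarrow> (nat \<Rightarrow> nat) \<Rightarrow> real" where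
  "gap_dagger_hat d \<alpha> m k r x =
     spectral_gap (transpose_mat (L_hat d \<alpha> m k r x) * L_hat d \<alpha> m k r x)"

definition gap_dagger_avg :: "nat \<Rightarrow> real \<Rightarrow> nat \<Rightarrow> nat \<Rightarrow> (nat \<Rightarrow> nat) \<Rightarrow> real" where
  "gap_dagger_avg d \<alpha> m k x = (1 / real k) * (\<Sum>r<k. gap_dagger_hat d \<alpha> m k r x)"

definition pseudo_gap_hat :: "nat \<Rightarrow> real \<Rightarrow> nat \<Rightarrow> nat \<Rightarrow> (nat \<Rightarrow> nat) \<Rightarrow> real" where
  "pseudo_gap_hat d \<alpha> m K x = Max ((\<lambda>k. gap_dagger_avg d \<alpha> m k x / real k) ` {1..K})"

definition pi_hat :: "nat \<Rightarrow> real \<Rightarrow> nat \<Rightarrow> nat \<Rightarrow> nat \<Rightarrow> (nat \<Rightarrow> nat) \<Rightarrow> nat \<Rightarrow> real" where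
  "pi_hat d \<alpha> m k r x i = (real (visits m k r x i) + real d * \<alpha>) / (real (sublen m k r) + (real d)^2 * \<alpha>)"

definition pi_star_hat :: "nat \<Rightarrow> real \<Rightarrow> nat \<Rightarrow> (nat \<Rightarrow> nat) \<Rightarrow> real" where
  "pi_star_hat d \<alpha> m x = Min (pi_hat d \<alpha> m 1 0 x ` {..<d})"

definition abs_gap_hat :: "nat \<Rightarrow> real \<Rightarrow> nat \<Rightarrow> (nat \<Rightarrow> nat) \<Rightarrow> real" where
  "abs_gap_hat d \<alpha> m x = abs_spectral_gap (Matrix.mat d d (\<lambda>(i, j).
     (real (transitions m 1 0 x i j) + real (transitions m 1 0 x j i) + 2 * \<alpha>) /
     (2 * (real (visits m 1 0 x i) + real d * \<alpha>))))"


section \<open>Confidence intervals\<close>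

text \<open>For \<open>m = 0\<close>, the convention \<open>ln 0 = 0\<close> gives the same value of
  \<open>max \<lceil>ln (2 * m / t)\<rceil> 0\<close> as \<open>ln 0 = -\<infinity>\<close> would.\<close>

definition tau :: "nat \<Rightarrow> real \<Rightarrow> nat \<Rightarrow> real" where
  "tau d \<delta> m = Inf {t::real. t > 0 \<and>
     (1 + real_of_int (max \<lceil>ln (2 * real m / t)\<rceil> 0)) * (real d + 1) * exp (- t) \<le> \<delta>}"

definition d_width :: "nat \<Rightarrow> real \<Rightarrow> real \<Rightarrow> nat \<Rightarrow> nat \<Rightarrow> nat \<Rightarrow> (nat \<Rightarrow> nat) \<Rightarrow> real" where
  "d_width d \<alpha> \<delta> m k r x =
     4 * tau d (\<delta> / real d) (sublen m k r) * sqrt (real d / (real (visits_min d m k r x) + real d * \<alpha>)) +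
     2 * \<alpha> * real d / (real (visits_min d m k r x) + real d * \<alpha>)"

definition a_width :: "nat \<Rightarrow> real \<Rightarrow> real \<Rightarrow> nat \<Rightarrow> nat \<Rightarrow> nat \<Rightarrow> (nat \<Rightarrow> nat) \<Rightarrow> real" where
  "a_width d \<alpha> \<delta> m k r x =
     sqrt (real d) * ((real (visits_max d m k r x) + real d * \<alpha>) / (real (visits_min d m k r x) + real d * \<alpha>)) *
     d_width d \<alpha> \<delta> m k r x"

text \<open>
  Widths that may be infinite are of type \<open>ereal\<close>, where \<open>b / 0 = \<infinity>\<close> for \<open>b > 0\<close>.
  The gap estimate \<open>g\<close> in the denominator is the pseudo-spectral gap of \<open>M_hat\<close>, which is
  positive, or \<open>abs_gap_hat\<close>, which may be negative on atypical short trajectories, because the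
  matrix in its definition is only approximately stochastic. A nonpositive \<open>g\<close> carries no
  information and yields the trivial interval of half-width \<open>\<infinity>\<close>, just as \<open>g = 0\<close> does.
\<close>

definition b_width ::
    "real \<Rightarrow> real \<Rightarrow> nat \<Rightarrow> real \<Rightarrow> real \<Rightarrow> nat \<Rightarrow> nat \<Rightarrow> nat \<Rightarrow> (nat \<Rightarrow> nat) \<Rightarrow> ereal" where
  "b_width C g d \<alpha> \<delta> m k r x =
     ereal C / ereal (max g 0) *
     ereal (ln (2 * sqrt (2 * (real (sublen m k r) + (real d)^2 * \<alpha>) / (real (visits_min d m k r x) + real d * \<alpha>)))) *
     ereal (d_width d \<alpha> \<delta> m k r x)"

definition c_width :: "ereal \<Rightarrow> nat \<Rightarrow> real \<Rightarrow> nat \<Rightarrow> nat \<Rightarrow> nat \<Rightarrow> (nat \<Rightarrow> nat) \<Rightarrow> ereal" where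
  "c_width b d \<alpha> m k r x = ereal (1 / 2) *
     Max ((\<lambda>i. max (b / ereal (pi_hat d \<alpha> m k r x i))
                   (b / max (ereal (pi_hat d \<alpha> m k r x i) - b) 0)) ` {..<d})"

definition gap_width ::
    "real \<Rightarrow> real \<Rightarrow> nat \<Rightarrow> real \<Rightarrow> real \<Rightarrow> nat \<Rightarrow> nat \<Rightarrow> nat \<Rightarrow> (nat \<Rightarrow> nat) \<Rightarrow> ereal" where
  "gap_width C g d \<alpha> \<delta> m k r x =
     (let c = c_width (b_width C g d \<alpha> \<delta> m k r x) d \<alpha> m k r x
      in ereal (a_width d \<alpha> \<delta> m k r x) + 2 * c + c^2)"

definition ps_b_width ::
    "real \<Rightarrow> nat \<Rightarrow> real \<Rightarrow> real \<Rightarrow> nat \<Rightarrow> nat \<Rightarrow> nat \<Rightarrow> (nat \<Rightarrow> nat) \<Rightarrow> ereal" where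
  "ps_b_width C d \<alpha> \<delta> m k r x = b_width C (pseudo_gap (M_hat d \<alpha> m k r x)) d \<alpha> \<delta> m k r x"

definition ps_gap_width ::
    "real \<Rightarrow> nat \<Rightarrow> real \<Rightarrow> real \<Rightarrow> nat \<Rightarrow> nat \<Rightarrow> (nat \<Rightarrow> nat) \<Rightarrow> ereal" where
  "ps_gap_width C d \<alpha> \<delta> m K x =
     ereal (1 / real K) + 2 * Max ((\<lambda>k. ereal (1 / (real k)^2) *
       (\<Sum>r<k. gap_width C (pseudo_gap (M_hat d \<alpha> m k r x)) d \<alpha> \<delta> m k r x)) ` {1..K})"

definition rev_b_width ::
    "real \<Rightarrow> nat \<Rightarrow> real \<Rightarrow> real \<Rightarrow> nat \<Rightarrow> (nat \<Rightarrow> nat) \<Rightarrow> ereal" where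
  "rev_b_width C d \<alpha> \<delta> m x = b_width C (abs_gap_hat d \<alpha> m x) d \<alpha> \<delta> m 1 0 x"

definition rev_gap_width ::
    "real \<Rightarrow> nat \<Rightarrow> real \<Rightarrow> real \<Rightarrow> nat \<Rightarrow> (nat \<Rightarrow> nat) \<Rightarrow> ereal" where
  "rev_gap_width C d \<alpha> \<delta> m x = gap_width C (abs_gap_hat d \<alpha> m x) d \<alpha> \<delta> m 1 0 x"

text \<open>
  The factor suppressed by the soft-O notation in the asymptotic widths, up to a universal
  constant; \<open>g\<close> is the gap of the chain. For a fixed chain and \<open>m \<rightarrow> \<infinity>\<close>, an
  additional power of \<open>ln m\<close> would absorb any dependence on \<open>d\<close>, \<open>pi_star\<close> and \<open>g\<close>, so \<open>m\<close>
  enters only through the order \<open>ln (d * ln m / \<delta>)\<close> of \<open>tau\<close>.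
\<close>

definition log_factor :: "nat \<Rightarrow> nat \<Rightarrow> real \<Rightarrow> real \<Rightarrow> real \<Rightarrow> nat \<Rightarrow> real" where
  "log_factor p d \<delta> pst g m = (ln (real d / (\<delta> * pst * g))) ^ p * ln (real d * ln (real m) / \<delta>)"

end

theory Submission
  imports Defs
begin

text \<open>
  Up to a boundary term, signed row sums of \<open>N_ij - N_i M(i,j)\<close> are martingales with bounded increments;
  an exponential moment bound and a union over the \<open>2\<^sup>d\<close> sign vectors control whole rows in
  \<open>l\<^sub>1\<close>, at all skips \<open>k\<close> at once. If the interval is wider than the range of the gaps there is
  nothing to prove. Otherwise \<open>M_hat\<close> is so close to \<open>M\<close> that the observed gap of \<open>M_hat\<close> forces
  \<open>M\<close> itself to contract oscillations after \<open>O(\<Lambda> / g)\<close> steps, and telescoping over these steps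
  shows that \<open>pi_hat\<close> is close to \<open>\<pi>\<close>. Rescaling by \<open>\<surd>\<pi>\<close> turns the gaps into second eigenvalues
  of symmetric matrices, for which the perturbation bound follows from the variational characterization.
  The bias \<open>1/K\<close> arises because the \<open>k\<close>-th term in the pseudo-spectral gap is at most \<open>1/k\<close>.

  For reversible chains the deviations are controlled relative to \<open>N_i\<close> by peeling, and the
  trajectory is closed up into a cycle, for which the visit frequencies are exactly stationary. The
  asymptotic widths follow from the almost sure consistency of all estimators.
\<close>

section \<open>Eigenvalues of symmetric matrices\<close>

text \<open>The gap in a width is the observed one, so every estimate has to run from
  \<open>M_hat\<close> towards \<open>M\<close>. At a skip \<open>k\<close> the skipped trajectory
  may be too short to be of any use although the one at skip 1 is informative. Hence the gap
  observed at \<open>k = 1\<close> is used for all skips, and the factor 2 in front of the maximum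
  pays for this: one copy of the maximum covers the term \<open>k = 1\<close>, the other covers
  skipped estimates whose smallest smoothed count is below 1. The union over skips and offsets
  leaves no trace in \<open>tau\<close>: the threshold at skip \<open>k\<close> grows like
  \<open>sqrt k\<close>, its failure probability is at most \<open>\<delta> / 9^k\<close>, and the
  factor \<open>k\<close> lost in the error is regained by averaging over \<open>r\<close> and
  dividing by \<open>k\<close>. In the general case errors may be divided by the smallest frequency,
  so deviations of absolute size \<open>sqrt n\<close> suffice. The interval for
  \<open>pi_star\<close> allows no such division, which forces deviations relative to
  \<open>N_i\<close> for reversible chains.\<close>

definition ip :: "nat \<Rightarrow> (nat \<Rightarrow> real) \<Rightarrow> (nat \<Rightarrow> real) \<Rightarrow> real" where
  "ip d x y = (\<Sum>i<d. x i * y i)"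

definition mv :: "nat \<Rightarrow> real mat \<Rightarrow> (nat \<Rightarrow> real) \<Rightarrow> nat \<Rightarrow> real" where
  "mv d A x i = (\<Sum>j<d. A $$ (i, j) * x j)"

definition sym_mat :: "nat \<Rightarrow> real mat \<Rightarrow> bool" where
  "sym_mat d A \<longleftrightarrow> A \<in> carrier_mat d d \<and> (\<forall>i<d. \<forall>j<d. A $$ (i, j) = A $$ (j, i))"

lemma ip_sym: "ip d x y = ip d y x"
  by (simp add: ip_def mult.commute)

lemma ip_cong: "(\<And>i. i < d \<Longrightarrow> x i = x' i) \<Longrightarrow> (\<And>i. i < d \<Longrightarrow> y i = y' i) \<Longrightarrow> ip d x y = ip d x' y'"
  by (auto simp: ip_def intro!: sum.cong)

lemma mv_cong: "(\<And>i. i < d \<Longrightarrow> x i = x' i) \<Longrightarrow> mv d A x = mv d A x'"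
  by (auto simp: mv_def intro!: sum.cong)

lemma ip_add_left: "ip d (\<lambda>i. x i + y i) z = ip d x z + ip d y z"
  and ip_add_right: "ip d z (\<lambda>i. x i + y i) = ip d z x + ip d z y"
  and ip_diff_left: "ip d (\<lambda>i. x i - y i) z = ip d x z - ip d y z"
  and ip_diff_right: "ip d z (\<lambda>i. x i - y i) = ip d z x - ip d z y"
  and ip_scale_left: "ip d (\<lambda>i. c * x i) z = c * ip d x z"
  and ip_scale_right: "ip d z (\<lambda>i. c * x i) = c * ip d z x"
  by (simp_all add: ip_def algebra_simps sum.distrib sum_subtractf sum_distrib_left)

lemma ip_sum_left: "ip d (\<lambda>a. \<Sum>k\<in>I. c k * v k a) z = (\<Sum>k\<in>I. c k * ip d (v k) z)"
  unfolding ip_def by (subst sum_distrib_left, subst sum.swap)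
    (auto simp: sum_distrib_right mult.assoc sum_distrib_left intro!: sum.cong)

lemmas ip_linear = ip_add_left ip_add_right ip_diff_left ip_diff_right ip_scale_left ip_scale_right

lemma mv_add: "mv d A (\<lambda>i. x i + y i) = (\<lambda>i. mv d A x i + mv d A y i)"
  and mv_diff: "mv d A (\<lambda>i. x i - y i) = (\<lambda>i. mv d A x i - mv d A y i)"
  and mv_scale: "mv d A (\<lambda>i. c * x i) = (\<lambda>i. c * mv d A x i)"
  by (auto simp: mv_def fun_eq_iff algebra_simps sum.distrib sum_subtractf sum_distrib_left)

lemmas mv_linear = mv_add mv_diff mv_scale

lemma ip_self_nonneg: "0 \<le> ip d x x"
  by (simp add: ip_def sum_nonneg)

lemma ip_self_eq_0_iff: "ip d x x = 0 \<longleftrightarrow> (\<forall>i<d. x i = 0)"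
  by (auto simp: ip_def sum_nonneg_eq_0_iff)

lemma ip_L2_set: "ip d x x = (L2_set x {..<d})\<^sup>2"
  by (simp add: ip_def L2_set_def sum_nonneg power2_eq_square)

lemma ip_mv_sym: "sym_mat d A \<Longrightarrow> ip d (mv d A x) y = ip d x (mv d A y)"
  unfolding ip_def mv_def sum_distrib_left sum_distrib_right
  by (subst sum.swap) (auto simp: sym_mat_def mult_ac intro!: sum.cong)

section \<open>Orthonormal systems and maximizers of the Rayleigh quotient\<close>

definition orthonormal_upto :: "nat \<Rightarrow> nat \<Rightarrow> (nat \<Rightarrow> nat \<Rightarrow> real) \<Rightarrow> bool" where
  "orthonormal_upto d k v \<longleftrightarrow> (\<forall>i<k. \<forall>j<k. ip d (v i) (v j) = (if i = j then 1 else 0))"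

text \<open>\<open>r\<close> is the unit vector at \<open>a\<close> minus its projection
  \<open>s\<close> onto the span of the \<open>v i\<close>. Both \<open>ip d e s\<close> and
  \<open>ip d s s\<close> are the squared length of the projection, so the formula is
  Pythagoras.\<close>

lemma orthonormal_residual_norm:
  assumes v: "orthonormal_upto d k v" and a: "a < d"
  defines "r \<equiv> \<lambda>b. (if b = a then 1 else 0) - (\<Sum>i<k. v i a * v i b)"
  shows "ip d r r = 1 - (\<Sum>i<k. (v i a)\<^sup>2)" and "\<And>i. i < k \<Longrightarrow> ip d r (v i) = 0"
proof -
  define e where "e = (\<lambda>b::nat. if b = a then 1::real else 0)"
  have ev: "ip d e x = x a" for x
    using a by (simp add: ip_def e_def if_distrib[of "\<lambda>z. z * _"] cong: if_cong)
  define s where "s = (\<lambda>b. \<Sum>i<k. v i a * v i b)"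
  have r: "r = (\<lambda>b. e b - s b)" by (simp add: r_def e_def s_def)
  have sv: "ip d s (v i) = v i a" if "i < k" for i
  proof -
    have "ip d s (v i) = (\<Sum>j<k. v j a * ip d (v j) (v i))"
      unfolding s_def by (rule ip_sum_left)
    also have "\<dots> = (\<Sum>j<k. if j = i then v j a else 0)"
      using v that by (intro sum.cong) (auto simp: orthonormal_upto_def)
    finally show ?thesis using that by simp
  qed
  have ss: "ip d s s = (\<Sum>i<k. (v i a)\<^sup>2)"
  proof -
    have "ip d s s = (\<Sum>j<k. v j a * ip d (v j) s)"
      unfolding s_def by (rule ip_sum_left)
    also have "\<dots> = (\<Sum>j<k. (v j a)\<^sup>2)"
      by (intro sum.cong) (auto simp: ip_sym[of _ _ s] sv power2_eq_square)
    finally show ?thesis .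
  qed
  have sa: "s a = (\<Sum>i<k. (v i a)\<^sup>2)" by (simp add: s_def power2_eq_square)
  have ea: "e a = 1" by (simp add: e_def)
  show "ip d r r = 1 - (\<Sum>i<k. (v i a)\<^sup>2)"
    unfolding r ip_linear by (simp add: ev ip_sym[of _ s e] ss sa ea)
  show "ip d r (v i) = 0" if "i < k" for i
    unfolding r ip_linear using sv[OF that] by (simp add: ev)
qed

text \<open>The trace of the projection onto the span is its dimension.\<close>

lemma orthonormal_norm_sum:
  assumes "orthonormal_upto d k v"
  shows "(\<Sum>a<d. \<Sum>i<k. (v i a)\<^sup>2) = real k"
proof -
  have "(\<Sum>a<d. \<Sum>i<k. (v i a)\<^sup>2) = (\<Sum>i<k. ip d (v i) (v i))"
    by (subst sum.swap) (simp add: ip_def power2_eq_square)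
  also have "\<dots> = (\<Sum>i<k. 1)" using assms by (intro sum.cong) (auto simp: orthonormal_upto_def)
  finally show ?thesis by simp
qed

text \<open>The squared projections of the \<open>d\<close> unit vectors sum to
  \<open>k < d\<close>, so some unit vector has a nonzero residual, which is then
  normalized.\<close>

lemma orthonormal_extend:
  assumes v: "orthonormal_upto d k v" and k: "k < d"
  shows "\<exists>u. ip d u u = 1 \<and> (\<forall>i<k. ip d u (v i) = 0)"
proof -
  have "\<exists>a<d. (\<Sum>i<k. (v i a)\<^sup>2) < 1"
  proof (rule ccontr)
    assume "\<not> ?thesis"
    then have "(\<Sum>a<d. \<Sum>i<k. (v i a)\<^sup>2) \<ge> (\<Sum>a<d. 1)" by (intro sum_mono) (metis lessThan_iff not_less)
    with orthonormal_norm_sum[OF v] k show False by simp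
  qed
  then obtain a where a: "a < d" "(\<Sum>i<k. (v i a)\<^sup>2) < 1" by blast
  define r where "r = (\<lambda>b. (if b = a then 1 else 0) - (\<Sum>i<k. v i a * v i b))"
  have r: "ip d r r > 0" "\<And>i. i < k \<Longrightarrow> ip d r (v i) = 0"
    using orthonormal_residual_norm[OF v a(1)] a(2) by (simp_all add: r_def)
  have "ip d (\<lambda>i. (1 / sqrt (ip d r r)) * r i) (\<lambda>i. (1 / sqrt (ip d r r)) * r i) = 1"
    unfolding ip_scale_left ip_scale_right using r(1) by (simp add: field_simps)
  moreover have "\<forall>i<k. ip d (\<lambda>i. (1 / sqrt (ip d r r)) * r i) (v i) = 0"
    unfolding ip_scale_left using r(2) by simp
  ultimately show ?thesis by blast
qed

text \<open>With \<open>d\<close> orthonormal vectors the squared norms of the residuals are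
  nonnegative and sum to 0, so every unit vector is its own projection.\<close>

lemma orthonormal_complete:
  assumes v: "orthonormal_upto d d v" and "a < d" "b < d"
  shows "(\<Sum>i<d. v i a * v i b) = (if a = b then 1 else 0)"
proof -
  define q where "q = (\<lambda>a. 1 - (\<Sum>i<d. (v i a)\<^sup>2))"
  have q: "q a \<ge> 0" if "a < d" for a
    unfolding q_def orthonormal_residual_norm(1)[OF v that, symmetric] by (rule ip_self_nonneg)
  have "(\<Sum>a<d. q a) = 0" unfolding q_def sum_subtractf using orthonormal_norm_sum[OF v] by simp
  then have "q a = 0" using q \<open>a < d\<close> by (subst (asm) sum_nonneg_eq_0_iff) auto
  then have "(if b = a then 1 else 0) - (\<Sum>i<d. v i a * v i b) = 0"
    using orthonormal_residual_norm(1)[OF v \<open>a < d\<close>] \<open>b < d\<close>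
    by (simp add: q_def ip_self_eq_0_iff)
  then show ?thesis by (auto split: if_splits)
qed

text \<open>A continuous function attains its maximum on the compact unit sphere of the orthogonal
  complement; homogeneity extends the bound to all \<open>y\<close>.\<close>

lemma rayleigh_max_exists:
  assumes v: "orthonormal_upto d k v" and k: "k < d"
  shows "\<exists>u. ip d u u = 1 \<and> (\<forall>i<k. ip d u (v i) = 0) \<and>
    (\<forall>y. (\<forall>i<k. ip d y (v i) = 0) \<longrightarrow> ip d y (mv d A y) \<le> ip d u (mv d A u) * ip d y y)"
proof -
  \<comment> \<open>Vectors are functions on all naturals. Fixing the value 0 outside
    \<open>{..<d}\<close> makes the box a product of compact sets, and finite sums of coordinates
    are continuous in the product topology.\<close>
  define Box where "Box = PiE UNIV (\<lambda>i. if i < d then {-1..1::real} else {0})"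
  define C where "C = Box \<inter> {x. ip d x x = 1} \<inter> (\<Inter>i<k. {x. ip d x (v i) = 0})"
  have cB: "compact Box"
    using compactin_PiE[of "\<lambda>i. euclidean" UNIV "\<lambda>i. if i < d then {-1..1::real} else {0}"]
    unfolding Box_def euclidean_product_topology by (auto simp: PiE_eq_empty_iff)
  have cont: "continuous_on UNIV (\<lambda>x. ip d x x)" "\<And>i. continuous_on UNIV (\<lambda>x. ip d x (v i))"
     "continuous_on UNIV (\<lambda>x. ip d x (mv d A x))"
    unfolding ip_def mv_def by (intro continuous_intros continuous_on_product_coordinates)+
  have cC: "compact C" unfolding C_def
    by (intro compact_Int_closed cB closed_INT ballI closed_Collect_eq cont continuous_on_const)
  have mem: "(\<lambda>i. if i < d then c * y i else 0) \<in> C"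
    if y: "\<forall>i<k. ip d y (v i) = 0" "c\<^sup>2 * ip d y y = 1" for y c
  proof -
    let ?z = "\<lambda>i. if i < d then c * y i else 0"
    have z: "ip d ?z w = ip d (\<lambda>i. c * y i) w" "ip d w ?z = ip d w (\<lambda>i. c * y i)" for w
      by (auto intro!: ip_cong)
    have zz: "ip d ?z ?z = 1" using y(2) by (simp only: z ip_linear) (simp add: power2_eq_square)
    have "?z i \<in> {-1..1}" if "i < d" for i
    proof -
      have "(?z i)\<^sup>2 \<le> (\<Sum>i<d. (?z i)\<^sup>2)" using that by (intro member_le_sum) auto
      also have "\<dots> = 1" using zz by (simp add: ip_def power2_eq_square)
      finally show ?thesis by (simp add: abs_square_le_1 abs_le_iff del: power2_eq_square)
    qed
    then have "?z \<in> Box" by (auto simp: Box_def PiE_def extensional_def)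
    then show ?thesis using zz y(1) by (auto simp: C_def z ip_linear)
  qed
  from orthonormal_extend[OF v k] obtain u0 where "ip d u0 u0 = 1" "\<forall>i<k. ip d u0 (v i) = 0" by blast
  from mem[of u0 1] this have ne: "C \<noteq> {}" by auto
  obtain u where u: "u \<in> C" "\<And>y. y \<in> C \<Longrightarrow> ip d y (mv d A y) \<le> ip d u (mv d A u)"
    using continuous_attains_sup[OF cC ne continuous_on_subset[OF cont(3)]] by auto
  have "ip d y (mv d A y) \<le> ip d u (mv d A u) * ip d y y" if y: "\<forall>i<k. ip d y (v i) = 0" for y
  proof (cases "ip d y y = 0")
    case True
    then have "ip d y (mv d A y) = 0" unfolding ip_self_eq_0_iff by (simp add: ip_def)
    with True show ?thesis by simp
  next
    case False
    then have pos: "ip d y y > 0" using ip_self_nonneg[of d y] by linarith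
    define c where "c = 1 / sqrt (ip d y y)"
    have c: "c\<^sup>2 * ip d y y = 1" using pos by (simp add: c_def power_divide)
    let ?z = "\<lambda>i. if i < d then c * y i else 0"
    have "ip d ?z (mv d A ?z) = ip d (\<lambda>i. c * y i) (mv d A (\<lambda>i. c * y i))"
      by (subst mv_cong[of d ?z "\<lambda>i. c * y i"]) (auto intro!: ip_cong)
    also have "\<dots> = c\<^sup>2 * ip d y (mv d A y)" by (simp add: mv_linear ip_linear power2_eq_square)
    finally have "c\<^sup>2 * ip d y (mv d A y) \<le> ip d u (mv d A u)" using u(2)[OF mem[OF y c]] by simp
    then have "ip d y (mv d A y) \<le> ip d u (mv d A u) / c\<^sup>2"
      using c pos by (metis divide_eq_0_iff less_irrefl mult.commute mult_zero_left not_le pos_le_divide_eq zero_less_power2 zero_neq_one zero_power2)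
    also have "1 / c\<^sup>2 = ip d y y" using pos by (simp add: c_def power_divide)
    then have "ip d u (mv d A u) / c\<^sup>2 = ip d u (mv d A u) * ip d y y" by (metis times_divide_eq_right mult.right_neutral)
    finally show ?thesis .
  qed
  with u(1) show ?thesis by (auto simp: C_def)
qed

text \<open>First-order condition at a maximum: the test value \<open>t = a / c\<close> with
  \<open>c > b\<close> would give \<open>2 * c \<le> b\<close> if \<open>a\<close> were not
  0.\<close>

lemma quadratic_nonneg_imp_linear_zero:
  fixes a b :: real
  assumes "\<And>t. 2 * t * a \<le> b * t\<^sup>2"
  shows "a = 0"
proof (rule ccontr)
  assume "a \<noteq> 0"
  define c where "c = \<bar>b\<bar> + 1"
  have c: "c > 0" "b < c" by (auto simp: c_def)
  have "2 * (a / c) * a \<le> b * (a / c)\<^sup>2" by (rule assms)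
  then have "2 * a\<^sup>2 * c \<le> b * a\<^sup>2" using c by (simp add: field_simps power2_eq_square)
  then have "2 * c \<le> b" using \<open>a \<noteq> 0\<close> by (simp add: mult.commute mult.left_commute)
  with c show False by simp
qed

text \<open>The residual \<open>w\<close> is orthogonal to the earlier eigenvectors because
  \<open>A\<close> is symmetric, so \<open>u + t * w\<close> is admissible for all \<open>t\<close>.
  Maximality along this line makes the linear coefficient \<open>ip d w w\<close> vanish.\<close>

lemma rayleigh_max_eigenvector:
  assumes A: "sym_mat d A"
    and ev: "\<forall>i<k. \<forall>a<d. mv d A (v i) a = l i * v i a"
    and u: "ip d u u = 1" "\<forall>i<k. ip d u (v i) = 0"
    and mx: "\<forall>y. (\<forall>i<k. ip d y (v i) = 0) \<longrightarrow> ip d y (mv d A y) \<le> ip d u (mv d A u) * ip d y y"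
  shows "\<forall>a<d. mv d A u a = ip d u (mv d A u) * u a"
proof -
  define q where "q = ip d u (mv d A u)"
  define w where "w = (\<lambda>a. mv d A u a - q * u a)"
  have wv: "ip d w (v i) = 0" if "i < k" for i
  proof -
    have "ip d (mv d A u) (v i) = ip d u (\<lambda>a. l i * v i a)"
      unfolding ip_mv_sym[OF A] using ev that by (intro ip_cong) auto
    then show ?thesis using u that by (simp add: w_def ip_linear)
  qed
  have wu: "ip d w u = 0" using u by (simp add: w_def ip_linear q_def ip_sym)
  have "2 * t * ip d w w \<le> (q * ip d w w - ip d w (mv d A w)) * t\<^sup>2" for t
  proof -
    define y where "y = (\<lambda>a. u a + t * w a)"
    have "\<forall>i<k. ip d y (v i) = 0" using u wv by (simp add: y_def ip_linear)
    with mx have "ip d y (mv d A y) \<le> q * ip d y y" unfolding q_def by blast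
    moreover have "ip d y y = 1 + t\<^sup>2 * ip d w w"
      using u wu by (simp add: y_def ip_linear ip_sym[of d u w] power2_eq_square)
    moreover have "ip d y (mv d A y) = q + 2 * t * ip d w (mv d A u) + t\<^sup>2 * ip d w (mv d A w)"
      using ip_mv_sym[OF A, of u w] ip_sym[of d "mv d A u" w]
      by (simp add: y_def ip_linear mv_linear q_def power2_eq_square algebra_simps)
    moreover have "ip d w (mv d A u) = ip d w w"
      unfolding w_def[unfolded fun_eq_iff]
      using wu by (simp add: w_def ip_linear)
    ultimately show ?thesis by (simp add: algebra_simps)
  qed
  then have "ip d w w = 0" by (rule quadratic_nonneg_imp_linear_zero)
  then show ?thesis by (simp add: ip_self_eq_0_iff w_def q_def)
qed

text \<open>The eigenvectors are found greedily: each maximizes the Rayleigh quotient on the orthogonal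
  complement of its predecessors, which makes the eigenvalues decreasing.\<close>

lemma sym_mat_eigenbasis:
  assumes A: "sym_mat d A"
  obtains v l where "orthonormal_upto d d v" "\<And>i a. i < d \<Longrightarrow> a < d \<Longrightarrow> mv d A (v i) a = l i * v i a"
    "\<And>i j. i \<le> j \<Longrightarrow> j < d \<Longrightarrow> l j \<le> l i"
proof -
  define good where "good = (\<lambda>k v. orthonormal_upto d k v \<and>
     (\<forall>i<k. \<forall>a<d. mv d A (v i) a = ip d (v i) (mv d A (v i)) * v i a) \<and>
     (\<forall>i<k. \<forall>y. (\<forall>j<i. ip d y (v j) = 0) \<longrightarrow> ip d y (mv d A y) \<le> ip d (v i) (mv d A (v i)) * ip d y y))"
  have "\<exists>v. good k v" if "k \<le> d" for k
    using that
  proof (induction k)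
    case 0
    show ?case by (simp add: good_def orthonormal_upto_def)
  next
    case (Suc k)
    then obtain v where v: "good k v" by auto
    obtain u where u: "ip d u u = 1" "\<forall>i<k. ip d u (v i) = 0"
      "\<forall>y. (\<forall>i<k. ip d y (v i) = 0) \<longrightarrow> ip d y (mv d A y) \<le> ip d u (mv d A u) * ip d y y"
      using rayleigh_max_exists[of d k v A] v Suc.prems by (auto simp: good_def)
    have e: "\<forall>a<d. mv d A u a = ip d u (mv d A u) * u a"
      by (rule rayleigh_max_eigenvector[OF A _ u]) (use v in \<open>auto simp: good_def\<close>)
    let ?w = "v(k := u)"
    have "orthonormal_upto d (Suc k) ?w"
      using v u(1,2) ip_sym[of d "v _" u] by (simp add: good_def orthonormal_upto_def less_Suc_eq)
    moreover have "\<forall>i<Suc k. \<forall>a<d. mv d A (?w i) a = ip d (?w i) (mv d A (?w i)) * ?w i a"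
      using v e by (simp add: good_def less_Suc_eq)
    moreover have "\<forall>i<Suc k. \<forall>y. (\<forall>j<i. ip d y (?w j) = 0) \<longrightarrow>
        ip d y (mv d A y) \<le> ip d (?w i) (mv d A (?w i)) * ip d y y"
      using v u(3) by (simp add: good_def less_Suc_eq)
    ultimately have "good (Suc k) ?w" unfolding good_def by blast
    then show ?case by blast
  qed
  then obtain v where v: "good d v" by blast
  define l where "l = (\<lambda>i. ip d (v i) (mv d A (v i)))"
  have "l j \<le> l i" if "i \<le> j" "j < d" for i j
  proof -
    have "\<forall>m<i. ip d (v j) (v m) = 0" using v that by (auto simp: good_def orthonormal_upto_def)
    then have "ip d (v j) (mv d A (v j)) \<le> ip d (v i) (mv d A (v i)) * ip d (v j) (v j)"
      using v that unfolding good_def by auto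
    then show ?thesis using v that by (simp add: l_def good_def orthonormal_upto_def)
  qed
  with v show thesis by (intro that[of v l]) (auto simp: good_def l_def)
qed

text \<open>The roots with multiplicity recover the multiset of entries, and a sorted list is
  determined by its multiset. This is the uniqueness behind the description in
  \<open>eigvals\<close>.\<close>

lemma prod_linear_factors_eqD:
  fixes xs ys :: "real list"
  assumes "sorted_wrt (\<ge>) xs" "sorted_wrt (\<ge>) ys"
    and "(\<Prod>a\<leftarrow>xs. [:- a, 1:]) = (\<Prod>a\<leftarrow>ys. [:- a, 1:])"
  shows "xs = ys"
proof -
  have roots: "proots (\<Prod>a\<leftarrow>zs. [:- a, 1:]) = mset zs" for zs :: "real list"
  proof (induction zs)
    case (Cons a zs)
    have "proots ([:- a, 1:]) = {#a#}"
      by (rule multiset_eqI) (auto simp: order_linear' order_0I)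
    moreover have "(\<Prod>a\<leftarrow>zs. [:- a, 1:]) \<noteq> 0" by (auto simp: prod_list_zero_iff)
    ultimately have "proots ([:- a, 1:] * (\<Prod>a\<leftarrow>zs. [:- a, 1:])) = {#a#} + mset zs"
      using Cons by (subst proots_mult) auto
    then show ?case by (simp only: list.map prod_list.Cons mset.simps) simp
  qed simp
  have "mset (rev xs) = mset (rev ys)" using roots[of xs] roots[of ys] assms(3) by simp
  moreover have "sorted (rev xs)" "sorted (rev ys)" using assms(1,2) by (auto simp: sorted_wrt_rev)
  ultimately show ?thesis by (metis properties_for_sort rev_rev_ident)
qed

lemma eigvals_eqI:
  assumes "sorted_wrt (\<ge>) l" "char_poly A = (\<Prod>a\<leftarrow>l. [:- a, 1:])"
  shows "eigvals A = l"
  unfolding eigvals_def using assms prod_linear_factors_eqD by (intro the_equality) metis+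

text \<open>The eigenvectors are the columns of an orthogonal matrix that conjugates
  \<open>A\<close> to a diagonal one, whose characteristic polynomial is read off. Thus
  \<open>eigvals\<close>, defined through the polynomial, is the list of the successive Rayleigh
  maxima.\<close>

lemma sym_mat_eigvals:
  assumes A: "sym_mat d A"
  obtains v where "orthonormal_upto d d v" "length (eigvals A) = d"
    "\<And>i a. i < d \<Longrightarrow> a < d \<Longrightarrow> mv d A (v i) a = eigvals A ! i * v i a"
    "\<And>i j. i \<le> j \<Longrightarrow> j < d \<Longrightarrow> eigvals A ! j \<le> eigvals A ! i"
proof -
  obtain v l where v: "orthonormal_upto d d v" "\<And>i a. i < d \<Longrightarrow> a < d \<Longrightarrow> mv d A (v i) a = l i * v i a"
    "\<And>i j. i \<le> j \<Longrightarrow> j < d \<Longrightarrow> l j \<le> l i" using sym_mat_eigenbasis[OF A] by blast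
  define V where "V = Matrix.mat d d (\<lambda>(a, i). v i a)"
  define L where "L = Matrix.mat d d (\<lambda>(i, j). if i = j then l i else 0)"
  define W where "W = Matrix.mat d d (\<lambda>(i, a). v i a)"
  have c: "A \<in> carrier_mat d d" "V \<in> carrier_mat d d" "L \<in> carrier_mat d d" "W \<in> carrier_mat d d"
    using A by (auto simp: sym_mat_def V_def L_def W_def)
  have VW: "V * W = 1\<^sub>m d"
    by (rule eq_matI) (use orthonormal_complete[OF v(1)] in
        \<open>auto simp: V_def W_def scalar_prod_def atLeast0LessThan\<close>)
  have WV: "W * V = 1\<^sub>m d"
    by (rule eq_matI) (use v(1) in
        \<open>auto simp: V_def W_def scalar_prod_def atLeast0LessThan orthonormal_upto_def ip_def\<close>)
  have AV: "A * V = V * L"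
  proof (rule eq_matI)
    fix a i assume "a < dim_row (V * L)" "i < dim_col (V * L)"
    then have ai: "a < d" "i < d" using c by auto
    have "(A * V) $$ (a, i) = mv d A (v i) a" using ai c
      by (auto simp: V_def scalar_prod_def atLeast0LessThan mv_def intro!: sum.cong)
    moreover have "(V * L) $$ (a, i) = (\<Sum>j<d. v j a * (if j = i then l j else 0))" using ai c
      by (auto simp: V_def L_def scalar_prod_def atLeast0LessThan intro!: sum.cong)
    ultimately show "(A * V) $$ (a, i) = (V * L) $$ (a, i)" using v(2)[OF ai(2,1)] ai
      by (simp add: if_distrib[of "\<lambda>z. _ * z"] cong: if_cong)
  qed (use c in auto)
  have "A = V * L * W"
    using c VW AV by (metis assoc_mult_mat right_mult_one_mat)
  then have "similar_mat A L" using c VW WV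
    by (intro similar_matI[of _ _ V W d]) auto
  then have "char_poly A = char_poly L" by (rule char_poly_similar)
  also have "\<dots> = (\<Prod>a\<leftarrow>diag_mat L. [:- a, 1:])"
    by (rule char_poly_upper_triangular[OF c(3)]) (auto simp: L_def)
  also have "diag_mat L = map l [0..<d]" using c by (auto simp: diag_mat_def L_def)
  finally have "char_poly A = (\<Prod>a\<leftarrow>map l [0..<d]. [:- a, 1:])" .
  moreover have "sorted_wrt (\<ge>) (map l [0..<d])"
    using v(3) by (auto simp: sorted_wrt_iff_nth_less)
  ultimately have "eigvals A = map l [0..<d]" by (intro eigvals_eqI)
  with v show thesis by (intro that[of v]) auto
qed

section \<open>Parseval's identity and variational bounds for the second and the last
  eigenvalue\<close>

lemma orthonormal_parseval:
  assumes v: "orthonormal_upto d d v"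
  shows "(\<Sum>i<d. ip d x (v i) * ip d y (v i)) = ip d x y"
proof -
  have "(\<Sum>i<d. ip d x (v i) * ip d y (v i)) = (\<Sum>i<d. \<Sum>a<d. \<Sum>b<d. x a * y b * (v i a * v i b))"
    by (simp add: ip_def sum_product mult_ac)
  also have "\<dots> = (\<Sum>a<d. \<Sum>i<d. \<Sum>b<d. x a * y b * (v i a * v i b))" by (rule sum.swap)
  also have "\<dots> = (\<Sum>a<d. \<Sum>b<d. \<Sum>i<d. x a * y b * (v i a * v i b))"
    by (intro sum.cong refl sum.swap)
  also have "\<dots> = (\<Sum>a<d. \<Sum>b<d. x a * y b * (if a = b then 1 else 0))"
    by (intro sum.cong refl) (simp add: sum_distrib_left[symmetric] orthonormal_complete[OF v])
  also have "\<dots> = ip d x y"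
    by (simp add: ip_def if_distrib[of "\<lambda>z. _ * z"] cong: if_cong)
  finally show ?thesis .
qed

lemma eigenbasis_quadratic_form:
  assumes A: "sym_mat d A" and v: "orthonormal_upto d d v"
    and ev: "\<And>i a. i < d \<Longrightarrow> a < d \<Longrightarrow> mv d A (v i) a = l i * v i a"
  shows "ip d x (mv d A x) = (\<Sum>i<d. l i * (ip d x (v i))\<^sup>2)"
proof -
  have "ip d (mv d A x) (v i) = l i * ip d x (v i)" if "i < d" for i
  proof -
    have "ip d (mv d A x) (v i) = ip d x (\<lambda>a. l i * v i a)"
      unfolding ip_mv_sym[OF A] by (intro ip_cong) (auto simp: ev that)
    then show ?thesis by (simp add: ip_linear)
  qed
  then have "(\<Sum>i<d. l i * (ip d x (v i))\<^sup>2) = (\<Sum>i<d. ip d x (v i) * ip d (mv d A x) (v i))"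
    by (intro sum.cong) (auto simp: power2_eq_square)
  then show ?thesis by (simp add: orthonormal_parseval[OF v])
qed

text \<open>One half of the min-max principle: the span of the two leading eigenvectors contains a
  nonzero vector orthogonal to \<open>w\<close>, and on that span the Rayleigh quotient is at least
  the second eigenvalue.\<close>

lemma second_eigval_le:
  assumes A: "sym_mat d A" and d: "2 \<le> d"
    and c: "\<And>x. ip d x w = 0 \<Longrightarrow> ip d x (mv d A x) \<le> c * ip d x x"
  shows "eigvals A ! 1 \<le> c"
proof -
  obtain v where v: "orthonormal_upto d d v"
    "\<And>i a. i < d \<Longrightarrow> a < d \<Longrightarrow> mv d A (v i) a = eigvals A ! i * v i a"
    "\<And>i j. i \<le> j \<Longrightarrow> j < d \<Longrightarrow> eigvals A ! j \<le> eigvals A ! i"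
    using sym_mat_eigvals[OF A] by metis
  have o: "ip d (v 0) (v 0) = 1" "ip d (v 1) (v 1) = 1" "ip d (v 0) (v 1) = 0" "ip d (v 1) (v 0) = 0"
    using v(1) d by (auto simp: orthonormal_upto_def)
  note o' = o[unfolded One_nat_def]
  have m: "ip d x (mv d A (v i)) = eigvals A ! i * ip d x (v i)" if "i < d" for x i
  proof -
    have "ip d x (mv d A (v i)) = ip d x (\<lambda>a. eigvals A ! i * v i a)"
      using v(2)[OF that] by (intro ip_cong) auto
    then show ?thesis by (simp add: ip_linear)
  qed
  have le: "eigvals A ! 1 \<le> eigvals A ! 0" using v(3)[of 0 1] d by auto
  obtain a b :: real where ab: "a\<^sup>2 + b\<^sup>2 > 0" "a * ip d (v 0) w + b * ip d (v 1) w = 0"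
  proof (cases "ip d (v 0) w = 0 \<and> ip d (v 1) w = 0")
    case True then show ?thesis by (intro that[of 1 0]) auto
  next
    case False then show ?thesis
      by (intro that[of "ip d (v 1) w" "- ip d (v 0) w"]) (auto simp: sum_power2_gt_zero_iff)
  qed
  define x where "x = (\<lambda>i. a * v 0 i + b * v 1 i)"
  have "ip d x (mv d A x) \<le> c * ip d x x"
    by (rule c) (use ab in \<open>simp add: x_def ip_linear\<close>)
  moreover have "ip d x x = a\<^sup>2 + b\<^sup>2" by (simp add: x_def ip_linear o' power2_eq_square)
  moreover have "ip d x (mv d A x) = a\<^sup>2 * eigvals A ! 0 + b\<^sup>2 * eigvals A ! 1"
    using d by (simp add: x_def ip_linear mv_linear m o' power2_eq_square)
  moreover have "a\<^sup>2 * eigvals A ! 1 \<le> a\<^sup>2 * eigvals A ! 0" using le by (simp add: mult_left_mono)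
  ultimately have "(a\<^sup>2 + b\<^sup>2) * eigvals A ! 1 \<le> (a\<^sup>2 + b\<^sup>2) * c" by (simp add: algebra_simps)
  with ab(1) show ?thesis by simp
qed

text \<open>\<open>u\<close> is a fixed vector, possibly different from the leading eigenvector
  \<open>v 0\<close>. The span of \<open>u\<close> and \<open>x\<close> contains a nonzero
  \<open>y\<close> orthogonal to \<open>v 0\<close>, so the quotient of \<open>y\<close> is at most
  the second eigenvalue. It is a weighted mean of the quotients of \<open>u\<close> and
  \<open>x\<close>, of which that of \<open>x\<close> is the smaller one by
  \<open>q\<close>.\<close>

lemma rayleigh_le_second_eigval:
  assumes A: "sym_mat d A" and d: "2 \<le> d"
    and u: "ip d u u = 1" "\<And>i. i < d \<Longrightarrow> mv d A u i = u i"
    and x: "ip d x u = 0" and q: "ip d x (mv d A x) \<le> ip d x x"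
  shows "ip d x (mv d A x) \<le> eigvals A ! 1 * ip d x x"
proof (cases "ip d x x = 0")
  case True
  then have "ip d x (mv d A x) = 0" unfolding ip_self_eq_0_iff by (simp add: ip_def)
  with True show ?thesis by simp
next
  case False
  then have xx: "ip d x x > 0" using ip_self_nonneg[of d x] by linarith
  obtain v where v: "orthonormal_upto d d v"
    "\<And>i a. i < d \<Longrightarrow> a < d \<Longrightarrow> mv d A (v i) a = eigvals A ! i * v i a"
    "\<And>i j. i \<le> j \<Longrightarrow> j < d \<Longrightarrow> eigvals A ! j \<le> eigvals A ! i"
    using sym_mat_eigvals[OF A] by metis
  have top: "ip d y (mv d A y) \<le> eigvals A ! 1 * ip d y y" if y: "ip d y (v 0) = 0" for y
  proof -
    have "ip d y (mv d A y) = (\<Sum>i<d. eigvals A ! i * (ip d y (v i))\<^sup>2)"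
      by (rule eigenbasis_quadratic_form[OF A v(1,2)])
    also have "\<dots> \<le> (\<Sum>i<d. eigvals A ! 1 * (ip d y (v i))\<^sup>2)"
    proof (intro sum_mono)
      fix i assume i: "i \<in> {..<d}"
      show "eigvals A ! i * (ip d y (v i))\<^sup>2 \<le> eigvals A ! 1 * (ip d y (v i))\<^sup>2"
        by (cases "i = 0") (use y v(3)[of 1 i] i in \<open>auto intro!: mult_right_mono\<close>)
    qed
    also have "\<dots> = eigvals A ! 1 * ip d y y"
      unfolding sum_distrib_left[symmetric] using orthonormal_parseval[OF v(1), of y y]
      by (simp add: power2_eq_square)
    finally show ?thesis .
  qed
  have Au: "ip d y (mv d A u) = ip d y u" for y using u(2) by (intro ip_cong) auto
  obtain a b :: real where ab: "a\<^sup>2 + b\<^sup>2 > 0" "a * ip d u (v 0) + b * ip d x (v 0) = 0"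
  proof (cases "ip d u (v 0) = 0 \<and> ip d x (v 0) = 0")
    case True then show ?thesis by (intro that[of 1 0]) auto
  next
    case False then show ?thesis
      by (intro that[of "ip d x (v 0)" "- ip d u (v 0)"]) (auto simp: sum_power2_gt_zero_iff)
  qed
  define y where "y = (\<lambda>i. a * u i + b * x i)"
  have "ip d y (mv d A y) \<le> eigvals A ! 1 * ip d y y"
    by (rule top) (use ab in \<open>simp add: y_def ip_linear\<close>)
  moreover have yy: "ip d y y = a\<^sup>2 + b\<^sup>2 * ip d x x"
    using u x ip_sym[of d u x] by (simp add: y_def ip_linear power2_eq_square)
  moreover have "ip d u (mv d A x) = 0"
    using x Au[of x] ip_mv_sym[OF A, of u x] ip_sym[of d "mv d A u" x] by simp
  then have "ip d y (mv d A y) = a\<^sup>2 + b\<^sup>2 * ip d x (mv d A x)"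
    using u x by (simp add: y_def ip_linear mv_linear Au power2_eq_square)
  ultimately have "a\<^sup>2 + b\<^sup>2 * ip d x (mv d A x) \<le> eigvals A ! 1 * (a\<^sup>2 + b\<^sup>2 * ip d x x)" by simp
  moreover have "a\<^sup>2 * ip d x (mv d A x) \<le> a\<^sup>2 * ip d x x" using q by (simp add: mult_left_mono)
  ultimately have "(a\<^sup>2 + b\<^sup>2 * ip d x x) * ip d x (mv d A x)
      \<le> (a\<^sup>2 + b\<^sup>2 * ip d x x) * (eigvals A ! 1 * ip d x x)"
    using mult_left_mono[of "a\<^sup>2 + b\<^sup>2 * ip d x (mv d A x)" "eigvals A ! 1 * (a\<^sup>2 + b\<^sup>2 * ip d x x)" "ip d x x"] xx
    by (simp add: algebra_simps)
  moreover have "a\<^sup>2 + b\<^sup>2 * ip d x x > 0" using ab(1) xx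
    by (metis add_pos_nonneg add_cancel_right_left mult_pos_pos zero_le_power2 zero_less_power2 less_eq_real_def add_nonneg_pos zero_le_mult_iff)
  ultimately show ?thesis by simp
qed

lemma last_eigval:
  assumes A: "sym_mat d A" and d: "1 \<le> d"
  shows "last (eigvals A) * ip d x x \<le> ip d x (mv d A x)"
    and "\<exists>u. ip d u u = 1 \<and> ip d u (mv d A u) = last (eigvals A)"
proof -
  obtain v where v: "orthonormal_upto d d v" "length (eigvals A) = d"
    "\<And>i a. i < d \<Longrightarrow> a < d \<Longrightarrow> mv d A (v i) a = eigvals A ! i * v i a"
    "\<And>i j. i \<le> j \<Longrightarrow> j < d \<Longrightarrow> eigvals A ! j \<le> eigvals A ! i"
    using sym_mat_eigvals[OF A] by metis
  have l: "last (eigvals A) = eigvals A ! (d - 1)" using v(2) d by (subst last_conv_nth) auto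
  have "last (eigvals A) * ip d x x = (\<Sum>i<d. eigvals A ! (d - 1) * (ip d x (v i))\<^sup>2)"
    unfolding l sum_distrib_left[symmetric] using orthonormal_parseval[OF v(1), of x x]
    by (simp add: power2_eq_square)
  also have "\<dots> \<le> (\<Sum>i<d. eigvals A ! i * (ip d x (v i))\<^sup>2)"
    using v(4) d by (intro sum_mono mult_right_mono) auto
  also have "\<dots> = ip d x (mv d A x)" by (rule eigenbasis_quadratic_form[OF A v(1,3), symmetric])
  finally show "last (eigvals A) * ip d x x \<le> ip d x (mv d A x)" .
  have "ip d (v (d - 1)) (mv d A (v (d - 1))) = ip d (v (d - 1)) (\<lambda>a. eigvals A ! (d - 1) * v (d - 1) a)"
    using v(3) d by (intro ip_cong) auto
  also have "\<dots> = last (eigvals A)" using v(1) d by (simp add: ip_linear l orthonormal_upto_def)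
  finally show "\<exists>u. ip d u u = 1 \<and> ip d u (mv d A u) = last (eigvals A)"
    using v(1) d by (intro exI[of _ "v (d - 1)"]) (auto simp: orthonormal_upto_def)
qed

text \<open>Weyl's inequality: the hyperplane orthogonal to the leading eigenvector of
  \<open>B\<close> serves as test space for the second eigenvalue of \<open>A\<close>.\<close>

lemma second_eigval_perturb_le:
  assumes A: "sym_mat d A" and B: "sym_mat d B" and d: "2 \<le> d"
    and e: "\<And>x. \<bar>ip d x (mv d A x) - ip d x (mv d B x)\<bar> \<le> e * ip d x x"
  shows "eigvals A ! 1 \<le> eigvals B ! 1 + e"
proof -
  obtain v where v: "orthonormal_upto d d v"
    "\<And>i a. i < d \<Longrightarrow> a < d \<Longrightarrow> mv d B (v i) a = eigvals B ! i * v i a"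
    "\<And>i j. i \<le> j \<Longrightarrow> j < d \<Longrightarrow> eigvals B ! j \<le> eigvals B ! i"
    using sym_mat_eigvals[OF B] by metis
  have top: "ip d y (mv d B y) \<le> eigvals B ! 1 * ip d y y" if y: "ip d y (v 0) = 0" for y
  proof -
    have "ip d y (mv d B y) = (\<Sum>i<d. eigvals B ! i * (ip d y (v i))\<^sup>2)"
      by (rule eigenbasis_quadratic_form[OF B v(1,2)])
    also have "\<dots> \<le> (\<Sum>i<d. eigvals B ! 1 * (ip d y (v i))\<^sup>2)"
    proof (intro sum_mono)
      fix i assume i: "i \<in> {..<d}"
      show "eigvals B ! i * (ip d y (v i))\<^sup>2 \<le> eigvals B ! 1 * (ip d y (v i))\<^sup>2"
        by (cases "i = 0") (use y v(3)[of 1 i] i in \<open>auto intro!: mult_right_mono\<close>)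
    qed
    also have "\<dots> = eigvals B ! 1 * ip d y y"
      unfolding sum_distrib_left[symmetric] using orthonormal_parseval[OF v(1), of y y]
      by (simp add: power2_eq_square)
    finally show ?thesis .
  qed
  show ?thesis
  proof (rule second_eigval_le[OF A d, of "v 0"])
    fix x assume "ip d x (v 0) = 0"
    from top[OF this] e[of x] show "ip d x (mv d A x) \<le> (eigvals B ! 1 + e) * ip d x x"
      by (simp add: algebra_simps)
  qed
qed

lemma last_eigval_perturb_le:
  assumes A: "sym_mat d A" and B: "sym_mat d B" and d: "1 \<le> d"
    and e: "\<And>x. \<bar>ip d x (mv d A x) - ip d x (mv d B x)\<bar> \<le> e * ip d x x"
  shows "last (eigvals A) \<le> last (eigvals B) + e"
proof -
  obtain u where u: "ip d u u = 1" "ip d u (mv d B u) = last (eigvals B)"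
    using last_eigval(2)[OF B d] by blast
  then show ?thesis using last_eigval(1)[OF A d, of u] e[of u] by simp
qed

lemma abs_spectral_gap_perturb:
  assumes A: "sym_mat d A" and B: "sym_mat d B" and d: "2 \<le> d"
    and e: "\<And>x. \<bar>ip d x (mv d A x) - ip d x (mv d B x)\<bar> \<le> e * ip d x x"
  shows "\<bar>abs_spectral_gap A - abs_spectral_gap B\<bar> \<le> e"
proof -
  have e': "\<bar>ip d x (mv d B x) - ip d x (mv d A x)\<bar> \<le> e * ip d x x" for x using e[of x] by linarith
  have "1 \<le> d" using d by simp
  then show ?thesis
    using second_eigval_perturb_le[OF A B d e] second_eigval_perturb_le[OF B A d e']
      last_eigval_perturb_le[OF A B _ e] last_eigval_perturb_le[OF B A _ e']
    by (auto simp: abs_spectral_gap_def max_def abs_if split: if_splits)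
qed

section \<open>Bounds on the Euclidean operator norm\<close>

definition op_bound :: "nat \<Rightarrow> real mat \<Rightarrow> real \<Rightarrow> bool" where
  "op_bound d A e \<longleftrightarrow> 0 \<le> e \<and> (\<forall>x. L2_set (mv d A x) {..<d} \<le> e * L2_set x {..<d})"

lemma op_boundD: "op_bound d A e \<Longrightarrow> L2_set (mv d A x) {..<d} \<le> e * L2_set x {..<d}"
  by (simp add: op_bound_def)

lemma op_bound_mono: "op_bound d A e \<Longrightarrow> e \<le> e' \<Longrightarrow> op_bound d A e'"
  unfolding op_bound_def by (meson L2_set_nonneg mult_right_mono order_trans)

lemma op_bound_ip: "op_bound d A e \<longleftrightarrow> 0 \<le> e \<and> (\<forall>x. ip d (mv d A x) (mv d A x) \<le> e\<^sup>2 * ip d x x)"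
  unfolding op_bound_def ip_L2_set power_mult_distrib[symmetric]
  by (auto simp: power2_le_iff_abs_le mult_nonneg_nonneg abs_mult)

lemma ip_le_L2_set: "\<bar>ip d x y\<bar> \<le> L2_set x {..<d} * L2_set y {..<d}"
proof -
  have "\<bar>ip d x y\<bar> \<le> (\<Sum>i<d. \<bar>x i\<bar> * \<bar>y i\<bar>)"
    unfolding ip_def by (rule order_trans[OF sum_abs]) (simp add: abs_mult)
  then show ?thesis using L2_set_mult_ineq order_trans by blast
qed

lemma op_bound_quadratic: 
  assumes "op_bound d A e" shows "\<bar>ip d x (mv d A x)\<bar> \<le> e * ip d x x"
proof -
  have "\<bar>ip d x (mv d A x)\<bar> \<le> L2_set x {..<d} * L2_set (mv d A x) {..<d}" by (rule ip_le_L2_set)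
  also have "\<dots> \<le> L2_set x {..<d} * (e * L2_set x {..<d})"
    by (intro mult_left_mono op_boundD assms) auto
  finally show ?thesis by (simp add: ip_L2_set power2_eq_square mult_ac)
qed

lemma op_bound_add:
  assumes "op_bound d A a" "op_bound d B b"
    and C: "\<And>i j. i < d \<Longrightarrow> j < d \<Longrightarrow> C $$ (i, j) = A $$ (i, j) + B $$ (i, j)"
  shows "op_bound d C (a + b)"
  unfolding op_bound_def
proof (intro conjI allI)
  fix x
  have "L2_set (mv d C x) {..<d} = L2_set (\<lambda>i. mv d A x i + mv d B x i) {..<d}"
    by (intro L2_set_cong) (auto simp: mv_def C sum.distrib distrib_right)
  also have "\<dots> \<le> L2_set (mv d A x) {..<d} + L2_set (mv d B x) {..<d}"
    by (rule L2_set_triangle_ineq)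
  also have "\<dots> \<le> a * L2_set x {..<d} + b * L2_set x {..<d}"
    by (intro add_mono op_boundD assms)
  finally show "L2_set (mv d C x) {..<d} \<le> (a + b) * L2_set x {..<d}" by (simp add: algebra_simps)
qed (use assms in \<open>auto simp: op_bound_def\<close>)

lemma op_bound_scale:
  assumes A: "op_bound d A a" and s: "\<And>i. i < d \<Longrightarrow> \<bar>s i\<bar> \<le> p" "\<And>i. i < d \<Longrightarrow> \<bar>t i\<bar> \<le> q" "0 \<le> p" "0 \<le> q"
    and C: "\<And>i j. i < d \<Longrightarrow> j < d \<Longrightarrow> C $$ (i, j) = s i * A $$ (i, j) * t j"
  shows "op_bound d C (p * a * q)"
  unfolding op_bound_ip
proof (intro conjI allI)
  have a: "0 \<le> a" using A by (simp add: op_bound_def)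
  then show "0 \<le> p * a * q" using s by simp
  fix x
  have "ip d (mv d C x) (mv d C x) = (\<Sum>i<d. (s i)\<^sup>2 * (mv d A (\<lambda>j. t j * x j) i)\<^sup>2)"
    unfolding ip_def
  proof (intro sum.cong refl)
    fix i assume "i \<in> {..<d}"
    then have "mv d C x i = s i * mv d A (\<lambda>j. t j * x j) i"
      by (auto simp: mv_def C sum_distrib_left mult_ac intro!: sum.cong)
    then show "mv d C x i * mv d C x i = (s i)\<^sup>2 * (mv d A (\<lambda>j. t j * x j) i)\<^sup>2"
      by (simp add: power2_eq_square)
  qed
  also have "\<dots> \<le> (\<Sum>i<d. p\<^sup>2 * (mv d A (\<lambda>j. t j * x j) i)\<^sup>2)"
    using s by (intro sum_mono mult_right_mono) (auto simp: power2_le_iff_abs_le)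
  also have "\<dots> = p\<^sup>2 * ip d (mv d A (\<lambda>j. t j * x j)) (mv d A (\<lambda>j. t j * x j))"
    by (simp add: ip_def sum_distrib_left power2_eq_square)
  also have "\<dots> \<le> p\<^sup>2 * (a\<^sup>2 * ip d (\<lambda>j. t j * x j) (\<lambda>j. t j * x j))"
    using A by (intro mult_left_mono) (auto simp: op_bound_ip)
  also have "\<dots> \<le> p\<^sup>2 * (a\<^sup>2 * (q\<^sup>2 * ip d x x))"
  proof (intro mult_left_mono)
    show "ip d (\<lambda>j. t j * x j) (\<lambda>j. t j * x j) \<le> q\<^sup>2 * ip d x x"
    unfolding ip_def sum_distrib_left
  proof (intro sum_mono)
    fix i assume "i \<in> {..<d}"
    then have "(t i)\<^sup>2 * (x i)\<^sup>2 \<le> q\<^sup>2 * (x i)\<^sup>2"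
      using s by (intro mult_right_mono) (auto simp: power2_le_iff_abs_le)
    then show "t i * x i * (t i * x i) \<le> q\<^sup>2 * (x i * x i)" by (simp add: power2_eq_square mult_ac)
  qed
  qed auto
  finally show "ip d (mv d C x) (mv d C x) \<le> (p * a * q)\<^sup>2 * ip d x x"
    by (simp add: power_mult_distrib mult_ac)
qed

lemma op_bound_frobenius:
  assumes e: "0 \<le> e" "(\<Sum>i<d. \<Sum>j<d. (A $$ (i, j))\<^sup>2) \<le> e\<^sup>2"
  shows "op_bound d A e"
  unfolding op_bound_ip
proof (intro conjI allI e)
  fix x
  have "ip d (mv d A x) (mv d A x) = (\<Sum>i<d. (mv d A x i)\<^sup>2)" by (simp add: ip_def power2_eq_square)
  also have "\<dots> \<le> (\<Sum>i<d. (\<Sum>j<d. (A $$ (i, j))\<^sup>2) * ip d x x)"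
    unfolding mv_def ip_def power2_eq_square[symmetric]
    by (intro sum_mono Cauchy_Schwarz_ineq_sum)
  also have "\<dots> = (\<Sum>i<d. \<Sum>j<d. (A $$ (i, j))\<^sup>2) * ip d x x" by (simp add: sum_distrib_right)
  also have "\<dots> \<le> e\<^sup>2 * ip d x x" by (intro mult_right_mono e ip_self_nonneg)
  finally show "ip d (mv d A x) (mv d A x) \<le> e\<^sup>2 * ip d x x" .
qed

section \<open>Products, Gram matrices and diagonal conjugation\<close>

lemma mv_mult:
  assumes "A \<in> carrier_mat d d" "B \<in> carrier_mat d d" "i < d"
  shows "mv d (A * B) x i = mv d A (mv d B x) i"
proof -
  have "mv d (A * B) x i = (\<Sum>j<d. \<Sum>k<d. A $$ (i, k) * B $$ (k, j) * x j)"
    using assms by (auto simp: mv_def scalar_prod_def atLeast0LessThan sum_distrib_right intro!: sum.cong)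
  also have "\<dots> = mv d A (mv d B x) i"
    by (subst sum.swap) (simp add: mv_def sum_distrib_left mult_ac)
  finally show ?thesis .
qed

lemma ip_mv_transpose:
  assumes "A \<in> carrier_mat d d"
  shows "ip d (mv d (transpose_mat A) x) y = ip d x (mv d A y)"
  unfolding ip_def mv_def sum_distrib_left sum_distrib_right
  by (subst sum.swap) (use assms in \<open>auto simp: mult_ac intro!: sum.cong\<close>)

lemma gram_sym_mat: "A \<in> carrier_mat d d \<Longrightarrow> sym_mat d (transpose_mat A * A)"
  by (auto simp: sym_mat_def scalar_prod_def mult.commute intro!: sum.cong)

lemma gram_quadratic:
  assumes "A \<in> carrier_mat d d"
  shows "ip d x (mv d (transpose_mat A * A) x) = ip d (mv d A x) (mv d A x)"
proof -
  have "ip d x (mv d (transpose_mat A * A) x) = ip d x (mv d (transpose_mat A) (mv d A x))"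
    using assms by (intro ip_cong mv_mult) auto
  then show ?thesis using ip_mv_transpose[OF assms] by (simp add: ip_sym)
qed

text \<open>The difference of the squared norms of \<open>A x\<close> and \<open>B x\<close> factors
  into a difference of norms, at most \<open>e\<close>, and a sum, at most \<open>2 + e\<close>, for
  \<open>x\<close> of norm 1. This is the origin of the shape \<open>2 * c + c^2\<close> in the
  widths.\<close>

lemma spectral_gap_gram_perturb:
  assumes A: "A \<in> carrier_mat d d" and B: "B \<in> carrier_mat d d" and d: "2 \<le> d"
    and C: "op_bound d C e" "\<And>i j. i < d \<Longrightarrow> j < d \<Longrightarrow> C $$ (i, j) = A $$ (i, j) - B $$ (i, j)"
    and b: "op_bound d B 1"
  shows "\<bar>spectral_gap (transpose_mat A * A) - spectral_gap (transpose_mat B * B)\<bar> \<le> 2 * e + e\<^sup>2"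
proof -
  have e: "0 \<le> e" using C(1) by (simp add: op_bound_def)
  have *: "\<bar>ip d x (mv d (transpose_mat A * A) x) - ip d x (mv d (transpose_mat B * B) x)\<bar>
      \<le> (2 * e + e\<^sup>2) * ip d x x" for x
  proof -
    let ?n = "\<lambda>x. L2_set x {..<d}"
    have "mv d A x i = mv d B x i + mv d C x i" if "i < d" for i
      using that by (simp add: mv_def C(2) left_diff_distrib sum_subtractf)
    then have "?n (mv d A x) = ?n (\<lambda>i. mv d B x i + mv d C x i)" by (intro L2_set_cong) auto
    then have a: "?n (mv d A x) \<le> ?n (mv d B x) + ?n (mv d C x)"
      using L2_set_triangle_ineq[of "mv d B x" "mv d C x" "{..<d}"] by simp
    have "mv d B x i = mv d A x i + (- mv d C x i)" if "i < d" for i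
      using that by (simp add: mv_def C(2) left_diff_distrib sum_subtractf)
    then have "?n (mv d B x) = ?n (\<lambda>i. mv d A x i + (- mv d C x i))" by (intro L2_set_cong) auto
    moreover have "?n (\<lambda>i. - mv d C x i) = ?n (mv d C x)" by (simp add: L2_set_def)
    ultimately have b': "?n (mv d B x) \<le> ?n (mv d A x) + ?n (mv d C x)"
      using L2_set_triangle_ineq[of "mv d A x" "\<lambda>i. - mv d C x i" "{..<d}"] by simp
    have c: "?n (mv d C x) \<le> e * ?n x" using C(1) by (rule op_boundD)
    have bb: "?n (mv d B x) \<le> ?n x" using op_boundD[OF b] by simp
    have d1: "\<bar>?n (mv d A x) - ?n (mv d B x)\<bar> \<le> e * ?n x" using a b' c by linarith
    have "?n (mv d A x) \<le> (1 + e) * ?n x" using a c bb by (simp add: algebra_simps)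
    then have d2: "\<bar>?n (mv d A x) + ?n (mv d B x)\<bar> \<le> (2 + e) * ?n x"
      using bb by (simp add: algebra_simps abs_of_nonneg)
    have "\<bar>(?n (mv d A x))\<^sup>2 - (?n (mv d B x))\<^sup>2\<bar>
        = \<bar>?n (mv d A x) - ?n (mv d B x)\<bar> * \<bar>?n (mv d A x) + ?n (mv d B x)\<bar>"
      unfolding abs_mult[symmetric] by (simp add: power2_eq_square algebra_simps)
    also have "\<dots> \<le> (e * ?n x) * ((2 + e) * ?n x)"
      by (intro mult_mono d1 d2) (use e in auto)
    also have "\<dots> = (2 * e + e\<^sup>2) * (?n x)\<^sup>2" by (simp add: power2_eq_square algebra_simps)
    finally show ?thesis by (simp add: gram_quadratic A B ip_L2_set)
  qed
  then have **: "\<bar>ip d x (mv d (transpose_mat B * B) x) - ip d x (mv d (transpose_mat A * A) x)\<bar>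
      \<le> (2 * e + e\<^sup>2) * ip d x x" for x by (simp add: abs_minus_commute)
  show ?thesis
    using second_eigval_perturb_le[OF gram_sym_mat[OF A] gram_sym_mat[OF B] d *]
      second_eigval_perturb_le[OF gram_sym_mat[OF B] gram_sym_mat[OF A] d **]
    by (simp add: spectral_gap_def)
qed

lemma second_eigval_gram_bounds:
  assumes A: "A \<in> carrier_mat d d" and d: "2 \<le> d" and e: "op_bound d A e"
  shows "0 \<le> eigvals (transpose_mat A * A) ! 1" "eigvals (transpose_mat A * A) ! 1 \<le> e\<^sup>2"
proof -
  obtain v where v: "orthonormal_upto d d v"
    "\<And>i a. i < d \<Longrightarrow> a < d \<Longrightarrow> mv d (transpose_mat A * A) (v i) a = eigvals (transpose_mat A * A) ! i * v i a"
    using sym_mat_eigvals[OF gram_sym_mat[OF A]] by metis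
  have "ip d (v 1) (mv d (transpose_mat A * A) (v 1)) = ip d (v 1) (\<lambda>a. eigvals (transpose_mat A * A) ! 1 * v 1 a)"
    using v(2) d by (intro ip_cong) auto
  then have "eigvals (transpose_mat A * A) ! 1 = ip d (mv d A (v 1)) (mv d A (v 1))"
    using v(1) d by (simp add: gram_quadratic A ip_linear orthonormal_upto_def)
  then show "0 \<le> eigvals (transpose_mat A * A) ! 1" by (simp add: ip_self_nonneg)
  show "eigvals (transpose_mat A * A) ! 1 \<le> e\<^sup>2"
    by (rule second_eigval_le[OF gram_sym_mat[OF A] d, of "\<lambda>_. 0"])
      (use e in \<open>simp add: gram_quadratic A op_bound_ip\<close>)
qed

text \<open>\<open>eigvals\<close> only sees the characteristic polynomial, so this passes from the
  matrices in the definitions of the gaps to symmetric ones.\<close>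

lemma char_poly_diag_conj:
  fixes A B :: "real mat"
  assumes A: "A \<in> carrier_mat d d" and B: "B \<in> carrier_mat d d" and s: "\<And>i. i < d \<Longrightarrow> s i \<noteq> 0"
    and AB: "\<And>i j. i < d \<Longrightarrow> j < d \<Longrightarrow> A $$ (i, j) = B $$ (i, j) * s j / s i"
  shows "char_poly A = char_poly B"
proof -
  define P where "P = Matrix.mat d d (\<lambda>(i, j). if i = j then 1 / s i else 0)"
  define Q where "Q = Matrix.mat d d (\<lambda>(i, j). if i = j then s i else 0)"
  have c: "P \<in> carrier_mat d d" "Q \<in> carrier_mat d d" by (auto simp: P_def Q_def)
  have PQ: "P * Q = 1\<^sub>m d"
    by (rule eq_matI) (auto simp: P_def Q_def scalar_prod_def atLeast0LessThan s if_distrib[of "\<lambda>z. _ * z"]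
        if_distrib[of "\<lambda>z. z * _"] cong: if_cong)
  have QP: "Q * P = 1\<^sub>m d"
    by (rule eq_matI) (auto simp: P_def Q_def scalar_prod_def atLeast0LessThan s if_distrib[of "\<lambda>z. _ * z"]
        if_distrib[of "\<lambda>z. z * _"] cong: if_cong)
  have "A = P * B * Q"
  proof (rule eq_matI)
    fix i j assume "i < dim_row (P * B * Q)" "j < dim_col (P * B * Q)"
    then have ij: "i < d" "j < d" using c by auto
    have PB: "(P * B) $$ (i, k) = B $$ (i, k) / s i" if "k < d" for k
    proof -
      have "(P * B) $$ (i, k) = (\<Sum>l<d. P $$ (i, l) * B $$ (l, k))"
        using ij that B c by (simp add: scalar_prod_def atLeast0LessThan)
      also have "\<dots> = (\<Sum>l<d. (if l = i then 1 / s i * B $$ (l, k) else 0))"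
        using ij by (intro sum.cong) (auto simp: P_def)
      finally have "(P * B) $$ (i, k) = (\<Sum>l<d. (if l = i then 1 / s i * B $$ (l, k) else 0))" .
      then show ?thesis using ij by simp
    qed
    have "(P * B * Q) $$ (i, j) = (\<Sum>k<d. (P * B) $$ (i, k) * Q $$ (k, j))"
      using ij c B by (subst index_mult_mat(1)) (auto simp: scalar_prod_def atLeast0LessThan simp del: assoc_mult_mat)
    also have "\<dots> = (\<Sum>k<d. if k = j then B $$ (i, k) / s i * s j else 0)"
      using ij by (intro sum.cong) (auto simp: PB Q_def)
    finally show "A $$ (i, j) = (P * B * Q) $$ (i, j)" using ij AB by simp
  qed (use c A in auto)
  then have "similar_mat A B" using A B c PQ QP by (intro similar_matI[of _ _ P Q d]) auto
  then show ?thesis by (rule char_poly_similar)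
qed

lemma eigvals_cong: "char_poly A = char_poly B \<Longrightarrow> eigvals A = eigvals B"
  by (simp add: eigvals_def)

section \<open>Stochastic matrices and oscillations\<close>

lemma distribution_ip_const: "distribution d p \<Longrightarrow> ip d p (\<lambda>_. c) = c"
  by (simp add: ip_def distribution_def sum_distrib_right[symmetric])

lemma stochastic_matD:
  assumes "stochastic_mat d M"
  shows "M \<in> carrier_mat d d" "\<And>i j. i < d \<Longrightarrow> j < d \<Longrightarrow> 0 \<le> M $$ (i, j)"
    "\<And>i. i < d \<Longrightarrow> (\<Sum>j<d. M $$ (i, j)) = 1"
  using assms by (auto simp: stochastic_mat_def)

lemma mv_const: "stochastic_mat d M \<Longrightarrow> i < d \<Longrightarrow> mv d M (\<lambda>_. c) i = c"
  by (simp add: mv_def sum_distrib_right[symmetric] stochastic_matD)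

lemma mv_one_mat: "i < d \<Longrightarrow> mv d (1\<^sub>m d) f i = f i"
proof -
  assume i: "i < d"
  have "mv d (1\<^sub>m d) f i = (\<Sum>j<d. if j = i then f j else 0)"
    unfolding mv_def by (intro sum.cong) (use i in auto)
  then show ?thesis using i by simp
qed

lemma mat_entry_mv:
  assumes "i < d" "j < d"
  shows "A $$ (i, j) = mv d A (\<lambda>k. if k = j then 1 else 0) i"
  using assms by (simp add: mv_def if_distrib[of "\<lambda>z. _ * z"] cong: if_cong)

lemma stochastic_matI_mv:
  assumes "A \<in> carrier_mat d d" "\<And>f i. i < d \<Longrightarrow> (\<And>j. j < d \<Longrightarrow> 0 \<le> f j) \<Longrightarrow> 0 \<le> mv d A f i"
    "\<And>i. i < d \<Longrightarrow> mv d A (\<lambda>_. 1) i = 1"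
  shows "stochastic_mat d A"
  unfolding stochastic_mat_def
proof (intro conjI allI impI assms)
  show "0 \<le> A $$ (i, j)" if "i < d" "j < d" for i j
    unfolding mat_entry_mv[OF that] by (rule assms(2)) (use that in auto)
  show "(\<Sum>j<d. A $$ (i, j)) = 1" if "i < d" for i
    using assms(3)[OF that] by (simp add: mv_def)
qed

lemma mv_nonneg: "stochastic_mat d M \<Longrightarrow> i < d \<Longrightarrow> (\<And>j. j < d \<Longrightarrow> 0 \<le> f j) \<Longrightarrow> 0 \<le> mv d M f i"
  unfolding mv_def by (intro sum_nonneg mult_nonneg_nonneg) (auto dest: stochastic_matD)

lemma mv_mono:
  assumes "stochastic_mat d M" "i < d" "\<And>j. j < d \<Longrightarrow> f j \<le> g j" shows "mv d M f i \<le> mv d M g i"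
  using mv_nonneg[OF assms(1,2), of "\<lambda>j. g j - f j"] assms(3) by (simp add: mv_linear)

lemma stochastic_mat_mult:
  assumes A: "stochastic_mat d A" and B: "stochastic_mat d B"
  shows "stochastic_mat d (A * B)"
proof (rule stochastic_matI_mv)
  have c: "A \<in> carrier_mat d d" "B \<in> carrier_mat d d" using assms by (auto dest: stochastic_matD)
  then show "A * B \<in> carrier_mat d d" by auto
  show "0 \<le> mv d (A * B) f i" if "i < d" "\<And>j. j < d \<Longrightarrow> 0 \<le> f j" for f i
    unfolding mv_mult[OF c that(1)] by (intro mv_nonneg[OF A] mv_nonneg[OF B] that)
  show "mv d (A * B) (\<lambda>_. 1) i = 1" if "i < d" for i
    using mv_const[OF A that, of 1] mv_cong[of d "mv d B (\<lambda>_. 1)" "\<lambda>_. 1" A] mv_const[OF B]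
    by (simp add: mv_mult[OF c that])
qed

lemma stochastic_one_mat: "stochastic_mat d (1\<^sub>m d)"
  by (rule stochastic_matI_mv) (auto simp: mv_one_mat)

lemma stochastic_mat_pow: "stochastic_mat d M \<Longrightarrow> stochastic_mat d (M ^\<^sub>m k)"
  by (induction k) (auto simp: stochastic_one_mat stochastic_mat_mult dest: stochastic_matD(1))

lemma pow_mat_carrier: "M \<in> carrier_mat d d \<Longrightarrow> M ^\<^sub>m k \<in> carrier_mat d d"
  by simp

lemma pow_mat_add: "M \<in> carrier_mat d d \<Longrightarrow> M ^\<^sub>m (k + l) = M ^\<^sub>m k * M ^\<^sub>m l"
  by (induction l) (auto simp: assoc_mult_mat[of _ d d _ d _ d])

lemma pow_mat_mult: "M \<in> carrier_mat d d \<Longrightarrow> (M ^\<^sub>m k) ^\<^sub>m l = M ^\<^sub>m (k * l)"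
proof (induction l)
  case (Suc l)
  have "M ^\<^sub>m (k * Suc l) = M ^\<^sub>m (k * l) * M ^\<^sub>m k"
    using pow_mat_add[OF Suc.prems, of "k * l" k] by (simp add: add.commute)
  then show ?case using Suc by simp
qed simp

lemma mv_pow_add:
  "M \<in> carrier_mat d d \<Longrightarrow> i < d \<Longrightarrow> mv d (M ^\<^sub>m (k + l)) f i = mv d (M ^\<^sub>m k) (mv d (M ^\<^sub>m l) f) i"
  by (simp add: pow_mat_add mv_mult)

lemma mv_pow_Suc:
  assumes "M \<in> carrier_mat d d" "i < d"
  shows "mv d (M ^\<^sub>m Suc k) f i = mv d M (mv d (M ^\<^sub>m k) f) i"
  using mv_pow_add[OF assms, of 1 k] assms by simp

lemma mv_pow_0: "M \<in> carrier_mat d d \<Longrightarrow> i < d \<Longrightarrow> mv d (M ^\<^sub>m 0) f i = f i"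
  by (simp add: mv_one_mat)

section \<open>Stationary distributions\<close>

definition stat_dist :: "nat \<Rightarrow> real mat \<Rightarrow> (nat \<Rightarrow> real) \<Rightarrow> bool" where
  "stat_dist d M p \<longleftrightarrow> distribution d p \<and> (\<forall>j<d. (\<Sum>i<d. p i * M $$ (i, j)) = p j)"

lemma ip_stat:
  assumes "stat_dist d M p" shows "ip d p (mv d M f) = ip d p f"
proof -
  have "ip d p (mv d M f) = (\<Sum>j<d. (\<Sum>i<d. p i * M $$ (i, j)) * f j)"
    unfolding ip_def mv_def sum_distrib_left sum_distrib_right
    by (subst sum.swap) (simp add: mult_ac)
  then show ?thesis using assms by (simp add: ip_def stat_dist_def)
qed

lemma stat_distI_ip:
  assumes "distribution d p" "\<And>f. ip d p (mv d M f) = ip d p f" shows "stat_dist d M p"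
  unfolding stat_dist_def
proof (intro conjI allI impI assms)
  fix j assume j: "j < d"
  have "(\<Sum>i<d. p i * M $$ (i, j)) = ip d p (mv d M (\<lambda>k. if k = j then 1 else 0))"
    unfolding ip_def by (intro sum.cong) (simp_all add: mat_entry_mv[OF _ j])
  also have "\<dots> = p j"
    unfolding assms(2) unfolding ip_def using j by (simp add: if_distrib[of "\<lambda>z. _ * z"] cong: if_cong)
  finally show "(\<Sum>i<d. p i * M $$ (i, j)) = p j" .
qed

lemma stat_dist_pow:
  assumes p: "stat_dist d M p" and M: "M \<in> carrier_mat d d" shows "stat_dist d (M ^\<^sub>m k) p"
proof (rule stat_distI_ip)
  show "distribution d p" using p by (simp add: stat_dist_def)
  show "ip d p (mv d (M ^\<^sub>m k) f) = ip d p f" for f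
  proof (induction k)
    case 0 show ?case using M by (intro ip_cong) (auto simp: mv_one_mat)
  next
    case (Suc k)
    have "ip d p (mv d (M ^\<^sub>m Suc k) f) = ip d p (mv d M (mv d (M ^\<^sub>m k) f))"
      by (intro ip_cong mv_pow_Suc M) auto
    then show ?case using Suc ip_stat[OF p] by simp
  qed
qed

section \<open>Oscillation of functions and its contraction\<close>

definition osc_le :: "nat \<Rightarrow> (nat \<Rightarrow> real) \<Rightarrow> real \<Rightarrow> bool" where
  "osc_le d f w \<longleftrightarrow> (\<forall>i<d. \<forall>j<d. f i - f j \<le> w)"

text \<open>The Dobrushin coefficient of \<open>A\<close> is at most \<open>q\<close>. The notion
  does not refer to a stationary distribution, so a contraction can be moved from a matrix to a
  nearby one.\<close>

definition contr :: "nat \<Rightarrow> real mat \<Rightarrow> real \<Rightarrow> bool" where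
  "contr d A q \<longleftrightarrow> (\<forall>f w. osc_le d f w \<longrightarrow> osc_le d (mv d A f) (q * w))"

lemma osc_leD: "osc_le d f w \<Longrightarrow> i < d \<Longrightarrow> j < d \<Longrightarrow> f i - f j \<le> w"
  by (simp add: osc_le_def)

lemma osc_le_nonneg: "osc_le d f w \<Longrightarrow> 0 < d \<Longrightarrow> 0 \<le> w"
  using osc_leD[of d f w 0 0] by simp

lemma osc_le_cong: "(\<And>i. i < d \<Longrightarrow> f i = g i) \<Longrightarrow> osc_le d f w \<longleftrightarrow> osc_le d g w"
  by (auto simp: osc_le_def)

lemma osc_le_argmin:
  assumes "osc_le d f w" "0 < d"
  obtains a where "a < d" "\<And>i. i < d \<Longrightarrow> f a \<le> f i" "\<And>i. i < d \<Longrightarrow> f i \<le> f a + w"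
proof -
  have "Min (f ` {..<d}) \<in> f ` {..<d}" using assms(2) by (intro Min_in) auto
  then obtain a where a: "a < d" "Min (f ` {..<d}) = f a" by auto
  have "f a \<le> f i" if "i < d" for i using that a(2)[symmetric] by simp
  moreover have "f i \<le> f a + w" if "i < d" for i using osc_leD[OF assms(1) that a(1)] by simp
  ultimately show thesis using a(1) that by blast
qed

lemma osc_le_center:
  assumes "osc_le d f w" "0 < d"
  obtains c where "\<And>i. i < d \<Longrightarrow> \<bar>f i - c\<bar> \<le> w / 2"
proof -
  obtain a where a: "a < d" "\<And>i. i < d \<Longrightarrow> f a \<le> f i" "\<And>i. i < d \<Longrightarrow> f i \<le> f a + w"
    using osc_le_argmin[OF assms] by blast
  show thesis
  proof (rule that[of "f a + w / 2"])
    fix i assume "i < d"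
    from a(2,3)[OF this] show "\<bar>f i - (f a + w / 2)\<bar> \<le> w / 2" by linarith
  qed
qed

lemma osc_le_mv:
  assumes M: "stochastic_mat d M" and f: "osc_le d f w" shows "osc_le d (mv d M f) w"
proof (cases "d = 0")
  case False
  then obtain a where a: "a < d" "\<And>i. i < d \<Longrightarrow> f a \<le> f i" "\<And>i. i < d \<Longrightarrow> f i \<le> f a + w"
    using osc_le_argmin[OF f] by blast
  have "mv d M f i \<le> f a + w" "f a \<le> mv d M f i" if "i < d" for i
    using mv_mono[OF M that, of f "\<lambda>_. f a + w"] mv_mono[OF M that, of "\<lambda>_. f a" f] a mv_const[OF M that] by auto
  then show ?thesis by (fastforce simp: osc_le_def)
qed (simp add: osc_le_def)

text \<open>Doeblin's argument: every row puts mass at least \<open>e\<close> on the minimizer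
  \<open>a\<close> of \<open>f\<close>, where \<open>f\<close> lies \<open>w\<close> below the upper
  bound \<open>f a + w\<close>. This lowers the upper bound by \<open>e * w\<close>, and the lower
  bound \<open>f a\<close> persists.\<close>

lemma contr_positive:
  assumes M: "stochastic_mat d M" and e: "\<And>i j. i < d \<Longrightarrow> j < d \<Longrightarrow> e \<le> M $$ (i, j)"
  shows "contr d M (1 - e)"
  unfolding contr_def
proof (intro allI impI)
  fix f w assume f: "osc_le d f w"
  show "osc_le d (mv d M f) ((1 - e) * w)"
  proof (cases "d = 0")
    case False
    then have w: "0 \<le> w" using osc_le_nonneg[OF f] by simp
    obtain a where a: "a < d" "\<And>i. i < d \<Longrightarrow> f a \<le> f i" "\<And>i. i < d \<Longrightarrow> f i \<le> f a + w"
      using osc_le_argmin[OF f] False by blast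
    have "mv d M f i \<le> f a + (1 - e) * w" if i: "i < d" for i
    proof -
      have "mv d M f i \<le> mv d M (\<lambda>k. (f a + w) - w * (if k = a then 1 else 0)) i"
        by (intro mv_mono[OF M i]) (use a in auto)
      also have "\<dots> = (f a + w) - w * M $$ (i, a)"
        unfolding mv_diff mv_scale mv_const[OF M i] mat_entry_mv[OF i a(1), symmetric] by simp
      also have "\<dots> \<le> (f a + w) - w * e" using e[OF i a(1)] w by (simp add: mult_left_mono)
      finally show ?thesis by (simp add: algebra_simps)
    qed
    moreover have "f a \<le> mv d M f i" if "i < d" for i
      using mv_mono[OF M that, of "\<lambda>_. f a" f] a mv_const[OF M that] by auto
    ultimately show ?thesis by (fastforce simp: osc_le_def)
  qed (simp add: osc_le_def)
qed

lemma contr_pow: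
  assumes M: "M \<in> carrier_mat d d" and c: "contr d M q" shows "contr d (M ^\<^sub>m k) (q ^ k)"
proof (induction k)
  case 0 show ?case using M by (auto simp: contr_def osc_le_def mv_one_mat)
next
  case (Suc k)
  show ?case unfolding contr_def
  proof (intro allI impI)
    fix f w assume "osc_le d f w"
    then have "osc_le d (mv d M (mv d (M ^\<^sub>m k) f)) (q * (q ^ k * w))" using Suc c by (simp add: contr_def)
    then show "osc_le d (mv d (M ^\<^sub>m Suc k) f) (q ^ Suc k * w)"
      using osc_le_cong[of d "mv d (M ^\<^sub>m Suc k) f" "mv d M (mv d (M ^\<^sub>m k) f)" "q * (q ^ k * w)"]
        mv_pow_Suc[OF M, of _ k f] by (simp only: power_Suc mult.assoc)
  qed
qed

text \<open>A vector of total mass 0 annihilates constants, so \<open>g\<close> may be centred at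
  the middle of its range, where its absolute value is at most \<open>w / 2\<close>.\<close>

lemma zero_sum_ip_bound:
  assumes "(\<Sum>i<d. \<nu> i) = 0" "osc_le d g w"
  shows "\<bar>ip d \<nu> g\<bar> \<le> (\<Sum>i<d. \<bar>\<nu> i\<bar>) * w / 2"
proof (cases "d = 0")
  case False
  then obtain c where c: "\<And>i. i < d \<Longrightarrow> \<bar>g i - c\<bar> \<le> w / 2" using osc_le_center[OF assms(2)] by blast
  have "ip d \<nu> g = (\<Sum>i<d. \<nu> i * (g i - c))"
    using assms(1) by (simp add: ip_def right_diff_distrib sum_subtractf sum_distrib_right[symmetric])
  also have "\<bar>\<dots>\<bar> \<le> (\<Sum>i<d. \<bar>\<nu> i\<bar> * (w / 2))"
  proof (rule order_trans[OF sum_abs], rule sum_mono)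
    show "\<bar>\<nu> i * (g i - c)\<bar> \<le> \<bar>\<nu> i\<bar> * (w / 2)" if "i \<in> {..<d}" for i
      unfolding abs_mult using c that by (intro mult_left_mono) auto
  qed
  finally show ?thesis by (simp only: sum_distrib_right sum_divide_distrib times_divide_eq_right)
qed (simp add: ip_def)

text \<open>Powers of \<open>M\<close> keep the oscillation at most \<open>w\<close>, so the defect
  \<open>e * w\<close> is paid once per step.\<close>

lemma ip_telescope:
  assumes M: "stochastic_mat d M"
    and e: "\<And>f w. osc_le d f w \<Longrightarrow> \<bar>ip d \<nu> f - ip d \<nu> (mv d M f)\<bar> \<le> e * w"
    and f: "osc_le d f w"
  shows "\<bar>ip d \<nu> f - ip d \<nu> (mv d (M ^\<^sub>m t) f)\<bar> \<le> real t * e * w"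
proof (induction t)
  case 0
  have "ip d \<nu> (mv d (M ^\<^sub>m 0) f) = ip d \<nu> f"
    by (intro ip_cong mv_pow_0) (use stochastic_matD(1)[OF M] in auto)
  then show ?case by simp
next
  case (Suc t)
  have "osc_le d (mv d (M ^\<^sub>m t) f) w" by (intro osc_le_mv stochastic_mat_pow M f)
  from e[OF this]
  have "\<bar>ip d \<nu> (mv d (M ^\<^sub>m t) f) - ip d \<nu> (mv d M (mv d (M ^\<^sub>m t) f))\<bar> \<le> e * w" .
  moreover have "ip d \<nu> (mv d M (mv d (M ^\<^sub>m t) f)) = ip d \<nu> (mv d (M ^\<^sub>m Suc t) f)"
    by (intro ip_cong) (simp_all only: mv_pow_Suc[OF stochastic_matD(1)[OF M]])
  ultimately show ?case using Suc by (simp add: algebra_simps)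
qed

text \<open>Tested on its own sign function, of oscillation 2, \<open>\<nu>\<close> yields its l1
  norm. After \<open>t\<close> steps at most the fraction \<open>q\<close> of it remains, while the
  telescoped defect is at most \<open>2 * t * e\<close>. An indicator has oscillation 1, which gains
  a factor 2 for single entries.\<close>

lemma near_stationary_bound:
  assumes M: "stochastic_mat d M" and c: "contr d (M ^\<^sub>m t) q" and q: "q < 1"
    and \<nu>: "(\<Sum>i<d. \<nu> i) = 0"
    and e: "\<And>f w. osc_le d f w \<Longrightarrow> \<bar>ip d \<nu> f - ip d \<nu> (mv d M f)\<bar> \<le> e * w"
  shows "(\<Sum>i<d. \<bar>\<nu> i\<bar>) \<le> 2 * (real t * e / (1 - q))"
    and "\<And>i. i < d \<Longrightarrow> \<bar>\<nu> i\<bar> \<le> real t * e / (1 - q)"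
proof -
  let ?A = "\<Sum>i<d. \<bar>\<nu> i\<bar>"
  let ?s = "\<lambda>i. sgn (\<nu> i)"
  have "ip d \<nu> ?s = ?A" unfolding ip_def by (intro sum.cong) (auto simp: abs_sgn[symmetric])
  moreover have s: "osc_le d ?s 2" by (auto simp: osc_le_def sgn_if)
  moreover have "\<bar>ip d \<nu> (mv d (M ^\<^sub>m t) ?s)\<bar> \<le> ?A * (q * 2) / 2"
    using c s by (intro zero_sum_ip_bound \<nu>) (auto simp: contr_def)
  moreover have "\<bar>ip d \<nu> ?s - ip d \<nu> (mv d (M ^\<^sub>m t) ?s)\<bar> \<le> real t * e * 2"
    by (rule ip_telescope[OF M e s])
  ultimately have "(1 - q) * ?A \<le> 2 * (real t * e)" by (simp add: algebra_simps abs_le_iff)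
  then show A: "?A \<le> 2 * (real t * e / (1 - q))" using q by (simp add: field_simps)
  fix i assume i: "i < d"
  have "\<bar>ip d \<nu> (\<lambda>k. if k = i then 1 else 0)\<bar> \<le> ?A * 1 / 2"
    by (intro zero_sum_ip_bound \<nu>) (auto simp: osc_le_def)
  moreover have "ip d \<nu> (\<lambda>k. if k = i then 1 else 0) = \<nu> i"
    using i by (simp add: ip_def if_distrib[of "\<lambda>z. _ * z"] cong: if_cong)
  ultimately show "\<bar>\<nu> i\<bar> \<le> real t * e / (1 - q)" using A by simp
qed

lemma stat_dist_unique:
  assumes M: "stochastic_mat d M" and c: "contr d (M ^\<^sub>m t) q" and q: "q < 1"
    and p: "stat_dist d M p" and p': "stat_dist d M p'"
  shows "p = p'"
proof
  fix i
  show "p i = p' i"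
  proof (cases "i < d")
    case True
    have "\<bar>p i - p' i\<bar> \<le> real t * 0 / (1 - q)"
      by (rule near_stationary_bound(2)[OF M c q, of "\<lambda>i. p i - p' i"])
        (use p p' True in \<open>auto simp: sum_subtractf ip_linear ip_stat, auto simp: stat_dist_def distribution_def\<close>)
    then show ?thesis by simp
  qed (use p p' in \<open>auto simp: stat_dist_def distribution_def\<close>)
qed

text \<open>Constants make 1 an eigenvalue of \<open>M\<close>, hence of its transpose. The absolute
  values \<open>u\<close> of a left eigenvector satisfy \<open>u \<le> u M\<close> entrywise; both
  sides have the same total mass because rows sum to 1, so equality holds and \<open>u\<close> can
  be normalized.\<close>

lemma stat_dist_exists:
  assumes M: "stochastic_mat d M" and d: "0 < d"
  shows "\<exists>p. stat_dist d M p"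
proof -
  have Mc: "M \<in> carrier_mat d d" by (rule stochastic_matD(1)[OF M])
  have "eigenvector M (Matrix.vec d (\<lambda>_. 1::real)) 1"
    unfolding eigenvector_def
  proof (intro conjI)
    show "Matrix.vec d (\<lambda>_. 1::real) \<in> carrier_vec (dim_row M)" using Mc by auto
    show "Matrix.vec d (\<lambda>_. 1::real) \<noteq> 0\<^sub>v (dim_row M)"
      using d Mc by (auto dest!: arg_cong[of _ _ "\<lambda>v. vec_index v 0"])
    show "M *\<^sub>v Matrix.vec d (\<lambda>_. 1::real) = 1 \<cdot>\<^sub>v Matrix.vec d (\<lambda>_. 1::real)"
      by (rule eq_vecI) (use Mc stochastic_matD(3)[OF M] in
          \<open>auto simp: scalar_prod_def atLeast0LessThan\<close>)
  qed
  then have "eigenvalue M 1" by (auto simp: eigenvalue_def)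
  then have "eigenvalue (transpose_mat M) 1"
    using Mc by (simp add: eigenvalue_root_char_poly[of _ d])
  then obtain v where v: "v \<in> carrier_vec d" "v \<noteq> 0\<^sub>v d" "transpose_mat M *\<^sub>v v = v"
    using Mc by (auto simp: eigenvalue_def eigenvector_def)
  define u where "u = (\<lambda>i. \<bar>vec_index v i\<bar>)"
  define s where "s = (\<Sum>i<d. u i)"
  have le: "u j \<le> (\<Sum>i<d. u i * M $$ (i, j))" if j: "j < d" for j
  proof -
    have "vec_index v j = vec_index (transpose_mat M *\<^sub>v v) j" by (simp add: v(3))
    also have "\<dots> = (\<Sum>i<d. M $$ (i, j) * vec_index v i)"
      using j Mc v(1) by (auto simp: scalar_prod_def atLeast0LessThan intro!: sum.cong)
    finally have "u j \<le> (\<Sum>i<d. \<bar>M $$ (i, j) * vec_index v i\<bar>)" by (simp add: u_def)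
    also have "\<dots> = (\<Sum>i<d. u i * M $$ (i, j))"
      using stochastic_matD(2)[OF M] j by (intro sum.cong) (auto simp: u_def abs_mult)
    finally show ?thesis .
  qed
  have "(\<Sum>j<d. (\<Sum>i<d. u i * M $$ (i, j)) - u j) = 0"
    unfolding sum_subtractf
    by (subst sum.swap) (simp add: sum_distrib_left[symmetric] stochastic_matD(3)[OF M])
  then have eq: "(\<Sum>i<d. u i * M $$ (i, j)) = u j" if "j < d" for j
    using le that by (subst (asm) sum_nonneg_eq_0_iff) auto
  have "\<exists>i<d. u i \<noteq> 0"
  proof (rule ccontr)
    assume "\<not> ?thesis"
    then have "v = 0\<^sub>v d" using v(1) by (intro eq_vecI) (auto simp: u_def)
    with v(2) show False ..
  qed
  then have s: "s > 0" unfolding s_def by (auto intro!: sum_pos2 simp: u_def)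
  show ?thesis
  proof (rule exI[of _ "\<lambda>i. if i < d then u i / s else 0"])
    have "(\<Sum>i<d. u i / s * M $$ (i, j)) = u j / s" if "j < d" for j
      using eq[OF that] by (simp add: sum_divide_distrib[symmetric])
    then show "stat_dist d M (\<lambda>i. if i < d then u i / s else 0)"
      using s by (auto simp: stat_dist_def distribution_def u_def sum_divide_distrib[symmetric] s_def)
  qed
qed

text \<open>The smallest entry \<open>e\<close> of a positive power is a mass common to all rows, so
  \<open>contr_positive\<close> applies and the stationary distribution is unique. The same
  \<open>e\<close> bounds every stationary probability from below.\<close>

lemma ergodicD:
  assumes "ergodic d M" "0 < d"
  shows "stochastic_mat d M" "stat_dist d M (stationary M)" "\<And>i. i < d \<Longrightarrow> 0 < stationary M i"
    "\<exists>t q. 1 \<le> t \<and> q < 1 \<and> 0 \<le> q \<and> contr d (M ^\<^sub>m t) q"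
    "\<And>p. stat_dist d M p \<Longrightarrow> stationary M = p"
proof -
  obtain k where k: "stochastic_mat d M" "k \<ge> 1" "\<And>i j. i < d \<Longrightarrow> j < d \<Longrightarrow> 0 < (M ^\<^sub>m k) $$ (i, j)"
    using assms by (auto simp: ergodic_def)
  show M: "stochastic_mat d M" by fact
  have Mk: "stochastic_mat d (M ^\<^sub>m k)" by (rule stochastic_mat_pow[OF M])
  define e where "e = Min ((\<lambda>(i, j). (M ^\<^sub>m k) $$ (i, j)) ` ({..<d} \<times> {..<d}))"
  have e: "0 < e" unfolding e_def using k assms(2) by (subst Min_gr_iff) auto
  have el: "e \<le> (M ^\<^sub>m k) $$ (i, j)" if "i < d" "j < d" for i j
    unfolding e_def using that by (intro Min_le) auto
  have "(M ^\<^sub>m k) $$ (0, 0) \<le> (\<Sum>j<d. (M ^\<^sub>m k) $$ (0, j))"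
    using assms(2) by (intro member_le_sum) (auto intro: stochastic_matD(2)[OF Mk])
  then have e1: "e \<le> 1" using el[of 0 0] assms(2) stochastic_matD(3)[OF Mk, of 0] by simp
  have c: "contr d (M ^\<^sub>m k) (1 - e)" by (rule contr_positive[OF Mk el])
  then show "\<exists>t q. 1 \<le> t \<and> q < 1 \<and> 0 \<le> q \<and> contr d (M ^\<^sub>m t) q" using e e1 k(2) by (intro exI[of _ k] exI[of _ "1 - e"]) auto
  obtain p where p: "stat_dist d M p" using stat_dist_exists[OF M assms(2)] by blast
  have dim: "dim_row M = d" using stochastic_matD(1)[OF M] by auto
  have st: "stationary M = p'" if "stat_dist d M p'" for p'
    unfolding stationary_def dim stat_dist_def[symmetric]
  proof (rule the_equality)
    show "stat_dist d M p'" by (rule that)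
    show "p = p'" if "stat_dist d M p" for p
      by (rule stat_dist_unique[OF M c _ that \<open>stat_dist d M p'\<close>]) (use e in simp)
  qed
  show "stationary M = p'" if "stat_dist d M p'" for p' by (rule st[OF that])
  show sd: "stat_dist d M (stationary M)" using st[OF p] p by simp
  fix i assume i: "i < d"
  have "stat_dist d (M ^\<^sub>m k) p" by (rule stat_dist_pow[OF p stochastic_matD(1)[OF M]])
  then have "p i = (\<Sum>j<d. p j * (M ^\<^sub>m k) $$ (j, i))" using i by (simp add: stat_dist_def)
  moreover have "(\<Sum>j<d. p j * e) \<le> (\<Sum>j<d. p j * (M ^\<^sub>m k) $$ (j, i))"
    using p el i by (intro sum_mono mult_left_mono) (auto simp: stat_dist_def distribution_def)
  moreover have "(\<Sum>j<d. p j * e) = e"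
    using p by (simp add: sum_distrib_right[symmetric] stat_dist_def distribution_def)
  ultimately show "0 < stationary M i" using e st[OF p] by simp
qed

lemma ergodic_pow:
  assumes M: "ergodic d M" and d: "0 < d" and k: "1 \<le> k"
  shows "ergodic d (M ^\<^sub>m k)" "stationary (M ^\<^sub>m k) = stationary M"
proof -
  note s = ergodicD[OF M d]
  have c: "M \<in> carrier_mat d d" by (rule stochastic_matD(1)[OF s(1)])
  obtain l where l: "l \<ge> 1" "\<And>i j. i < d \<Longrightarrow> j < d \<Longrightarrow> 0 < (M ^\<^sub>m l) $$ (i, j)"
    using M by (auto simp: ergodic_def)
  \<comment> \<open>All multiples of the exponent \<open>l\<close> give positive powers, and the
    exponent \<open>l * k\<close> belongs to the \<open>l\<close>-th power of
    \<open>M^k\<close>.\<close>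
  have "0 < (M ^\<^sub>m (l * n)) $$ (i, j)" if "1 \<le> n" "i < d" "j < d" for n i j
    using that
  proof (induction n arbitrary: i rule: nat_induct_at_least)
    case base then show ?case using l by simp
  next
    case (Suc n)
    have "M ^\<^sub>m (l * Suc n) = M ^\<^sub>m l * M ^\<^sub>m (l * n)" using pow_mat_add[OF c] by simp
    then have "(M ^\<^sub>m (l * Suc n)) $$ (i, j) = (\<Sum>a<d. (M ^\<^sub>m l) $$ (i, a) * (M ^\<^sub>m (l * n)) $$ (a, j))"
      using Suc.prems c by (simp add: scalar_prod_def atLeast0LessThan)
    also have "\<dots> > 0" using Suc l(2) d by (intro sum_pos) auto
    finally show ?case .
  qed
  then have "\<forall>i<d. \<forall>j<d. 0 < ((M ^\<^sub>m k) ^\<^sub>m l) $$ (i, j)" using k c by (simp add: pow_mat_mult mult.commute)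
  then show e: "ergodic d (M ^\<^sub>m k)" using l(1) stochastic_mat_pow[OF s(1)] by (auto simp: ergodic_def)
  show "stationary (M ^\<^sub>m k) = stationary M" by (rule ergodicD(5)[OF e d stat_dist_pow[OF s(2) c]])
qed

section \<open>The pseudo-spectral gap\<close>

definition wsq :: "nat \<Rightarrow> (nat \<Rightarrow> real) \<Rightarrow> (nat \<Rightarrow> real) \<Rightarrow> real" where
  "wsq d p f = (\<Sum>i<d. p i * (f i)\<^sup>2)"

definition conj_mat :: "nat \<Rightarrow> (nat \<Rightarrow> real) \<Rightarrow> real mat \<Rightarrow> real mat" where
  "conj_mat d p A = Matrix.mat d d (\<lambda>(i, j). sqrt (p i) * A $$ (i, j) / sqrt (p j))"

text \<open>The matrix \<open>time_reversal A * A\<close> is similar to the Gram matrix of \<open>conj_mat d p A\<close>. For the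
  weights \<open>pi_hat\<close> and \<open>A = M_hat\<close>, \<open>conj_mat d p A\<close> is \<open>L_hat\<close>, although \<open>pi_hat\<close> is
  only approximately stationary for \<open>M_hat\<close>.\<close>

definition gram_gap :: "nat \<Rightarrow> (nat \<Rightarrow> real) \<Rightarrow> real mat \<Rightarrow> real" where
  "gram_gap d p A = spectral_gap (transpose_mat (conj_mat d p A) * conj_mat d p A)"

lemma conj_mat_carrier [simp]: "conj_mat d p A \<in> carrier_mat d d"
  by (simp add: conj_mat_def)

lemma conj_mat_index: "i < d \<Longrightarrow> j < d \<Longrightarrow> conj_mat d p A $$ (i, j) = sqrt (p i) * A $$ (i, j) / sqrt (p j)"
  by (simp add: conj_mat_def)

text \<open>Multiplication by \<open>sqrt p\<close> is an isometry from functions with weight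
  \<open>p\<close> to Euclidean space, and \<open>conj_mat d p A\<close> is \<open>A\<close> in
  these coordinates.\<close>

lemma mv_conj_mat:
  assumes "\<And>i. i < d \<Longrightarrow> 0 < p i" "i < d"
  shows "mv d (conj_mat d p A) (\<lambda>j. sqrt (p j) * f j) i = sqrt (p i) * mv d A f i"
proof -
  have "sqrt (p i) * A $$ (i, j) / sqrt (p j) * (sqrt (p j) * f j) = sqrt (p i) * (A $$ (i, j) * f j)" if "j < d" for j
    using assms(1)[OF that] by simp
  then show ?thesis using assms(2) by (simp add: mv_def conj_mat_index sum_distrib_left)
qed

lemma ip_sqrt_weights:
  assumes "\<And>i. i < d \<Longrightarrow> 0 < p i"
  shows "ip d (\<lambda>i. sqrt (p i) * f i) (\<lambda>i. sqrt (p i) * g i) = (\<Sum>i<d. p i * (f i * g i))"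
proof -
  have h: "sqrt (p i) * f i * (sqrt (p i) * g i) = p i * (f i * g i)" if "i < d" for i
  proof -
    have "sqrt (p i) * f i * (sqrt (p i) * g i) = (sqrt (p i) * sqrt (p i)) * (f i * g i)" by (simp only: mult_ac)
    then show ?thesis using assms[OF that] by simp
  qed
  show ?thesis unfolding ip_def by (rule sum.cong[OF refl], rule h) simp
qed

lemma ip_sqrt_weights_self:
  assumes "\<And>i. i < d \<Longrightarrow> 0 < p i"
  shows "ip d (\<lambda>i. sqrt (p i) * f i) (\<lambda>i. sqrt (p i) * f i) = wsq d p f"
  by (simp add: ip_sqrt_weights[OF assms] wsq_def power2_eq_square)

lemma conj_mat_norm:
  assumes "\<And>i. i < d \<Longrightarrow> 0 < p i"
  shows "ip d (mv d (conj_mat d p A) (\<lambda>j. sqrt (p j) * f j)) (mv d (conj_mat d p A) (\<lambda>j. sqrt (p j) * f j))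
    = wsq d p (mv d A f)"
proof -
  have "ip d (mv d (conj_mat d p A) (\<lambda>j. sqrt (p j) * f j)) (mv d (conj_mat d p A) (\<lambda>j. sqrt (p j) * f j))
    = ip d (\<lambda>i. sqrt (p i) * mv d A f i) (\<lambda>i. sqrt (p i) * mv d A f i)"
    by (intro ip_cong mv_conj_mat assms) auto
  also have "\<dots> = wsq d p (mv d A f)" by (rule ip_sqrt_weights_self) (rule assms)
  finally show ?thesis .
qed

lemma wsq_nonneg: "(\<And>i. i < d \<Longrightarrow> 0 < p i) \<Longrightarrow> 0 \<le> wsq d p f"
  unfolding wsq_def by (intro sum_nonneg mult_nonneg_nonneg) (auto intro: less_imp_le)

text \<open>The variance of \<open>f\<close> under row \<open>i\<close> is nonnegative.\<close>

lemma mv_square_le: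
  assumes M: "stochastic_mat d M" and i: "i < d"
  shows "(mv d M f i)\<^sup>2 \<le> mv d M (\<lambda>j. (f j)\<^sup>2) i"
proof -
  let ?m = "mv d M f i"
  have "0 \<le> mv d M (\<lambda>j. (f j - ?m)\<^sup>2) i" by (intro mv_nonneg[OF M i]) auto
  also have "(\<lambda>j. (f j - ?m)\<^sup>2) = (\<lambda>j. ((f j)\<^sup>2 - (2 * ?m) * f j) + ?m\<^sup>2)"
    by (simp add: power2_diff algebra_simps)
  also have "mv d M \<dots> i = mv d M (\<lambda>j. (f j)\<^sup>2) i - 2 * ?m * ?m + ?m\<^sup>2"
    unfolding mv_add mv_diff mv_scale mv_const[OF M i] by simp
  finally show ?thesis by (simp add: power2_eq_square)
qed

lemma wsq_mv_le:
  assumes M: "stochastic_mat d M" and p: "stat_dist d M p"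
  shows "wsq d p (mv d M f) \<le> wsq d p f"
proof -
  have "wsq d p (mv d M f) \<le> ip d p (mv d M (\<lambda>j. (f j)\<^sup>2))"
    unfolding wsq_def ip_def using p
    by (intro sum_mono mult_left_mono mv_square_le M) (auto simp: stat_dist_def distribution_def)
  also have "\<dots> = wsq d p f" unfolding ip_stat[OF p] by (simp add: wsq_def ip_def)
  finally show ?thesis .
qed

text \<open>\<open>p\<close> is any positive stationary distribution rather than
  \<open>stationary A\<close>; thus the locale can be instantiated directly for powers of a chain,
  for its lazy version and for a trajectory closed up into a cycle. A second eigenvalue exists
  because of \<open>2 \<le> d\<close>.\<close>

locale weighted_chain =
  fixes d :: nat and A :: "real mat" and p :: "nat \<Rightarrow> real"
  assumes d: "2 \<le> d" and stoch: "stochastic_mat d A" and stat: "stat_dist d A p"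
    and pos: "\<And>i. i < d \<Longrightarrow> 0 < p i"
begin

lemma weight_sqrt_decomp:
  obtains f where "\<And>i. i < d \<Longrightarrow> x i = sqrt (p i) * f i"
  using pos by (intro that[of "\<lambda>i. x i / sqrt (p i)"]) (force dest: pos)

lemma sum_p: "(\<Sum>i<d. p i) = 1"
  using stat by (simp add: stat_dist_def distribution_def)

lemma ip_sqrt: "ip d (\<lambda>i. sqrt (p i) * f i) (\<lambda>i. sqrt (p i) * g i) = (\<Sum>i<d. p i * (f i * g i))"
  by (rule ip_sqrt_weights) (rule pos)

lemma ip_sqrt_self: "ip d (\<lambda>i. sqrt (p i) * f i) (\<lambda>i. sqrt (p i) * f i) = wsq d p f"
  by (rule ip_sqrt_weights_self) (rule pos)

lemma conj_norm: "ip d (mv d (conj_mat d p B) (\<lambda>j. sqrt (p j) * f j)) (mv d (conj_mat d p B) (\<lambda>j. sqrt (p j) * f j))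
    = wsq d p (mv d B f)"
  by (rule conj_mat_norm) (rule pos)

lemma op_bound_conj_mat: "op_bound d (conj_mat d p A) 1"
  unfolding op_bound_ip
proof (intro conjI allI)
  fix x
  obtain f where f: "\<And>i. i < d \<Longrightarrow> x i = sqrt (p i) * f i" using weight_sqrt_decomp by blast
  have "mv d (conj_mat d p A) x = mv d (conj_mat d p A) (\<lambda>j. sqrt (p j) * f j)"
    by (rule mv_cong) (rule f)
  moreover have "ip d x x = wsq d p f"
    unfolding ip_sqrt_self[symmetric] by (intro ip_cong f)
  ultimately show "ip d (mv d (conj_mat d p A) x) (mv d (conj_mat d p A) x) \<le> 1\<^sup>2 * ip d x x"
    using wsq_mv_le[OF stoch stat, of f] by (simp add: conj_norm)
qed simp

lemma gram_gap_bounds: "0 \<le> gram_gap d p A" "gram_gap d p A \<le> 1"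
  using second_eigval_gram_bounds[OF _ d op_bound_conj_mat] by (simp_all add: gram_gap_def spectral_gap_def)

text \<open>The vector \<open>sqrt p\<close> is fixed by \<open>conj_mat d p A\<close>, because rows
  sum to 1, and by its transpose, because \<open>p\<close> is stationary. It is therefore fixed by
  the Gram matrix, and centred functions form its orthogonal complement.\<close>

lemma wsq_contract:
  assumes f: "ip d p f = 0"
  shows "wsq d p (mv d A f) \<le> (1 - gram_gap d p A) * wsq d p f"
proof -
  let ?L = "conj_mat d p A" and ?u = "\<lambda>i. sqrt (p i) * 1" and ?x = "\<lambda>i. sqrt (p i) * f i"
  let ?S = "transpose_mat ?L * ?L"
  have u: "ip d ?u ?u = 1" unfolding ip_sqrt using sum_p by simp
  have Lu: "mv d ?L ?u i = ?u i" if "i < d" for i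
    using mv_conj_mat[OF pos that, where f = "\<lambda>_. 1"] mv_const[OF stoch that] by simp
  have LTu: "mv d (transpose_mat ?L) ?u i = ?u i" if i: "i < d" for i
  proof -
    have "mv d (transpose_mat ?L) ?u i = (\<Sum>j<d. sqrt (p j) * A $$ (j, i) / sqrt (p i) * sqrt (p j))"
      using i unfolding mv_def by (intro sum.cong) (auto simp: conj_mat_index conj_mat_def)
    also have "\<dots> = (\<Sum>j<d. p j * A $$ (j, i) / sqrt (p i))"
    proof (intro sum.cong refl)
      fix j assume "j \<in> {..<d}"
      then have "sqrt (p j) * sqrt (p j) = p j" using pos[of j] by simp
      then show "sqrt (p j) * A $$ (j, i) / sqrt (p i) * sqrt (p j) = p j * A $$ (j, i) / sqrt (p i)"
        by (metis (no_types, lifting) mult.commute mult.left_commute times_divide_eq_left)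
    qed
    also have "\<dots> = p i / sqrt (p i)"
      using stat i by (simp add: sum_divide_distrib[symmetric] stat_dist_def)
    also have "\<dots> = ?u i" using pos[OF i] by (simp add: real_div_sqrt)
    finally show ?thesis .
  qed
  have Su: "mv d ?S ?u i = ?u i" if "i < d" for i
    using that mv_cong[of d "mv d ?L ?u" ?u "transpose_mat ?L"] Lu LTu by (simp add: mv_mult)
  have q: "ip d ?x (mv d ?S ?x) = wsq d p (mv d A f)" by (simp add: gram_quadratic conj_norm)
  have "ip d ?x (mv d ?S ?x) \<le> eigvals ?S ! 1 * ip d ?x ?x"
  proof (rule rayleigh_le_second_eigval[OF gram_sym_mat d u Su])
    show "ip d ?x ?u = 0" unfolding ip_sqrt using f by (simp add: ip_def)
    show "ip d ?x (mv d ?S ?x) \<le> ip d ?x ?x"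
      unfolding q ip_sqrt_self by (rule wsq_mv_le[OF stoch stat])
  qed auto
  then show ?thesis unfolding q ip_sqrt_self by (simp add: gram_gap_def spectral_gap_def)
qed

text \<open>Converse of \<open>wsq_contract\<close>: together they identify
  \<open>1 - gram_gap d p A\<close> as the best contraction factor of \<open>A\<close> for
  \<open>wsq\<close> on centred functions.\<close>

lemma gram_gap_ge:
  assumes c: "\<And>f. ip d p f = 0 \<Longrightarrow> wsq d p (mv d A f) \<le> c * wsq d p f"
  shows "1 - c \<le> gram_gap d p A"
proof -
  let ?L = "conj_mat d p A"
  have "eigvals (transpose_mat ?L * ?L) ! 1 \<le> c"
  proof (rule second_eigval_le[OF gram_sym_mat d, of _ "\<lambda>i. sqrt (p i) * 1"])
    fix x assume x: "ip d x (\<lambda>i. sqrt (p i) * 1) = 0"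
    obtain f where f: "\<And>i. i < d \<Longrightarrow> x i = sqrt (p i) * f i" using weight_sqrt_decomp by blast
    have xs: "ip d x y = ip d (\<lambda>j. sqrt (p j) * f j) y" "ip d y x = ip d y (\<lambda>j. sqrt (p j) * f j)" for y
      by (auto intro!: ip_cong f)
    have "ip d p f = 0" using x unfolding xs ip_sqrt by (simp add: ip_def)
    moreover have "mv d ?L x = mv d ?L (\<lambda>j. sqrt (p j) * f j)" by (rule mv_cong) (rule f)
    moreover have "ip d x x = wsq d p f" unfolding xs ip_sqrt_self ..
    ultimately show "ip d x (mv d (transpose_mat ?L * ?L) x) \<le> c * ip d x x"
      using c by (simp add: gram_quadratic conj_norm)
  qed simp
  then show ?thesis by (simp add: gram_gap_def spectral_gap_def)
qed

lemma weighted_chain_pow: "weighted_chain d (A ^\<^sub>m k) p"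
  using d stochastic_mat_pow[OF stoch] stat_dist_pow[OF stat stochastic_matD(1)[OF stoch]] pos
  by unfold_locales

lemma centered_mv: "ip d p f = 0 \<Longrightarrow> ip d p (mv d A f) = 0"
  by (simp add: ip_stat[OF stat])

lemma wsq_contract_pow:
  assumes g: "\<And>f. ip d p f = 0 \<Longrightarrow> wsq d p (mv d A f) \<le> c * wsq d p f" and c: "0 \<le> c"
    and f: "ip d p f = 0"
  shows "ip d p (mv d (A ^\<^sub>m j) f) = 0 \<and> wsq d p (mv d (A ^\<^sub>m j) f) \<le> c ^ j * wsq d p f"
proof (induction j)
  case 0
  have e: "mv d (A ^\<^sub>m 0) f i = f i" if "i < d" for i
    using that by (intro mv_pow_0) (rule stochastic_matD(1)[OF stoch])
  have "ip d p (mv d (A ^\<^sub>m 0) f) = ip d p f" by (intro ip_cong e) auto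
  moreover have "wsq d p (mv d (A ^\<^sub>m 0) f) = wsq d p f" unfolding wsq_def by (intro sum.cong) (auto simp only: e lessThan_iff)
  ultimately show ?case using f by simp
next
  case (Suc j)
  have e: "mv d (A ^\<^sub>m Suc j) f i = mv d A (mv d (A ^\<^sub>m j) f) i" if "i < d" for i
    using that by (intro mv_pow_Suc) (rule stochastic_matD(1)[OF stoch])
  have "ip d p (mv d (A ^\<^sub>m Suc j) f) = ip d p (mv d A (mv d (A ^\<^sub>m j) f))" by (intro ip_cong e) auto
  moreover have "wsq d p (mv d (A ^\<^sub>m Suc j) f) = wsq d p (mv d A (mv d (A ^\<^sub>m j) f))"
    unfolding wsq_def by (intro sum.cong) (auto simp only: e lessThan_iff)
  moreover have "wsq d p (mv d A (mv d (A ^\<^sub>m j) f)) \<le> c * wsq d p (mv d (A ^\<^sub>m j) f)"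
    using Suc by (intro g) simp
  moreover have "c * wsq d p (mv d (A ^\<^sub>m j) f) \<le> c * (c ^ j * wsq d p f)"
    using Suc c by (intro mult_left_mono) auto
  ultimately show ?case using Suc centered_mv by (simp add: mult.assoc)
qed

text \<open>Passing from the weighted square norm to the supremum costs a factor
  \<open>1 / pm\<close>, which \<open>4 * c ^ j \<le> pm\<close> beats. Among all centrings the mean
  minimizes \<open>wsq\<close>, so centring at the middle of the range shows
  \<open>wsq d p h \<le> (w / 2)^2\<close>.\<close>

lemma contr_of_wsq_contract:
  assumes g: "\<And>f. ip d p f = 0 \<Longrightarrow> wsq d p (mv d A f) \<le> c * wsq d p f" and c: "0 \<le> c"
    and pm: "\<And>i. i < d \<Longrightarrow> pm \<le> p i" "0 < pm"
    and j: "4 * c ^ j \<le> pm"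
  shows "contr d (A ^\<^sub>m j) (1 / 2)"
  unfolding contr_def
proof (intro allI impI)
  fix f w assume f: "osc_le d f w"
  have w: "0 \<le> w" using osc_le_nonneg[OF f] d by simp
  obtain m where m: "\<And>i. i < d \<Longrightarrow> \<bar>f i - m\<bar> \<le> w / 2" using osc_le_center[OF f] d by auto
  define h where "h = (\<lambda>i. f i - ip d p f)"
  have dist: "distribution d p" using stat by (simp add: stat_dist_def)
  have h0: "ip d p h = 0" by (simp add: h_def ip_linear distribution_ip_const[OF dist])
  have "wsq d p h \<le> wsq d p (\<lambda>i. h i + (ip d p f - m))"
  proof -
    have "wsq d p (\<lambda>i. h i + (ip d p f - m)) = (\<Sum>i<d. p i * (h i)\<^sup>2 + (2 * (ip d p f - m)) * (p i * h i) + (ip d p f - m)\<^sup>2 * p i)"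
      unfolding wsq_def by (intro sum.cong) (auto simp: power2_eq_square algebra_simps)
    also have "\<dots> = wsq d p h + 2 * (ip d p f - m) * ip d p h + (ip d p f - m)\<^sup>2"
      by (simp add: sum.distrib sum_distrib_left[symmetric] wsq_def ip_def sum_p)
    finally show ?thesis by (simp add: h0)
  qed
  also have "\<dots> \<le> (\<Sum>i<d. p i * (w / 2)\<^sup>2)"
    unfolding wsq_def h_def using m pos
    by (intro sum_mono mult_left_mono) (auto simp: power2_le_iff_abs_le w less_imp_le)
  also have "\<dots> = (w / 2)\<^sup>2" by (simp add: sum_distrib_right[symmetric] sum_p)
  finally have wh: "wsq d p h \<le> (w / 2)\<^sup>2" .
  have b: "\<bar>mv d (A ^\<^sub>m j) h i\<bar> \<le> w / 4" if i: "i < d" for i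
  proof -
    have "pm * (mv d (A ^\<^sub>m j) h i)\<^sup>2 \<le> p i * (mv d (A ^\<^sub>m j) h i)\<^sup>2"
      using pm i by (intro mult_right_mono) auto
    also have "\<dots> \<le> wsq d p (mv d (A ^\<^sub>m j) h)"
      unfolding wsq_def using i pos by (intro member_le_sum) (auto simp: less_imp_le)
    also have "\<dots> \<le> c ^ j * wsq d p h" using wsq_contract_pow[OF g c h0] by simp
    also have "\<dots> \<le> c ^ j * (w / 2)\<^sup>2" using wh c by (intro mult_left_mono) auto
    also have "\<dots> = 4 * c ^ j * (w / 4)\<^sup>2" by (simp add: power2_eq_square)
    also have "\<dots> \<le> pm * (w / 4)\<^sup>2" using j by (intro mult_right_mono) auto
    finally have "(mv d (A ^\<^sub>m j) h i)\<^sup>2 \<le> (w / 4)\<^sup>2" using pm by simp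
    then show ?thesis using w by (simp add: power2_le_iff_abs_le)
  qed
  have "mv d (A ^\<^sub>m j) f i - mv d (A ^\<^sub>m j) f i' \<le> 1 / 2 * w" if "i < d" "i' < d" for i i'
  proof -
    have "mv d (A ^\<^sub>m j) h i = mv d (A ^\<^sub>m j) f i - ip d p f" if "i < d" for i
      unfolding h_def mv_diff using mv_const[OF stochastic_mat_pow[OF stoch] that] by simp
    then have "mv d (A ^\<^sub>m j) f i - mv d (A ^\<^sub>m j) f i' = mv d (A ^\<^sub>m j) h i - mv d (A ^\<^sub>m j) h i'"
      using that by simp
    then show ?thesis using b[OF that(1)] b[OF that(2)] by linarith
  qed
  then show "osc_le d (mv d (A ^\<^sub>m j) f) (1 / 2 * w)" by (simp add: osc_le_def)
qed

end

section \<open>Time reversal and the pseudo-spectral gap as a supremum of Gram gaps\<close>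

lemma mult_mat_index:
  assumes "A \<in> carrier_mat d d" "B \<in> carrier_mat d d" "i < d" "j < d"
  shows "(A * B) $$ (i, j) = (\<Sum>l<d. A $$ (i, l) * B $$ (l, j))"
  using assms by (simp add: scalar_prod_def atLeast0LessThan)

lemma gram_index:
  assumes "A \<in> carrier_mat d d" "i < d" "j < d"
  shows "(transpose_mat A * A) $$ (i, j) = (\<Sum>l<d. A $$ (l, i) * A $$ (l, j))"
  using assms by (simp add: scalar_prod_def atLeast0LessThan)

text \<open>The power of the reversal is the reversal of the power; the induction step turns the
  order of the factors around.\<close>

lemma time_reversal_pow_index:
  assumes M: "stochastic_mat d M" and p: "stationary M = p" "\<And>i. i < d \<Longrightarrow> 0 < p i" and "i < d" "j < d"
  shows "(time_reversal M ^\<^sub>m k) $$ (i, j) = p j * (M ^\<^sub>m k) $$ (j, i) / p i"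
  using \<open>i < d\<close> \<open>j < d\<close>
proof (induction k arbitrary: i j)
  case 0
  then show ?case using M p(2)[of i] stochastic_matD(1)[OF M] by (auto simp: time_reversal_def)
next
  case (Suc k)
  have c: "M \<in> carrier_mat d d" "time_reversal M \<in> carrier_mat d d"
    using stochastic_matD(1)[OF M] by (auto simp: time_reversal_def)
  have T: "time_reversal M $$ (l, j) = p j * M $$ (j, l) / p l" if "l < d" for l
    using that Suc.prems c by (auto simp: time_reversal_def p(1))
  have "(time_reversal M ^\<^sub>m Suc k) $$ (i, j) = (\<Sum>l<d. (time_reversal M ^\<^sub>m k) $$ (i, l) * time_reversal M $$ (l, j))"
    using Suc.prems c pow_mat_carrier[OF c(2), of k] by (simp add: scalar_prod_def atLeast0LessThan)
  also have "\<dots> = (\<Sum>l<d. p j / p i * (M $$ (j, l) * (M ^\<^sub>m k) $$ (l, i)))"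
    by (intro sum.cong refl) (use Suc in \<open>auto simp: T dest!: p(2)\<close>)
  also have "\<dots> = p j / p i * (M * M ^\<^sub>m k) $$ (j, i)"
    using Suc.prems c pow_mat_carrier[OF c(1), of k]
    by (simp add: scalar_prod_def atLeast0LessThan sum_distrib_left)
  also have "M * M ^\<^sub>m k = M ^\<^sub>m Suc k" using pow_mat_add[OF c(1), of 1 k] c by simp
  finally show ?case by simp
qed

lemma spectral_gap_eq_gram_gap:
  assumes M: "stochastic_mat d M" and p: "stationary M = p" "\<And>i. i < d \<Longrightarrow> 0 < p i"
  shows "spectral_gap (time_reversal M ^\<^sub>m k * M ^\<^sub>m k) = gram_gap d p (M ^\<^sub>m k)"
proof -
  have c: "M \<in> carrier_mat d d" "time_reversal M \<in> carrier_mat d d"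
    using stochastic_matD(1)[OF M] by (auto simp: time_reversal_def)
  note ck = pow_mat_carrier[OF c(1), of k] pow_mat_carrier[OF c(2), of k]
  let ?L = "conj_mat d p (M ^\<^sub>m k)"
  have "char_poly (time_reversal M ^\<^sub>m k * M ^\<^sub>m k) = char_poly (transpose_mat ?L * ?L)"
  proof (rule char_poly_diag_conj[of _ d _ "\<lambda>i. sqrt (p i)"])
    fix i j assume ij: "i < d" "j < d"
    have pi: "0 < p i" "0 < p j" using p(2) ij by auto
    have "(transpose_mat ?L * ?L) $$ (i, j) * sqrt (p j) / sqrt (p i)
        = (\<Sum>l<d. ?L $$ (l, i) * ?L $$ (l, j) * sqrt (p j) / sqrt (p i))"
      unfolding gram_index[OF conj_mat_carrier ij] by (simp only: sum_distrib_right sum_divide_distrib)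
    also have "\<dots> = (\<Sum>l<d. (time_reversal M ^\<^sub>m k) $$ (i, l) * (M ^\<^sub>m k) $$ (l, j))"
    proof (intro sum.cong refl)
      fix l assume "l \<in> {..<d}"
      then have l: "l < d" "0 < p l" using p(2) by auto
      have "?L $$ (l, i) * ?L $$ (l, j) * sqrt (p j) / sqrt (p i)
          = (sqrt (p l) * sqrt (p l)) * (M ^\<^sub>m k) $$ (l, i) * (M ^\<^sub>m k) $$ (l, j) / (sqrt (p i) * sqrt (p i))"
        using pi by (simp add: conj_mat_index l ij)
      also have "\<dots> = p l * (M ^\<^sub>m k) $$ (l, i) * (M ^\<^sub>m k) $$ (l, j) / p i"
        using pi l by simp
      finally show "?L $$ (l, i) * ?L $$ (l, j) * sqrt (p j) / sqrt (p i)
          = (time_reversal M ^\<^sub>m k) $$ (i, l) * (M ^\<^sub>m k) $$ (l, j)"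
        by (simp add: time_reversal_pow_index[OF M p ij(1) l(1)])
    qed
    also have "\<dots> = (time_reversal M ^\<^sub>m k * M ^\<^sub>m k) $$ (i, j)"
      by (rule mult_mat_index[OF ck(2,1) ij, symmetric])
    finally show "(time_reversal M ^\<^sub>m k * M ^\<^sub>m k) $$ (i, j)
        = (transpose_mat ?L * ?L) $$ (i, j) * sqrt (p j) / sqrt (p i)" by (rule sym)
  next
    show "sqrt (p i) \<noteq> 0" if "i < d" for i using p(2)[OF that] by simp
  next
    show "time_reversal M ^\<^sub>m k * M ^\<^sub>m k \<in> carrier_mat d d" by (rule mult_carrier_mat[OF ck(2,1)])
    show "transpose_mat ?L * ?L \<in> carrier_mat d d" by (rule mult_carrier_mat[of _ _ d]) auto
  qed
  then have "eigvals (time_reversal M ^\<^sub>m k * M ^\<^sub>m k) = eigvals (transpose_mat ?L * ?L)" by (rule eigvals_cong)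
  then show ?thesis unfolding gram_gap_def spectral_gap_def by (simp only:)
qed

lemma pseudo_gap_eq:
  assumes M: "stochastic_mat d M" and p: "stationary M = p" "\<And>i. i < d \<Longrightarrow> 0 < p i"
  shows "pseudo_gap M = (SUP k\<in>{1..}. gram_gap d p (M ^\<^sub>m k) / real k)"
  by (simp add: pseudo_gap_def spectral_gap_eq_gram_gap[OF M p])

context weighted_chain
begin

lemma gram_gap_term_bounds: "0 \<le> gram_gap d p (A ^\<^sub>m k) / real k" "1 \<le> k \<Longrightarrow> gram_gap d p (A ^\<^sub>m k) / real k \<le> 1 / real k"
  using weighted_chain.gram_gap_bounds[OF weighted_chain_pow, of k] by (auto intro: divide_right_mono)

lemma gram_gap_term_le_1: "1 \<le> k \<Longrightarrow> gram_gap d p (A ^\<^sub>m k) / real k \<le> 1"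
  using weighted_chain.gram_gap_bounds(2)[OF weighted_chain_pow, of k] by (simp add: divide_simps)

lemma bdd_above_gram_gaps: "bdd_above ((\<lambda>k. gram_gap d p (A ^\<^sub>m k) / real k) ` {1..})"
proof (rule bdd_aboveI2)
  fix k :: nat assume "k \<in> {1..}"
  then show "gram_gap d p (A ^\<^sub>m k) / real k \<le> 1"
    by (intro gram_gap_term_le_1) auto
qed

lemma pseudo_gap_SUP:
  "stationary A = p \<Longrightarrow> pseudo_gap A = (SUP k\<in>{1..}. gram_gap d p (A ^\<^sub>m k) / real k)"
  by (rule pseudo_gap_eq[OF stoch]) (assumption, rule pos)

lemma pseudo_gap_upper: "stationary A = p \<Longrightarrow> 1 \<le> k \<Longrightarrow> gram_gap d p (A ^\<^sub>m k) / real k \<le> pseudo_gap A"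
  by (subst pseudo_gap_SUP, assumption, rule cSUP_upper[OF _ bdd_above_gram_gaps]) simp

lemma pseudo_gap_bounds: "stationary A = p \<Longrightarrow> 0 \<le> pseudo_gap A" "stationary A = p \<Longrightarrow> pseudo_gap A \<le> 1"
proof -
  assume s: "stationary A = p"
  show "0 \<le> pseudo_gap A" using pseudo_gap_upper[OF s, of 1] gram_gap_term_bounds(1)[of 1] by simp
  have "gram_gap d p (A ^\<^sub>m k) / real k \<le> 1" if "k \<in> {1..}" for k
    using that by (intro gram_gap_term_le_1) auto
  then show "pseudo_gap A \<le> 1" unfolding pseudo_gap_SUP[OF s] by (intro cSUP_least) auto
qed

lemma pseudo_gap_approx:
  assumes s: "stationary A = p" and c: "c < pseudo_gap A"
  obtains k where "1 \<le> k" "c < gram_gap d p (A ^\<^sub>m k) / real k"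
proof -
  have "\<exists>k\<in>{1..}. c < gram_gap d p (A ^\<^sub>m k) / real k"
    using c less_cSUP_iff[OF _ bdd_above_gram_gaps, of c] unfolding pseudo_gap_SUP[OF s] by auto
  then show thesis using that by auto
qed

text \<open>The additional factor, a power of \<open>A\<close>, does not increase the weighted
  norm.\<close>

lemma gram_gap_mono: 
  assumes "k \<le> l" shows "gram_gap d p (A ^\<^sub>m k) \<le> gram_gap d p (A ^\<^sub>m l)"
proof -
  have "1 - (1 - gram_gap d p (A ^\<^sub>m k)) \<le> gram_gap d p (A ^\<^sub>m l)"
  proof (rule weighted_chain.gram_gap_ge[OF weighted_chain_pow])
    fix f assume f: "ip d p f = 0"
    have e: "mv d (A ^\<^sub>m l) f i = mv d (A ^\<^sub>m (l - k)) (mv d (A ^\<^sub>m k) f) i" if "i < d" for i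
      using mv_pow_add[OF stochastic_matD(1)[OF stoch] that, of "l - k" k f] assms by simp
    have "wsq d p (mv d (A ^\<^sub>m l) f) = wsq d p (mv d (A ^\<^sub>m (l - k)) (mv d (A ^\<^sub>m k) f))"
      unfolding wsq_def by (intro sum.cong) (auto simp only: e lessThan_iff)
    also have "\<dots> \<le> wsq d p (mv d (A ^\<^sub>m k) f)"
      by (intro wsq_mv_le stochastic_mat_pow stoch stat_dist_pow stat stochastic_matD(1)[OF stoch])
    also have "\<dots> \<le> (1 - gram_gap d p (A ^\<^sub>m k)) * wsq d p f"
      by (rule weighted_chain.wsq_contract[OF weighted_chain_pow f])
    finally show "wsq d p (mv d (A ^\<^sub>m l) f) \<le> (1 - gram_gap d p (A ^\<^sub>m k)) * wsq d p f" .
  qed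
  then show ?thesis by simp
qed

text \<open>Lets the widths at skip \<open>k\<close> be expressed through the gap of the original
  chain. The term \<open>l\<close> of the supremum is compared with the term \<open>j\<close> for
  \<open>A^k\<close>, where \<open>j\<close> is \<open>l / k\<close> rounded up, so that
  \<open>l \<le> k * j\<close> and \<open>j \<le> l\<close>.\<close>

lemma pseudo_gap_pow_ge:
  assumes s: "stationary A = p" "stationary (A ^\<^sub>m k) = p" and k: "1 \<le> k"
  shows "pseudo_gap A \<le> pseudo_gap (A ^\<^sub>m k)"
  unfolding pseudo_gap_SUP[OF s(1)]
proof (rule cSUP_least)
  fix l :: nat assume l: "l \<in> {1..}"
  define j where "j = (l + k - 1) div k"
  have j: "1 \<le> j" "j \<le> l" "l \<le> k * j"
  proof -
    show "1 \<le> j" using l k by (auto simp: j_def less_eq_div_iff_mult_less_eq)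
    have "l + k - 1 < k * l + k" using l k by (cases k) auto
    then have "j < l + 1" unfolding j_def using k by (subst div_less_iff_less_mult) (auto simp: algebra_simps)
    then show "j \<le> l" by simp
    have "l + k - 1 = k * j + (l + k - 1) mod k" by (simp add: j_def)
    moreover have "(l + k - 1) mod k < k" using k by simp
    ultimately show "l \<le> k * j" by linarith
  qed
  have "gram_gap d p (A ^\<^sub>m l) / real l \<le> gram_gap d p (A ^\<^sub>m (k * j)) / real j"
    using l j gram_gap_mono[OF j(3)] weighted_chain.gram_gap_bounds[OF weighted_chain_pow, of "k * j"]
    by (intro frac_le) auto
  also have "A ^\<^sub>m (k * j) = (A ^\<^sub>m k) ^\<^sub>m j" by (simp add: pow_mat_mult[OF stochastic_matD(1)[OF stoch]])
  also have "gram_gap d p \<dots> / real j \<le> pseudo_gap (A ^\<^sub>m k)"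
    by (rule weighted_chain.pseudo_gap_upper[OF weighted_chain_pow s(2) j(1)])
  finally show "gram_gap d p (A ^\<^sub>m l) / real l \<le> pseudo_gap (A ^\<^sub>m k)" .
qed simp

end

lemma ergodic_weighted_chain:
  assumes "ergodic d M" "2 \<le> d" shows "weighted_chain d M (stationary M)"
proof
  have d: "0 < d" using assms(2) by simp
  show "2 \<le> d" by fact
  show "stochastic_mat d M" by (rule ergodicD(1)[OF assms(1) d])
  show "stat_dist d M (stationary M)" by (rule ergodicD(2)[OF assms(1) d])
  show "0 < stationary M i" if "i < d" for i by (rule ergodicD(3)[OF assms(1) d that])
qed

section \<open>Path probabilities\<close>

definition paths :: "nat \<Rightarrow> nat \<Rightarrow> (nat \<Rightarrow> nat) set" where
  "paths d n = PiE {1..n} (\<lambda>_. {..<d})"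

definition path_weight :: "real mat \<Rightarrow> (nat \<Rightarrow> real) \<Rightarrow> nat \<Rightarrow> (nat \<Rightarrow> nat) \<Rightarrow> real" where
  "path_weight M \<mu> n x = \<mu> (x 1) * (\<Prod>t\<in>{1..<n}. M $$ (x t, x (Suc t)))"

text \<open>All events of interest are determined by finitely many states. For these, measurability
  and probabilities reduce to sums over paths, and conditional expectations become finite
  sums.\<close>

definition depends_upto :: "nat \<Rightarrow> ((nat \<Rightarrow> nat) \<Rightarrow> 'a) \<Rightarrow> bool" where
  "depends_upto n Q \<longleftrightarrow> (\<forall>x y. (\<forall>t\<in>{1..n}. x t = y t) \<longrightarrow> Q x = Q y)"

lemma depends_uptoD: "depends_upto n Q \<Longrightarrow> (\<And>t. 1 \<le> t \<Longrightarrow> t \<le> n \<Longrightarrow> x t = y t) \<Longrightarrow> Q x = Q y"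
  unfolding depends_upto_def by (metis atLeastAtMost_iff)

lemma depends_upto_mono: "depends_upto n Q \<Longrightarrow> n \<le> m \<Longrightarrow> depends_upto m Q"
  unfolding depends_upto_def by (meson atLeastAtMost_iff order_trans)

lemma paths_range: "x \<in> paths d n \<Longrightarrow> 1 \<le> t \<Longrightarrow> t \<le> n \<Longrightarrow> x t < d"
  by (auto simp: paths_def PiE_iff)

lemma finite_paths [simp]: "finite (paths d n)"
  by (auto simp: paths_def intro: finite_PiE)

lemma sum_paths_Suc:
  "(\<Sum>x\<in>paths d (Suc n). F x) = (\<Sum>x\<in>paths d n. \<Sum>j<d. F (x(Suc n := j)))"
proof -
  have s: "{1..Suc n} = insert (Suc n) {1..n}" by auto
  have eq: "paths d (Suc n) = (\<lambda>(j, x). x(Suc n := j)) ` ({..<d} \<times> paths d n)"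
    unfolding paths_def s by (rule PiE_insert_eq)
  have inj: "inj_on (\<lambda>(j, x). x(Suc n := j)) ({..<d} \<times> paths d n)"
    unfolding paths_def by (rule inj_combinator) auto
  have "(\<Sum>x\<in>paths d (Suc n). F x) = (\<Sum>(j, x)\<in>{..<d} \<times> paths d n. F (x(Suc n := j)))"
    unfolding eq sum.reindex[OF inj] by (auto intro!: sum.cong)
  also have "\<dots> = (\<Sum>j<d. \<Sum>x\<in>paths d n. F (x(Suc n := j)))"
    by (rule sum.cartesian_product[symmetric])
  finally show ?thesis by (subst (asm) sum.swap)
qed

lemma path_weight_Suc: "1 \<le> n \<Longrightarrow> path_weight M \<mu> (Suc n) (x(Suc n := j)) = path_weight M \<mu> n x * M $$ (x n, j)"
proof -
  assume n: "1 \<le> n"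
  have s: "{1..<Suc n} = insert n {1..<n}" using n by auto
  have "(\<Prod>t\<in>{1..<n}. M $$ ((x(Suc n := j)) t, (x(Suc n := j)) (Suc t))) = (\<Prod>t\<in>{1..<n}. M $$ (x t, x (Suc t)))"
    by (intro prod.cong) auto
  then show ?thesis using n unfolding path_weight_def s by simp
qed

text \<open>The expectation of \<open>F\<close> under the law of the first \<open>n\<close>
  states.\<close>

definition path_sum :: "nat \<Rightarrow> real mat \<Rightarrow> (nat \<Rightarrow> real) \<Rightarrow> nat \<Rightarrow> ((nat \<Rightarrow> nat) \<Rightarrow> real) \<Rightarrow> real" where
  "path_sum d M \<mu> n F = (\<Sum>x\<in>paths d n. path_weight M \<mu> n x * F x)"

lemma path_sum_cong: "(\<And>x. x \<in> paths d n \<Longrightarrow> F x = G x) \<Longrightarrow> path_sum d M \<mu> n F = path_sum d M \<mu> n G"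
  by (auto simp: path_sum_def intro!: sum.cong)

locale chain =
  fixes d :: nat and P :: "'w measure" and X :: "nat \<Rightarrow> 'w \<Rightarrow> nat" and M :: "real mat" and \<mu> :: "nat \<Rightarrow> real"
  assumes mc: "markov_chain P X M \<mu>" and stoch: "stochastic_mat d M" and init: "distribution d \<mu>" and d_pos: "0 < d"
begin

sublocale prob_space P
  using mc by (simp add: markov_chain_def)

lemma measurable_X: "1 \<le> t \<Longrightarrow> X t \<in> measurable P (count_space UNIV)"
  using mc by (simp add: markov_chain_def)

lemma path_weight_nonneg: "1 \<le> n \<Longrightarrow> x \<in> paths d n \<Longrightarrow> 0 \<le> path_weight M \<mu> n x"
  unfolding path_weight_def
  by (intro mult_nonneg_nonneg prod_nonneg stochastic_matD(2)[OF stoch])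
     (use init in \<open>auto simp: distribution_def paths_range\<close>)

text \<open>The Markov property: integrating out the last state replaces \<open>g\<close> by
  \<open>mv d M g\<close>.\<close>

lemma path_sum_step:
  assumes n: "1 \<le> n" and F: "depends_upto n F"
  shows "path_sum d M \<mu> (Suc n) (\<lambda>x. F x * g (x (Suc n))) = path_sum d M \<mu> n (\<lambda>x. F x * mv d M g (x n))"
  unfolding path_sum_def sum_paths_Suc
proof (intro sum.cong refl)
  fix x assume "x \<in> paths d n"
  have "F (x(Suc n := j)) = F x" for j by (rule depends_uptoD[OF F]) auto
  then show "(\<Sum>j<d. path_weight M \<mu> (Suc n) (x(Suc n := j)) * (F (x(Suc n := j)) * g ((x(Suc n := j)) (Suc n))))
      = path_weight M \<mu> n x * (F x * mv d M g (x n))"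
    by (simp add: path_weight_Suc[OF n] mv_def sum_distrib_left mult_ac)
qed

lemma path_sum_steps:
  assumes s: "1 \<le> s" and F: "depends_upto s F"
  shows "path_sum d M \<mu> (s + k) (\<lambda>x. F x * g (x (s + k))) = path_sum d M \<mu> s (\<lambda>x. F x * mv d (M ^\<^sub>m k) g (x s))"
proof (induction k arbitrary: g)
  case 0
  show ?case unfolding add_0_right by (rule path_sum_cong)
      (use s in \<open>auto simp: mv_pow_0[OF stochastic_matD(1)[OF stoch]] paths_range simp del: pow_mat.simps\<close>)
next
  case (Suc k)
  have "path_sum d M \<mu> (s + Suc k) (\<lambda>x. F x * g (x (s + Suc k)))
      = path_sum d M \<mu> (s + k) (\<lambda>x. F x * mv d M g (x (s + k)))"
    using path_sum_step[of "s + k" F g] s depends_upto_mono[OF F, of "s + k"] by simp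
  also have "\<dots> = path_sum d M \<mu> s (\<lambda>x. F x * mv d (M ^\<^sub>m k) (mv d M g) (x s))" by (rule Suc.IH)
  also have "\<dots> = path_sum d M \<mu> s (\<lambda>x. F x * mv d (M ^\<^sub>m Suc k) g (x s))"
  proof (rule path_sum_cong)
    fix x assume "x \<in> paths d s"
    then have "x s < d" using s by (auto intro: paths_range)
    then show "F x * mv d (M ^\<^sub>m k) (mv d M g) (x s) = F x * mv d (M ^\<^sub>m Suc k) g (x s)"
      using mv_mult[OF pow_mat_carrier[OF stochastic_matD(1)[OF stoch]] stochastic_matD(1)[OF stoch], of "x s" k g]
      by simp
  qed
  finally show ?case .
qed

lemma path_sum_one: "1 \<le> n \<Longrightarrow> path_sum d M \<mu> n (\<lambda>_. 1) = 1"
proof (induction n rule: nat_induct_at_least)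
  case base
  have "path_sum d M \<mu> 1 (\<lambda>_. 1) = (\<Sum>x\<in>paths d (Suc 0). path_weight M \<mu> 1 x)" by (simp add: path_sum_def)
  also have "\<dots> = (\<Sum>x\<in>paths d 0. \<Sum>j<d. path_weight M \<mu> 1 (x(Suc 0 := j)))" by (rule sum_paths_Suc)
  also have "\<dots> = 1" using init by (simp add: paths_def path_weight_def distribution_def)
  finally show ?case .
next
  case (Suc n)
  have "path_sum d M \<mu> (Suc n) (\<lambda>x. 1 * (\<lambda>_. 1) (x (Suc n))) = path_sum d M \<mu> n (\<lambda>x. 1 * mv d M (\<lambda>_. 1) (x n))"
    by (rule path_sum_step) (use Suc in \<open>auto simp: depends_upto_def\<close>)
  also have "\<dots> = path_sum d M \<mu> n (\<lambda>_. 1)"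
    by (rule path_sum_cong) (use Suc in \<open>auto simp: mv_const[OF stoch] paths_range\<close>)
  finally show ?case using Suc by simp
qed

text \<open>States are natural numbers, so the restrictions to the first \<open>n\<close> times form
  a countable set and the event is a countable union of cylinders. Values from \<open>d\<close> on
  have to be included, as they are excluded only almost surely.\<close>

lemma sets_depends_upto:
  assumes Q: "depends_upto n Q" shows "{\<omega> \<in> space P. Q (\<lambda>t. X t \<omega>)} \<in> sets P"
proof -
  let ?I = "PiE {1..n} (\<lambda>_. UNIV :: nat set) \<inter> {y. Q y}"
  have "{\<omega> \<in> space P. Q (\<lambda>t. X t \<omega>)} = (\<Union>y\<in>?I. {\<omega> \<in> space P. \<forall>t\<in>{1..n}. X t \<omega> = y t})"
  proof (rule Set.set_eqI, rule iffI)
    fix \<omega> assume w: "\<omega> \<in> {\<omega> \<in> space P. Q (\<lambda>t. X t \<omega>)}"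
    let ?y = "restrict (\<lambda>t. X t \<omega>) {1..n}"
    have "Q ?y = Q (\<lambda>t. X t \<omega>)" by (rule depends_uptoD[OF Q]) auto
    then have "?y \<in> ?I" using w by auto
    then show "\<omega> \<in> (\<Union>y\<in>?I. {\<omega> \<in> space P. \<forall>t\<in>{1..n}. X t \<omega> = y t})" by (rule UN_I) (use w in auto)
  next
    fix \<omega> assume "\<omega> \<in> (\<Union>y\<in>?I. {\<omega> \<in> space P. \<forall>t\<in>{1..n}. X t \<omega> = y t})"
    then obtain y where y: "Q y" "\<omega> \<in> space P" "\<forall>t\<in>{1..n}. X t \<omega> = y t" by auto
    have "Q (\<lambda>t. X t \<omega>) = Q y" by (rule depends_uptoD[OF Q]) (use y in auto)
    then show "\<omega> \<in> {\<omega> \<in> space P. Q (\<lambda>t. X t \<omega>)}" using y by simp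
  qed
  also have "\<dots> \<in> sets P"
  proof (rule sets.countable_UN')
    show "countable ?I" by (rule countable_subset[of _ "PiE {1..n} (\<lambda>_. UNIV)"]) (auto intro!: countable_PiE)
    show "(\<lambda>y. {\<omega> \<in> space P. \<forall>t\<in>{1..n}. X t \<omega> = y t}) ` ?I \<subseteq> sets P"
    proof (intro image_subsetI)
      fix y
      have "{\<omega> \<in> space P. X t \<omega> = y t} \<in> sets P" if "t \<in> {1..n}" for t
      proof -
        have "X t -` {y t} \<inter> space P \<in> sets P" using that by (intro measurable_sets[OF measurable_X]) auto
        then show ?thesis by (simp add: vimage_def Int_def conj_commute)
      qed
      then show "{\<omega> \<in> space P. \<forall>t\<in>{1..n}. X t \<omega> = y t} \<in> sets P" by (intro sets.sets_Collect_finite_All) auto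
    qed
  qed
  finally show ?thesis .
qed

lemma prob_path:
  assumes "1 \<le> n" "x \<in> paths d n"
  shows "prob {\<omega> \<in> space P. \<forall>t\<in>{1..n}. X t \<omega> = x t} = path_weight M \<mu> n x"
  using mc assms stochastic_matD(1)[OF stoch]
  unfolding markov_chain_def path_weight_def by (auto simp: paths_range)

text \<open>\<open>markov_chain\<close> fixes the probabilities of cylinders with states below
  \<open>d\<close> only. These add up to 1, so every event may be intersected with the range
  condition without changing its probability.\<close>

lemma prob_depends_upto:
  assumes n: "1 \<le> n" and Q: "depends_upto n Q"
  shows "prob {\<omega> \<in> space P. Q (\<lambda>t. X t \<omega>)} = path_sum d M \<mu> n (\<lambda>x. if Q x then 1 else 0)"
proof -
  have main: "prob {\<omega> \<in> space P. (\<forall>t\<in>{1..n}. X t \<omega> < d) \<and> R (\<lambda>t. X t \<omega>)} = path_sum d M \<mu> n (\<lambda>x. if R x then 1 else 0)"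
    if R: "depends_upto n R" for R
  proof -
    let ?C = "\<lambda>x. {\<omega> \<in> space P. \<forall>t\<in>{1..n}. X t \<omega> = x t}"
    have "{\<omega> \<in> space P. (\<forall>t\<in>{1..n}. X t \<omega> < d) \<and> R (\<lambda>t. X t \<omega>)} = (\<Union>x\<in>{x\<in>paths d n. R x}. ?C x)"
    proof (rule Set.set_eqI, rule iffI)
      fix \<omega> assume w: "\<omega> \<in> {\<omega> \<in> space P. (\<forall>t\<in>{1..n}. X t \<omega> < d) \<and> R (\<lambda>t. X t \<omega>)}"
      let ?y = "restrict (\<lambda>t. X t \<omega>) {1..n}"
      have "R ?y = R (\<lambda>t. X t \<omega>)" by (rule depends_uptoD[OF R]) auto
      then have "?y \<in> {x\<in>paths d n. R x}" using w by (auto simp: paths_def)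
      then show "\<omega> \<in> (\<Union>x\<in>{x\<in>paths d n. R x}. ?C x)" by (rule UN_I) (use w in auto)
    next
      fix \<omega> assume "\<omega> \<in> (\<Union>x\<in>{x\<in>paths d n. R x}. ?C x)"
      then obtain y where y: "y \<in> paths d n" "R y" "\<omega> \<in> ?C y" by auto
      have "R (\<lambda>t. X t \<omega>) = R y" by (rule depends_uptoD[OF R]) (use y in auto)
      then show "\<omega> \<in> {\<omega> \<in> space P. (\<forall>t\<in>{1..n}. X t \<omega> < d) \<and> R (\<lambda>t. X t \<omega>)}"
        using y paths_range[OF y(1)] by auto
    qed
    also have "prob \<dots> = (\<Sum>x\<in>{x\<in>paths d n. R x}. prob (?C x))"
    proof (rule finite_measure_finite_Union)
      show "?C ` {x\<in>paths d n. R x} \<subseteq> events"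
        by (intro image_subsetI sets_depends_upto[of n "\<lambda>z. \<forall>t\<in>{1..n}. z t = _ t"]) (auto simp: depends_upto_def)
      show "disjoint_family_on ?C {x\<in>paths d n. R x}"
      proof (unfold disjoint_family_on_def, intro ballI impI)
        fix x y assume xy: "x \<in> {x\<in>paths d n. R x}" "y \<in> {x\<in>paths d n. R x}" "x \<noteq> y"
        then have "\<exists>t\<in>{1..n}. x t \<noteq> y t"
          unfolding paths_def by (metis (mono_tags, lifting) PiE_ext mem_Collect_eq)
        then show "?C x \<inter> ?C y = {}" by auto
      qed
    qed simp
    also have "\<dots> = (\<Sum>x\<in>{x\<in>paths d n. R x}. path_weight M \<mu> n x)"
      by (intro sum.cong refl prob_path n) auto
    also have "\<dots> = path_sum d M \<mu> n (\<lambda>x. if R x then 1 else 0)"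
      unfolding path_sum_def by (simp add: sum.inter_filter[symmetric] if_distrib[of "\<lambda>z. _ * z"] cong: if_cong)
    finally show ?thesis .
  qed
  have "prob {\<omega> \<in> space P. (\<forall>t\<in>{1..n}. X t \<omega> < d) \<and> True} = 1"
    using main[of "\<lambda>_. True"] path_sum_one[OF n] by (simp add: depends_upto_def)
  then have "AE \<omega> in P. \<forall>t\<in>{1..n}. X t \<omega> < d"
    using sets_depends_upto[of n "\<lambda>z. \<forall>t\<in>{1..n}. z t < d"]
    by (subst (asm) prob_Collect_eq_1) (auto simp: depends_upto_def)
  then have "prob {\<omega> \<in> space P. Q (\<lambda>t. X t \<omega>)} = prob {\<omega> \<in> space P. (\<forall>t\<in>{1..n}. X t \<omega> < d) \<and> Q (\<lambda>t. X t \<omega>)}"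
    by (intro finite_measure_eq_AE sets_depends_upto[OF Q]
        sets_depends_upto[of n "\<lambda>z. (\<forall>t\<in>{1..n}. z t < d) \<and> Q z"])
       (use Q in \<open>auto simp: depends_upto_def\<close>)
  then show ?thesis using main[OF Q] by simp
qed

lemma path_sum_mono: "1 \<le> n \<Longrightarrow> (\<And>x. x \<in> paths d n \<Longrightarrow> F x \<le> G x) \<Longrightarrow> path_sum d M \<mu> n F \<le> path_sum d M \<mu> n G"
  unfolding path_sum_def by (intro sum_mono mult_left_mono path_weight_nonneg)

lemma AE_range: "AE \<omega> in P. \<forall>t\<ge>1. X t \<omega> < d"
proof -
  have "AE \<omega> in P. X t \<omega> < d" if t: "1 \<le> t" for t
  proof -
    have dep: "depends_upto t (\<lambda>z. z t < d)" using t by (auto simp: depends_upto_def)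
    have "path_sum d M \<mu> t (\<lambda>x. if x t < d then 1 else 0) = path_sum d M \<mu> t (\<lambda>_. 1)"
      by (rule path_sum_cong) (use t in \<open>auto dest: paths_range\<close>)
    then have "prob {\<omega> \<in> space P. X t \<omega> < d} = 1"
      using prob_depends_upto[OF t dep] path_sum_one[OF t] by simp
    then show ?thesis using sets_depends_upto[OF dep] by (subst (asm) prob_Collect_eq_1) auto
  qed
  then show ?thesis by (simp add: AE_all_countable)
qed

text \<open>A skipped trajectory is again a chain, started from the law of \<open>X (r + k)\<close>.
  Concentration and almost sure consistency can therefore be proved at skip 1 and
  transferred.\<close>

lemma chain_skipped:
  assumes k: "1 \<le> k"
  obtains \<mu>' where "chain d P (\<lambda>t. X (r + t * k)) (M ^\<^sub>m k) \<mu>'"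
proof -
  define \<mu>' where "\<mu>' = (\<lambda>j. if j < d then prob {\<omega> \<in> space P. X (r + k) \<omega> = j} else 0)"
  have rk: "1 \<le> r + k" using k by simp
  have \<mu>'_path: "\<mu>' j = path_sum d M \<mu> (r + k) (\<lambda>x. if x (r + k) = j then 1 else 0)" if "j < d" for j
    unfolding \<mu>'_def using that
    prob_depends_upto[OF rk, of "\<lambda>x. x (r + k) = j"] rk by (auto simp: depends_upto_def)
  have dist: "distribution d \<mu>'"
    unfolding distribution_def
  proof (intro conjI allI impI)
    show "0 \<le> \<mu>' i" for i by (simp add: \<mu>'_def)
    show "\<mu>' i = 0" if "d \<le> i" for i using that by (simp add: \<mu>'_def)
    have "(\<Sum>i<d. \<mu>' i) = (\<Sum>i<d. path_sum d M \<mu> (r + k) (\<lambda>x. if x (r + k) = i then 1 else 0))"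
      by (intro sum.cong \<mu>'_path) auto
    also have "\<dots> = path_sum d M \<mu> (r + k) (\<lambda>x. \<Sum>i<d. if x (r + k) = i then 1 else 0)"
      unfolding path_sum_def sum_distrib_left by (rule sum.swap)
    also have "\<dots> = path_sum d M \<mu> (r + k) (\<lambda>_. 1)"
      by (rule path_sum_cong) (use rk in \<open>auto dest: paths_range\<close>)
    finally show "(\<Sum>i<d. \<mu>' i) = 1" using path_sum_one[OF rk] by simp
  qed
  have Mk: "stochastic_mat d (M ^\<^sub>m k)" by (rule stochastic_mat_pow[OF stoch])
  then have dimk: "dim_row (M ^\<^sub>m k) = d" using stochastic_matD(1) by blast
  have "markov_chain P (\<lambda>t. X (r + t * k)) (M ^\<^sub>m k) \<mu>'"
    unfolding markov_chain_def
  proof (intro conjI allI impI)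
    show "prob_space P" by (rule prob_space_axioms)
    show "X (r + t * k) \<in> P \<rightarrow>\<^sub>M count_space UNIV" if "1 \<le> t" for t
      using that k by (intro measurable_X) (auto simp: Suc_le_eq)
    fix n x assume n: "1 \<le> (n::nat)" and x: "\<forall>t\<in>{1..n}. x t < dim_row (M ^\<^sub>m k)"
    have "path_sum d M \<mu> (r + n * k) (\<lambda>y. if \<forall>t\<in>{1..n}. y (r + t * k) = x t then 1 else 0)
        = \<mu>' (x 1) * (\<Prod>t\<in>{1..<n}. (M ^\<^sub>m k) $$ (x t, x (Suc t)))"
      using n x[unfolded dimk]
    proof (induction n rule: nat_induct_at_least)
      case base
      then show ?case using \<mu>'_path[of "x 1"] by simp
    next
      case (Suc n)
      let ?F = "\<lambda>y. if \<forall>t\<in>{1..n}. y (r + t * k) = x t then 1 else (0::real)"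
      let ?g = "\<lambda>i. if i = x (Suc n) then 1 else (0::real)"
      have xs: "x n < d" "x (Suc n) < d" using Suc by auto
      have dep: "depends_upto (r + n * k) ?F"
        unfolding depends_upto_def
      proof (intro allI impI)
        fix y z :: "nat \<Rightarrow> nat" assume yz: "\<forall>t\<in>{1..r + n * k}. y t = z t"
        have "y (r + t * k) = z (r + t * k)" if "t \<in> {1..n}" for t
          using that k by (intro yz[rule_format]) (auto simp: Suc_le_eq)
        then show "?F y = ?F z" by simp
      qed
      have "path_sum d M \<mu> (r + Suc n * k) (\<lambda>y. if \<forall>t\<in>{1..Suc n}. y (r + t * k) = x t then 1 else 0)
          = path_sum d M \<mu> ((r + n * k) + k) (\<lambda>y. ?F y * ?g (y ((r + n * k) + k)))"
      proof -
        have e: "r + Suc n * k = (r + n * k) + k" by simp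
        show ?thesis unfolding e
          by (rule path_sum_cong) (use Suc.hyps in \<open>auto simp: atLeastAtMostSuc_conv add.commute add.left_commute\<close>)
      qed
      also have "\<dots> = path_sum d M \<mu> (r + n * k) (\<lambda>y. ?F y * mv d (M ^\<^sub>m k) ?g (y (r + n * k)))"
        by (rule path_sum_steps[OF _ dep]) (use Suc.hyps k in \<open>auto simp: Suc_le_eq\<close>)
      also have "\<dots> = path_sum d M \<mu> (r + n * k) (\<lambda>y. ?F y * (M ^\<^sub>m k) $$ (x n, x (Suc n)))"
        using Suc.hyps mat_entry_mv[OF xs, of "M ^\<^sub>m k"] by (intro path_sum_cong) auto
      also have "\<dots> = path_sum d M \<mu> (r + n * k) ?F * (M ^\<^sub>m k) $$ (x n, x (Suc n))"
        by (simp add: path_sum_def sum_distrib_right mult.assoc)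
      also have "path_sum d M \<mu> (r + n * k) ?F = \<mu>' (x 1) * (\<Prod>t\<in>{1..<n}. (M ^\<^sub>m k) $$ (x t, x (Suc t)))"
        by (rule Suc.IH) (use Suc.prems in auto)
      also have "{1..<Suc n} = insert n {1..<n}" using Suc.hyps by auto
      ultimately show ?case by (simp add: mult_ac)
    qed
    moreover have "prob {\<omega> \<in> space P. \<forall>t\<in>{1..n}. X (r + t * k) \<omega> = x t}
        = path_sum d M \<mu> (r + n * k) (\<lambda>y. if \<forall>t\<in>{1..n}. y (r + t * k) = x t then 1 else 0)"
    proof (rule prob_depends_upto)
      show "1 \<le> r + n * k" using n k by (simp add: Suc_le_eq)
      show "depends_upto (r + n * k) (\<lambda>z. \<forall>t\<in>{1..n}. z (r + t * k) = x t)"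
        unfolding depends_upto_def
      proof (intro allI impI)
        fix y z :: "nat \<Rightarrow> nat" assume yz: "\<forall>t\<in>{1..r + n * k}. y t = z t"
        have "y (r + t * k) = z (r + t * k)" if "t \<in> {1..n}" for t
          using that k by (intro yz[rule_format]) (auto simp: Suc_le_eq)
        then show "(\<forall>t\<in>{1..n}. y (r + t * k) = x t) = (\<forall>t\<in>{1..n}. z (r + t * k) = x t)" by simp
      qed
    qed
    ultimately show "prob {\<omega> \<in> space P. \<forall>t\<in>{1..n}. X (r + t * k) \<omega> = x t}
        = \<mu>' (x 1) * (\<Prod>t\<in>{1..<n}. (M ^\<^sub>m k) $$ (x t, x (Suc t)))" by simp
  qed
  then have "chain d P (\<lambda>t. X (r + t * k)) (M ^\<^sub>m k) \<mu>'" using Mk dist d_pos by unfold_locales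
  then show thesis by (rule that)
qed

end

section \<open>Concentration of transition counts\<close>

lemma sublen_1_0 [simp]: "sublen n 1 0 = n" "sublen n (Suc 0) 0 = n"
  by (simp_all add: sublen_def)

lemma skipped_1_0 [simp]: "skipped 1 0 x = x" "skipped (Suc 0) 0 x = x"
  by (simp_all add: skipped_def fun_eq_iff)

lemma visits_sum: "real (visits n 1 0 x i) = (\<Sum>t\<in>{1..<n}. if x t = i then 1 else 0)"
proof -
  have "{t \<in> {1..n - 1}. x t = i} = {t \<in> {1..<n}. x t = i}" by auto
  then show ?thesis by (simp add: visits_def sum.If_cases Int_def)
qed

lemma transitions_sum:
  "real (transitions n 1 0 x i j) = (\<Sum>t\<in>{1..<n}. if x t = i \<and> x (Suc t) = j then 1 else 0)"
proof -
  have "{t \<in> {1..n - 1}. x t = i \<and> x (t + 1) = j} = {t \<in> {1..<n}. x t = i \<and> x (Suc t) = j}" by auto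
  then show ?thesis by (simp add: transitions_def sum.If_cases Int_def)
qed

definition dev :: "real mat \<Rightarrow> nat \<Rightarrow> (nat \<Rightarrow> nat) \<Rightarrow> nat \<Rightarrow> nat \<Rightarrow> real" where
  "dev M n x i j = real (transitions n 1 0 x i j) - real (visits n 1 0 x i) * M $$ (i, j)"

lemma depends_visits: "depends_upto n (\<lambda>x. visits n 1 0 x i)"
  unfolding depends_upto_def
proof (intro allI impI)
  fix x y :: "nat \<Rightarrow> nat" assume "\<forall>t\<in>{1..n}. x t = y t"
  then have "{t \<in> {1..n - 1}. x t = i} = {t \<in> {1..n - 1}. y t = i}" by auto
  then show "visits n 1 0 x i = visits n 1 0 y i" by (simp add: visits_def)
qed

lemma depends_transitions: "depends_upto n (\<lambda>x. transitions n 1 0 x i j)"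
  unfolding depends_upto_def
proof (intro allI impI)
  fix x y :: "nat \<Rightarrow> nat" assume xy: "\<forall>t\<in>{1..n}. x t = y t"
  have "x t = y t \<and> x (t + 1) = y (t + 1)" if "t \<in> {1..n - 1}" for t
  proof -
    have "t \<in> {1..n}" "t + 1 \<in> {1..n}" using that by auto
    with xy show ?thesis by blast
  qed
  then have "{t \<in> {1..n - 1}. x t = i \<and> x (t + 1) = j} = {t \<in> {1..n - 1}. y t = i \<and> y (t + 1) = j}" by auto
  then show "transitions n 1 0 x i j = transitions n 1 0 y i j" by (simp add: transitions_def)
qed

lemma depends_dev: "depends_upto n (\<lambda>x. dev M n x i j)"
  unfolding depends_upto_def
proof (intro allI impI)
  fix x y :: "nat \<Rightarrow> nat" assume "\<forall>t\<in>{1..n}. x t = y t"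
  then have "visits n 1 0 x i = visits n 1 0 y i" "transitions n 1 0 x i j = transitions n 1 0 y i j"
    using depends_visits[of n i] depends_transitions[of n i j] unfolding depends_upto_def by blast+
  then show "dev M n x i j = dev M n y i j" by (simp only: dev_def)
qed

text \<open>The signed row sum is a sum of centred increments over the visits to \<open>i\<close>.
  This is the martingale to which the exponential bound applies.\<close>

lemma sum_dev:
  assumes x: "\<And>t. 1 \<le> t \<Longrightarrow> t \<le> n \<Longrightarrow> x t < d"
  shows "(\<Sum>j<d. \<sigma> j * dev M n x i j) = (\<Sum>t\<in>{1..<n}. if x t = i then \<sigma> (x (Suc t)) - mv d M \<sigma> i else 0)"
proof -
  have "(\<Sum>j<d. \<sigma> j * dev M n x i j)
      = (\<Sum>j<d. \<Sum>t\<in>{1..<n}. \<sigma> j * ((if x t = i \<and> x (Suc t) = j then 1 else 0) - (if x t = i then 1 else 0) * M $$ (i, j)))"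
  proof (rule sum.cong[OF refl])
    fix j
    have "dev M n x i j = (\<Sum>t\<in>{1..<n}. (if x t = i \<and> x (Suc t) = j then 1 else 0) - (if x t = i then 1 else 0) * M $$ (i, j))"
      unfolding dev_def visits_sum transitions_sum sum_subtractf by (simp only: sum_distrib_right)
    then show "\<sigma> j * dev M n x i j = (\<Sum>t\<in>{1..<n}. \<sigma> j * ((if x t = i \<and> x (Suc t) = j then 1 else 0) - (if x t = i then 1 else 0) * M $$ (i, j)))"
      by (simp only: sum_distrib_left)
  qed
  also have "\<dots> = (\<Sum>t\<in>{1..<n}. \<Sum>j<d. \<sigma> j * ((if x t = i \<and> x (Suc t) = j then 1 else 0) - (if x t = i then 1 else 0) * M $$ (i, j)))"
    by (rule sum.swap)
  also have "\<dots> = (\<Sum>t\<in>{1..<n}. if x t = i then \<sigma> (x (Suc t)) - mv d M \<sigma> i else 0)"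
  proof (intro sum.cong refl)
    fix t assume t: "t \<in> {1..<n}"
    have "(\<Sum>j<d. \<sigma> j * ((if x (Suc t) = j then 1 else 0) - M $$ (i, j)))
      = (\<Sum>j<d. if j = x (Suc t) then \<sigma> j else 0) - (\<Sum>j<d. M $$ (i, j) * \<sigma> j)"
      unfolding sum_subtractf[symmetric] by (intro sum.cong) (auto simp: algebra_simps)
    also have "\<dots> = \<sigma> (x (Suc t)) - mv d M \<sigma> i" using x[of "Suc t"] t by (simp add: mv_def)
    finally show "(\<Sum>j<d. \<sigma> j * ((if x t = i \<and> x (Suc t) = j then 1 else 0) - (if x t = i then 1 else 0) * M $$ (i, j)))
       = (if x t = i then \<sigma> (x (Suc t)) - mv d M \<sigma> i else 0)" by simp
  qed
  finally show ?thesis .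
qed

text \<open>For a centred variable the linear term has mean 0, so the exponential moment is bounded
  by that of the square. Below 0 and down to -1 the inequality follows from
  \<open>(1 + y + y^2) * (1 - y) = 1 - y^3\<close>, which is at least 1.\<close>

lemma exp_le_add_exp_square: "exp (y::real) \<le> y + exp (y\<^sup>2)"
proof (cases "y < - 1")
  case True
  have "1 + y\<^sup>2 \<le> exp (y\<^sup>2)" using exp_ge_add_one_self[of "y\<^sup>2"] by simp
  moreover have "0 \<le> y * (y + 1)" using True by (intro mult_nonpos_nonpos) auto
  then have "- y \<le> y\<^sup>2" by (simp add: power2_eq_square algebra_simps)
  ultimately show ?thesis using True exp_le_one_iff[of y] by linarith
next
  case False
  show ?thesis
  proof (cases "y \<le> 1")
    case True
    have "exp y \<le> 1 + y + y\<^sup>2"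
    proof (cases "0 \<le> y")
      case True from exp_bound[OF this \<open>y \<le> 1\<close>] show ?thesis .
    next
      case False
      have "(1 + y + y\<^sup>2) * exp (- y) \<ge> (1 + y + y\<^sup>2) * (1 + (- y))"
      proof (intro mult_left_mono exp_ge_add_one_self)
        have "0 \<le> (y + 1 / 2)\<^sup>2 + 3 / 4" by simp
        then show "0 \<le> 1 + y + y\<^sup>2" by (simp add: power2_eq_square algebra_simps)
      qed
      moreover have "(1 + y + y\<^sup>2) * (1 + (- y)) = 1 - y ^ 3" by (simp add: algebra_simps power2_eq_square power3_eq_cube)
      moreover have "y ^ 3 \<le> 0" using False by (simp add: power3_eq_cube mult_nonneg_nonpos mult_nonpos_nonpos)
      ultimately have "1 \<le> (1 + y + y\<^sup>2) * exp (- y)" by linarith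
      then show ?thesis by (simp add: exp_minus divide_simps)
    qed
    then show ?thesis using exp_ge_add_one_self[of "y\<^sup>2"] by linarith
  next
    case False
    then have "y \<le> y\<^sup>2" by (simp add: power2_eq_square)
    then have "exp y \<le> exp (y\<^sup>2)" by simp
    then show ?thesis using False by linarith
  qed
qed

text \<open>Both \<open>\<sigma> j\<close> and its mean are at most 1 in absolute value, so an
  increment is at most 2; its square is the 4 in the exponent.\<close>

lemma mgf_step:
  assumes M: "stochastic_mat d M" and i: "i < d" and s: "\<And>j. j < d \<Longrightarrow> \<bar>\<sigma> j\<bar> \<le> 1"
  shows "mv d M (\<lambda>j. exp (l * (\<sigma> j - mv d M \<sigma> i) - 4 * l\<^sup>2)) i \<le> 1"
proof -
  let ?m = "mv d M \<sigma> i"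
  have m: "\<bar>?m\<bar> \<le> 1"
    using mv_mono[OF M i, of \<sigma> "\<lambda>_. 1"] mv_mono[OF M i, of "\<lambda>_. -1" \<sigma>] s mv_const[OF M i]
    by (fastforce simp: abs_le_iff)
  have le: "exp (l * (\<sigma> j - ?m)) \<le> l * (\<sigma> j - ?m) + exp (4 * l\<^sup>2)" if "j < d" for j
  proof -
    have "\<bar>\<sigma> j - ?m\<bar> \<le> 2" using s[OF that] m by linarith
    then have "(\<sigma> j - ?m)\<^sup>2 \<le> 2\<^sup>2" using power_mono[of "\<bar>\<sigma> j - ?m\<bar>" 2 2] unfolding power2_abs by simp
    then have "(l * (\<sigma> j - ?m))\<^sup>2 \<le> l\<^sup>2 * 2\<^sup>2" unfolding power_mult_distrib by (intro mult_left_mono) auto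
    then have "exp ((l * (\<sigma> j - ?m))\<^sup>2) \<le> exp (4 * l\<^sup>2)" by simp
    then show ?thesis using exp_le_add_exp_square[of "l * (\<sigma> j - ?m)"] by linarith
  qed
  have "mv d M (\<lambda>j. exp (l * (\<sigma> j - ?m))) i \<le> mv d M (\<lambda>j. l * (\<sigma> j - ?m) + exp (4 * l\<^sup>2)) i"
    by (rule mv_mono[OF M i le])
  also have "\<dots> = exp (4 * l\<^sup>2)"
    unfolding mv_add mv_scale mv_diff mv_const[OF M i] by simp
  finally have "mv d M (\<lambda>j. exp (- 4 * l\<^sup>2) * exp (l * (\<sigma> j - ?m))) i \<le> exp (- 4 * l\<^sup>2) * exp (4 * l\<^sup>2)"
    unfolding mv_scale by (intro mult_left_mono) auto
  also have "exp (- 4 * l\<^sup>2) * exp (4 * l\<^sup>2) = 1" by (simp add: exp_minus)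
  also have "(\<lambda>j. exp (- 4 * l\<^sup>2) * exp (l * (\<sigma> j - ?m))) = (\<lambda>j. exp (l * (\<sigma> j - ?m) - 4 * l\<^sup>2))"
    by (simp add: exp_add[symmetric] add.commute)
  finally show ?thesis .
qed

text \<open>\<open>flat_ok\<close> holds up to an exponentially small probability without any logarithm, but it is not
  relative to the number of visits; \<open>peel_ok\<close> is, at the price of a union over dyadic scales of the
  number of visits, which is where the logarithm in \<open>tau\<close> is needed.\<close>

definition flat_ok :: "nat \<Rightarrow> real mat \<Rightarrow> nat \<Rightarrow> real \<Rightarrow> (nat \<Rightarrow> nat) \<Rightarrow> bool" where
  "flat_ok d M n s x \<longleftrightarrow> (\<forall>i<d. (\<Sum>j<d. \<bar>dev M n x i j\<bar>) \<le> s * sqrt (real n)) \<and>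
     (\<Sum>j<d. \<bar>\<Sum>i<d. dev M n x i j\<bar>) \<le> s * sqrt (real n)"

definition peel_ok :: "nat \<Rightarrow> real mat \<Rightarrow> nat \<Rightarrow> real \<Rightarrow> (nat \<Rightarrow> nat) \<Rightarrow> bool" where
  "peel_ok d M n \<theta> x \<longleftrightarrow> (\<forall>i<d. (\<Sum>j<d. \<bar>dev M n x i j\<bar>) \<le> 5 * sqrt (\<theta> * real (visits n 1 0 x i)))"

lemma depends_flat_ok: "depends_upto n (flat_ok d M n s)"
  unfolding depends_upto_def
proof (intro allI impI)
  fix x y :: "nat \<Rightarrow> nat" assume "\<forall>t\<in>{1..n}. x t = y t"
  then have "dev M n x i j = dev M n y i j" for i j
    using depends_dev[of n M i j] unfolding depends_upto_def by blast
  then show "flat_ok d M n s x = flat_ok d M n s y" by (simp only: flat_ok_def)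
qed

lemma depends_peel_ok: "depends_upto n (peel_ok d M n \<theta>)"
  unfolding depends_upto_def
proof (intro allI impI)
  fix x y :: "nat \<Rightarrow> nat" assume xy: "\<forall>t\<in>{1..n}. x t = y t"
  then have "dev M n x i j = dev M n y i j" for i j
    using depends_dev[of n M i j] unfolding depends_upto_def by blast
  moreover have "visits n 1 0 x i = visits n 1 0 y i" for i
    using xy depends_visits[of n i] unfolding depends_upto_def by blast
  ultimately show "peel_ok d M n \<theta> x = peel_ok d M n \<theta> y" by (simp only: peel_ok_def)
qed

section \<open>Sign vectors and tail bounds for the deviations\<close>

definition signs :: "nat \<Rightarrow> (nat \<Rightarrow> real) set" where
  "signs d = PiE {..<d} (\<lambda>_. {-1, 1})"

lemma finite_signs [simp]: "finite (signs d)" by (auto simp: signs_def intro!: finite_PiE)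
lemma card_signs: "card (signs d) = 2 ^ d" by (simp add: signs_def card_PiE numeral_2_eq_2)
lemma signs_abs: "\<sigma> \<in> signs d \<Longrightarrow> j < d \<Longrightarrow> \<bar>\<sigma> j\<bar> \<le> 1"
proof -
  assume "\<sigma> \<in> signs d" "j < d"
  then have "\<sigma> j \<in> {-1, 1}" by (auto simp: signs_def PiE_iff)
  then show "\<bar>\<sigma> j\<bar> \<le> 1" by auto
qed

text \<open>The l1 norm is attained by one of the \<open>2^d\<close> signed sums, so a union over
  \<open>signs d\<close> controls it.\<close>

lemma sum_abs_eq_signed:
  obtains \<sigma> where "\<sigma> \<in> signs d" "(\<Sum>j<d. \<sigma> j * z j) = (\<Sum>j<d. \<bar>z j\<bar>)"
proof (rule that)
  let ?s = "\<lambda>j\<in>{..<d}. if z j < 0 then -1 else 1::real"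
  show "?s \<in> signs d" by (auto simp: signs_def)
  show "(\<Sum>j<d. ?s j * z j) = (\<Sum>j<d. \<bar>z j\<bar>)" by (intro sum.cong) auto
qed

lemma sum_visits_le: "finite A \<Longrightarrow> (\<Sum>i\<in>A. real (visits n 1 0 x i)) \<le> real n"
proof -
  assume A: "finite A"
  have "(\<Sum>i\<in>A. real (visits n 1 0 x i)) = (\<Sum>t\<in>{1..<n}. \<Sum>i\<in>A. if x t = i then 1 else 0)"
    unfolding visits_sum by (rule sum.swap)
  also have "\<dots> \<le> (\<Sum>t\<in>{1..<n}. 1)" using A by (intro sum_mono) auto
  also have "\<dots> \<le> real n" by simp
  finally show ?thesis .
qed

context chain
begin

text \<open>The exponential is a supermartingale: summing over the last state contributes a factor
  at most 1 by \<open>mgf_step\<close> if the chain is in \<open>A\<close>, and exactly 1 otherwise.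
  The compensator \<open>4 * l^2\<close> is thus charged only for visits to
  \<open>A\<close>.\<close>

lemma mgf_bound:
  assumes s: "\<And>j. j < d \<Longrightarrow> \<bar>\<sigma> j\<bar> \<le> 1" and n: "1 \<le> n"
  shows "path_sum d M \<mu> n (\<lambda>x. exp (\<Sum>t\<in>{1..<n}. if x t \<in> A then l * (\<sigma> (x (Suc t)) - mv d M \<sigma> (x t)) - 4 * l\<^sup>2 else 0)) \<le> 1"
  using n
proof (induction n rule: nat_induct_at_least)
  case base
  then show ?case using path_sum_one[of 1] by simp
next
  case (Suc n)
  let ?y = "\<lambda>x t. if x t \<in> A then l * (\<sigma> (x (Suc t)) - mv d M \<sigma> (x t)) - 4 * l\<^sup>2 else 0"
  have "path_sum d M \<mu> (Suc n) (\<lambda>x. exp (\<Sum>t\<in>{1..<Suc n}. ?y x t)) =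
     (\<Sum>x\<in>paths d n. path_weight M \<mu> n x * (exp (\<Sum>t\<in>{1..<n}. ?y x t) *
        (\<Sum>j<d. M $$ (x n, j) * exp (?y (x(Suc n := j)) n))))"
    unfolding path_sum_def sum_paths_Suc
  proof (intro sum.cong refl)
    fix x assume x: "x \<in> paths d n"
    have i: "{1..<Suc n} = insert n {1..<n}" using Suc.hyps by auto
    have "(\<Sum>t\<in>{1..<Suc n}. ?y (x(Suc n := j)) t) = ?y (x(Suc n := j)) n + (\<Sum>t\<in>{1..<n}. ?y x t)" for j
      unfolding i by (subst sum.insert) (auto intro!: sum.cong)
    then show "(\<Sum>j<d. path_weight M \<mu> (Suc n) (x(Suc n := j)) * exp (\<Sum>t\<in>{1..<Suc n}. ?y (x(Suc n := j)) t))
      = path_weight M \<mu> n x * (exp (\<Sum>t\<in>{1..<n}. ?y x t) * (\<Sum>j<d. M $$ (x n, j) * exp (?y (x(Suc n := j)) n)))"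
      by (simp only: path_weight_Suc[OF Suc.hyps] sum_distrib_left exp_add mult_ac)
  qed
  also have "\<dots> \<le> (\<Sum>x\<in>paths d n. path_weight M \<mu> n x * (exp (\<Sum>t\<in>{1..<n}. ?y x t) * 1))"
  proof (intro sum_mono mult_left_mono path_weight_nonneg Suc.hyps)
    fix x assume x: "x \<in> paths d n"
    then have xn: "x n < d" using Suc.hyps by (intro paths_range) auto
    show "(\<Sum>j<d. M $$ (x n, j) * exp (?y (x(Suc n := j)) n)) \<le> 1"
    proof (cases "x n \<in> A")
      case True
      then show ?thesis using mgf_step[OF stoch xn s, where l = l] by (simp add: mv_def)
    next
      case False
      then show ?thesis using stochastic_matD(3)[OF stoch xn] by simp
    qed
  qed auto
  also have "\<dots> \<le> 1" using Suc.IH by (simp add: path_sum_def)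
  finally show ?case .
qed

text \<open>Markov's inequality for the exponential of \<open>mgf_bound\<close>. The compensator is
  the random number of visits and not its bound \<open>n\<close>, which is what peeling exploits.
  Singletons \<open>A\<close> give single rows, and \<open>A = {..<d}\<close> gives the sums over
  all rows.\<close>

lemma signed_deviation_tail:
  fixes l \<theta> :: real
  assumes A: "A \<subseteq> {..<d}" and s: "\<And>j. j < d \<Longrightarrow> \<bar>\<sigma> j\<bar> \<le> 1" and n: "1 \<le> n"
  defines "Y \<equiv> \<lambda>x. l * (\<Sum>i\<in>A. \<Sum>j<d. \<sigma> j * dev M n x i j) - 4 * l\<^sup>2 * (\<Sum>i\<in>A. real (visits n 1 0 x i))"
  shows "{\<omega> \<in> space P. \<theta> \<le> Y (\<lambda>t. X t \<omega>)} \<in> events" "prob {\<omega> \<in> space P. \<theta> \<le> Y (\<lambda>t. X t \<omega>)} \<le> exp (- \<theta>)"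
proof -
  have dep: "depends_upto n (\<lambda>x. \<theta> \<le> Y x)"
    unfolding depends_upto_def
  proof (intro allI impI)
    fix x y :: "nat \<Rightarrow> nat" assume xy: "\<forall>t\<in>{1..n}. x t = y t"
    have "dev M n x i j = dev M n y i j" "visits n 1 0 x i = visits n 1 0 y i" for i j
      using xy depends_dev[of n M i j] depends_visits[of n i] unfolding depends_upto_def by blast+
    then show "(\<theta> \<le> Y x) = (\<theta> \<le> Y y)" unfolding Y_def by simp
  qed
  then show "{\<omega> \<in> space P. \<theta> \<le> Y (\<lambda>t. X t \<omega>)} \<in> events" by (rule sets_depends_upto)
  let ?y = "\<lambda>x t. if x t \<in> A then l * (\<sigma> (x (Suc t)) - mv d M \<sigma> (x t)) - 4 * l\<^sup>2 else 0"
  have Y: "Y x = (\<Sum>t\<in>{1..<n}. ?y x t)" if "x \<in> paths d n" for x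
  proof -
    have fA: "finite A" using A finite_subset by blast
    have "Y x = (\<Sum>i\<in>A. \<Sum>t\<in>{1..<n}. if x t = i then l * (\<sigma> (x (Suc t)) - mv d M \<sigma> i) - 4 * l\<^sup>2 else 0)"
    proof -
      have "l * (\<Sum>j<d. \<sigma> j * dev M n x i j) - 4 * l\<^sup>2 * real (visits n 1 0 x i)
          = (\<Sum>t\<in>{1..<n}. if x t = i then l * (\<sigma> (x (Suc t)) - mv d M \<sigma> i) - 4 * l\<^sup>2 else 0)" for i
      proof -
        have "(\<Sum>j<d. \<sigma> j * dev M n x i j) = (\<Sum>t\<in>{1..<n}. if x t = i then \<sigma> (x (Suc t)) - mv d M \<sigma> i else 0)"
          by (rule sum_dev) (rule paths_range[OF that])
        then show ?thesis
          unfolding visits_sum by (simp only: sum_distrib_left sum_subtractf[symmetric]) (auto intro!: sum.cong)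
      qed
      then show ?thesis unfolding Y_def sum_distrib_left sum_subtractf[symmetric] by (simp only: sum_distrib_left)
    qed
    also have "\<dots> = (\<Sum>t\<in>{1..<n}. \<Sum>i\<in>A. if x t = i then l * (\<sigma> (x (Suc t)) - mv d M \<sigma> i) - 4 * l\<^sup>2 else 0)"
      by (rule sum.swap)
    also have "\<dots> = (\<Sum>t\<in>{1..<n}. ?y x t)"
      using fA by (intro sum.cong) auto
    finally show ?thesis .
  qed
  have "prob {\<omega> \<in> space P. \<theta> \<le> Y (\<lambda>t. X t \<omega>)} = path_sum d M \<mu> n (\<lambda>x. if \<theta> \<le> Y x then 1 else 0)"
    by (rule prob_depends_upto[OF n dep])
  also have "\<dots> \<le> path_sum d M \<mu> n (\<lambda>x. exp (- \<theta>) * exp (\<Sum>t\<in>{1..<n}. ?y x t))"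
    by (intro path_sum_mono n) (simp_all add: Y exp_add[symmetric])
  also have "\<dots> = exp (- \<theta>) * path_sum d M \<mu> n (\<lambda>x. exp (\<Sum>t\<in>{1..<n}. ?y x t))"
    by (simp add: path_sum_def sum_distrib_left mult_ac)
  also have "\<dots> \<le> exp (- \<theta>) * 1" by (intro mult_left_mono mgf_bound s n) auto
  finally show "prob {\<omega> \<in> space P. \<theta> \<le> Y (\<lambda>t. X t \<omega>)} \<le> exp (- \<theta>)" by simp
qed

lemma finite_union_bound:
  assumes I: "finite I" "real (card I) \<le> c" and e: "0 \<le> e" "\<And>i. i \<in> I \<Longrightarrow> B i \<in> events" "\<And>i. i \<in> I \<Longrightarrow> prob (B i) \<le> e"
    and A: "A \<subseteq> (\<Union>i\<in>I. B i)"
  shows "prob A \<le> c * e"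
proof -
  have "prob A \<le> prob (\<Union>i\<in>I. B i)" using I e by (intro finite_measure_mono A) auto
  also have "\<dots> \<le> (\<Sum>i\<in>I. prob (B i))" using I e by (intro finite_measure_subadditive_finite) auto
  also have "\<dots> \<le> (\<Sum>i\<in>I. e)" by (intro sum_mono e)
  also have "\<dots> \<le> c * e" using I e by (simp add: mult_right_mono)
  finally show ?thesis .
qed

lemma prob_not_flat_ok:
  assumes n: "1 \<le> n" and s: "0 \<le> s"
  shows "prob {\<omega> \<in> space P. \<not> flat_ok d M n s (\<lambda>t. X t \<omega>)} \<le> (real d + 1) * 2 ^ d * exp (- (s\<^sup>2 / 16))"
proof (rule finite_union_bound)
  let ?I = "insert {..<d} ((\<lambda>i. {i}) ` {..<d}) \<times> signs d"
  \<comment> \<open>Maximizes \<open>l * s * sqrt n - 4 * l^2 * n\<close>, the exponent for at most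
    \<open>n\<close> visits; the maximum is \<open>s^2 / 16\<close>.\<close>
  define l where "l = s / (8 * sqrt (real n))"
  let ?B = "\<lambda>(A, \<sigma>). {\<omega> \<in> space P. s\<^sup>2 / 16 \<le> l * (\<Sum>i\<in>A. \<Sum>j<d. \<sigma> j * dev M n (\<lambda>t. X t \<omega>) i j)
      - 4 * l\<^sup>2 * (\<Sum>i\<in>A. real (visits n 1 0 (\<lambda>t. X t \<omega>) i))}"
  show "finite ?I" by auto
  have "card (insert {..<d} ((\<lambda>i. {i}) ` {..<d})) \<le> Suc (card ((\<lambda>i. {i}) ` {..<d}))"
    by (simp add: card_insert_if)
  moreover have "card ((\<lambda>i. {i}) ` {..<d}) \<le> d" using card_image_le[of "{..<d}" "\<lambda>i. {i}"] by simp
  ultimately have "card ?I \<le> (d + 1) * 2 ^ d" unfolding card_cartesian_product card_signs by (intro mult_right_mono) auto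
  then have "real (card ?I) \<le> real ((d + 1) * 2 ^ d)" by (simp only: of_nat_le_iff)
  then show "real (card ?I) \<le> (real d + 1) * 2 ^ d" by (simp add: algebra_simps)
  have B: "?B i \<in> events \<and> prob (?B i) \<le> exp (- (s\<^sup>2 / 16))" if "i \<in> ?I" for i
  proof -
    obtain A \<sigma> where i: "i = (A, \<sigma>)" by (cases i)
    then have A: "A \<subseteq> {..<d}" and \<sigma>: "\<sigma> \<in> signs d" using that by auto
    note T = signed_deviation_tail[OF A signs_abs[OF \<sigma>] n, where \<theta> = "s\<^sup>2 / 16" and l = l]
    show ?thesis unfolding i prod.case by (intro conjI T)
  qed
  show "?B i \<in> events" if "i \<in> ?I" for i using B[OF that] by blast
  show "prob (?B i) \<le> exp (- (s\<^sup>2 / 16))" if "i \<in> ?I" for i using B[OF that] by blast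
  have n0: "real n > 0" using n by simp
  have key: "s\<^sup>2 / 16 \<le> l * S - 4 * l\<^sup>2 * N" if "s * sqrt (real n) \<le> S" "N \<le> real n" for S N
  proof -
    have "l * (s * sqrt (real n)) \<le> l * S" using that s by (intro mult_left_mono) (auto simp: l_def)
    moreover have "l * (s * sqrt (real n)) = s\<^sup>2 / 8" using n0 by (simp add: l_def power2_eq_square)
    moreover have "4 * l\<^sup>2 * N \<le> 4 * l\<^sup>2 * real n" using that by (intro mult_left_mono) auto
    moreover have "4 * l\<^sup>2 * real n = s\<^sup>2 / 16" using n0 by (simp add: l_def power_divide power_mult_distrib)
    ultimately show ?thesis by simp
  qed
  show "{\<omega> \<in> space P. \<not> flat_ok d M n s (\<lambda>t. X t \<omega>)} \<subseteq> (\<Union>i\<in>?I. ?B i)"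
  proof
    fix \<omega> assume w: "\<omega> \<in> {\<omega> \<in> space P. \<not> flat_ok d M n s (\<lambda>t. X t \<omega>)}"
    let ?x = "\<lambda>t. X t \<omega>"
    obtain A where A: "A \<in> insert {..<d} ((\<lambda>i. {i}) ` {..<d})" "s * sqrt (real n) < (\<Sum>j<d. \<bar>\<Sum>i\<in>A. dev M n ?x i j\<bar>)"
    proof (cases "s * sqrt (real n) < (\<Sum>j<d. \<bar>\<Sum>i<d. dev M n ?x i j\<bar>)")
      case True then show ?thesis using that by blast
    next
      case False
      then obtain i where "i < d" "s * sqrt (real n) < (\<Sum>j<d. \<bar>dev M n ?x i j\<bar>)"
        using w by (auto simp: flat_ok_def not_le)
      then show ?thesis by (intro that[of "{i}"]) auto
    qed
    obtain \<sigma> where \<sigma>: "\<sigma> \<in> signs d" "(\<Sum>j<d. \<sigma> j * (\<Sum>i\<in>A. dev M n ?x i j)) = (\<Sum>j<d. \<bar>\<Sum>i\<in>A. dev M n ?x i j\<bar>)"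
      by (rule sum_abs_eq_signed[of d "\<lambda>j. \<Sum>i\<in>A. dev M n ?x i j"])
    have "(\<Sum>i\<in>A. \<Sum>j<d. \<sigma> j * dev M n ?x i j) = (\<Sum>j<d. \<sigma> j * (\<Sum>i\<in>A. dev M n ?x i j))"
      unfolding sum_distrib_left by (rule sum.swap)
    then have S: "s * sqrt (real n) \<le> (\<Sum>i\<in>A. \<Sum>j<d. \<sigma> j * dev M n ?x i j)" using A(2) \<sigma>(2) by linarith
    have N: "(\<Sum>i\<in>A. real (visits n 1 0 ?x i)) \<le> real n" by (rule sum_visits_le) (use A(1) in auto)
    have "\<omega> \<in> ?B (A, \<sigma>)" unfolding prod.case using key[OF S N] w by (intro CollectI conjI) auto
    then show "\<omega> \<in> (\<Union>i\<in>?I. ?B i)" by (rule UN_I[rotated]) (intro SigmaI A(1) \<sigma>(1))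
  qed
qed simp

lemma prob_not_peel_ok:
  assumes n: "1 \<le> n" and \<theta>: "0 \<le> \<theta>" and J: "n \<le> 2 ^ J"
  shows "prob {\<omega> \<in> space P. \<not> peel_ok d M n \<theta> (\<lambda>t. X t \<omega>)} \<le> (real d * 2 ^ d * (real J + 1)) * exp (- \<theta>)"
proof (rule finite_union_bound)
  let ?I = "{..<d} \<times> signs d \<times> {..J}"
  \<comment> \<open>Tuned to the scale of \<open>2^a\<close> visits. If the number of visits lies
    between \<open>2^a / 2\<close> and \<open>2^a\<close>, the ratio \<open>r\<close> below lies in
    \<open>[7/10, 1]\<close>, where \<open>5 / 2 * r - r^2 \<ge> 1\<close>; this is why
    \<open>peel_ok\<close> has the constant 5.\<close>
  define l where "l = (\<lambda>a::nat. sqrt (\<theta> / 2 ^ a) / 2)"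
  let ?B = "\<lambda>(i, \<sigma>, a). {\<omega> \<in> space P. \<theta> \<le> l a * (\<Sum>i\<in>{i}. \<Sum>j<d. \<sigma> j * dev M n (\<lambda>t. X t \<omega>) i j)
      - 4 * (l a)\<^sup>2 * (\<Sum>i\<in>{i}. real (visits n 1 0 (\<lambda>t. X t \<omega>) i))}"
  show "finite ?I" by auto
  show "real (card ?I) \<le> real d * 2 ^ d * (real J + 1)" by (simp add: card_cartesian_product card_signs algebra_simps)
  show "?B i \<in> events" if "i \<in> ?I" for i
  proof -
    obtain a \<sigma> b where i: "i = (a, \<sigma>, b)" by (cases i)
    then have a: "{a} \<subseteq> {..<d}" and \<sigma>: "\<sigma> \<in> signs d" using that by auto
    from signed_deviation_tail(1)[OF a signs_abs[OF \<sigma>] n, where \<theta> = \<theta> and l = "l b"] show ?thesis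
      unfolding i prod.case .
  qed
  show "prob (?B i) \<le> exp (- \<theta>)" if "i \<in> ?I" for i
  proof -
    obtain a \<sigma> b where i: "i = (a, \<sigma>, b)" by (cases i)
    then have a: "{a} \<subseteq> {..<d}" and \<sigma>: "\<sigma> \<in> signs d" using that by auto
    from signed_deviation_tail(2)[OF a signs_abs[OF \<sigma>] n, where \<theta> = \<theta> and l = "l b"] show ?thesis
      unfolding i prod.case .
  qed
  show "{\<omega> \<in> space P. \<not> peel_ok d M n \<theta> (\<lambda>t. X t \<omega>)} \<subseteq> (\<Union>i\<in>?I. ?B i)"
  proof
    fix \<omega> assume w: "\<omega> \<in> {\<omega> \<in> space P. \<not> peel_ok d M n \<theta> (\<lambda>t. X t \<omega>)}"
    let ?x = "\<lambda>t. X t \<omega>"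
    obtain i where i: "i < d" "5 * sqrt (\<theta> * real (visits n 1 0 ?x i)) < (\<Sum>j<d. \<bar>dev M n ?x i j\<bar>)"
      using w by (auto simp: peel_ok_def not_le)
    let ?N = "visits n 1 0 ?x i"
    \<comment> \<open>Without a visit all deviations of the row vanish, contradicting the strict
      inequality. A visit also gives \<open>2^a \<le> 2 * N\<close> in the case
      \<open>a = 0\<close>.\<close>
    have N: "1 \<le> ?N"
    proof (rule ccontr)
      assume "\<not> ?thesis"
      then have z: "?N = 0" by simp
      have "transitions n 1 0 ?x i j \<le> ?N" for j
        unfolding transitions_def visits_def by (intro card_mono) auto
      with z have "dev M n ?x i j = 0" for j by (simp add: dev_def)
      with i z show False by simp
    qed
    define a where "a = (LEAST a. ?N \<le> 2 ^ a)"
    have Nn: "?N \<le> n" using sum_visits_le[of "{i}" n ?x] by simp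
    have a1: "?N \<le> 2 ^ a" unfolding a_def by (rule LeastI[of _ J]) (use Nn J in simp)
    have aJ: "a \<le> J" unfolding a_def by (rule Least_le) (use Nn J in simp)
    have a2: "2 ^ a \<le> 2 * ?N"
    proof (cases a)
      case 0 then show ?thesis using N by simp
    next
      case (Suc b)
      then have "\<not> ?N \<le> 2 ^ b" using not_less_Least[of b "\<lambda>a. ?N \<le> 2 ^ a"] by (simp add: a_def)
      then show ?thesis using Suc by simp
    qed
    obtain \<sigma> where \<sigma>: "\<sigma> \<in> signs d" "(\<Sum>j<d. \<sigma> j * dev M n ?x i j) = (\<Sum>j<d. \<bar>dev M n ?x i j\<bar>)"
      by (rule sum_abs_eq_signed[of d "\<lambda>j. dev M n ?x i j"])
    define r where "r = sqrt (real ?N / 2 ^ a)"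
    have a1': "real ?N \<le> 2 ^ a" and a2': "2 ^ a \<le> 2 * real ?N"
    proof -
      have "real ?N \<le> real (2 ^ a)" using a1 by (simp only: of_nat_le_iff)
      then show "real ?N \<le> 2 ^ a" by simp
      have "real (2 ^ a) \<le> real (2 * ?N)" using a2 by (simp only: of_nat_le_iff)
      then show "2 ^ a \<le> 2 * real ?N" by simp
    qed
    have r: "r \<le> 1" "7 / 10 \<le> r"
    proof -
      show "r \<le> 1" using a1' by (simp add: r_def)
      have "(7 / 10)\<^sup>2 \<le> real ?N / 2 ^ a" using a2' by (simp add: field_simps power2_eq_square)
      then show "7 / 10 \<le> r" unfolding r_def by (rule real_le_rsqrt)
    qed
    have "l a * (5 * sqrt (\<theta> * real ?N)) = 5 / 2 * \<theta> * r"
    proof -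
      have *: "u / v / 2 * (5 * (u * w)) = 5 / 2 * (u * u) * (w / v)" for u v w :: real by (simp add: field_simps)
      have "l a * (5 * sqrt (\<theta> * real ?N)) = 5 / 2 * (sqrt \<theta> * sqrt \<theta>) * r"
        unfolding l_def r_def real_sqrt_mult real_sqrt_divide by (rule *)
      then show ?thesis using \<theta> by simp
    qed
    moreover have "4 * (l a)\<^sup>2 * real ?N = \<theta> * r\<^sup>2"
      using \<theta> by (simp add: l_def r_def power_divide)
    moreover have "l a * (5 * sqrt (\<theta> * real ?N)) \<le> l a * (\<Sum>j<d. \<bar>dev M n ?x i j\<bar>)"
      using i \<theta> by (intro mult_left_mono) (auto simp: l_def)
    moreover have "\<theta> * 1 \<le> \<theta> * (5 / 2 * r - r\<^sup>2)"
    proof (intro mult_left_mono \<theta>)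
      have "0 \<le> (r - 7 / 10) * (1 - r)" using r by simp
      moreover have "(r - 7 / 10) * (1 - r) = 17 / 10 * r - 7 / 10 - r * r" by (simp add: field_simps)
      ultimately have "r * r \<le> 17 / 10 * r - 7 / 10" by linarith
      then show "1 \<le> 5 / 2 * r - r\<^sup>2" using r unfolding power2_eq_square by linarith
    qed
    ultimately have "\<theta> \<le> l a * (\<Sum>j<d. \<bar>dev M n ?x i j\<bar>) - 4 * (l a)\<^sup>2 * real ?N" by (simp add: algebra_simps)
    then have "\<theta> \<le> l a * (\<Sum>i\<in>{i}. \<Sum>j<d. \<sigma> j * dev M n ?x i j) - 4 * (l a)\<^sup>2 * (\<Sum>i\<in>{i}. real (visits n 1 0 ?x i))"
      using \<sigma>(2) by simp
    then have "\<omega> \<in> ?B (i, \<sigma>, a)" unfolding prod.case using w by (intro CollectI conjI) auto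
    then show "\<omega> \<in> (\<Union>i\<in>?I. ?B i)"
      by (rule UN_I[rotated]) (intro SigmaI \<sigma>(1), use i(1) aJ in auto)
  qed
qed simp

end

section \<open>Smoothed estimators along a trajectory\<close>

text \<open>The same \<open>\<xi>\<close> serves for the quotient and its inverse because
  \<open>(1 + \<xi>)^2 * (1 - \<xi>) \<ge> 1\<close> for
  \<open>0 \<le> \<xi> \<le> 1 / 2\<close>.\<close>

lemma mult_diff_bound:
  assumes "0 < p" "0 < q" "\<bar>q - p\<bar> \<le> \<xi> * p" "\<xi> \<le> 1 / 2"
  shows "\<bar>sqrt q / sqrt p - 1\<bar> \<le> \<xi>" "\<bar>sqrt p / sqrt q - 1\<bar> \<le> \<xi>"
proof -
  define u where "u = q / p"
  have \<xi>0: "0 \<le> \<xi>" using assms(1,3) by (smt (verit) mult_neg_pos)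
  have u: "0 < u" "1 - \<xi> \<le> u" "u \<le> 1 + \<xi>"
  proof -
    show "0 < u" using assms by (simp add: u_def)
    have "(1 - \<xi>) * p \<le> q" "q \<le> (1 + \<xi>) * p" using assms(3) by (auto simp: abs_le_iff algebra_simps)
    then show "1 - \<xi> \<le> u" "u \<le> 1 + \<xi>" using assms(1) by (auto simp: u_def pos_le_divide_eq pos_divide_le_eq)
  qed
  have s1: "sqrt q / sqrt p = sqrt u" "sqrt p / sqrt q = 1 / sqrt u" by (auto simp: u_def real_sqrt_divide)
  have "1 - \<xi> \<le> sqrt u"
  proof (rule real_le_rsqrt)
    have "(1 - \<xi>) * (1 - \<xi>) \<le> 1 * (1 - \<xi>)" using \<xi>0 assms(4) by (intro mult_right_mono) auto
    then have "(1 - \<xi>) * (1 - \<xi>) \<le> 1 - \<xi>" by simp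
    then show "(1 - \<xi>)\<^sup>2 \<le> u" using u(2) unfolding power2_eq_square by (rule order_trans)
  qed
  moreover have up: "sqrt u \<le> 1 + \<xi>"
  proof (rule real_le_lsqrt)
    have "1 * (1 + \<xi>) \<le> (1 + \<xi>) * (1 + \<xi>)" using \<xi>0 by (intro mult_right_mono) auto
    then have "1 + \<xi> \<le> (1 + \<xi>) * (1 + \<xi>)" by simp
    with u(3) show "u \<le> (1 + \<xi>)\<^sup>2" unfolding power2_eq_square by (rule order_trans)
  qed (use u \<xi>0 in auto)
  ultimately show "\<bar>sqrt q / sqrt p - 1\<bar> \<le> \<xi>" unfolding s1 by (simp add: abs_le_iff)
  have su: "0 < sqrt u" using u by simp
  have "1 \<le> (1 + \<xi>) * sqrt u"
  proof -
    have "\<xi> * \<xi> \<le> 1 / 2 * (1 / 2)" using \<xi>0 assms(4) by (intro mult_mono) auto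
    then have "0 \<le> \<xi> * (1 - \<xi> - \<xi> * \<xi>)" using \<xi>0 assms(4) by (intro mult_nonneg_nonneg) linarith+
    moreover have "(1 + \<xi>)\<^sup>2 * (1 - \<xi>) = 1 + \<xi> * (1 - \<xi> - \<xi> * \<xi>)"
      by (simp add: power2_eq_square algebra_simps)
    ultimately have "1 \<le> (1 + \<xi>)\<^sup>2 * (1 - \<xi>)" by linarith
    also have "\<dots> \<le> (1 + \<xi>)\<^sup>2 * u" using u by (intro mult_left_mono) auto
    also have "\<dots> = ((1 + \<xi>) * sqrt u)\<^sup>2" using u by (simp add: power_mult_distrib)
    finally have "1\<^sup>2 \<le> ((1 + \<xi>) * sqrt u)\<^sup>2" by simp
    then show ?thesis by (rule power2_le_imp_le) (use \<xi>0 su in auto)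
  qed
  then have "1 / sqrt u \<le> 1 + \<xi>" using su by (simp add: pos_divide_le_eq)
  moreover have "1 - \<xi> \<le> 1 / sqrt u"
  proof -
    have "(1 - \<xi>) * sqrt u \<le> (1 - \<xi>) * (1 + \<xi>)" using up assms(4) by (intro mult_left_mono) auto
    also have "\<dots> \<le> 1" by (simp add: algebra_simps)
    finally show ?thesis using su by (simp add: pos_le_divide_eq)
  qed
  ultimately show "\<bar>sqrt p / sqrt q - 1\<bar> \<le> \<xi>" unfolding s1 by (simp add: abs_le_iff)
qed

text \<open>Changing the weights multiplies \<open>L = conj_mat d p A\<close> on both sides by
  diagonal matrices close to the identity. The change is \<open>(r - 1) L s + L (s - 1)\<close>, of
  norm at most \<open>2 * \<xi> + \<xi>^2 \<le> 9 / 4 * \<xi>\<close>; the change of the matrix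
  itself is measured in the new weights \<open>q\<close>.\<close>

lemma conj_mat_perturb:
  assumes p: "\<And>i. i < d \<Longrightarrow> 0 < p i" and q: "\<And>i. i < d \<Longrightarrow> 0 < q i"
    and pq: "\<And>i. i < d \<Longrightarrow> \<bar>q i - p i\<bar> \<le> \<xi> * p i" and \<xi>: "0 \<le> \<xi>" "\<xi> \<le> 1 / 4"
    and L: "op_bound d (conj_mat d p A) 1"
    and E: "\<And>i j. i < d \<Longrightarrow> j < d \<Longrightarrow> E $$ (i, j) = A' $$ (i, j) - A $$ (i, j)"
    and F: "op_bound d (conj_mat d q E) \<phi>"
    and C: "\<And>i j. i < d \<Longrightarrow> j < d \<Longrightarrow> C $$ (i, j) = conj_mat d q A' $$ (i, j) - conj_mat d p A $$ (i, j)"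
  shows "op_bound d C (9 / 4 * \<xi> + \<phi>)"
proof -
  let ?r = "\<lambda>i. sqrt (q i) / sqrt (p i)" and ?s = "\<lambda>i. sqrt (p i) / sqrt (q i)"
  have r: "\<bar>?r i - 1\<bar> \<le> \<xi>" "\<bar>?s i - 1\<bar> \<le> \<xi>" if "i < d" for i
    using mult_diff_bound[OF p q pq, of i] that \<xi> by auto
  have r3: "\<bar>?s i\<bar> \<le> 1 + \<xi>" if "i < d" for i using r(2)[OF that] by linarith
  define L1 where "L1 = Matrix.mat d d (\<lambda>(i, j). (?r i - 1) * conj_mat d p A $$ (i, j) * ?s j)"
  define L2 where "L2 = Matrix.mat d d (\<lambda>(i, j). 1 * conj_mat d p A $$ (i, j) * (?s j - 1))"
  define L12 where "L12 = Matrix.mat d d (\<lambda>(i, j). L1 $$ (i, j) + L2 $$ (i, j))"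
  have "op_bound d L1 (\<xi> * 1 * (1 + \<xi>))"
    by (rule op_bound_scale[OF L, of "\<lambda>i. ?r i - 1" _ ?s])
      (use r(1) r3 \<xi> in \<open>auto simp: L1_def simp del: abs_divide\<close>)
  moreover have "op_bound d L2 (1 * 1 * \<xi>)"
    by (rule op_bound_scale[OF L, of "\<lambda>_. 1" _ "\<lambda>j. ?s j - 1"]) (use r \<xi> in \<open>auto simp: L2_def\<close>)
  ultimately have "op_bound d L12 (\<xi> * 1 * (1 + \<xi>) + 1 * 1 * \<xi>)"
    by (rule op_bound_add) (simp add: L12_def)
  then have "op_bound d C ((\<xi> * 1 * (1 + \<xi>) + 1 * 1 * \<xi>) + \<phi>)"
  proof (rule op_bound_add[OF _ F])
    fix i j assume ij: "i < d" "j < d"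
    have nz: "sqrt (p i) \<noteq> 0" "sqrt (q i) \<noteq> 0" "sqrt (p j) \<noteq> 0" "sqrt (q j) \<noteq> 0"
      using p[OF ij(1)] p[OF ij(2)] q[OF ij(1)] q[OF ij(2)] by auto
    have "conj_mat d q A' $$ (i, j) - conj_mat d p A $$ (i, j)
        = ?r i * conj_mat d p A $$ (i, j) * ?s j - conj_mat d p A $$ (i, j) + conj_mat d q E $$ (i, j)"
      using nz ij by (simp add: conj_mat_index E field_simps)
    also have "?r i * conj_mat d p A $$ (i, j) * ?s j - conj_mat d p A $$ (i, j)
      = L12 $$ (i, j)" using ij by (simp add: L12_def L1_def L2_def algebra_simps)
    finally show "C $$ (i, j) = L12 $$ (i, j) + conj_mat d q E $$ (i, j)" using C ij by simp
  qed
  moreover have "\<xi> * 1 * (1 + \<xi>) + 1 * 1 * \<xi> + \<phi> \<le> 9 / 4 * \<xi> + \<phi>"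
    using mult_left_mono[OF \<xi>(2,1)] by (simp add: algebra_simps)
  ultimately show ?thesis by (rule op_bound_mono)
qed

text \<open>The analogue of \<open>wsq_mv_le\<close> for weights that are only nearly stationary:
  Jensen's inequality in each row, then the column condition. For \<open>pi_hat\<close> and
  \<open>M_hat\<close> the constant \<open>c\<close> exceeds 1 by a boundary term.\<close>

lemma op_bound_conj_subinvariant:
  assumes A: "stochastic_mat d A" and q: "\<And>i. i < d \<Longrightarrow> 0 < q i" and c: "0 \<le> c"
    and col: "\<And>j. j < d \<Longrightarrow> (\<Sum>i<d. q i * A $$ (i, j)) \<le> c * q j"
  shows "op_bound d (conj_mat d q A) (sqrt c)"
  unfolding op_bound_ip
proof (intro conjI allI)
  fix x
  define f where "f = (\<lambda>i. x i / sqrt (q i))"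
  have f: "x i = sqrt (q i) * f i" if "i < d" for i using q[OF that] by (simp add: f_def)
  have "mv d (conj_mat d q A) x = mv d (conj_mat d q A) (\<lambda>j. sqrt (q j) * f j)"
    by (rule mv_cong) (rule f)
  then have 1: "ip d (mv d (conj_mat d q A) x) (mv d (conj_mat d q A) x) = wsq d q (mv d A f)"
    using conj_mat_norm[of d q A f, OF q] by simp
  have "ip d x x = ip d (\<lambda>i. sqrt (q i) * f i) (\<lambda>i. sqrt (q i) * f i)" by (intro ip_cong f)
  also have "\<dots> = wsq d q f" by (rule ip_sqrt_weights_self) (rule q)
  finally have 2: "ip d x x = wsq d q f" .
  have "wsq d q (mv d A f) \<le> (\<Sum>i<d. q i * mv d A (\<lambda>j. (f j)\<^sup>2) i)"
    unfolding wsq_def using q by (intro sum_mono mult_left_mono mv_square_le A) (auto simp: less_imp_le)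
  also have "\<dots> = (\<Sum>j<d. (\<Sum>i<d. q i * A $$ (i, j)) * (f j)\<^sup>2)"
    unfolding mv_def sum_distrib_left sum_distrib_right by (subst sum.swap) (simp add: mult_ac)
  also have "\<dots> \<le> (\<Sum>j<d. c * q j * (f j)\<^sup>2)" using col by (intro sum_mono mult_right_mono) auto
  also have "\<dots> = c * wsq d q f" by (simp add: wsq_def sum_distrib_left mult.assoc)
  finally show "ip d (mv d (conj_mat d q A) x) (mv d (conj_mat d q A) x) \<le> (sqrt c)\<^sup>2 * ip d x x"
    unfolding 1 2 using c by simp
qed (use c in simp)

lemma row_error_mv:
  assumes A: "stochastic_mat d A" and B: "stochastic_mat d B" and i: "i < d"
    and h: "(\<Sum>j<d. \<bar>A $$ (i, j) - B $$ (i, j)\<bar>) \<le> h" and f: "osc_le d f w" and w: "0 \<le> w"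
  shows "\<bar>mv d A f i - mv d B f i\<bar> \<le> h * w / 2"
proof -
  have "mv d A f i - mv d B f i = ip d (\<lambda>j. A $$ (i, j) - B $$ (i, j)) f"
    by (simp add: mv_def ip_def left_diff_distrib sum_subtractf)
  moreover have "\<bar>ip d (\<lambda>j. A $$ (i, j) - B $$ (i, j)) f\<bar> \<le> (\<Sum>j<d. \<bar>A $$ (i, j) - B $$ (i, j)\<bar>) * w / 2"
    by (intro zero_sum_ip_bound f) (simp add: sum_subtractf stochastic_matD(3)[OF A i] stochastic_matD(3)[OF B i])
  moreover have "(\<Sum>j<d. \<bar>A $$ (i, j) - B $$ (i, j)\<bar>) * w / 2 \<le> h * w / 2" using h w by (simp add: mult_right_mono)
  ultimately show ?thesis by linarith
qed

lemma mv_pow_perturb: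
  assumes A: "stochastic_mat d A" and B: "stochastic_mat d B"
    and h: "\<And>i. i < d \<Longrightarrow> (\<Sum>j<d. \<bar>A $$ (i, j) - B $$ (i, j)\<bar>) \<le> h" and f: "osc_le d f w" and i: "i < d"
  shows "\<bar>mv d (A ^\<^sub>m t) f i - mv d (B ^\<^sub>m t) f i\<bar> \<le> real t * (h * w / 2)"
  using i
proof (induction t arbitrary: i)
  case 0
  then show ?case using mv_pow_0[of A d i f] mv_pow_0[of B d i f] stochastic_matD(1)[OF A] stochastic_matD(1)[OF B]
    by (simp del: pow_mat.simps)
next
  case (Suc t)
  let ?a = "mv d (A ^\<^sub>m t) f" and ?b = "mv d (B ^\<^sub>m t) f"
  have w: "0 \<le> w" using osc_le_nonneg[OF f] Suc.prems by simp
  have "mv d A (\<lambda>j. ?a j - ?b j) i \<le> mv d A (\<lambda>_. real t * (h * w / 2)) i"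
       "mv d A (\<lambda>_. - (real t * (h * w / 2))) i \<le> mv d A (\<lambda>j. ?a j - ?b j) i"
  proof -
    have ih: "?a j - ?b j \<le> real t * (h * w / 2)" "- (real t * (h * w / 2)) \<le> ?a j - ?b j" if "j < d" for j
      using Suc.IH[OF that] by linarith+
    show "mv d A (\<lambda>j. ?a j - ?b j) i \<le> mv d A (\<lambda>_. real t * (h * w / 2)) i"
      by (rule mv_mono[OF A Suc.prems ih(1)])
    show "mv d A (\<lambda>_. - (real t * (h * w / 2))) i \<le> mv d A (\<lambda>j. ?a j - ?b j) i"
      by (rule mv_mono[OF A Suc.prems ih(2)])
  qed
  then have 1: "\<bar>mv d A ?a i - mv d A ?b i\<bar> \<le> real t * (h * w / 2)"
    unfolding mv_const[OF A Suc.prems] mv_diff by linarith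
  have "osc_le d ?b w" by (intro osc_le_mv stochastic_mat_pow B f)
  then have 2: "\<bar>mv d A ?b i - mv d B ?b i\<bar> \<le> h * w / 2" by (intro row_error_mv[OF A B Suc.prems] h Suc.prems w)
  show ?case
    unfolding mv_pow_Suc[OF stochastic_matD(1)[OF A] Suc.prems] mv_pow_Suc[OF stochastic_matD(1)[OF B] Suc.prems]
  proof -
    have "real (Suc t) * (h * w / 2) = real t * (h * w / 2) + h * w / 2" by (simp add: algebra_simps)
    then show "\<bar>mv d A ?a i - mv d B ?b i\<bar> \<le> real (Suc t) * (h * w / 2)" using 1 2 by linarith
  qed
qed

text \<open>The powers differ by at most \<open>t * h * w / 2\<close> at each of the two states
  compared, hence by \<open>t * h * w\<close> in the oscillation.\<close>

lemma contr_perturb: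
  assumes A: "stochastic_mat d A" and B: "stochastic_mat d B"
    and h: "\<And>i. i < d \<Longrightarrow> (\<Sum>j<d. \<bar>A $$ (i, j) - B $$ (i, j)\<bar>) \<le> h"
    and c: "contr d (A ^\<^sub>m t) q"
  shows "contr d (B ^\<^sub>m t) (q + real t * h)"
  unfolding contr_def
proof (intro allI impI)
  fix f w assume f: "osc_le d f w"
  have a: "osc_le d (mv d (A ^\<^sub>m t) f) (q * w)" using c f by (simp add: contr_def)
  show "osc_le d (mv d (B ^\<^sub>m t) f) ((q + real t * h) * w)"
    unfolding osc_le_def
  proof (intro allI impI)
    fix i j assume ij: "i < d" "j < d"
    show "mv d (B ^\<^sub>m t) f i - mv d (B ^\<^sub>m t) f j \<le> (q + real t * h) * w"
    proof -
      have "(q + real t * h) * w = q * w + 2 * (real t * (h * w / 2))" by (simp add: algebra_simps)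
      then show ?thesis
        using osc_leD[OF a ij] mv_pow_perturb[OF A B h f ij(1), of t] mv_pow_perturb[OF A B h f ij(2), of t]
        by linarith
    qed
  qed
qed

lemma contr_pow_mono:
  assumes M: "stochastic_mat d M" and c: "contr d (M ^\<^sub>m t) q" and "t \<le> t'"
  shows "contr d (M ^\<^sub>m t') q"
  unfolding contr_def
proof (intro allI impI)
  fix f w assume f: "osc_le d f w"
  have "osc_le d (mv d (M ^\<^sub>m t) (mv d (M ^\<^sub>m (t' - t)) f)) (q * w)"
    using c osc_le_mv[OF stochastic_mat_pow[OF M] f] by (simp add: contr_def)
  then show "osc_le d (mv d (M ^\<^sub>m t') f) (q * w)"
    using mv_pow_add[OF stochastic_matD(1)[OF M], of _ t "t' - t" f] \<open>t \<le> t'\<close>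
    by (simp add: osc_le_def)
qed

lemma contr_mono:
  assumes "contr d A q" "q \<le> q'" shows "contr d A q'"
  unfolding contr_def
proof (intro allI impI)
  fix f w assume f: "osc_le d f w"
  then have "osc_le d (mv d A f) (q * w)" using assms by (simp add: contr_def)
  moreover have "q * w \<le> q' * w" if "0 < d" using osc_le_nonneg[OF f that] assms by (intro mult_right_mono)
  ultimately show "osc_le d (mv d A f) (q' * w)"
    unfolding osc_le_def by (meson le_less_trans order_trans zero_le)
qed

locale traj =
  fixes d n :: nat and x :: "nat \<Rightarrow> nat" and \<alpha> :: real
  assumes d: "2 \<le> d" and \<alpha>: "0 < \<alpha>" and range: "\<And>t. 1 \<le> t \<Longrightarrow> t \<le> n \<Longrightarrow> x t < d"
begin

definition "vis i = real (visits n 1 0 x i)"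
definition "tr i j = real (transitions n 1 0 x i j)"
definition "Nt i = vis i + real d * \<alpha>"
text \<open>\<open>Z\<close> counts \<open>n\<close> states although only \<open>n - 1\<close> of
  them enter \<open>vis\<close>, so for \<open>n \<ge> 1\<close> the weights \<open>ph\<close> have
  total mass \<open>1 - 1 / Z\<close>.\<close>

definition "Z = real n + (real d)\<^sup>2 * \<alpha>"
definition "D = real (visits_min d n 1 0 x) + real d * \<alpha>"
definition "\<mu>m = D / Z"
definition "MH = M_hat d \<alpha> n 1 0 x"
definition "ph = pi_hat d \<alpha> n 1 0 x"

lemmas vis_sum = visits_sum[of n x, folded vis_def]
lemmas tr_sum = transitions_sum[of n x, folded tr_def]

lemma vis_nonneg: "0 \<le> vis i" by (simp add: vis_def)
lemma tr_nonneg: "0 \<le> tr i j" by (simp add: tr_def)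
lemma dev_eq: "dev M n x i j = tr i j - vis i * M $$ (i, j)" by (simp only: dev_def vis_def tr_def)

lemma d_pos: "0 < real d" using d by simp
lemma d\<alpha>_pos: "0 < real d * \<alpha>" using d \<alpha> by simp
lemma Nt_pos: "0 < Nt i" using d\<alpha>_pos by (simp add: Nt_def add_nonneg_pos vis_nonneg)
lemma Z_pos: "0 < Z" using d \<alpha> by (simp add: Z_def add_nonneg_pos)
lemma D_pos: "0 < D" using d\<alpha>_pos by (simp add: D_def add_nonneg_pos)

lemma D_le: "i < d \<Longrightarrow> D \<le> Nt i"
  unfolding D_def Nt_def visits_min_def vis_def by simp

lemma D_attained: obtains i where "i < d" "D = Nt i"
proof -
  have "Min (visits n 1 0 x ` {..<d}) \<in> visits n 1 0 x ` {..<d}" using d by (intro Min_in) (auto simp: lessThan_empty_iff)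
  then show thesis using that by (auto simp: D_def Nt_def visits_min_def vis_def)
qed

lemma ph_eq: "ph i = Nt i / Z"
  by (simp add: ph_def pi_hat_def Nt_def Z_def vis_def)

lemma ph_pos: "0 < ph i" using Nt_pos Z_pos by (simp add: ph_eq)

lemma \<mu>m_pos: "0 < \<mu>m" using D_pos Z_pos by (simp add: \<mu>m_def)

lemma \<mu>m_le: "i < d \<Longrightarrow> \<mu>m \<le> ph i"
  using D_le Z_pos by (simp add: \<mu>m_def ph_eq divide_right_mono)

lemma sum_vis: "(\<Sum>i<d. vis i) = real (n - 1)"
proof -
  have "(\<Sum>i<d. vis i) = (\<Sum>t\<in>{1..<n}. \<Sum>i<d. if x t = i then 1 else 0)"
    unfolding vis_sum by (rule sum.swap)
  also have "\<dots> = (\<Sum>t\<in>{1..<n}. 1)" using range by (intro sum.cong) auto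
  finally show ?thesis by simp
qed

lemma sum_Nt: "(\<Sum>i<d. Nt i) = real (n - 1) + (real d)\<^sup>2 * \<alpha>"
  by (simp add: Nt_def sum.distrib sum_vis power2_eq_square)

lemma sum_Nt_le: "(\<Sum>i<d. Nt i) \<le> Z" by (simp add: sum_Nt Z_def)

lemma sum_ph_le: "(\<Sum>i<d. ph i) \<le> 1"
  using sum_Nt_le Z_pos by (simp add: ph_eq sum_divide_distrib[symmetric])

lemma dD_le: "real d * D \<le> Z"
proof -
  have "(\<Sum>i<d. D) \<le> (\<Sum>i<d. Nt i)" by (intro sum_mono D_le) auto
  then show ?thesis using sum_Nt_le by simp
qed

lemma d\<mu>m_le: "real d * \<mu>m \<le> 1"
  using dD_le Z_pos by (simp add: \<mu>m_def)

lemma \<mu>m_half: "\<mu>m \<le> 1 / 2"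
proof -
  have "2 * \<mu>m \<le> real d * \<mu>m" using d \<mu>m_pos by (intro mult_right_mono) auto
  then show ?thesis using d\<mu>m_le by linarith
qed

lemma sum_tr: "i < d \<Longrightarrow> (\<Sum>j<d. tr i j) = vis i"
proof -
  have "(\<Sum>j<d. tr i j) = (\<Sum>t\<in>{1..<n}. \<Sum>j<d. if x t = i \<and> x (Suc t) = j then 1 else 0)"
    unfolding tr_sum by (rule sum.swap)
  also have "\<dots> = (\<Sum>t\<in>{1..<n}. if x t = i then 1 else 0)"
  proof (rule sum.cong[OF refl])
    fix t assume "t \<in> {1..<n}"
    then have "x (Suc t) < d" by (intro range) auto
    then show "(\<Sum>j<d. if x t = i \<and> x (Suc t) = j then 1 else 0) = (if x t = i then 1 else (0::real))" by simp
  qed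
  finally show ?thesis by (simp only: vis_sum)
qed

text \<open>\<open>vis\<close> omits the last state and the column sums of \<open>tr\<close> omit
  the first one. \<open>cnt\<close> counts all \<open>n\<close> states and isolates both boundary
  terms.\<close>

definition "cnt i = (\<Sum>t\<in>{1..n}. if x t = i then 1 else (0::real))"

lemma cnt_vis: "1 \<le> n \<Longrightarrow> cnt i = vis i + (if x n = i then 1 else 0)"
proof -
  assume "1 \<le> n"
  then have "{1..n} = insert n {1..<n}" by auto
  then show ?thesis by (simp add: cnt_def vis_sum)
qed

lemma sum_tr_col: "1 \<le> n \<Longrightarrow> (\<Sum>i<d. tr i j) = cnt j - (if x 1 = j then 1 else 0)"
proof -
  assume n: "1 \<le> n"
  have "(\<Sum>i<d. tr i j) = (\<Sum>t\<in>{1..<n}. \<Sum>i<d. if x t = i \<and> x (Suc t) = j then 1 else 0)"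
    unfolding tr_sum by (rule sum.swap)
  also have "\<dots> = (\<Sum>t\<in>{1..<n}. if x (Suc t) = j then 1 else 0)"
  proof (rule sum.cong[OF refl])
    fix t assume "t \<in> {1..<n}"
    then have "x t < d" by (intro range) auto
    then show "(\<Sum>i<d. if x t = i \<and> x (Suc t) = j then 1 else 0) = (if x (Suc t) = j then 1 else (0::real))"
      by (simp add: if_distrib cong: if_cong) 
  qed
  also have "\<dots> = (\<Sum>t\<in>{Suc 1..<Suc n}. if x t = j then 1 else 0)"
    by (rule sum.shift_bounds_Suc_ivl[symmetric])
  also have "{1..n} = insert 1 {Suc 1..<Suc n}" using n by auto
  then have "(\<Sum>t\<in>{Suc 1..<Suc n}. if x t = j then 1 else 0) = cnt j - (if x 1 = j then 1 else (0::real))"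
    by (simp add: cnt_def)
  finally show ?thesis .
qed

lemma MH_index: "i < d \<Longrightarrow> j < d \<Longrightarrow> MH $$ (i, j) = (tr i j + \<alpha>) / Nt i"
  by (simp add: MH_def M_hat_def Nt_def vis_def tr_def)

lemma MH_carrier: "MH \<in> carrier_mat d d" by (simp add: MH_def M_hat_def)

lemma MH_pos: "i < d \<Longrightarrow> j < d \<Longrightarrow> 0 < MH $$ (i, j)"
  using Nt_pos[of i] \<alpha> by (simp add: MH_index add_nonneg_pos tr_nonneg)

lemma MH_stoch: "stochastic_mat d MH"
  unfolding stochastic_mat_def
proof (intro conjI allI impI MH_carrier)
  show "0 \<le> MH $$ (i, j)" if "i < d" "j < d" for i j using MH_pos[OF that] by simp
  show "(\<Sum>j<d. MH $$ (i, j)) = 1" if "i < d" for i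
    using that Nt_pos[of i] by (simp add: MH_index sum_divide_distrib[symmetric] sum.distrib sum_tr) (simp add: Nt_def)
qed

lemma MH_ergodic: "ergodic d MH"
  unfolding ergodic_def using MH_stoch MH_pos MH_carrier by (intro conjI exI[of _ 1]) auto

lemma L_hat_eq: "L_hat d \<alpha> n 1 0 x = conj_mat d ph MH"
proof (rule eq_matI)
  fix i j assume "i < dim_row (conj_mat d ph MH)" "j < dim_col (conj_mat d ph MH)"
  then have ij: "i < d" "j < d" by (auto simp: conj_mat_def)
  have "sqrt (ph i) / sqrt (ph j) = sqrt (Nt i) / sqrt (Nt j)"
    using Z_pos by (simp add: ph_eq real_sqrt_divide)
  moreover have "conj_mat d ph MH $$ (i, j) = sqrt (ph i) / sqrt (ph j) * ((tr i j + \<alpha>) / Nt i)"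
    using ij by (simp add: conj_mat_index MH_index)
  ultimately have "conj_mat d ph MH $$ (i, j) = sqrt (Nt i) / sqrt (Nt j) * ((tr i j + \<alpha>) / Nt i)"
    by simp
  also have "\<dots> = (tr i j + \<alpha>) / (sqrt (Nt i) * sqrt (Nt j))"
  proof -
    have "sqrt (Nt i) / Nt i = 1 / sqrt (Nt i)" using Nt_pos[of i] real_sqrt_mult_self[of "Nt i"]
      by (simp add: field_simps)
    then show ?thesis by (metis (no_types, opaque_lifting) divide_divide_eq_left mult.commute mult.right_neutral times_divide_eq_left times_divide_eq_right)
  qed
  finally show "L_hat d \<alpha> n 1 0 x $$ (i, j) = conj_mat d ph MH $$ (i, j)"
    using ij by (simp add: L_hat_def Nt_def real_sqrt_mult vis_def tr_def)
qed (auto simp: L_hat_def conj_mat_def)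

definition "bd = (if 1 \<le> n then 1 else (0::real))"

text \<open>A state is entered at most once more often than it is left, so smoothed column sums
  exceed \<open>Nt j\<close> by at most 1, a relative excess of at most \<open>1 / D\<close>. The
  norm of \<open>L_hat\<close> can therefore exceed 1 and the estimated gap can be negative.\<close>

lemma op_bound_L_hat: "op_bound d (conj_mat d ph MH) (sqrt (1 + bd / D))"
proof (rule op_bound_conj_subinvariant[OF MH_stoch ph_pos])
  show "0 \<le> 1 + bd / D" using D_pos by (simp add: bd_def)
  fix j assume j: "j < d"
  have "(\<Sum>i<d. ph i * MH $$ (i, j)) = (\<Sum>i<d. tr i j + \<alpha>) / Z"
    unfolding sum_divide_distrib using j Nt_pos Z_pos
    by (intro sum.cong) (auto simp: ph_eq MH_index less_imp_neq[symmetric])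
  also have "(\<Sum>i<d. tr i j + \<alpha>) = (\<Sum>i<d. tr i j) + real d * \<alpha>" by (simp add: sum.distrib)
  also have "(\<Sum>i<d. tr i j) \<le> vis j + bd"
  proof (cases "1 \<le> n")
    case True then show ?thesis by (simp add: sum_tr_col cnt_vis bd_def)
  next
    case False then show ?thesis by (simp add: tr_sum bd_def vis_nonneg)
  qed
  finally have "(\<Sum>i<d. ph i * MH $$ (i, j)) \<le> (Nt j + bd) / Z"
    using Z_pos by (simp add: divide_right_mono Nt_def add_ac)
  also have "\<dots> \<le> (Nt j + bd * (Nt j / D)) / Z"
    using D_le[OF j] D_pos Z_pos by (intro divide_right_mono add_left_mono) (auto simp: bd_def)
  finally show "(\<Sum>i<d. ph i * MH $$ (i, j)) \<le> (1 + bd / D) * ph j"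
    by (simp add: ph_eq algebra_simps add_divide_distrib)
qed

lemma gap_dagger_hat_eq: "gap_dagger_hat d \<alpha> n 1 0 x = gram_gap d ph MH"
  unfolding gap_dagger_hat_def L_hat_eq gram_gap_def ..

lemma gap_dagger_hat_bounds: "gram_gap d ph MH \<le> 1" "- (bd / D) \<le> gram_gap d ph MH"
  using second_eigval_gram_bounds[OF _ d op_bound_L_hat] D_pos
  by (auto simp: gram_gap_def spectral_gap_def bd_def)

end

section \<open>The quantity tau and the interval widths\<close>

lemma tau_set_nonempty:
  assumes "0 < \<delta>"
  shows "\<exists>t>0. (1 + real_of_int (max \<lceil>ln (2 * real m / t)\<rceil> 0)) * (real d + 1) * exp (- t) \<le> \<delta>"
proof -
  \<comment> \<open>Above \<open>2 * m\<close> the logarithm is at most 0 and the ceiling drops out;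
    above the second value the exponential beats \<open>(d + 1) / \<delta>\<close>.\<close>
  define t where "t = max (2 * real m + 1) (ln ((real d + 1) / \<delta>))"
  have t: "0 < t" "2 * real m < t" by (auto simp: t_def)
  have "ln (2 * real m / t) \<le> 0"
  proof (cases "m = 0")
    case False
    then have "0 < 2 * real m / t" "2 * real m / t \<le> 1" using t by auto
    then show ?thesis by (simp add: ln_le_zero_iff)
  qed simp
  then have "max \<lceil>ln (2 * real m / t)\<rceil> 0 = 0" by (simp add: max_def ceiling_le_zero)
  moreover have "exp (- t) \<le> exp (- ln ((real d + 1) / \<delta>))" by (simp add: t_def)
  then have "exp (- t) \<le> \<delta> / (real d + 1)" using assms by (simp add: exp_minus)
  then have "(real d + 1) * exp (- t) \<le> \<delta>" by (simp add: pos_le_divide_eq mult.commute add_nonneg_pos)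
  ultimately show ?thesis using t by (intro exI[of _ t]) simp
qed

lemma tau_leI:
  assumes "0 < t" "(1 + real_of_int (max \<lceil>ln (2 * real m / t)\<rceil> 0)) * (real d + 1) * exp (- t) \<le> \<delta>"
  shows "tau d \<delta> m \<le> t"
  unfolding tau_def using assms by (intro cInf_lower) (auto intro!: bdd_belowI[of _ 0])

lemma tau_ge:
  assumes "0 < \<delta>" shows "ln ((real d + 1) / \<delta>) \<le> tau d \<delta> m"
  unfolding tau_def
proof (rule cInf_greatest)
  show "{t. 0 < t \<and> (1 + real_of_int (max \<lceil>ln (2 * real m / t)\<rceil> 0)) * (real d + 1) * exp (- t) \<le> \<delta>} \<noteq> {}"
    using tau_set_nonempty[OF assms] by blast
  fix t assume "t \<in> {t. 0 < t \<and> (1 + real_of_int (max \<lceil>ln (2 * real m / t)\<rceil> 0)) * (real d + 1) * exp (- t) \<le> \<delta>}"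
  then have t: "(1 + real_of_int (max \<lceil>ln (2 * real m / t)\<rceil> 0)) * (real d + 1) * exp (- t) \<le> \<delta>" by simp
  have "1 * (real d + 1) * exp (- t) \<le> (1 + real_of_int (max \<lceil>ln (2 * real m / t)\<rceil> 0)) * (real d + 1) * exp (- t)"
    by (intro mult_right_mono) auto
  with t have "(real d + 1) * exp (- t) \<le> \<delta>" by linarith
  then have "(real d + 1) / \<delta> \<le> exp t" using assms by (simp add: exp_minus field_simps)
  then show "ln ((real d + 1) / \<delta>) \<le> t" 
    using ln_le_cancel_iff[of "(real d + 1) / \<delta>" "exp t"] assms by (simp add: add_nonneg_pos)
qed

text \<open>Every \<open>t\<close> above the infimum lies above some \<open>s\<close> in the set.
  With the logarithm in place of its ceiling the left side is monotone, so the bound holds at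
  \<open>t\<close>; it is also continuous, so the bound passes to the infimum.\<close>

lemma tau_property:
  assumes "0 < \<delta>" "\<delta> < 1" "1 \<le> d"
  shows "(1 + max (ln (2 * real m / tau d \<delta> m)) 0) * (real d + 1) * exp (- tau d \<delta> m) \<le> \<delta>"
proof -
  let ?T = "{t. 0 < t \<and> (1 + real_of_int (max \<lceil>ln (2 * real m / t)\<rceil> 0)) * (real d + 1) * exp (- t) \<le> \<delta>}"
  let ?F = "\<lambda>t. (1 + max (ln (2 * real m / t)) 0) * (real d + 1) * exp (- t)"
  let ?u = "tau d \<delta> m"
  have "1 < (real d + 1) / \<delta>" using assms by simp
  then have u: "0 < ?u" using tau_ge[OF assms(1), of d m] ln_gt_zero[of "(real d + 1) / \<delta>"] by linarith
  have le: "?F t \<le> \<delta>" if "?u < t" for t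
  proof -
    have "?T \<noteq> {}" using tau_set_nonempty[OF assms(1), of m d] by blast
    moreover have "bdd_below ?T" by (rule bdd_belowI[of _ 0]) simp
    ultimately have "\<exists>s\<in>?T. s < t" using that cInf_less_iff[of ?T t] unfolding tau_def by blast
    then obtain s where s: "0 < s" "s < t" "(1 + real_of_int (max \<lceil>ln (2 * real m / s)\<rceil> 0)) * (real d + 1) * exp (- s) \<le> \<delta>" by auto
    have "ln (2 * real m / t) \<le> ln (2 * real m / s)"
    proof (cases "m = 0")
      case False
      then have "2 * real m / t \<le> 2 * real m / s" using s by (intro divide_left_mono) auto
      then show ?thesis using False s by (subst ln_le_cancel_iff) auto
    qed simp
    also have "ln (2 * real m / s) \<le> real_of_int \<lceil>ln (2 * real m / s)\<rceil>" by (rule le_of_int_ceiling)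
    finally have "max (ln (2 * real m / t)) 0 \<le> real_of_int (max \<lceil>ln (2 * real m / s)\<rceil> 0)" by simp
    then have "?F t \<le> (1 + real_of_int (max \<lceil>ln (2 * real m / s)\<rceil> 0)) * (real d + 1) * exp (- s)"
      using s by (intro mult_mono) auto
    then show ?thesis using s(3) by (rule order_trans)
  qed
  have "isCont ?F ?u"
  proof (cases "m = 0")
    case True then show ?thesis by (auto intro!: continuous_intros)
  next
    case False
    with u have "0 < 2 * real m / ?u" by simp
    then show ?thesis using u False by (intro continuous_intros) auto
  qed
  then have "(?F \<longlongrightarrow> ?F ?u) (at_right ?u)" by (simp add: isCont_def filterlim_at_split)
  moreover have "eventually (\<lambda>t. ?F t \<le> \<delta>) (at_right ?u)" using le by (auto simp: eventually_at_right_field intro!: exI[of _ "?u + 1"])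
  ultimately show ?thesis by (rule tendsto_upperbound) simp
qed

text \<open>At confidence \<open>\<delta> / d\<close> the factor \<open>d + 1\<close> in
  \<open>tau\<close> leads to \<open>\<delta> / (d * (d + 1))\<close>, which is at most
  \<open>1 / 6\<close>; the bound \<open>3 / 2\<close> then follows from
  \<open>exp (3 / 2) < 6\<close>.\<close>

lemma tau_basic:
  assumes "0 < \<delta>" "\<delta> < 1" "2 \<le> d"
  shows "3 / 2 \<le> tau d (\<delta> / real d) n"
    and "(1 + max (ln (2 * real n / tau d (\<delta> / real d) n)) 0) * exp (- tau d (\<delta> / real d) n) \<le> \<delta> / (real d * (real d + 1))"
    and "exp (- tau d (\<delta> / real d) n) \<le> \<delta> / (real d * (real d + 1))"
proof -
  let ?t = "tau d (\<delta> / real d) n"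
  have d0: "0 < real d" using assms by simp
  have dd: "\<delta> / real d < 1" using assms by simp
  have p: "(1 + max (ln (2 * real n / ?t)) 0) * (real d + 1) * exp (- ?t) \<le> \<delta> / real d"
    by (rule tau_property) (use assms dd in auto)
  then have "(1 + max (ln (2 * real n / ?t)) 0) * exp (- ?t) * (real d * (real d + 1)) \<le> \<delta>"
    using d0 by (simp add: pos_le_divide_eq mult_ac)
  then show 1: "(1 + max (ln (2 * real n / ?t)) 0) * exp (- ?t) \<le> \<delta> / (real d * (real d + 1))"
    using d0 by (simp add: pos_le_divide_eq add_pos_pos)
  have "1 * exp (- ?t) \<le> (1 + max (ln (2 * real n / ?t)) 0) * exp (- ?t)" by (intro mult_right_mono) auto
  with 1 show 2: "exp (- ?t) \<le> \<delta> / (real d * (real d + 1))" by linarith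
  have "2 * (2 + 1) \<le> real d * (real d + 1)" using assms by (intro mult_mono) auto
  then have "\<delta> / (real d * (real d + 1)) \<le> 1 / 6" using assms by (intro frac_le) auto
  with 2 have "exp (- ?t) \<le> 1 / 6" by linarith
  then have e6: "6 \<le> exp ?t" by (simp add: exp_minus field_simps)
  have "exp (1 / 2 :: real) \<le> 1 + 1 / 2 + (1 / 2)\<^sup>2" by (rule exp_bound) auto
  then have h: "exp (1 / 2 :: real) \<le> 7 / 4" by (simp add: power2_eq_square)
  have "exp (3 / 2 :: real) = exp (1 / 2) ^ 3" by (simp add: exp_of_nat_mult[symmetric])
  also have "\<dots> \<le> (7 / 4) ^ 3" using h by (intro power_mono) auto
  also have "\<dots> < 6" by (simp add: power3_eq_cube)
  finally have "exp (3 / 2) \<le> exp ?t" using e6 by linarith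
  then show "3 / 2 \<le> ?t" by simp
qed

text \<open>With \<open>y = d * ln m / \<delta> \<ge> 2\<close>, the defining expression at
  \<open>8 * ln y\<close> is at most \<open>6 * \<delta> * y / y^8\<close>, and
  \<open>6 / 2^7 < 1\<close>.\<close>

lemma tau_upper:
  assumes "2 \<le> d" "3 \<le> m" "0 < \<delta>" "\<delta> < 1"
  shows "tau d \<delta> m \<le> 8 * ln (real d * ln (real m) / \<delta>)"
proof (rule tau_leI)
  have m3: "3 \<le> real m" using assms by simp
  have ln3: "1 \<le> ln (real m)" using m3 exp_le by (subst ln_ge_iff) auto
  define y where "y = real d * ln (real m) / \<delta>"
  have "2 * 1 \<le> real d * ln (real m)" using assms ln3 by (intro mult_mono) auto
  also have "real d * ln (real m) \<le> y" using assms \<open>2 * 1 \<le> real d * ln (real m)\<close>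
    by (simp add: y_def le_divide_eq)
  finally have y: "2 \<le> y" by simp
  have lny: "2 / 3 \<le> ln y" using ln2_ge_two_thirds y ln_le_cancel_iff[of 2 y] by linarith
  then show "0 < 8 * ln (real d * ln (real m) / \<delta>)" by (simp add: y_def)
  have "ln (2 * real m / (8 * ln y)) \<le> ln (real m)"
    using lny m3 by (subst ln_le_cancel_iff) (auto simp: divide_simps)
  then have c: "real_of_int (max \<lceil>ln (2 * real m / (8 * ln y))\<rceil> 0) \<le> ln (real m) + 1"
  proof -
    define z where "z = ln (2 * real m / (8 * ln y))"
    have "real_of_int \<lceil>z\<rceil> \<le> ln (real m) + 1"
      using of_int_ceiling_le_add_one[of z] \<open>ln (2 * real m / (8 * ln y)) \<le> ln (real m)\<close> unfolding z_def by linarith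
    then have "real_of_int (max \<lceil>z\<rceil> 0) \<le> ln (real m) + 1" using ln3 by (simp add: of_int_max)
    then show ?thesis by (simp only: z_def)
  qed
  have ex: "exp (- (8 * ln y)) = (1 / y) ^ 8"
  proof -
    have "exp (- (8 * ln y)) = exp (real 8 * - ln y)" by simp
    also have "\<dots> = exp (- ln y) ^ 8" by (rule exp_of_nat_mult)
    also have "exp (- ln y) = 1 / y" using y by (simp add: exp_minus field_simps)
    finally show ?thesis .
  qed
  have "(1 + real_of_int (max \<lceil>ln (2 * real m / (8 * ln y))\<rceil> 0)) * (real d + 1) * exp (- (8 * ln y))
      \<le> (3 * ln (real m)) * (2 * real d) * (1 / y) ^ 8"
    unfolding ex using c ln3 assms y by (intro mult_mono) auto
  also have "\<dots> = 6 * \<delta> * (y * (1 / y) ^ 8)" using assms by (simp add: y_def)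
  also have "y * (1 / y) ^ 8 = (1 / y) ^ 7" using y by (simp add: power_divide eval_nat_numeral)
  also have "(1 / y) ^ 7 \<le> (1 / 2) ^ 7" using y by (intro power_mono divide_left_mono) auto
  finally have "(1 + real_of_int (max \<lceil>ln (2 * real m / (8 * ln y))\<rceil> 0)) * (real d + 1) * exp (- (8 * ln y)) \<le> 6 * \<delta> * (1 / 2) ^ 7"
    using assms by (auto simp: mult_left_mono)
  also have "\<dots> \<le> \<delta>" using assms by (simp add: power_divide eval_nat_numeral)
  finally show "(1 + real_of_int (max \<lceil>ln (2 * real m / (8 * ln (real d * ln (real m) / \<delta>)))\<rceil> 0)) * (real d + 1) *
      exp (- (8 * ln (real d * ln (real m) / \<delta>))) \<le> \<delta>" by (simp add: y_def)
qed

text \<open>Reduction to skip 1: the following lemmas rewrite estimators and widths at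
  \<open>(k, r)\<close> as those at \<open>(1, 0)\<close> for the skipped trajectory with its own
  length.\<close>

lemma visits_max_skipped: "visits_max d m k r x = visits_max d (sublen m k r) 1 0 (skipped k r x)"
  and visits_min_skipped: "visits_min d m k r x = visits_min d (sublen m k r) 1 0 (skipped k r x)"
  by (simp_all add: visits_max_def visits_min_def visits_def)

lemma M_hat_skipped: "M_hat d \<alpha> m k r x = M_hat d \<alpha> (sublen m k r) 1 0 (skipped k r x)"
  and L_hat_skipped: "L_hat d \<alpha> m k r x = L_hat d \<alpha> (sublen m k r) 1 0 (skipped k r x)"
  and pi_hat_skipped: "pi_hat d \<alpha> m k r x = pi_hat d \<alpha> (sublen m k r) 1 0 (skipped k r x)"
  by (simp_all add: M_hat_def L_hat_def pi_hat_def visits_def transitions_def fun_eq_iff)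

lemma gap_dagger_hat_skipped: "gap_dagger_hat d \<alpha> m k r x = gap_dagger_hat d \<alpha> (sublen m k r) 1 0 (skipped k r x)"
  unfolding gap_dagger_hat_def L_hat_skipped[of d \<alpha> m k r x] ..

lemma d_width_skipped: "d_width d \<alpha> \<delta> m k r x = d_width d \<alpha> \<delta> (sublen m k r) 1 0 (skipped k r x)"
  unfolding d_width_def visits_min_skipped[of d m k r x] sublen_1_0 ..

lemma gap_width_skipped: "gap_width C g d \<alpha> \<delta> m k r x = gap_width C g d \<alpha> \<delta> (sublen m k r) 1 0 (skipped k r x)"
  unfolding gap_width_def c_width_def b_width_def a_width_def visits_min_skipped[of d m k r x]
    visits_max_skipped[of d m k r x] d_width_skipped[of d \<alpha> \<delta> m k r x] pi_hat_skipped[of d \<alpha> m k r x] sublen_1_0 ..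

locale conf = traj +
  fixes \<delta> :: real
  assumes \<delta>: "0 < \<delta>" "\<delta> < 1"
begin

definition "\<tau> = tau d (\<delta> / real d) n"
text \<open>\<open>\<eta>1\<close> is the statistical part of the width and \<open>\<eta>2\<close>
  the bias due to smoothing. They are kept apart because boundary terms are compared with the first
  one.\<close>

definition "\<eta>1 = 4 * \<tau> * sqrt (real d / D)"
definition "\<eta>2 = 2 * \<alpha> * real d / D"
definition "\<eta> = \<eta>1 + \<eta>2"
definition "\<Lambda> = ln (2 * sqrt (2 * Z / D))"

lemma \<tau>_ge: "3 / 2 \<le> \<tau>" unfolding \<tau>_def by (rule tau_basic(1)[OF \<delta> d])

lemma \<eta>1_pos: "0 < \<eta>1" using \<tau>_ge d D_pos by (simp add: \<eta>1_def)
lemma \<eta>2_pos: "0 < \<eta>2" using \<alpha> d D_pos by (simp add: \<eta>2_def)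
lemma \<eta>_pos: "0 < \<eta>" using \<eta>1_pos \<eta>2_pos by (simp add: \<eta>_def)

lemma d_width_eq: "d_width d \<alpha> \<delta> n 1 0 x = \<eta>"
  by (simp add: d_width_def \<eta>_def \<eta>1_def \<eta>2_def \<tau>_def D_def)

lemma \<Lambda>_ge: "4 / 3 \<le> \<Lambda>"
proof -
  have "2 * D \<le> real d * D" using d D_pos by (intro mult_right_mono) auto
  then have "2 * D \<le> Z" using dD_le by linarith
  then have "4 \<le> 2 * Z / D" using D_pos by (simp add: pos_le_divide_eq)
  then have "sqrt 4 \<le> sqrt (2 * Z / D)" by (rule real_sqrt_le_mono)
  then have "4 \<le> 2 * sqrt (2 * Z / D)" by simp
  then have "ln 4 \<le> \<Lambda>" unfolding \<Lambda>_def using Z_pos D_pos by (subst ln_le_cancel_iff) auto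
  moreover have "ln (4::real) = 2 * ln 2" using ln_realpow[of 2 2] by simp
  ultimately show ?thesis using ln2_ge_two_thirds by linarith
qed

text \<open>\<open>2 * \<Lambda>\<close> is the logarithm of \<open>8 / \<mu>m\<close>. Decay at
  rate \<open>g\<close> over \<open>2 * \<Lambda> / g\<close> steps thus beats the factor
  \<open>1 / \<mu>m\<close> lost between the weighted norm and the supremum; this is where the
  logarithm in the width comes from.\<close>

lemma \<Lambda>_exp: "exp (- (2 * \<Lambda>)) = \<mu>m / 8"
proof -
  have p: "0 < 2 * sqrt (2 * Z / D)" using Z_pos D_pos by simp
  have "2 * \<Lambda> = ln ((2 * sqrt (2 * Z / D))\<^sup>2)" 
    using ln_realpow[of "2 * sqrt (2 * Z / D)" 2] by (simp only: \<Lambda>_def of_nat_numeral)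
  also have "(2 * sqrt (2 * Z / D))\<^sup>2 = 8 * Z / D" using Z_pos D_pos by (simp add: power_mult_distrib)
  finally have "exp (2 * \<Lambda>) = 8 * Z / D" using Z_pos D_pos by simp
  then show ?thesis by (simp add: exp_minus \<mu>m_def field_simps)
qed

lemma b_width_pos:
  assumes "0 < g" shows "b_width C g d \<alpha> \<delta> n 1 0 x = ereal (C / g * \<Lambda> * \<eta>)"
proof -
  have "max g 0 = g" using assms by simp
  then show ?thesis using assms d_width_eq
    by (simp add: b_width_def \<Lambda>_def Z_def D_def mult.assoc)
qed

lemma b_width_inf:
  assumes "g \<le> 0" "0 < C" shows "b_width C g d \<alpha> \<delta> n 1 0 x = \<infinity>"
proof -
  have m: "max g 0 = 0" using assms by simp
  have "0 < ln (2 * sqrt (2 * (real n + (real d)\<^sup>2 * \<alpha>) / (real (visits_min d n 1 0 x) + real d * \<alpha>)))"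
    using \<Lambda>_ge by (simp add: \<Lambda>_def Z_def D_def)
  moreover have "0 < d_width d \<alpha> \<delta> n 1 0 x" using \<eta>_pos d_width_eq by simp
  ultimately show ?thesis using assms m
    by (simp add: b_width_def divide_ereal_def)
qed

lemma a_width_nonneg: "0 \<le> a_width d \<alpha> \<delta> n 1 0 x"
proof -
  have "0 \<le> real d * \<alpha>" using d\<alpha>_pos by simp
  then show ?thesis unfolding a_width_def d_width_eq using \<eta>_pos by (simp add: add_nonneg_nonneg)
qed

lemma c_width_ge:
  assumes "i < d" shows "ereal (1 / 2) * (b / ereal (ph i)) \<le> c_width b d \<alpha> n 1 0 x"
proof -
  let ?f = "\<lambda>i. max (b / ereal (pi_hat d \<alpha> n 1 0 x i)) (b / max (ereal (pi_hat d \<alpha> n 1 0 x i) - b) 0)"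
  have "b / ereal (ph i) \<le> ?f i" by (simp add: ph_def)
  also have "?f i \<le> Max (?f ` {..<d})" using assms by (intro Max_ge) auto
  finally show ?thesis unfolding c_width_def by (intro ereal_mult_left_mono) auto
qed

text \<open>Only the entry \<open>b / \<mu>m\<close> of the maximum, at a state of minimal
  frequency, is kept; the factors 2 and \<open>1 / 2\<close> cancel. For positive \<open>g\<close>
  the coverage argument uses the width only through this bound.\<close>

lemma gap_width_ge:
  assumes g: "0 < g" and C: "0 \<le> C"
  shows "ereal (C / g * \<Lambda> * \<eta> / \<mu>m) \<le> gap_width C g d \<alpha> \<delta> n 1 0 x"
proof -
  define b where "b = C / g * \<Lambda> * \<eta>"
  have b0: "0 \<le> b" using g C \<Lambda>_ge \<eta>_pos by (simp add: b_def)
  obtain i where i: "i < d" "D = Nt i" by (rule D_attained)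
  define c where "c = c_width (b_width C g d \<alpha> \<delta> n 1 0 x) d \<alpha> n 1 0 x"
  have phm: "ph i = \<mu>m" by (simp add: ph_eq \<mu>m_def i(2))
  have "ereal (1 / 2) * (ereal b / ereal (ph i)) = ereal (b / \<mu>m / 2)"
    using \<mu>m_pos unfolding phm by simp
  then have ci: "ereal (b / \<mu>m / 2) \<le> c"
    using c_width_ge[OF i(1), of "ereal b"] unfolding c_def b_width_pos[OF g] b_def[symmetric] by simp
  have c0: "0 \<le> c" using ci b0 \<mu>m_pos by (intro order_trans[OF _ ci]) simp
  have "ereal (b / \<mu>m) = 2 * ereal (b / \<mu>m / 2)" by simp
  also have "\<dots> \<le> 2 * c" by (intro ereal_mult_left_mono ci) auto
  also have "\<dots> = 0 + 2 * c + 0" by simp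
  also have "\<dots> \<le> ereal (a_width d \<alpha> \<delta> n 1 0 x) + 2 * c + c\<^sup>2"
    by (intro add_mono) (use a_width_nonneg c0 in auto)
  finally show ?thesis by (simp add: gap_width_def Let_def c_def b_def)
qed

lemma gap_width_inf:
  assumes "g \<le> 0" "0 < C" shows "gap_width C g d \<alpha> \<delta> n 1 0 x = \<infinity>"
proof -
  define c where "c = c_width (b_width C g d \<alpha> \<delta> n 1 0 x) d \<alpha> n 1 0 x"
  have "0 < d" using d by simp
  from c_width_ge[OF this, of \<infinity>] have "c = \<infinity>"
    unfolding c_def b_width_inf[OF assms] using ph_pos[of 0] by (simp add: divide_ereal_def)
  then show ?thesis unfolding gap_width_def Let_def c_def[symmetric] by simp
qed

text \<open>The 36 is \<open>16 * (3 / 2)^2\<close>, from \<open>\<tau> \<ge> 3 / 2\<close>.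
  Boundary terms of size \<open>1 / Z\<close> are thus of second order in the width.\<close>

lemma inverse_Z_le: "36 * real d / Z \<le> \<eta>1\<^sup>2 * \<mu>m"
proof -
  have "\<eta>1\<^sup>2 = 16 * \<tau>\<^sup>2 * (real d / D)" using D_pos by (simp add: \<eta>1_def power_mult_distrib)
  moreover have "(3 / 2)\<^sup>2 \<le> \<tau>\<^sup>2" using \<tau>_ge by (intro power_mono) auto
  then have "16 * (9 / 4) * (real d / D) \<le> 16 * \<tau>\<^sup>2 * (real d / D)"
    using D_pos by (intro mult_right_mono) (auto simp: power2_eq_square)
  ultimately have "36 * (real d / D) * \<mu>m \<le> \<eta>1\<^sup>2 * \<mu>m" using \<mu>m_pos by (intro mult_right_mono) auto
  then show ?thesis using D_pos by (simp add: \<mu>m_def)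
qed

end

lemma mv_between:
  assumes M: "stochastic_mat d M" and i: "i < d" and j: "j < d" and f: "osc_le d f w"
  shows "\<bar>mv d M f i - f j\<bar> \<le> w"
proof -
  obtain a where a: "a < d" "\<And>i. i < d \<Longrightarrow> f a \<le> f i" "\<And>i. i < d \<Longrightarrow> f i \<le> f a + w"
    using osc_le_argmin[OF f] i by auto
  have "mv d M f i \<le> f a + w" "f a \<le> mv d M f i"
    using mv_mono[OF M i, of f "\<lambda>_. f a + w"] mv_mono[OF M i, of "\<lambda>_. f a" f] a mv_const[OF M i] by auto
  then show ?thesis using a(2)[OF j] a(3)[OF j] by linarith
qed

context traj
begin

text \<open>For \<open>n \<ge> 1\<close> this is \<open>ph\<close> with the missing mass
  \<open>1 / Z\<close> added at the last state; its entries sum to 1.\<close>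

definition "\<nu> i = (cnt i + real d * \<alpha>) / Z"

lemma cnt_nonneg: "0 \<le> cnt i" by (simp add: cnt_def sum_nonneg)

lemma sum_cnt: "(\<Sum>i<d. cnt i) = real n"
proof -
  have "(\<Sum>i<d. cnt i) = (\<Sum>t\<in>{1..n}. \<Sum>i<d. if x t = i then 1 else 0)"
    unfolding cnt_def by (rule sum.swap)
  also have "\<dots> = (\<Sum>t\<in>{1..n}. 1)" using range by (intro sum.cong) auto
  finally show ?thesis by simp
qed

lemma sum_\<nu>: "(\<Sum>i<d. \<nu> i) = 1"
  using Z_pos by (simp add: \<nu>_def sum_divide_distrib[symmetric] sum.distrib sum_cnt Z_def power2_eq_square)

lemma ph_le_\<nu>: "1 \<le> n \<Longrightarrow> ph i \<le> \<nu> i" and \<nu>_ph_diff: "1 \<le> n \<Longrightarrow> \<bar>\<nu> i - ph i\<bar> \<le> 1 / Z"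
proof -
  assume n: "1 \<le> n"
  have "\<nu> i - ph i = (if x n = i then 1 else 0) / Z"
    by (simp add: \<nu>_def ph_eq Nt_def cnt_vis[OF n] add_divide_distrib[symmetric] diff_divide_distrib[symmetric])
  moreover have "0 \<le> (if x n = i then 1 else 0) / Z" "(if x n = i then 1 else 0) / Z \<le> 1 / Z" using Z_pos by auto
  ultimately show "ph i \<le> \<nu> i" "\<bar>\<nu> i - ph i\<bar> \<le> 1 / Z" by linarith+
qed

lemma sum_vis_mv:
  assumes n: "1 \<le> n"
  shows "(\<Sum>i<d. vis i * mv d M f i) = (\<Sum>j<d. cnt j * f j) - f (x 1) - (\<Sum>j<d. (\<Sum>i<d. dev M n x i j) * f j)"
proof -
  have "(\<Sum>i<d. vis i * mv d M f i) = (\<Sum>j<d. (\<Sum>i<d. vis i * M $$ (i, j)) * f j)"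
    unfolding mv_def sum_distrib_left sum_distrib_right by (subst sum.swap) (simp add: mult_ac)
  also have "\<dots> = (\<Sum>j<d. (\<Sum>i<d. tr i j) * f j) - (\<Sum>j<d. (\<Sum>i<d. dev M n x i j) * f j)"
    unfolding sum_subtractf[symmetric] left_diff_distrib[symmetric] by (simp add: dev_eq)
  also have "(\<Sum>j<d. (\<Sum>i<d. tr i j) * f j) = (\<Sum>j<d. cnt j * f j) - (\<Sum>j<d. if j = x 1 then f j else 0)"
    unfolding sum_tr_col[OF n] sum_subtractf[symmetric] by (intro sum.cong) (auto simp: algebra_simps)
  also have "(\<Sum>j<d. if j = x 1 then f j else 0) = f (x 1)" using range[of 1] n by simp
  finally show ?thesis .
qed

lemma sum_cnt_f:
  assumes n: "1 \<le> n" shows "(\<Sum>i<d. cnt i * g i) = (\<Sum>i<d. vis i * g i) + g (x n)"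
proof -
  have "(\<Sum>i<d. cnt i * g i) = (\<Sum>i<d. vis i * g i + (if i = x n then g i else 0))"
    by (intro sum.cong) (auto simp: cnt_vis[OF n] algebra_simps)
  then show ?thesis using range[of n] n by (simp add: sum.distrib)
qed

text \<open>The defect of stationarity has three exact contributions: the two ends of the
  trajectory, the summed deviations, and the smoothing.\<close>

lemma \<nu>_mv:
  assumes n: "1 \<le> n"
  shows "ip d \<nu> (mv d M f) - ip d \<nu> f = (mv d M f (x n) - f (x 1)
    - (\<Sum>j<d. (\<Sum>i<d. dev M n x i j) * f j) + real d * \<alpha> * (\<Sum>i<d. mv d M f i - f i)) / Z"
proof -
  have v: "ip d \<nu> g = ((\<Sum>i<d. cnt i * g i) + real d * \<alpha> * (\<Sum>i<d. g i)) / Z" for g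
    unfolding ip_def \<nu>_def by (simp add: sum_divide_distrib sum_distrib_left algebra_simps sum.distrib add_divide_distrib)
  show ?thesis unfolding v diff_divide_distrib[symmetric]
    by (simp add: sum_cnt_f[OF n, of "mv d M f"] sum_vis_mv[OF n] sum_subtractf algebra_simps)
qed

lemma sum_dev_zero:
  assumes M: "stochastic_mat d M" and i: "i < d" shows "(\<Sum>j<d. dev M n x i j) = 0"
  by (simp add: dev_eq sum_subtractf sum_tr[OF i] sum_distrib_left[symmetric] stochastic_matD(3)[OF M i])

text \<open>All three terms of \<open>\<nu>_mv\<close> vanish on constants, so the oscillation
  bounds them: \<open>S / 2\<close> from the deviations, 1 from the ends, and
  \<open>d^2 * \<alpha>\<close> from smoothing.\<close>

lemma \<nu>_near_stationary:
  assumes n: "1 \<le> n" and M: "stochastic_mat d M" and S: "(\<Sum>j<d. \<bar>\<Sum>i<d. dev M n x i j\<bar>) \<le> S" and f: "osc_le d f w"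
  shows "\<bar>ip d \<nu> (mv d M f) - ip d \<nu> f\<bar> \<le> ((S / 2 + 1 + (real d)\<^sup>2 * \<alpha>) / Z) * w"
proof -
  have d0: "0 < d" using d by simp
  have w: "0 \<le> w" by (rule osc_le_nonneg[OF f d0])
  have "\<bar>ip d (\<lambda>j. \<Sum>i<d. dev M n x i j) f\<bar> \<le> (\<Sum>j<d. \<bar>\<Sum>i<d. dev M n x i j\<bar>) * w / 2"
    by (rule zero_sum_ip_bound[OF _ f]) (subst sum.swap, simp add: sum_dev_zero[OF M])
  also have "\<dots> \<le> S * w / 2" using S w by (simp add: mult_right_mono)
  finally have 1: "\<bar>\<Sum>j<d. (\<Sum>i<d. dev M n x i j) * f j\<bar> \<le> S * w / 2" by (simp add: ip_def)
  have 2: "\<bar>mv d M f (x n) - f (x 1)\<bar> \<le> w" using range n by (intro mv_between[OF M _ _ f]) auto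
  have "\<bar>\<Sum>i<d. mv d M f i - f i\<bar> \<le> (\<Sum>i<d. w)"
    by (rule order_trans[OF sum_abs]) (intro sum_mono mv_between[OF M _ _ f], auto)
  then have "real d * \<alpha> * \<bar>\<Sum>i<d. mv d M f i - f i\<bar> \<le> real d * \<alpha> * (real d * w)"
    using d\<alpha>_pos by (intro mult_left_mono) auto
  then have 3: "\<bar>real d * \<alpha> * (\<Sum>i<d. mv d M f i - f i)\<bar> \<le> (real d)\<^sup>2 * \<alpha> * w"
    unfolding abs_mult[of "real d * \<alpha>"] abs_of_pos[OF d\<alpha>_pos] by (simp add: power2_eq_square mult_ac)
  have "\<bar>ip d \<nu> (mv d M f) - ip d \<nu> f\<bar> \<le> (w + S * w / 2 + (real d)\<^sup>2 * \<alpha> * w) / Z"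
    unfolding \<nu>_mv[OF n] abs_divide using 1 2 3 Z_pos by (simp add: divide_right_mono)
  also have "\<dots> = ((S / 2 + 1 + (real d)\<^sup>2 * \<alpha>) / Z) * w" by (simp add: algebra_simps add_divide_distrib)
  finally show ?thesis .
qed

text \<open>\<open>near_stationary_bound\<close> for \<open>\<nu> - p\<close> with
  \<open>q = 3 / 4\<close>, whence the factor 4; the final \<open>1 / Z\<close> is the step from
  \<open>\<nu>\<close> to \<open>ph\<close>.\<close>

lemma ph_near_stationary:
  assumes n: "1 \<le> n" and M: "stochastic_mat d M" and p: "stat_dist d M p" and c: "contr d (M ^\<^sub>m t) (3 / 4)"
    and S: "(\<Sum>j<d. \<bar>\<Sum>i<d. dev M n x i j\<bar>) \<le> S" and i: "i < d"
  shows "\<bar>ph i - p i\<bar> \<le> 4 * real t * ((S / 2 + 1 + (real d)\<^sup>2 * \<alpha>) / Z) + 1 / Z"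
proof -
  have "\<bar>\<nu> i - p i\<bar> \<le> real t * ((S / 2 + 1 + (real d)\<^sup>2 * \<alpha>) / Z) / (1 - 3 / 4)"
  proof (rule near_stationary_bound(2)[OF M c _ _ _ i, of "\<lambda>i. \<nu> i - p i"])
    show "(\<Sum>i<d. \<nu> i - p i) = 0" using p by (simp add: sum_subtractf sum_\<nu> stat_dist_def distribution_def)
    show "\<bar>ip d (\<lambda>i. \<nu> i - p i) f - ip d (\<lambda>i. \<nu> i - p i) (mv d M f)\<bar> \<le> ((S / 2 + 1 + (real d)\<^sup>2 * \<alpha>) / Z) * w"
      if "osc_le d f w" for f w
      using \<nu>_near_stationary[OF n M S that] by (simp add: ip_linear ip_stat[OF p] abs_minus_commute)
  qed simp
  moreover have "real t * ((S / 2 + 1 + (real d)\<^sup>2 * \<alpha>) / Z) / (1 - 3 / 4) = 4 * real t * ((S / 2 + 1 + (real d)\<^sup>2 * \<alpha>) / Z)"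
    by simp
  ultimately show ?thesis using \<nu>_ph_diff[OF n, of i] by linarith
qed

text \<open>Smoothing pulls the row towards the uniform distribution. It adds
  \<open>\<alpha> - d * \<alpha> * M(i,j)\<close> to the deviation, with absolute values of total at
  most \<open>2 * d * \<alpha>\<close>.\<close>

lemma row_error:
  assumes M: "stochastic_mat d M" and i: "i < d"
  shows "(\<Sum>j<d. \<bar>MH $$ (i, j) - M $$ (i, j)\<bar>) \<le> ((\<Sum>j<d. \<bar>dev M n x i j\<bar>) + 2 * real d * \<alpha>) / Nt i"
proof -
  have e: "MH $$ (i, j) - M $$ (i, j) = (dev M n x i j + (\<alpha> - real d * \<alpha> * M $$ (i, j))) / Nt i" if "j < d" for j
    using Nt_pos[of i] that i by (simp add: MH_index dev_eq field_simps) (simp add: Nt_def algebra_simps)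
  have "(\<Sum>j<d. \<bar>MH $$ (i, j) - M $$ (i, j)\<bar>) = (\<Sum>j<d. \<bar>dev M n x i j + (\<alpha> - real d * \<alpha> * M $$ (i, j))\<bar>) / Nt i"
    unfolding sum_divide_distrib using Nt_pos[of i] by (intro sum.cong) (auto simp: e abs_divide)
  also have "\<dots> \<le> (\<Sum>j<d. \<bar>dev M n x i j\<bar> + (\<alpha> + real d * \<alpha> * M $$ (i, j))) / Nt i"
  proof (intro divide_right_mono sum_mono)
    fix j assume "j \<in> {..<d}"
    then have "0 \<le> real d * \<alpha> * M $$ (i, j)" using stochastic_matD(2)[OF M i] d\<alpha>_pos by simp
    then show "\<bar>dev M n x i j + (\<alpha> - real d * \<alpha> * M $$ (i, j))\<bar> \<le> \<bar>dev M n x i j\<bar> + (\<alpha> + real d * \<alpha> * M $$ (i, j))"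
      using \<alpha> by linarith
  qed (use Nt_pos[of i] in simp)
  also have "(\<Sum>j<d. \<bar>dev M n x i j\<bar> + (\<alpha> + real d * \<alpha> * M $$ (i, j))) = (\<Sum>j<d. \<bar>dev M n x i j\<bar>) + 2 * real d * \<alpha>"
    by (simp add: sum.distrib sum_distrib_left[symmetric] stochastic_matD(3)[OF M i])
  finally show ?thesis .
qed

definition "err M = Matrix.mat d d (\<lambda>(i, j). MH $$ (i, j) - M $$ (i, j))"

text \<open>The Frobenius norm bounds the operator norm, the l1 norm of a row bounds its l2 norm,
  and the weights in the denominator are at least \<open>pm\<close>.\<close>

lemma op_bound_err:
  assumes h: "\<And>i. i < d \<Longrightarrow> (\<Sum>j<d. \<bar>MH $$ (i, j) - M $$ (i, j)\<bar>) \<le> h i"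
    and pm: "0 < pm" "\<And>i. i < d \<Longrightarrow> pm \<le> ph i"
    and \<phi>: "0 \<le> \<phi>" "(\<Sum>i<d. ph i * (h i)\<^sup>2) \<le> pm * \<phi>\<^sup>2"
  shows "op_bound d (conj_mat d ph (err M)) \<phi>"
proof (rule op_bound_frobenius[OF \<phi>(1)])
  have "(\<Sum>j<d. (conj_mat d ph (err M) $$ (i, j))\<^sup>2) \<le> ph i * (h i)\<^sup>2 / pm" if i: "i < d" for i
  proof -
    let ?e = "\<lambda>j. MH $$ (i, j) - M $$ (i, j)"
    have "(conj_mat d ph (err M) $$ (i, j))\<^sup>2 \<le> ph i * (?e j)\<^sup>2 / pm" if j: "j < d" for j
    proof -
      have "(conj_mat d ph (err M) $$ (i, j))\<^sup>2 = ph i * (?e j)\<^sup>2 / ph j"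
        using i j ph_pos[of i] ph_pos[of j] by (simp add: conj_mat_index err_def power_divide power_mult_distrib less_imp_le)
      also have "\<dots> \<le> ph i * (?e j)\<^sup>2 / pm"
        using pm(1) pm(2)[OF j] ph_pos[of i] by (intro divide_left_mono mult_pos_pos) (auto intro: less_le_trans less_imp_le)
      finally show ?thesis .
    qed
    then have "(\<Sum>j<d. (conj_mat d ph (err M) $$ (i, j))\<^sup>2) \<le> (\<Sum>j<d. ph i * (?e j)\<^sup>2 / pm)"
      by (intro sum_mono) auto
    also have "\<dots> = ph i * (\<Sum>j<d. (?e j)\<^sup>2) / pm" by (simp add: sum_distrib_left sum_divide_distrib)
    also have "\<dots> \<le> ph i * (h i)\<^sup>2 / pm"
    proof (intro divide_right_mono mult_left_mono)
      have "(\<Sum>j<d. (?e j)\<^sup>2) = (L2_set ?e {..<d})\<^sup>2" by (simp add: L2_set_def sum_nonneg)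
      also have "\<dots> \<le> (h i)\<^sup>2"
        using L2_set_le_sum_abs[of ?e "{..<d}"] h[OF i] by (intro power_mono) auto
      finally show "(\<Sum>j<d. (?e j)\<^sup>2) \<le> (h i)\<^sup>2" .
    qed (use ph_pos[of i] pm in auto)
    finally show ?thesis .
  qed
  then have "(\<Sum>i<d. \<Sum>j<d. (conj_mat d ph (err M) $$ (i, j))\<^sup>2) \<le> (\<Sum>i<d. ph i * (h i)\<^sup>2 / pm)" by (intro sum_mono) auto
  also have "\<dots> = (\<Sum>i<d. ph i * (h i)\<^sup>2) / pm" by (simp add: sum_divide_distrib)
  also have "\<dots> \<le> \<phi>\<^sup>2" using \<phi>(2) pm(1) by (simp add: pos_divide_le_eq mult.commute)
  finally show "(\<Sum>i<d. \<Sum>j<d. (conj_mat d ph (err M) $$ (i, j))\<^sup>2) \<le> \<phi>\<^sup>2" .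
qed

text \<open>With a common bound \<open>H\<close> for all rows,
  \<open>ph i * (H / Nt i)^2 = (H / Z)^2 / ph i\<close>; the sum over the \<open>d\<close> rows
  produces the factor \<open>sqrt d\<close>.\<close>

lemma op_bound_flat_err:
  assumes M: "stochastic_mat d M" and S: "\<And>i. i < d \<Longrightarrow> (\<Sum>j<d. \<bar>dev M n x i j\<bar>) \<le> S" "0 \<le> S"
    and pm: "0 < pm" "\<And>i. i < d \<Longrightarrow> pm \<le> ph i"
  shows "op_bound d (conj_mat d ph (err M)) (sqrt (real d) * ((S + 2 * real d * \<alpha>) / Z) / pm)"
proof (rule op_bound_err[OF _ pm])
  let ?H = "S + 2 * real d * \<alpha>"
  have H: "0 \<le> ?H" using S(2) d\<alpha>_pos by simp
  show "(\<Sum>j<d. \<bar>MH $$ (i, j) - M $$ (i, j)\<bar>) \<le> ?H / Nt i" if "i < d" for i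
    using row_error[OF M that] S(1)[OF that] Nt_pos[of i]
    by (rule_tac order_trans[OF row_error[OF M that]]) (intro divide_right_mono, auto)
  show "0 \<le> sqrt (real d) * (?H / Z) / pm" using H Z_pos pm by simp
  have "ph i * (?H / Nt i)\<^sup>2 \<le> (?H / Z)\<^sup>2 / pm" if i: "i < d" for i
  proof -
    have "ph i * (?H / Nt i)\<^sup>2 = (?H / Z)\<^sup>2 / ph i"
      using Nt_pos[of i] Z_pos by (simp add: ph_eq power2_eq_square field_simps)
    also have "\<dots> \<le> (?H / Z)\<^sup>2 / pm" using pm(1) pm(2)[OF i] by (intro divide_left_mono mult_pos_pos) auto
    finally show ?thesis .
  qed
  then have "(\<Sum>i<d. ph i * (?H / Nt i)\<^sup>2) \<le> (\<Sum>i<d. (?H / Z)\<^sup>2 / pm)" by (intro sum_mono) auto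
  also have "\<dots> = pm * (sqrt (real d) * (?H / Z) / pm)\<^sup>2"
    using pm(1) by (simp add: power_divide power_mult_distrib) (simp add: power2_eq_square)
  finally show "(\<Sum>i<d. ph i * (?H / Nt i)\<^sup>2) \<le> pm * (sqrt (real d) * (?H / Z) / pm)\<^sup>2" .
qed

lemma conj_mat_close:
  assumes W: "weighted_chain d M p" and pm: "0 < pm" "\<And>i. i < d \<Longrightarrow> pm \<le> p i"
    and \<xi>: "\<And>i. i < d \<Longrightarrow> \<bar>ph i - p i\<bar> \<le> \<xi> * pm" "0 \<le> \<xi>" "\<xi> \<le> 1 / 4"
    and F: "op_bound d (conj_mat d ph (err M)) \<phi>"
  shows "op_bound d (Matrix.mat d d (\<lambda>(i, j). conj_mat d ph MH $$ (i, j) - conj_mat d p M $$ (i, j))) (9 / 4 * \<xi> + \<phi>)"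
proof (rule conj_mat_perturb[OF _ ph_pos _ \<xi>(2,3) weighted_chain.op_bound_conj_mat[OF W] _ F])
  show "0 < p i" if "i < d" for i using pm(2)[OF that] pm(1) by linarith
  show "\<bar>ph i - p i\<bar> \<le> \<xi> * p i" if "i < d" for i
    using \<xi>(1)[OF that] mult_left_mono[OF pm(2)[OF that] \<xi>(2)] by linarith
qed (auto simp: err_def)

lemma gram_gap_close:
  assumes W: "weighted_chain d M p"
    and C: "op_bound d (Matrix.mat d d (\<lambda>(i, j). conj_mat d ph MH $$ (i, j) - conj_mat d p M $$ (i, j))) e"
  shows "\<bar>gram_gap d ph MH - gram_gap d p M\<bar> \<le> 2 * e + e\<^sup>2"
  unfolding gram_gap_def
  by (rule spectral_gap_gram_perturb[OF _ _ d C _ weighted_chain.op_bound_conj_mat[OF W]]) auto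

end

section \<open>Error bounds for the skipped estimators\<close>

context conf
begin

text \<open>\<open>small\<close> is the informative case: \<open>k\<close> times the lower bound of
  \<open>gap_width_ge\<close> is below 2, that is, \<open>u < \<mu>m / 96\<close>. Since
  \<open>\<mu>m \<le> 1 / 2\<close>, \<open>g \<le> 1\<close> and
  \<open>\<Lambda> \<ge> 4 / 3\<close>, all errors are then small, and boundary terms are even of
  order \<open>\<eta>1 * \<eta>\<close>.\<close>

lemma base_facts:
  assumes g: "0 < g" "g \<le> 1" and k: "1 \<le> k"
    and small: "192 / g * \<Lambda> * \<eta> / \<mu>m * real k < 2"
  defines "u \<equiv> real k * \<Lambda> * \<eta> / g"
  shows "u < \<mu>m / 96" "real k * \<eta> \<le> 3 / 4 * u" "\<Lambda> * \<eta> / g \<le> u" "\<eta> \<le> real k * \<eta>" "real k * \<eta> \<le> 1 / 256"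
    "\<eta> / g \<le> 1 / 256" "1 / Z \<le> \<eta>1 * \<eta> * \<mu>m / 72" "real k / Z \<le> real k * \<eta> / 36864"
    "(real d)\<^sup>2 * \<alpha> \<le> \<eta>2 * Z / 2" "511 / 512 * Z \<le> real n" "1 \<le> n" "(real d)\<^sup>2 * \<alpha> = \<eta>2 * (real d * \<mu>m) * Z / 2"
proof -
  have "192 / g * \<Lambda> * \<eta> / \<mu>m * real k = 192 * u / \<mu>m" by (simp add: u_def)
  then show u: "u < \<mu>m / 96" using small \<mu>m_pos by (simp add: pos_divide_less_eq)
  have k1: "1 \<le> real k" using k by simp
  have L1: "4 / 3 \<le> \<Lambda> / g"
  proof -
    have "\<Lambda> / 1 \<le> \<Lambda> / g" using g \<Lambda>_ge by (intro divide_left_mono) auto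
    then have "\<Lambda> \<le> \<Lambda> / g" by simp
    then show ?thesis using \<Lambda>_ge by linarith
  qed
  have "real k * \<eta> * (4 / 3) \<le> real k * \<eta> * (\<Lambda> / g)" using L1 \<eta>_pos by (intro mult_left_mono) auto
  also have "\<dots> = u" by (simp add: u_def)
  finally show ku: "real k * \<eta> \<le> 3 / 4 * u" by simp
  have "1 * (\<Lambda> * \<eta> / g) \<le> real k * (\<Lambda> * \<eta> / g)" using k1 \<Lambda>_ge \<eta>_pos g by (intro mult_right_mono) auto
  then show lu: "\<Lambda> * \<eta> / g \<le> u" by (simp add: u_def)
  have "1 * \<eta> \<le> real k * \<eta>" using k1 \<eta>_pos by (intro mult_right_mono) auto
  then show ek: "\<eta> \<le> real k * \<eta>" by simp
  show k256: "real k * \<eta> \<le> 1 / 256" using ku u \<mu>m_half by linarith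
  define v where "v = \<eta> / g"
  have "v * (4 / 3) \<le> v * \<Lambda>" using \<Lambda>_ge \<eta>_pos g by (intro mult_left_mono) (auto simp: v_def)
  also have "\<dots> = \<Lambda> * \<eta> / g" by (simp add: v_def)
  finally have "v \<le> 1 / 256" using lu u \<mu>m_half by linarith
  then show "\<eta> / g \<le> 1 / 256" by (simp add: v_def)
  have "36 * 2 / Z \<le> 36 * real d / Z" using d Z_pos by (intro divide_right_mono) auto
  also have "\<dots> \<le> \<eta>1\<^sup>2 * \<mu>m" by (rule inverse_Z_le)
  also have "\<dots> \<le> \<eta>1 * \<eta> * \<mu>m"
    using \<eta>1_pos \<eta>2_pos \<mu>m_pos unfolding power2_eq_square by (intro mult_right_mono mult_left_mono) (auto simp: \<eta>_def)
  finally show Z1: "1 / Z \<le> \<eta>1 * \<eta> * \<mu>m / 72" by simp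
  have "\<eta>1 \<le> \<eta>" using \<eta>2_pos by (simp add: \<eta>_def)
  then have "\<eta>1 \<le> 1 / 256" using k256 ek by linarith
  then have "\<eta>1 * \<mu>m \<le> 1 / 256 * (1 / 2)"
    using \<eta>1_pos \<mu>m_pos \<mu>m_half by (intro mult_mono) auto
  then have "\<eta> * (\<eta>1 * \<mu>m) \<le> \<eta> * (1 / 512)" using \<eta>_pos by (intro mult_left_mono) auto
  moreover have "\<eta>1 * \<eta> * \<mu>m / 72 = \<eta> * (\<eta>1 * \<mu>m) / 72" by simp
  ultimately have "1 / Z \<le> \<eta> / 36864" using Z1 by linarith
  then have "real k * (1 / Z) \<le> real k * (\<eta> / 36864)" by (intro mult_left_mono) auto
  then show "real k / Z \<le> real k * \<eta> / 36864" by simp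
  show ad: "(real d)\<^sup>2 * \<alpha> = \<eta>2 * (real d * \<mu>m) * Z / 2"
    using D_pos Z_pos by (simp add: \<eta>2_def \<mu>m_def power2_eq_square)
  have "\<eta>2 * (real d * \<mu>m) * Z / 2 \<le> \<eta>2 * 1 * Z / 2"
    using d\<mu>m_le \<eta>2_pos Z_pos by (intro divide_right_mono mult_right_mono mult_left_mono) auto
  then show a2: "(real d)\<^sup>2 * \<alpha> \<le> \<eta>2 * Z / 2" using ad by simp
  have "\<eta>2 \<le> \<eta>" using \<eta>1_pos by (simp add: \<eta>_def)
  then have e2: "\<eta>2 \<le> 1 / 256" using k256 ek by linarith
  then have "\<eta>2 * Z / 2 \<le> 1 / 256 * Z / 2" using Z_pos by (intro divide_right_mono mult_right_mono) auto
  then show nZ: "511 / 512 * Z \<le> real n" using a2 by (simp add: Z_def)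
  have "0 < real n" using nZ Z_pos by linarith
  then show "1 \<le> n" by simp
qed

text \<open>Contraction of oscillations for \<open>MH\<close> presupposes a lower bound on its
  stationary distribution \<open>\<rho>\<close>, so it cannot be used here. Instead the density of
  \<open>\<nu>\<close> relative to \<open>\<rho>\<close> is estimated in the weighted norm, where
  the gap acts directly.\<close>

lemma base_rho_min:
  assumes g: "0 < g" "g = pseudo_gap MH" and small: "192 / g * \<Lambda> * \<eta> / \<mu>m < 2" and i: "i < d"
  shows "\<mu>m / 2 \<le> stationary MH i"
proof -
  define \<rho> where "\<rho> = stationary MH"
  have W: "weighted_chain d MH \<rho>" unfolding \<rho>_def by (rule ergodic_weighted_chain[OF MH_ergodic d])
  interpret W: weighted_chain d MH \<rho> by (rule W)
  have g1: "g \<le> 1" using W.pseudo_gap_bounds g \<rho>_def by simp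
  note bf = base_facts[OF g(1) g1, of 1]
  have bf1: "\<eta> / g \<le> 1 / 256" "1 / Z \<le> \<eta>1 * \<eta> * \<mu>m / 72" "1 \<le> n" "\<eta> \<le> 1 / 256"
    using bf small by auto
  obtain k where k: "1 \<le> k" "9 / 10 * g < gram_gap d \<rho> (MH ^\<^sub>m k) / real k"
    using W.pseudo_gap_approx[of "9 / 10 * g"] g \<rho>_def by auto
  define h where "h = (\<lambda>i. \<nu> i / \<rho> i - 1)"
  define G where "G = gram_gap d \<rho> (MH ^\<^sub>m k)"
  have kp: "0 < real k" using k by simp
  have G: "0 < G" "real k / G \<le> 10 / 9 / g"
  proof -
    have kG: "9 / 10 * g * real k < G" using k kp by (simp add: G_def pos_less_divide_eq)
    have "0 < 9 / 10 * g * real k" using g kp by simp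
    with kG show G0: "0 < G" by linarith
    have "9 / 10 * g * real k = 9 / 10 * (real k * g)" by simp
    then have "9 * (real k * g) \<le> 10 * G" using kG by linarith
    then show "real k / G \<le> 10 / 9 / g" using G0 \<open>0 < g\<close> by (simp add: divide_simps)
  qed
  have rh: "\<rho> i * h i = \<nu> i - \<rho> i" if "i < d" for i using W.pos[OF that] by (simp add: h_def right_diff_distrib)
  have ip_rh: "ip d \<nu> f = ip d \<rho> f + (\<Sum>i<d. \<rho> i * h i * f i)" for f
    by (simp add: ip_def rh left_diff_distrib sum_subtractf)
  have h0: "ip d \<rho> h = 0" using W.sum_p sum_\<nu> by (simp add: ip_def rh sum_subtractf)
  have "Max ((\<lambda>i. \<bar>h i\<bar>) ` {..<d}) \<in> (\<lambda>i. \<bar>h i\<bar>) ` {..<d}" using d by (intro Max_in) (auto simp: lessThan_empty_iff)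
  then obtain i1 where i1: "i1 < d" "Max ((\<lambda>i. \<bar>h i\<bar>) ` {..<d}) = \<bar>h i1\<bar>" by auto
  define H where "H = \<bar>h i1\<bar>"
  have hH: "\<bar>h i\<bar> \<le> H" if "i < d" for i
    unfolding H_def i1(2)[symmetric] using that by (intro Max_ge) auto
  have osc: "osc_le d h (2 * H)" unfolding osc_le_def
  proof (intro allI impI)
    fix i j assume "i < d" "j < d"
    then show "h i - h j \<le> 2 * H" using hH[of i] hH[of j] by linarith
  qed
  have step: "\<bar>ip d \<nu> f - ip d \<nu> (mv d MH f)\<bar> \<le> 1 / Z * w" if f: "osc_le d f w" for f w
  proof -
    have "ip d \<nu> (mv d MH f) - ip d \<nu> f = (mv d MH f (x n) - f (x 1)) / Z"
    proof -
      \<comment> \<open>Relative to \<open>MH\<close> itself, deviations and smoothing cancel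
        exactly. Only the ends of the trajectory remain, so the defect per step is
        \<open>1 / Z\<close>.\<close>
      have "(\<Sum>j<d. (\<Sum>i<d. dev MH n x i j) * f j) = real d * \<alpha> * (\<Sum>i<d. mv d MH f i - f i)"
      proof -
        have e: "dev MH n x i j = real d * \<alpha> * MH $$ (i, j) - \<alpha>" if "i < d" "j < d" for i j
          using Nt_pos[of i] that by (simp add: dev_eq MH_index field_simps) (simp add: Nt_def algebra_simps)
        have "(\<Sum>j<d. (\<Sum>i<d. dev MH n x i j) * f j) = (\<Sum>j<d. \<Sum>i<d. real d * \<alpha> * (MH $$ (i, j) * f j) - \<alpha> * f j)"
          unfolding sum_distrib_right by (intro sum.cong refl) (simp add: e algebra_simps)
        also have "\<dots> = real d * \<alpha> * (\<Sum>i<d. mv d MH f i) - (\<Sum>j<d. real d * (\<alpha> * f j))"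
          unfolding sum_subtractf mv_def sum_distrib_left by (subst sum.swap) (simp add: sum_distrib_left)
        also have "\<dots> = real d * \<alpha> * (\<Sum>i<d. mv d MH f i - f i)"
          by (simp add: sum_subtractf sum_distrib_left right_diff_distrib mult.assoc)
        finally show ?thesis .
      qed
      then show ?thesis by (simp add: \<nu>_mv[OF bf1(3)])
    qed
    moreover have "\<bar>mv d MH f (x n) - f (x 1)\<bar> \<le> w"
      using range bf1(3) by (intro mv_between[OF MH_stoch _ _ f]) auto
    ultimately show ?thesis using Z_pos by (simp add: abs_minus_commute[of "ip d \<nu> f"] divide_right_mono)
  qed
  have tel: "\<bar>ip d \<nu> h - ip d \<nu> (mv d (MH ^\<^sub>m k) h)\<bar> \<le> real k * (1 / Z) * (2 * H)"
    by (rule ip_telescope[OF MH_stoch step osc])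
  let ?A = "mv d (MH ^\<^sub>m k) h"
  have hA: "ip d \<rho> ?A = 0" using weighted_chain.centered_mv[OF W.weighted_chain_pow h0] .
  have con: "wsq d \<rho> ?A \<le> (1 - G) * wsq d \<rho> h"
    unfolding G_def by (rule weighted_chain.wsq_contract[OF W.weighted_chain_pow h0])
  have "(\<Sum>i<d. \<rho> i * h i * ?A i) \<le> (\<Sum>i<d. (\<rho> i * (h i)\<^sup>2 + \<rho> i * (?A i)\<^sup>2) / 2)"
  proof (intro sum_mono)
    fix i assume "i \<in> {..<d}"
    then have "0 \<le> \<rho> i * (h i - ?A i)\<^sup>2" using W.pos[of i] by (intro mult_nonneg_nonneg) auto
    then show "\<rho> i * h i * ?A i \<le> (\<rho> i * (h i)\<^sup>2 + \<rho> i * (?A i)\<^sup>2) / 2"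
      by (simp add: power2_diff algebra_simps)
  qed
  also have "\<dots> = (wsq d \<rho> h + wsq d \<rho> ?A) / 2" by (simp add: wsq_def sum.distrib sum_divide_distrib[symmetric])
  finally have cross: "(\<Sum>i<d. \<rho> i * h i * ?A i) \<le> (wsq d \<rho> h + wsq d \<rho> ?A) / 2" .
  have self: "(\<Sum>i<d. \<rho> i * h i * h i) = wsq d \<rho> h" by (simp add: wsq_def power2_eq_square mult.assoc)
  \<comment> \<open>\<open>\<nu> - \<rho>\<close> has density \<open>h\<close> and is tested on
    \<open>h\<close> itself: the gap makes the pairing lose at least \<open>G / 2\<close> of the
    energy in \<open>k\<close> steps, and the telescoped defect bounds the loss.\<close>
  have "G / 2 * wsq d \<rho> h \<le> real k * (1 / Z) * (2 * H)"
  proof -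
    have "ip d \<nu> h = wsq d \<rho> h" "ip d \<nu> ?A = (\<Sum>i<d. \<rho> i * h i * ?A i)"
      unfolding ip_rh[of h] ip_rh[of ?A] h0 hA self by simp_all
    moreover have "wsq d \<rho> ?A \<le> wsq d \<rho> h - G * wsq d \<rho> h" using con by (simp add: algebra_simps)
    moreover have "Gw / 2 \<le> R" if "a = w" "b = c" "v \<le> w - Gw" "\<bar>a - b\<bar> \<le> R" "c \<le> (w + v) / 2" for a b c w v R Gw :: real
      using that by (auto simp: abs_le_iff field_simps)
    ultimately have "G * wsq d \<rho> h / 2 \<le> real k * (1 / Z) * (2 * H)" using tel cross by blast
    then show ?thesis by simp
  qed
  moreover have "\<rho> i1 * H\<^sup>2 \<le> wsq d \<rho> h"
  proof -
    have "\<rho> i1 * (h i1)\<^sup>2 \<le> wsq d \<rho> h" unfolding wsq_def using i1(1) W.pos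
      by (intro member_le_sum) (auto simp: less_imp_le)
    then show ?thesis by (simp add: H_def)
  qed
  then have "G / 2 * (\<rho> i1 * H\<^sup>2) \<le> G / 2 * wsq d \<rho> h" using G by (intro mult_left_mono) auto
  ultimately have HH: "G / 2 * (\<rho> i1 * H\<^sup>2) \<le> real k * (1 / Z) * (2 * H)" by linarith
  have "Min (\<rho> ` {..<d}) \<in> \<rho> ` {..<d}" using d by (intro Min_in) (auto simp: lessThan_empty_iff)
  then obtain i0 where i0: "i0 < d" "Min (\<rho> ` {..<d}) = \<rho> i0" by auto
  have r0: "\<rho> i0 \<le> \<rho> j" if "j < d" for j unfolding i0(2)[symmetric] using that by (intro Min_le) auto
  \<comment> \<open>The energy is at least \<open>\<rho> i1 * H^2\<close>. Cancelling one
    \<open>H\<close> leaves a bound on \<open>\<rho> i1 * H\<close>, which passes to the minimum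
    \<open>\<rho> i0 \<le> \<rho> i1\<close>.\<close>
  have key: "\<rho> i0 * H \<le> 4 * (real k / G) * (1 / Z)"
  proof (cases "H = 0")
    case False
    then have Hp: "0 < H" by (simp add: H_def)
    have "G / 2 * (\<rho> i1 * H) * H \<le> (2 * real k * (1 / Z)) * H" using HH by (simp add: power2_eq_square mult_ac)
    then have "G / 2 * (\<rho> i1 * H) \<le> 2 * real k * (1 / Z)" using Hp by (rule mult_right_le_imp_le)
    then have "G * (\<rho> i1 * H) \<le> 4 * real k * (1 / Z)" by (simp add: mult.assoc)
    then have "\<rho> i1 * H \<le> 4 * real k * (1 / Z) / G" using G(1) by (simp only: pos_le_divide_eq mult.commute)
    then have "\<rho> i1 * H \<le> 4 * (real k / G) * (1 / Z)" by (simp add: mult_ac)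
    moreover have "\<rho> i0 * H \<le> \<rho> i1 * H" using r0[OF i1(1)] Hp by (intro mult_right_mono) auto
    ultimately show ?thesis by linarith
  qed (use G Z_pos in simp)
  have "\<mu>m \<le> \<nu> i0" using \<mu>m_le[OF i0(1)] ph_le_\<nu>[OF bf1(3)] order_trans by blast
  also have "\<nu> i0 \<le> \<rho> i0 + \<rho> i0 * H"
  proof -
    have "\<rho> i0 * h i0 \<le> \<rho> i0 * H" using hH[OF i0(1)] W.pos[OF i0(1)] by (intro mult_left_mono) auto
    then show ?thesis using rh[OF i0(1)] by linarith
  qed
  also have "\<dots> \<le> \<rho> i0 + \<mu>m / 2"
  proof -
    have "4 * (real k / G) * (1 / Z) \<le> 4 * (10 / 9 / g) * (\<eta>1 * \<eta> * \<mu>m / 72)"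
      using G bf1(2) Z_pos g by (intro mult_mono) auto
    also have "\<dots> = (40 / 648) * (\<eta> / g) * \<eta>1 * \<mu>m" by simp
    also have "\<dots> \<le> (40 / 648) * (1 / 256) * 1 * \<mu>m"
      using bf1(1,4) \<eta>1_pos \<eta>2_pos \<mu>m_pos g by (intro mult_mono) (auto simp: \<eta>_def)
    also have "\<dots> \<le> \<mu>m / 2" using \<mu>m_pos by simp
    finally show ?thesis using key by linarith
  qed
  finally show ?thesis using r0[OF i] by (simp add: \<rho>_def)
qed

text \<open>The known pseudo-spectral gap of \<open>M_hat\<close> makes \<open>M_hat\<close> contract oscillations after
  \<open>4 * \<Lambda> / g\<close> steps, and closeness of the rows transfers the contraction to \<open>M\<close>. A contraction time
  of \<open>M\<close> then serves all its powers, so no gap of a skipped estimate is needed.\<close>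

lemma base_contraction:
  assumes M: "stochastic_mat d M" and flat: "flat_ok d M n (4 * \<tau> * sqrt (real d)) x"
    and g: "0 < g" "g = pseudo_gap MH" and small: "192 / g * \<Lambda> * \<eta> / \<mu>m < 2"
  shows "\<exists>T. contr d (M ^\<^sub>m T) (3 / 4) \<and> real T \<le> 4 * \<Lambda> / g"
proof -
  define \<rho> where "\<rho> = stationary MH"
  have W: "weighted_chain d MH \<rho>" unfolding \<rho>_def by (rule ergodic_weighted_chain[OF MH_ergodic d])
  interpret W: weighted_chain d MH \<rho> by (rule W)
  have g1: "g \<le> 1" using W.pseudo_gap_bounds g \<rho>_def by simp
  have bf: "\<Lambda> * \<eta> / g < \<mu>m / 96" using base_facts(1)[OF g(1) g1, of 1] small by simp
  obtain k where k: "1 \<le> k" "9 / 10 * g < gram_gap d \<rho> (MH ^\<^sub>m k) / real k"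
    using W.pseudo_gap_approx[of "9 / 10 * g"] g \<rho>_def by auto
  define G where "G = gram_gap d \<rho> (MH ^\<^sub>m k)"
  have kp: "0 < real k" using k by simp
  have kG: "9 / 10 * g * real k < G" using k kp by (simp add: G_def pos_less_divide_eq)
  have "0 < 9 / 10 * g * real k" using g kp by simp
  then have G: "0 < G" using kG by linarith
  have "9 / 10 * g * real k = 9 / 10 * (real k * g)" by simp
    then have "9 * (real k * g) \<le> 10 * G" using kG by linarith
  then have kdG: "real k / G \<le> 10 / 9 / g" using G \<open>0 < g\<close> by (simp add: divide_simps)
  have G1: "G \<le> 1" unfolding G_def by (rule weighted_chain.gram_gap_bounds[OF W.weighted_chain_pow])
  \<comment> \<open>Chosen for \<open>(1 - G) ^ j \<le> exp (- 2 * \<Lambda>) = \<mu>m / 8\<close>,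
    which is exactly the requirement when stationary probabilities are at least
    \<open>\<mu>m / 2\<close>.\<close>
  define j where "j = nat \<lceil>2 * \<Lambda> / G\<rceil>"
  have j: "2 * \<Lambda> \<le> G * real j" "real j \<le> 2 * \<Lambda> / G + 1"
  proof -
    have p: "0 \<le> 2 * \<Lambda> / G" using \<Lambda>_ge G by simp
    have rj: "real j = real_of_int \<lceil>2 * \<Lambda> / G\<rceil>" using p by (simp add: j_def)
    have "2 * \<Lambda> / G \<le> real j" unfolding rj by (rule le_of_int_ceiling)
    then show "2 * \<Lambda> \<le> G * real j" using G by (simp add: pos_divide_le_eq mult.commute)
    show "real j \<le> 2 * \<Lambda> / G + 1" unfolding rj by (rule of_int_ceiling_le_add_one)
  qed
  have "contr d ((MH ^\<^sub>m k) ^\<^sub>m j) (1 / 2)"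
  proof (rule weighted_chain.contr_of_wsq_contract[OF W.weighted_chain_pow])
    show "wsq d \<rho> (mv d (MH ^\<^sub>m k) f) \<le> (1 - G) * wsq d \<rho> f" if "ip d \<rho> f = 0" for f
      unfolding G_def by (rule weighted_chain.wsq_contract[OF W.weighted_chain_pow that])
    show "0 \<le> 1 - G" using G1 by simp
    show "\<mu>m / 2 \<le> \<rho> i" if "i < d" for i unfolding \<rho>_def by (rule base_rho_min[OF g small that])
    show "0 < \<mu>m / 2" using \<mu>m_pos by simp
    have "(1 - G) ^ j \<le> exp (- G) ^ j" using G1 exp_ge_add_one_self[of "- G"] by (intro power_mono) auto
    also have "\<dots> = exp (- (G * real j))" by (simp add: exp_of_nat_mult[symmetric] mult.commute)
    also have "\<dots> \<le> exp (- (2 * \<Lambda>))" using j by simp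
    also have "\<dots> = \<mu>m / 8" by (rule \<Lambda>_exp)
    finally show "4 * (1 - G) ^ j \<le> \<mu>m / 2" by simp
  qed
  then have c: "contr d (MH ^\<^sub>m (k * j)) (1 / 2)" by (simp add: pow_mat_mult[OF MH_carrier])
  have T: "real (k * j) \<le> 4 * \<Lambda> / g"
  proof -
    have "real (k * j) \<le> real k * (2 * \<Lambda> / G + 1)" unfolding of_nat_mult using j by (intro mult_left_mono) auto
    also have "\<dots> = (real k / G) * (2 * \<Lambda>) + (real k / G) * G" using G by (simp add: field_simps)
    also have "\<dots> \<le> (10 / 9 / g) * (2 * \<Lambda>) + (10 / 9 / g) * 1"
      using kdG G G1 g \<Lambda>_ge by (intro add_mono mult_mono) auto
    also have "\<dots> = (20 / 9 * \<Lambda> + 10 / 9) / g" by (simp add: add_divide_distrib)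
    also have "\<dots> \<le> 4 * \<Lambda> / g" using g \<Lambda>_ge by (intro divide_right_mono) auto
    finally show ?thesis .
  qed
  have h: "(\<Sum>j<d. \<bar>MH $$ (i, j) - M $$ (i, j)\<bar>) \<le> \<eta> / \<mu>m" if i: "i < d" for i
  proof -
    have "(\<Sum>j<d. \<bar>MH $$ (i, j) - M $$ (i, j)\<bar>) \<le> ((\<Sum>j<d. \<bar>dev M n x i j\<bar>) + 2 * real d * \<alpha>) / Nt i"
      by (rule row_error[OF M i])
    also have "\<dots> \<le> (4 * \<tau> * sqrt (real d) * sqrt (real n) + 2 * real d * \<alpha>) / Nt i"
      using flat i Nt_pos[of i] by (intro divide_right_mono add_right_mono) (auto simp: flat_ok_def)
    also have "\<dots> \<le> (4 * \<tau> * sqrt (real d) * sqrt (real n) + 2 * real d * \<alpha>) / D"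
      using D_le[OF i] D_pos \<tau>_ge \<alpha> by (intro divide_left_mono) auto
    also have "\<dots> \<le> (4 * \<tau> * sqrt (real d) * sqrt Z + 2 * real d * \<alpha>) / D"
      using D_pos \<tau>_ge \<alpha> by (intro divide_right_mono add_right_mono mult_left_mono) (auto simp: Z_def)
    also have "\<dots> = \<eta>1 * sqrt (Z / D) + \<eta>2"
    proof -
      have "\<eta>1 * sqrt (Z / D) = 4 * \<tau> * sqrt (real d) * sqrt Z / (sqrt D * sqrt D)"
        by (simp add: \<eta>1_def real_sqrt_divide del: real_sqrt_mult_self)
      then show ?thesis using D_pos by (simp add: \<eta>2_def add_divide_distrib mult_ac)
    qed
    also have "\<dots> \<le> \<eta>1 * (1 / \<mu>m) + \<eta>2 * (1 / \<mu>m)"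
    proof (intro add_mono mult_left_mono)
      have r: "1 \<le> 1 / \<mu>m" using \<mu>m_pos \<mu>m_half by simp
      have "sqrt (Z / D) \<le> sqrt ((Z / D)\<^sup>2)"
      proof (rule real_sqrt_le_mono)
        have "Z / D * 1 \<le> Z / D * (Z / D)" using r Z_pos D_pos by (intro mult_left_mono) (auto simp: \<mu>m_def)
        then show "Z / D \<le> (Z / D)\<^sup>2" by (simp add: power2_eq_square)
      qed
      then show "sqrt (Z / D) \<le> 1 / \<mu>m" using Z_pos D_pos by (simp add: \<mu>m_def)
      show "\<eta>2 \<le> \<eta>2 * (1 / \<mu>m)" using mult_left_mono[OF r, of \<eta>2] \<eta>2_pos by simp
    qed (use \<eta>1_pos in auto)
    also have "\<dots> = \<eta> / \<mu>m" by (simp add: \<eta>_def add_divide_distrib)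
    finally show ?thesis .
  qed
  have "contr d (M ^\<^sub>m (k * j)) (1 / 2 + real (k * j) * (\<eta> / \<mu>m))"
    by (rule contr_perturb[OF MH_stoch M h c])
  then have "contr d (M ^\<^sub>m (k * j)) (3 / 4)"
  proof (rule contr_mono)
    have "real (k * j) * (\<eta> / \<mu>m) \<le> (4 * \<Lambda> / g) * (\<eta> / \<mu>m)" using T \<eta>_pos \<mu>m_pos by (intro mult_right_mono) auto
    also have "\<dots> = 4 * (\<Lambda> * \<eta> / g) / \<mu>m" by simp
    also have "\<dots> \<le> 4 * (\<mu>m / 96) / \<mu>m" 
    proof (rule divide_right_mono)
      show "4 * (\<Lambda> * \<eta> / g) \<le> 4 * (\<mu>m / 96)" using bf by linarith
    qed (use \<mu>m_pos in simp)
    also have "\<dots> \<le> 1 / 4" using \<mu>m_pos by simp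
    finally show "1 / 2 + real (k * j) * (\<eta> / \<mu>m) \<le> 3 / 4" by simp
  qed
  with T show ?thesis by blast
qed

end

context conf
begin

text \<open>The length \<open>nk\<close> is at least \<open>9 / 10 * Z / k\<close>, so the
  deviations at skip \<open>k\<close> are of relative size \<open>k * \<eta>1\<close>: one factor
  \<open>sqrt k\<close> comes from the shorter trajectory, the other from the threshold in
  \<open>flat_ok\<close>.\<close>

lemma skipped_aux:
  assumes g: "0 < g" "g \<le> 1" and k: "1 \<le> k"
    and small: "192 / g * \<Lambda> * \<eta> / \<mu>m * real k < 2"
    and y: "traj d nk y \<alpha>" and nk: "real n / real k - 2 \<le> real nk"
  defines "Zk \<equiv> traj.Z d nk \<alpha>" and "S \<equiv> 4 * \<tau> * sqrt (real k * real d) * sqrt (real nk)"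
  shows "1 \<le> nk" "0 \<le> S" "S / Zk \<le> 3 / 4 * (real k * \<eta>1)" "sqrt (real d) * (S / Zk) \<le> 11 / 10 * (real k * \<eta>1)"
    "(real d)\<^sup>2 * \<alpha> / Zk \<le> 5 / 9 * (real k * \<eta>2)" "1 / Zk \<le> real k * \<eta> / 30000"
proof -
  interpret y: traj d nk y \<alpha> by (rule y)
  note bf = base_facts[OF g k small]
  have kp: "0 < real k" using k by simp
  have q: "real k / Z \<le> 1 / 9437184" using bf(8,5) by linarith
  then have "real k \<le> Z / 9437184" using Z_pos by (simp add: pos_divide_le_eq)
  then have "1 \<le> Z / real k / 9437184" using kp by (simp add: pos_le_divide_eq)
  moreover have "511 / 512 * (Z / real k) \<le> real n / real k" using divide_right_mono[OF bf(10), of "real k"] kp by simp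
  moreover have "9 / 10 * z \<le> v" if "1 \<le> z / 9437184" "511 / 512 * z \<le> w" "w - 2 \<le> v" for z w v :: real
    using that by linarith
  ultimately have nk9: "9 / 10 * (Z / real k) \<le> real nk" using nk by blast
  have Zk0: "0 < Z / real k" using Z_pos kp by simp
  have nk0: "0 < real nk" using nk9 Zk0 by linarith
  then show "1 \<le> nk" by simp
  have Zk: "real nk \<le> Zk" unfolding Zk_def y.Z_def using \<alpha> by simp
  have Zkp: "0 < Zk" using Zk nk0 by linarith
  have inv: "1 / Zk \<le> 10 / 9 * (real k / Z)"
  proof -
    have "1 / Zk \<le> 1 / real nk" using Zk nk0 by (intro divide_left_mono) auto
    also have "\<dots> \<le> 1 / (9 / 10 * (Z / real k))" using nk9 Zk0 nk0 by (intro divide_left_mono mult_pos_pos) auto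
    also have "\<dots> = 10 / 9 * (real k / Z)" using kp Z_pos by simp
    finally show ?thesis .
  qed
  show S0: "0 \<le> S" using \<tau>_ge by (simp add: S_def)
  have sq: "(S / Zk)\<^sup>2 \<le> 10 / 9 * (real k * \<eta>1)\<^sup>2 * \<mu>m"
  proof -
    have S2: "S\<^sup>2 = 16 * \<tau>\<^sup>2 * (real k * real d) * real nk" by (simp add: S_def power_mult_distrib)
    have "(S / Zk)\<^sup>2 = S\<^sup>2 / (Zk * Zk)" by (simp add: power_divide power2_eq_square)
    also have "\<dots> \<le> S\<^sup>2 / (Zk * real nk)" using Zk nk0 Zkp by (intro divide_left_mono mult_left_mono mult_pos_pos) auto
    also have "\<dots> = 16 * \<tau>\<^sup>2 * (real k * real d) * (1 / Zk)" using nk0 by (simp add: S2)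
    also have "\<dots> \<le> 16 * \<tau>\<^sup>2 * (real k * real d) * (10 / 9 * (real k / Z))" using inv by (intro mult_left_mono) auto
    also have "\<dots> = 10 / 9 * (real k * \<eta>1)\<^sup>2 * \<mu>m"
    proof -
      have "\<eta>1\<^sup>2 * \<mu>m = 16 * \<tau>\<^sup>2 * real d / Z" using D_pos by (simp add: \<eta>1_def power_mult_distrib \<mu>m_def)
      then have "10 / 9 * (real k)\<^sup>2 * (\<eta>1\<^sup>2 * \<mu>m) = 10 / 9 * (real k)\<^sup>2 * (16 * \<tau>\<^sup>2 * real d / Z)" by simp
      then show ?thesis by (simp add: power_mult_distrib power2_eq_square mult_ac)
    qed
    finally show ?thesis .
  qed
  show "S / Zk \<le> 3 / 4 * (real k * \<eta>1)"
  proof (rule power2_le_imp_le)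
    have "10 / 9 * (real k * \<eta>1)\<^sup>2 * \<mu>m \<le> 10 / 9 * (real k * \<eta>1)\<^sup>2 * (1 / 2)" using \<mu>m_half by (intro mult_left_mono) auto
    also have "\<dots> \<le> (3 / 4 * (real k * \<eta>1))\<^sup>2" unfolding power_mult_distrib[of "3 / 4"] by (simp add: power2_eq_square)
    finally show "(S / Zk)\<^sup>2 \<le> (3 / 4 * (real k * \<eta>1))\<^sup>2" using sq by linarith
  qed (use \<eta>1_pos in simp)
  show "sqrt (real d) * (S / Zk) \<le> 11 / 10 * (real k * \<eta>1)"
  proof (rule power2_le_imp_le)
    have "(sqrt (real d) * (S / Zk))\<^sup>2 = real d * (S / Zk)\<^sup>2"
      by (simp only: power_mult_distrib real_sqrt_pow2 of_nat_0_le_iff)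
    also have "\<dots> \<le> real d * (10 / 9 * (real k * \<eta>1)\<^sup>2 * \<mu>m)" using sq by (intro mult_left_mono) auto
    also have "\<dots> = 10 / 9 * (real k * \<eta>1)\<^sup>2 * (real d * \<mu>m)" by simp
    also have "\<dots> \<le> 10 / 9 * (real k * \<eta>1)\<^sup>2 * 1" using d\<mu>m_le by (intro mult_left_mono) auto
    also have "\<dots> \<le> (11 / 10 * (real k * \<eta>1))\<^sup>2" unfolding power_mult_distrib[of "11 / 10"] by (simp add: power2_eq_square)
    finally show "(sqrt (real d) * (S / Zk))\<^sup>2 \<le> (11 / 10 * (real k * \<eta>1))\<^sup>2" .
  qed (use \<eta>1_pos in simp)
  have "(real d)\<^sup>2 * \<alpha> / Zk = (real d)\<^sup>2 * \<alpha> * (1 / Zk)" by simp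
  also have "\<dots> \<le> \<eta>2 * Z / 2 * (10 / 9 * (real k / Z))"
    using bf(9) inv Zkp \<eta>2_pos Z_pos \<alpha> by (intro mult_mono) auto
  also have "\<dots> = 5 / 9 * (real k * \<eta>2)" using Z_pos by simp
  finally show "(real d)\<^sup>2 * \<alpha> / Zk \<le> 5 / 9 * (real k * \<eta>2)" .
  show "1 / Zk \<le> real k * \<eta> / 30000" using inv bf(8) \<eta>_pos kp
    mult_pos_pos[OF kp \<eta>_pos] by linarith
qed

text \<open>\<open>M^k\<close> contracts after \<open>T div k + 1\<close> of its steps, which are at
  most \<open>T + k\<close> steps of \<open>M\<close>. In units of
  \<open>k * \<Lambda> * \<eta> / g\<close> the errors add up to
  \<open>56 / 25 * (4 + 3 / 4)\<close> plus boundary terms, which is below 11.\<close>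

lemma skipped_ph_close:
  assumes g: "0 < g" "g \<le> 1" and k: "1 \<le> k"
    and small: "192 / g * \<Lambda> * \<eta> / \<mu>m * real k < 2"
    and M: "stochastic_mat d M" and p: "stat_dist d M p"
    and c: "contr d (M ^\<^sub>m T) (3 / 4)" "real T \<le> 4 * \<Lambda> / g"
    and y: "traj d nk y \<alpha>" and nk: "real n / real k - 2 \<le> real nk"
    and flat: "flat_ok d (M ^\<^sub>m k) nk (4 * \<tau> * sqrt (real k * real d)) y" and i: "i < d"
  shows "\<bar>traj.ph d nk y \<alpha> i - p i\<bar> \<le> 11 * (real k * \<Lambda> * \<eta> / g)"
proof -
  interpret y: traj d nk y \<alpha> by (rule y)
  note bf = base_facts[OF g k small]
  note sa = skipped_aux[OF g k small y nk]
  let ?S = "4 * \<tau> * sqrt (real k * real d) * sqrt (real nk)"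
  define t where "t = T div k + 1"
  have kt: "T \<le> k * t" "t * k \<le> T + k"
  proof -
    have "T = k * (T div k) + T mod k" by simp
    moreover have "T mod k < k" using k by simp
    ultimately show "T \<le> k * t" unfolding t_def by (metis add.commute add_le_cancel_left less_imp_le_nat mult.right_neutral distrib_left)
    show "t * k \<le> T + k" unfolding t_def by (simp add: add.commute)
  qed
  have Mc: "M \<in> carrier_mat d d" by (rule stochastic_matD(1)[OF M])
  have "contr d (M ^\<^sub>m (k * t)) (3 / 4)" by (rule contr_pow_mono[OF M c(1) kt(1)])
  then have ct: "contr d ((M ^\<^sub>m k) ^\<^sub>m t) (3 / 4)" by (simp add: pow_mat_mult[OF Mc])
  have S: "(\<Sum>j<d. \<bar>\<Sum>i<d. dev (M ^\<^sub>m k) nk y i j\<bar>) \<le> ?S" using flat by (simp add: flat_ok_def)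
  have "(?S / 2 + 1 + (real d)\<^sup>2 * \<alpha>) / y.Z \<le> 14 / 25 * (real k * \<eta>)"
  proof -
    have "(?S / 2 + 1 + (real d)\<^sup>2 * \<alpha>) / y.Z = (?S / y.Z) / 2 + 1 / y.Z + (real d)\<^sup>2 * \<alpha> / y.Z"
      by (simp add: add_divide_distrib)
    moreover have "real k * \<eta> = real k * \<eta>1 + real k * \<eta>2" by (simp add: \<eta>_def algebra_simps)
    moreover have "0 \<le> real k * \<eta>1" "0 \<le> real k * \<eta>2" using \<eta>1_pos \<eta>2_pos by auto
    moreover have "e \<le> 14 / 25 * k" if "e = a / 2 + b + c" "k = k1 + k2" "0 \<le> k1" "0 \<le> k2"
      "a \<le> 3 / 4 * k1" "c \<le> 5 / 9 * k2" "b \<le> k / 30000" for a b c e k k1 k2 :: real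
      using that by linarith
    ultimately show ?thesis using sa(3,5,6) by blast
  qed
  then have "4 * real t * ((?S / 2 + 1 + (real d)\<^sup>2 * \<alpha>) / y.Z) \<le> 4 * real t * (14 / 25 * (real k * \<eta>))"
    by (intro mult_left_mono) auto
  also have "\<dots> = 56 / 25 * (real (t * k) * \<eta>)" by simp
  also have "\<dots> \<le> 56 / 25 * ((real T + real k) * \<eta>)"
  proof (intro mult_left_mono mult_right_mono)
    have "real (t * k) \<le> real (T + k)" using kt(2) by (simp only: of_nat_le_iff)
    then show "real (t * k) \<le> real T + real k" by simp
  qed (use \<eta>_pos in auto)
  also have "\<dots> = 56 / 25 * (real T * \<eta>) + 56 / 25 * (real k * \<eta>)" by (simp add: algebra_simps)
  also have "\<dots> \<le> 56 / 25 * (4 * (\<Lambda> * \<eta> / g)) + 56 / 25 * (real k * \<eta>)"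
  proof -
    have "real T * \<eta> \<le> 4 * \<Lambda> / g * \<eta>" using c(2) \<eta>_pos by (intro mult_right_mono) auto
    then show ?thesis by simp
  qed
  finally have "4 * real t * ((?S / 2 + 1 + (real d)\<^sup>2 * \<alpha>) / y.Z) \<le> 56 / 25 * (4 * (\<Lambda> * \<eta> / g)) + 56 / 25 * (real k * \<eta>)" .
  moreover have "0 \<le> real k * \<eta>" using \<eta>_pos by simp
  moreover have "\<bar>y.ph i - p i\<bar> \<le> 4 * real t * ((?S / 2 + 1 + (real d)\<^sup>2 * \<alpha>) / y.Z) + 1 / y.Z"
    by (rule y.ph_near_stationary[OF sa(1) stochastic_mat_pow[OF M] stat_dist_pow[OF p Mc] ct S i])
  moreover have "z \<le> 11 * v" if "a \<le> 56 / 25 * (4 * L) + 56 / 25 * K" "0 \<le> K" "z \<le> a + y" "K \<le> 3 / 4 * v"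
    "L \<le> v" "y \<le> K / 30000" for a L K z y v :: real
    using that by linarith
  ultimately show ?thesis using bf(2,3) sa(6) by blast
qed

text \<open>Relative error \<open>13 * u / \<mu>m\<close> in the weights and
  \<open>2 * u / \<mu>m\<close> from the rows give a perturbation of norm
  \<open>e = 125 / 4 * (u / \<mu>m)\<close>. As \<open>u / \<mu>m \<le> 1 / 96\<close>, the bound
  \<open>2 * e + e^2\<close> stays below \<open>192 * (u / \<mu>m)\<close>.\<close>

lemma skipped_gap_close:
  assumes g: "0 < g" "g \<le> 1" and k: "1 \<le> k"
    and small: "192 / g * \<Lambda> * \<eta> / \<mu>m * real k < 2"
    and W: "weighted_chain d M p"
    and c: "contr d (M ^\<^sub>m T) (3 / 4)" "real T \<le> 4 * \<Lambda> / g"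
    and base: "flat_ok d M n (4 * \<tau> * sqrt (real d)) x"
    and y: "traj d nk y \<alpha>" and nk: "real n / real k - 2 \<le> real nk"
    and flat: "flat_ok d (M ^\<^sub>m k) nk (4 * \<tau> * sqrt (real k * real d)) y"
  shows "\<bar>gram_gap d (traj.ph d nk y \<alpha>) (traj.MH d nk y \<alpha>) - gram_gap d p (M ^\<^sub>m k)\<bar>
    \<le> real k * (192 / g * \<Lambda> * \<eta> / \<mu>m)"
proof -
  interpret y: traj d nk y \<alpha> by (rule y)
  interpret W: weighted_chain d M p by (rule W)
  note M = W.stoch and p = W.stat
  define u where "u = real k * \<Lambda> * \<eta> / g"
  note bf = base_facts[OF g k small, folded u_def]
  note sa = skipped_aux[OF g k small y nk]
  note cl = skipped_ph_close[OF g k small M p c y nk flat, folded u_def]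
  have Mc: "M \<in> carrier_mat d d" by (rule stochastic_matD(1)[OF M])
  have u0: "0 \<le> u" using \<Lambda>_ge \<eta>_pos g by (simp add: u_def)
  \<comment> \<open>The lower bound on \<open>p\<close> comes from skip 1, where all frequencies are
    at least \<open>\<mu>m\<close>. It is then transferred to the frequencies at skip
    \<open>k\<close>, for which no bound is available from the start.\<close>
  have pp: "7 / 8 * \<mu>m \<le> p i" if i: "i < d" for i
  proof -
    have "0 \<le> 192 / g * \<Lambda> * \<eta> / \<mu>m" using \<Lambda>_ge \<eta>_pos g \<mu>m_pos by simp
    then have "192 / g * \<Lambda> * \<eta> / \<mu>m * real 1 \<le> 192 / g * \<Lambda> * \<eta> / \<mu>m * real k" using k by (intro mult_left_mono) auto
    then have s1: "192 / g * \<Lambda> * \<eta> / \<mu>m * real 1 < 2" using small by linarith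
    have "flat_ok d (M ^\<^sub>m 1) n (4 * \<tau> * sqrt (real 1 * real d)) x" using base Mc by simp
    from skipped_ph_close[OF g _ s1 M p c traj_axioms _ this i]
    have "\<bar>ph i - p i\<bar> \<le> 11 * (\<Lambda> * \<eta> / g)" by simp
    then show ?thesis using \<mu>m_le[OF i] bf(1,3) by linarith
  qed
  have yp: "3 / 4 * \<mu>m \<le> y.ph i" if i: "i < d" for i
    using pp[OF i] cl[OF i] bf(1) by linarith
  let ?S = "4 * \<tau> * sqrt (real k * real d) * sqrt (real nk)"
  have F: "op_bound d (conj_mat d y.ph (y.err (M ^\<^sub>m k))) (sqrt (real d) * ((?S + 2 * real d * \<alpha>) / y.Z) / (3 / 4 * \<mu>m))"
  proof (rule y.op_bound_flat_err[OF stochastic_mat_pow[OF M] _ sa(2) _ yp])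
    show "(\<Sum>j<d. \<bar>dev (M ^\<^sub>m k) nk y i j\<bar>) \<le> ?S" if "i < d" for i using flat that by (simp add: flat_ok_def)
  qed (use \<mu>m_pos in simp)
  have "op_bound d (conj_mat d y.ph (y.err (M ^\<^sub>m k))) (2 * u / \<mu>m)"
  proof (rule op_bound_mono[OF F])
    have "sqrt (real d) * ((?S + 2 * real d * \<alpha>) / y.Z) = sqrt (real d) * (?S / y.Z) + 2 * (sqrt (real d) * real d * \<alpha> / y.Z)"
      by (simp add: algebra_simps add_divide_distrib)
    moreover have "sqrt (real d) * real d * \<alpha> / y.Z \<le> (real d)\<^sup>2 * \<alpha> / y.Z"
    proof (intro divide_right_mono mult_right_mono)
      have "sqrt (real d) \<le> sqrt ((real d)\<^sup>2)" using d by (intro real_sqrt_le_mono) (simp add: power2_eq_square)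
      then show "sqrt (real d) * real d \<le> (real d)\<^sup>2" by (simp add: power2_eq_square mult_right_mono)
    qed (use \<alpha> y.Z_pos in auto)
    moreover have "real k * \<eta> = real k * \<eta>1 + real k * \<eta>2" by (simp add: \<eta>_def algebra_simps)
    moreover have "0 \<le> real k * \<eta>1" "0 \<le> real k * \<eta>2" using \<eta>1_pos \<eta>2_pos by auto
    ultimately have "sqrt (real d) * ((?S + 2 * real d * \<alpha>) / y.Z) \<le> 10 / 9 * (real k * \<eta>)" using sa(4,5) by linarith
    then have "sqrt (real d) * ((?S + 2 * real d * \<alpha>) / y.Z) \<le> 3 / 2 * u" using bf(2) u0 by linarith
    then have "sqrt (real d) * ((?S + 2 * real d * \<alpha>) / y.Z) / (3 / 4 * \<mu>m) \<le> 3 / 2 * u / (3 / 4 * \<mu>m)"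
      using \<mu>m_pos by (intro divide_right_mono) auto
    then show "sqrt (real d) * ((?S + 2 * real d * \<alpha>) / y.Z) / (3 / 4 * \<mu>m) \<le> 2 * u / \<mu>m" by simp
  qed
  then have "op_bound d (Matrix.mat d d (\<lambda>(i, j). conj_mat d y.ph y.MH $$ (i, j) - conj_mat d p (M ^\<^sub>m k) $$ (i, j)))
      (9 / 4 * (13 * u / \<mu>m) + 2 * u / \<mu>m)"
  proof (rule y.conj_mat_close[OF W.weighted_chain_pow _ pp, rotated -1])
    show "0 < 7 / 8 * \<mu>m" using \<mu>m_pos by simp
    show "\<bar>y.ph i - p i\<bar> \<le> 13 * u / \<mu>m * (7 / 8 * \<mu>m)" if "i < d" for i
    proof -
      have "13 * u / \<mu>m * (7 / 8 * \<mu>m) = 91 / 8 * u" using \<mu>m_pos by simp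
      then show ?thesis using cl[OF that] u0 by linarith
    qed
    show "0 \<le> 13 * u / \<mu>m" using u0 \<mu>m_pos by simp
    show "13 * u / \<mu>m \<le> 1 / 4" using bf(1) u0 \<mu>m_pos by (simp add: pos_divide_le_eq)
  qed
  from y.gram_gap_close[OF W.weighted_chain_pow this]
  have "\<bar>gram_gap d y.ph y.MH - gram_gap d p (M ^\<^sub>m k)\<bar>
      \<le> 2 * (9 / 4 * (13 * u / \<mu>m) + 2 * u / \<mu>m) + (9 / 4 * (13 * u / \<mu>m) + 2 * u / \<mu>m)\<^sup>2" .
  also have "9 / 4 * (13 * u / \<mu>m) + 2 * u / \<mu>m = 125 / 4 * (u / \<mu>m)" by simp
  also have "2 * (125 / 4 * (u / \<mu>m)) + (125 / 4 * (u / \<mu>m))\<^sup>2 \<le> 192 * (u / \<mu>m)"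
  proof -
    have v: "0 \<le> u / \<mu>m" "u / \<mu>m \<le> 1 / 96" using u0 bf(1) \<mu>m_pos by (auto simp: pos_divide_le_eq)
    have "(125 / 4 * (u / \<mu>m))\<^sup>2 = 15625 / 16 * (u / \<mu>m) * (u / \<mu>m)" by (simp add: power2_eq_square)
    also have "\<dots> \<le> 15625 / 16 * (u / \<mu>m) * (1 / 96)" using v by (intro mult_left_mono) auto
    finally have "(125 / 4 * (u / \<mu>m))\<^sup>2 \<le> 15625 / 16 * (u / \<mu>m) * (1 / 96)" .
    moreover have "2 * (125 / 4 * v) + w \<le> 192 * v" if "w \<le> 15625 / 16 * v * (1 / 96)" "0 \<le> v" for v w :: real
      using that by linarith
    ultimately show ?thesis using v(1) by blast
  qed
  also have "192 * (u / \<mu>m) = real k * (192 / g * \<Lambda> * \<eta> / \<mu>m)" by (simp add: u_def)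
  finally show ?thesis .
qed

end

section \<open>Error bounds for reversible chains\<close>

text \<open>Applied to \<open>conj_mat d p A\<close> this is the mean of \<open>A\<close> and its
  adjoint for the weights \<open>p\<close>, in symmetric coordinates.\<close>

definition sym_part :: "nat \<Rightarrow> real mat \<Rightarrow> real mat" where
  "sym_part d A = Matrix.mat d d (\<lambda>(i, j). (A $$ (i, j) + A $$ (j, i)) / 2)"

lemma sym_part_sym_mat: "sym_mat d (sym_part d A)"
  by (auto simp: sym_mat_def sym_part_def add.commute)

lemma sym_part_quadratic: "ip d x (mv d (sym_part d A) x) = ip d x (mv d A x)"
proof -
  have "ip d x (mv d (sym_part d A) x) = (\<Sum>i<d. \<Sum>j<d. x i * A $$ (i, j) * x j / 2 + x i * A $$ (j, i) * x j / 2)"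
    unfolding ip_def mv_def sum_distrib_left
    by (intro sum.cong) (auto simp: sym_part_def algebra_simps add_divide_distrib)
  also have "\<dots> = (\<Sum>i<d. \<Sum>j<d. x i * A $$ (i, j) * x j / 2) + (\<Sum>i<d. \<Sum>j<d. x i * A $$ (j, i) * x j / 2)"
    by (simp add: sum.distrib)
  also have "(\<Sum>i<d. \<Sum>j<d. x i * A $$ (j, i) * x j / 2) = (\<Sum>i<d. \<Sum>j<d. x i * A $$ (i, j) * x j / 2)"
    by (subst sum.swap) (simp add: mult_ac)
  finally show ?thesis unfolding ip_def mv_def sum_distrib_left
    by (simp add: sum.distrib[symmetric] mult_ac)
qed

lemma abs_spectral_gap_range:
  assumes A: "sym_mat d A" and d: "2 \<le> d" and q: "\<And>x. \<bar>ip d x (mv d A x)\<bar> \<le> e * ip d x x"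
  shows "1 - e \<le> abs_spectral_gap A" "abs_spectral_gap A \<le> 1"
proof -
  have 1: "eigvals A ! 1 \<le> e"
    by (rule second_eigval_le[OF A d, of "\<lambda>_. 0"]) (use q in \<open>auto simp: abs_le_iff\<close>)
  obtain u where u: "ip d u u = 1" "ip d u (mv d A u) = last (eigvals A)" using last_eigval(2)[OF A] d by auto
  then have "\<bar>last (eigvals A)\<bar> \<le> e" using q[of u] by simp
  then show "1 - e \<le> abs_spectral_gap A" "abs_spectral_gap A \<le> 1" using 1 by (auto simp: abs_spectral_gap_def)
qed

lemma abs_spectral_gap_conj:
  assumes "A \<in> carrier_mat d d" "B \<in> carrier_mat d d" "\<And>i. i < d \<Longrightarrow> s i \<noteq> 0"
    "\<And>i j. i < d \<Longrightarrow> j < d \<Longrightarrow> A $$ (i, j) = B $$ (i, j) * s j / s i"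
  shows "abs_spectral_gap A = abs_spectral_gap B"
proof -
  have "char_poly A = char_poly B" by (rule char_poly_diag_conj[of A d B s]) (use assms in auto)
  then have "eigvals A = eigvals B" by (rule eigvals_cong)
  then show ?thesis by (simp only: abs_spectral_gap_def)
qed

context weighted_chain
begin

lemma sym_part_fixes_sqrt:
  assumes "i < d" shows "mv d (sym_part d (conj_mat d p A)) (\<lambda>i. sqrt (p i) * 1) i = sqrt (p i) * 1"
proof -
  let ?L = "conj_mat d p A" and ?u = "\<lambda>i. sqrt (p i) * 1"
  have Lu: "mv d ?L ?u i = ?u i"
    using mv_conj_mat[OF pos assms, where f = "\<lambda>_. 1"] mv_const[OF stoch assms] by simp
  have "(\<Sum>j<d. ?L $$ (j, i) * ?u j) = (\<Sum>j<d. p j * A $$ (j, i) / sqrt (p i))"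
  proof (intro sum.cong refl)
    fix j assume "j \<in> {..<d}"
    then have j: "j < d" "sqrt (p j) * sqrt (p j) = p j" using pos[of j] by auto
    have "?L $$ (j, i) * ?u j = (sqrt (p j) * sqrt (p j)) * A $$ (j, i) / sqrt (p i)"
      using j(1) assms by (simp add: conj_mat_index del: real_sqrt_mult_self)
    then show "?L $$ (j, i) * ?u j = p j * A $$ (j, i) / sqrt (p i)" by (simp only: j(2))
  qed
  also have "\<dots> = p i / sqrt (p i)"
    using stat assms by (simp add: sum_divide_distrib[symmetric] stat_dist_def)
  also have "\<dots> = ?u i" using pos[OF assms] by (simp add: real_div_sqrt)
  finally have "(\<Sum>j<d. ?L $$ (j, i) * ?u j) = ?u i" .
  moreover have "mv d (sym_part d ?L) ?u i = (mv d ?L ?u i + (\<Sum>j<d. ?L $$ (j, i) * ?u j)) / 2"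
    unfolding mv_def sum.distrib[symmetric] sum_divide_distrib using assms
    by (intro sum.cong) (auto simp: sym_part_def algebra_simps)
  ultimately show ?thesis using Lu by simp
qed

text \<open>The quadratic form of \<open>conj_mat d p A\<close> is that of its symmetric part, which
  fixes \<open>sqrt p\<close>; centred functions are again the orthogonal complement of this
  vector.\<close>

lemma dirichlet_le_second_eigval:
  assumes f: "ip d p f = 0"
  shows "(\<Sum>i<d. p i * (f i * mv d A f i)) \<le> eigvals (sym_part d (conj_mat d p A)) ! 1 * wsq d p f"
proof -
  let ?L = "conj_mat d p A" and ?x = "\<lambda>i. sqrt (p i) * f i" and ?u = "\<lambda>i. sqrt (p i) * 1"
  have "ip d ?x (mv d ?L ?x) = ip d ?x (\<lambda>i. sqrt (p i) * mv d A f i)"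
    by (intro ip_cong mv_conj_mat pos) auto
  then have q: "ip d ?x (mv d (sym_part d ?L) ?x) = (\<Sum>i<d. p i * (f i * mv d A f i))"
    by (simp only: sym_part_quadratic ip_sqrt)
  have "ip d ?x (mv d (sym_part d ?L) ?x) \<le> eigvals (sym_part d ?L) ! 1 * ip d ?x ?x"
  proof (rule rayleigh_le_second_eigval[OF sym_part_sym_mat d _ sym_part_fixes_sqrt])
    show "ip d ?u ?u = 1" unfolding ip_sqrt using sum_p by simp
    show "ip d ?x ?u = 0" unfolding ip_sqrt using f by (simp add: ip_def)
    show "ip d ?x (mv d (sym_part d ?L) ?x) \<le> ip d ?x ?x"
      unfolding sym_part_quadratic using op_bound_quadratic[OF op_bound_conj_mat, of ?x] by simp
  qed
  then show ?thesis unfolding q ip_sqrt_self .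
qed

text \<open>The second eigenvalue of the symmetric part controls the inner product of
  \<open>f\<close> and \<open>A f\<close>, but not the norm of \<open>A f\<close>. Averaging with
  the identity turns the former control into a contraction of the norm.\<close>

definition "lazy = Matrix.mat d d (\<lambda>(i, j). ((if i = j then 1 else 0) + A $$ (i, j)) / 2)"

lemma mv_lazy: "i < d \<Longrightarrow> mv d lazy f i = (f i + mv d A f i) / 2"
proof -
  assume i: "i < d"
  have "mv d lazy f i = (\<Sum>j<d. (if j = i then f j else 0) / 2 + A $$ (i, j) * f j / 2)"
    unfolding mv_def using i by (intro sum.cong) (auto simp: lazy_def algebra_simps add_divide_distrib)
  then show ?thesis using i by (simp add: sum.distrib sum_divide_distrib[symmetric] mv_def add_divide_distrib)
qed

lemma weighted_chain_lazy: "weighted_chain d lazy p"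
proof
  show "stochastic_mat d lazy"
  proof (rule stochastic_matI_mv)
    show "lazy \<in> carrier_mat d d" by (simp add: lazy_def)
    show "0 \<le> mv d lazy f i" if "i < d" "\<And>j. j < d \<Longrightarrow> 0 \<le> f j" for f i
      using mv_nonneg[OF stoch that] that by (simp add: mv_lazy)
    show "mv d lazy (\<lambda>_. 1) i = 1" if "i < d" for i using mv_const[OF stoch that, of 1] that by (simp add: mv_lazy)
  qed
  show "stat_dist d lazy p"
  proof (rule stat_distI_ip)
    show "distribution d p" using stat by (simp add: stat_dist_def)
    fix f
    have "ip d p (mv d lazy f) = ip d p (\<lambda>i. (1 / 2) * (f i + mv d A f i))"
      by (intro ip_cong) (auto simp: mv_lazy)
    then show "ip d p (mv d lazy f) = ip d p f" unfolding ip_linear ip_stat[OF stat] by simp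
  qed
qed (use d pos in auto)

text \<open>In the square of \<open>(f + A f) / 2\<close> the cross term is controlled by the
  eigenvalue, and for the last term \<open>A\<close> does not increase the norm.\<close>

lemma wsq_lazy_contract:
  assumes f: "ip d p f = 0"
  shows "wsq d p (mv d lazy f) \<le> (1 - (1 - eigvals (sym_part d (conj_mat d p A)) ! 1) / 2) * wsq d p f"
proof -
  let ?l = "eigvals (sym_part d (conj_mat d p A)) ! 1"
  have "wsq d p (mv d lazy f) = (\<Sum>i<d. (p i * (f i)\<^sup>2 + 2 * (p i * (f i * mv d A f i)) + p i * (mv d A f i)\<^sup>2) / 4)"
    unfolding wsq_def by (intro sum.cong) (auto simp: mv_lazy power2_eq_square algebra_simps)
  also have "\<dots> = (wsq d p f + 2 * (\<Sum>i<d. p i * (f i * mv d A f i)) + wsq d p (mv d A f)) / 4"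
    by (simp add: wsq_def sum.distrib sum_divide_distrib[symmetric] sum_distrib_left)
  also have "\<dots> \<le> (wsq d p f + 2 * (?l * wsq d p f) + wsq d p f) / 4"
    using dirichlet_le_second_eigval[OF f] wsq_mv_le[OF stoch stat, of f] by simp
  also have "\<dots> = (1 - (1 - ?l) / 2) * wsq d p f"
  proof -
    have "(w + 2 * (l * w) + w) / 4 = (1 - (1 - l) / 2) * w" for l w :: real by (simp add: field_simps)
    then show ?thesis .
  qed
  finally show ?thesis .
qed

lemma sym_part_conj_mat:
  assumes ij: "i < d" "j < d" and rev: "p i * A $$ (i, j) = p j * A $$ (j, i)"
  shows "sym_part d (conj_mat d p A) $$ (i, j) = conj_mat d p A $$ (i, j)"
proof -
  have pi: "0 < p i" "0 < p j" using pos ij by auto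
  have "sqrt (p j) * A $$ (j, i) / sqrt (p i) = (p j * A $$ (j, i)) / (sqrt (p i) * sqrt (p j))"
    using pi real_div_sqrt[of "p j"] by (simp add: field_simps)
  also have "\<dots> = (p i * A $$ (i, j)) / (sqrt (p i) * sqrt (p j))" using rev by simp
  also have "\<dots> = sqrt (p i) * A $$ (i, j) / sqrt (p j)" using pi real_div_sqrt[of "p i"] by (simp add: field_simps)
  finally show ?thesis using ij by (simp add: sym_part_def conj_mat_index)
qed

text \<open>Detailed balance makes \<open>conj_mat d p A\<close> symmetric, and it is a diagonal
  conjugate of \<open>A\<close>.\<close>

lemma abs_spectral_gap_reversible:
  assumes rev: "\<And>i j. i < d \<Longrightarrow> j < d \<Longrightarrow> p i * A $$ (i, j) = p j * A $$ (j, i)"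
  shows "abs_spectral_gap A = abs_spectral_gap (sym_part d (conj_mat d p A))"
proof (rule abs_spectral_gap_conj[of _ d _ "\<lambda>i. sqrt (p i)"])
    show "A \<in> carrier_mat d d" by (rule stochastic_matD(1)[OF stoch])
    show "sqrt (p i) \<noteq> 0" if "i < d" for i using pos[OF that] by simp
    fix i j assume ij: "i < d" "j < d"
    have pi: "0 < p i" "0 < p j" using pos ij by auto
    have "sym_part d (conj_mat d p A) $$ (i, j) = sqrt (p i) * A $$ (i, j) / sqrt (p j)"
      using sym_part_conj_mat[OF ij rev[OF ij]] ij by (simp add: conj_mat_index)
    then show "A $$ (i, j) = sym_part d (conj_mat d p A) $$ (i, j) * sqrt (p j) / sqrt (p i)"
      using pi by simp
qed (simp add: sym_part_def)

end

context traj
begin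

text \<open>Closing the trajectory up into a cycle by the transition from \<open>x n\<close> to \<open>x 1\<close> makes
  \<open>\<nu>\<close> exactly stationary.\<close>

definition "MC = Matrix.mat d d (\<lambda>(i, j). (tr i j + (if i = x n \<and> j = x 1 then 1 else 0) + \<alpha>) / (cnt i + real d * \<alpha>))"

lemma C_pos: "0 < cnt i + real d * \<alpha>" using cnt_nonneg[of i] d\<alpha>_pos by linarith

lemma \<nu>_pos: "0 < \<nu> i" using C_pos[of i] Z_pos by (simp add: \<nu>_def)

lemma MC_index: "i < d \<Longrightarrow> j < d \<Longrightarrow> MC $$ (i, j) = (tr i j + (if i = x n \<and> j = x 1 then 1 else 0) + \<alpha>) / (cnt i + real d * \<alpha>)"
  by (simp add: MC_def)

text \<open>\<open>distribution\<close> requires zeros from \<open>d\<close> on, whereas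
  \<open>\<nu>\<close> is positive everywhere.\<close>

definition "\<nu>0 i = (if i < d then \<nu> i else 0)"

lemma weighted_chain_MC:
  assumes n: "1 \<le> n" shows "weighted_chain d MC \<nu>0"
proof
  show "2 \<le> d" by (rule d)
  have x: "x n < d" "x 1 < d" using range n by auto
  show "stochastic_mat d MC" unfolding stochastic_mat_def
  proof (intro conjI allI impI)
    show "MC \<in> carrier_mat d d" by (simp add: MC_def)
    show "0 \<le> MC $$ (i, j)" if "i < d" "j < d" for i j
      using that C_pos[of i] \<alpha> tr_nonneg[of i j] by (simp add: MC_index)
    fix i assume i: "i < d"
    have "(\<Sum>j<d. MC $$ (i, j)) = (\<Sum>j<d. tr i j + (if j = x 1 then (if i = x n then 1 else 0) else 0) + \<alpha>) / (cnt i + real d * \<alpha>)"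
      unfolding sum_divide_distrib using i by (intro sum.cong) (auto simp: MC_index)
    also have "(\<Sum>j<d. tr i j + (if j = x 1 then (if i = x n then 1 else 0) else 0) + \<alpha>) = cnt i + real d * \<alpha>"
      using x by (simp add: sum.distrib sum_tr[OF i] cnt_vis[OF n])
    finally show "(\<Sum>j<d. MC $$ (i, j)) = 1" using C_pos[of i] by simp
  qed
  show "stat_dist d MC \<nu>0"
    unfolding stat_dist_def distribution_def
  proof (intro conjI allI impI)
    show "0 \<le> \<nu>0 i" for i using \<nu>_pos[of i] by (simp add: \<nu>0_def)
    show "\<nu>0 i = 0" if "d \<le> i" for i using that by (simp add: \<nu>0_def)
    show "(\<Sum>i<d. \<nu>0 i) = 1" using sum_\<nu> by (simp add: \<nu>0_def)
    fix j assume j: "j < d"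
    have "(\<Sum>i<d. \<nu>0 i * MC $$ (i, j)) = (\<Sum>i<d. tr i j + (if i = x n then (if j = x 1 then 1 else 0) else 0) + \<alpha>) / Z"
      unfolding sum_divide_distrib
    proof (intro sum.cong refl)
      fix i assume "i \<in> {..<d}"
      then show "\<nu>0 i * MC $$ (i, j) = (tr i j + (if i = x n then (if j = x 1 then 1 else 0) else 0) + \<alpha>) / Z"
        using j C_pos[of i] by (simp add: MC_index \<nu>_def \<nu>0_def)
    qed
    also have "(\<Sum>i<d. tr i j + (if i = x n then (if j = x 1 then 1 else 0) else 0) + \<alpha>) = cnt j + real d * \<alpha>"
      using x by (auto simp: sum.distrib sum_tr_col[OF n])
    finally show "(\<Sum>i<d. \<nu>0 i * MC $$ (i, j)) = \<nu>0 j" using j by (simp add: \<nu>_def \<nu>0_def)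
  qed
  show "0 < \<nu>0 i" if "i < d" for i using that \<nu>_pos[of i] by (simp add: \<nu>0_def)
qed

text \<open>Closing up adds one count to the row of the last state and changes nothing else.\<close>

lemma MC_row_error:
  assumes n: "1 \<le> n" and i: "i < d"
  shows "(\<Sum>j<d. \<bar>MH $$ (i, j) - MC $$ (i, j)\<bar>) \<le> (if i = x n then 2 / Nt i else 0)"
proof (cases "i = x n")
  case False
  then have "MH $$ (i, j) - MC $$ (i, j) = 0" if "j < d" for j
    using that i by (simp add: MH_index MC_index Nt_def cnt_vis[OF n])
  then show ?thesis using False by simp
next
  case True
  have x: "x 1 < d" using range n by auto
  have C: "cnt i + real d * \<alpha> = Nt i + 1" using True by (simp add: Nt_def cnt_vis[OF n])
  have N: "0 < Nt i" by (rule Nt_pos)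
  have "\<bar>MH $$ (i, j) - MC $$ (i, j)\<bar> \<le> (tr i j + \<alpha>) / Nt i / Nt i + (if j = x 1 then 1 / Nt i else 0)" if j: "j < d" for j
  proof -
    have "MH $$ (i, j) - MC $$ (i, j) = (tr i j + \<alpha>) / (Nt i * (Nt i + 1)) - (if j = x 1 then 1 / (Nt i + 1) else 0)"
    proof -
      have "a / N - (a + e) / (N + 1) = a / (N * (N + 1)) - e / (N + 1)" if "0 < N" for a e N :: real
        using that by (simp add: add_divide_distrib) (simp add: field_simps)
      from this[OF N, of "tr i j + \<alpha>" "if j = x 1 then 1 else 0"]
      show ?thesis unfolding MH_index[OF i j] MC_index[OF i j] C using True by (auto simp: add_ac)
    qed
    moreover have "(tr i j + \<alpha>) / (Nt i * (Nt i + 1)) \<le> (tr i j + \<alpha>) / (Nt i * Nt i)"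
      using N \<alpha> tr_nonneg[of i j] by (intro divide_left_mono mult_left_mono) auto
    moreover have "1 / (Nt i + 1) \<le> 1 / Nt i" using N by (intro divide_left_mono) auto
    moreover have "0 \<le> (tr i j + \<alpha>) / (Nt i * (Nt i + 1))" "0 \<le> 1 / (Nt i + 1)" using N \<alpha> tr_nonneg[of i j] by auto
    moreover have "\<bar>a - e\<bar> \<le> a' + e'" if "0 \<le> a" "a \<le> a'" "0 \<le> e" "e \<le> e'" for a e a' e' :: real
      using that by linarith
    ultimately show ?thesis unfolding divide_divide_eq_left by auto
  qed
  then have "(\<Sum>j<d. \<bar>MH $$ (i, j) - MC $$ (i, j)\<bar>) \<le> (\<Sum>j<d. (tr i j + \<alpha>) / Nt i / Nt i + (if j = x 1 then 1 / Nt i else 0))"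
    by (intro sum_mono) auto
  also have "\<dots> = (\<Sum>j<d. tr i j + \<alpha>) / Nt i / Nt i + 1 / Nt i"
    using x by (simp add: sum.distrib sum_divide_distrib add_divide_distrib)
  also have "(\<Sum>j<d. tr i j + \<alpha>) = Nt i" by (simp add: sum.distrib sum_tr[OF i] Nt_def)
  finally show ?thesis using True N by simp
qed

text \<open>Conjugation by \<open>sqrt Nt\<close> symmetrizes the matrix in the definition of the
  estimator.\<close>

lemma abs_gap_hat_eq: "abs_gap_hat d \<alpha> n x = abs_spectral_gap (sym_part d (conj_mat d ph MH))"
  unfolding abs_gap_hat_def
proof (rule abs_spectral_gap_conj[of _ d _ "\<lambda>i. sqrt (Nt i)"])
  show "sqrt (Nt i) \<noteq> 0" for i using Nt_pos[of i] by simp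
  fix i j assume ij: "i < d" "j < d"
  have L: "conj_mat d ph MH $$ (i, j) = (tr i j + \<alpha>) / (sqrt (Nt i) * sqrt (Nt j))" if "i < d" "j < d" for i j
    unfolding L_hat_eq[symmetric] using that by (simp add: L_hat_def Nt_def tr_def vis_def real_sqrt_mult)
  have "sym_part d (conj_mat d ph MH) $$ (i, j) = ((tr i j + \<alpha>) + (tr j i + \<alpha>)) / (2 * (sqrt (Nt i) * sqrt (Nt j)))"
    using ij by (simp add: sym_part_def L add_divide_distrib mult_ac)
  then have "sym_part d (conj_mat d ph MH) $$ (i, j) * sqrt (Nt j) / sqrt (Nt i)
     = ((tr i j + \<alpha>) + (tr j i + \<alpha>)) / (2 * (sqrt (Nt i) * sqrt (Nt i)))"
    using Nt_pos[of j] by simp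
  also have "\<dots> = (tr i j + tr j i + 2 * \<alpha>) / (2 * Nt i)" using Nt_pos[of i] by simp
  finally show "Matrix.mat d d (\<lambda>(i, j). (real (transitions n 1 0 x i j) + real (transitions n 1 0 x j i) + 2 * \<alpha>) /
      (2 * (real (visits n 1 0 x i) + real d * \<alpha>))) $$ (i, j)
     = sym_part d (conj_mat d ph MH) $$ (i, j) * sqrt (Nt j) / sqrt (Nt i)"
    using ij by (simp add: Nt_def tr_def vis_def)
qed (auto simp: sym_part_def)

lemma abs_gap_hat_range: "abs_gap_hat d \<alpha> n x \<le> 1" "1 - sqrt (1 + bd / D) \<le> abs_gap_hat d \<alpha> n x"
  unfolding abs_gap_hat_eq
  by (rule abs_spectral_gap_range[OF sym_part_sym_mat d],
      unfold sym_part_quadratic, rule op_bound_quadratic[OF op_bound_L_hat])+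

end

context conf
begin

text \<open>The counterpart of \<open>base_facts\<close> for a condition on \<open>b\<close> alone,
  without division by \<open>\<mu>m\<close>. The case \<open>n = 0\<close> is excluded because then
  \<open>\<eta>2 = 2\<close>.\<close>

lemma rev_base:
  assumes g: "0 < g" "g \<le> 1" and small: "192 / g * \<Lambda> * \<eta> < 1"
  shows "\<eta> / g \<le> 1 / 256" "\<eta> \<le> 1 / 256" "1 / D \<le> \<eta> * g / 10000" "1 \<le> n"
proof -
  define v where "v = \<eta> / g"
  have v0: "0 \<le> v" using g \<eta>_pos by (simp add: v_def)
  have e: "192 / g * \<Lambda> * \<eta> = 192 * (v * \<Lambda>)" by (simp add: v_def)
  have "v * (4 / 3) \<le> v * \<Lambda>" using \<Lambda>_ge v0 by (intro mult_left_mono) auto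
  then have v: "v \<le> 1 / 256" using small unfolding e by linarith
  then show "\<eta> / g \<le> 1 / 256" by (simp add: v_def)
  have \<eta>g: "\<eta> \<le> g / 256" using v g by (simp add: v_def pos_divide_le_eq)
  then show e2: "\<eta> \<le> 1 / 256" using g by linarith
  have "\<eta>1\<^sup>2 = 16 * \<tau>\<^sup>2 * (real d / D)" using D_pos by (simp add: \<eta>1_def power_mult_distrib)
  moreover have "(3 / 2)\<^sup>2 \<le> \<tau>\<^sup>2" using \<tau>_ge by (intro power_mono) auto
  then have "16 * (9 / 4) * (2 / D) \<le> 16 * \<tau>\<^sup>2 * (real d / D)"
    using D_pos d by (intro mult_mono divide_right_mono) (auto simp: power2_eq_square)
  ultimately have "72 / D \<le> \<eta>1\<^sup>2" by simp
  also have "\<eta>1\<^sup>2 \<le> \<eta> * \<eta>" using \<eta>1_pos \<eta>2_pos unfolding power2_eq_square by (intro mult_mono) (auto simp: \<eta>_def)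
  also have "\<dots> \<le> \<eta> * (g / 256)" using \<eta>g \<eta>_pos by (intro mult_left_mono) auto
  finally have "1 / D \<le> \<eta> * g / 18432" by simp
  moreover have "0 \<le> \<eta> * g" using \<eta>_pos g by simp
  ultimately show "1 / D \<le> \<eta> * g / 10000" by linarith
  show "1 \<le> n"
  proof (rule ccontr)
    assume "\<not> 1 \<le> n"
    then have n0: "n = 0" by simp
    obtain i where i: "i < d" "D = Nt i" by (rule D_attained)
    have "{1..<n} = {}" using n0 by simp
    then have "vis i = 0" unfolding vis_sum by simp
    then have "D = real d * \<alpha>" using i(2) by (simp add: Nt_def)
    then have "\<eta>2 = 2" using d \<alpha> by (simp add: \<eta>2_def)
    then show False using e2 \<eta>1_pos by (simp add: \<eta>_def)
  qed
qed

text \<open>As the deviations are relative to \<open>N_i\<close>, no frequency appears in the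
  denominator. The constant is \<open>5 * (8 / 5) = 8\<close>, twice the 4 in
  \<open>\<eta>1\<close>, where \<open>(8 / 5)^2 \<ge> 2\<close> covers the factor 2 in the peeling
  level.\<close>

lemma peel_row_error:
  assumes M: "stochastic_mat d M" and peel: "peel_ok d M n (2 * \<tau>\<^sup>2 * real d) x" and i: "i < d"
  shows "(\<Sum>j<d. \<bar>MH $$ (i, j) - M $$ (i, j)\<bar>) \<le> 2 * \<eta>"
proof -
  have N: "0 < Nt i" by (rule Nt_pos)
  have "(\<Sum>j<d. \<bar>dev M n x i j\<bar>) \<le> 5 * sqrt (2 * \<tau>\<^sup>2 * real d * vis i)"
    using peel i by (simp add: peel_ok_def vis_def)
  also have "\<dots> \<le> 5 * sqrt ((8 / 5 * \<tau>)\<^sup>2 * (real d * Nt i))"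
  proof (intro mult_left_mono real_sqrt_le_mono)
    have "2 * \<tau>\<^sup>2 * (real d * vis i) \<le> (8 / 5)\<^sup>2 * \<tau>\<^sup>2 * (real d * Nt i)"
      using vis_nonneg[of i] d\<alpha>_pos by (intro mult_mono) (auto simp: Nt_def power2_eq_square)
    then show "2 * \<tau>\<^sup>2 * real d * vis i \<le> (8 / 5 * \<tau>)\<^sup>2 * (real d * Nt i)"
      unfolding power_mult_distrib by (simp only: mult.assoc)
  qed simp
  also have "\<dots> = 8 * \<tau> * sqrt (real d * Nt i)" using \<tau>_ge by (simp add: real_sqrt_mult)
  finally have dev: "(\<Sum>j<d. \<bar>dev M n x i j\<bar>) \<le> 8 * \<tau> * sqrt (real d * Nt i)" .
  have "(\<Sum>j<d. \<bar>MH $$ (i, j) - M $$ (i, j)\<bar>) \<le> ((\<Sum>j<d. \<bar>dev M n x i j\<bar>) + 2 * real d * \<alpha>) / Nt i"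
    by (rule row_error[OF M i])
  also have "\<dots> \<le> (8 * \<tau> * sqrt (real d * Nt i) + 2 * real d * \<alpha>) / Nt i"
    using dev N by (intro divide_right_mono) auto
  also have "\<dots> = 8 * \<tau> * sqrt (real d / Nt i) + 2 * real d * \<alpha> / Nt i"
  proof -
    have "sqrt (real d * Nt i) / Nt i = sqrt (real d / Nt i)"
      using N by (simp add: real_sqrt_mult real_sqrt_divide real_div_sqrt field_simps)
    then show ?thesis by (simp add: add_divide_distrib) (metis mult.assoc times_divide_eq_right)
  qed
  also have "\<dots> \<le> 8 * \<tau> * sqrt (real d / D) + 2 * real d * \<alpha> / D"
    using D_le[OF i] D_pos N \<tau>_ge \<alpha> by (intro add_mono mult_left_mono real_sqrt_le_mono divide_left_mono) auto
  also have "8 * \<tau> * sqrt (real d / D) = 2 * \<eta>1" by (simp add: \<eta>1_def)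
  also have "2 * real d * \<alpha> / D = \<eta>2" by (simp add: \<eta>2_def mult_ac)
  also have "2 * \<eta>1 + \<eta>2 \<le> 2 * \<eta>" using \<eta>2_pos by (simp add: \<eta>_def)
  finally show ?thesis .
qed

text \<open>The direction is opposite to that in \<open>ph_near_stationary\<close>: \<open>p\<close>
  is nearly stationary for the lazy closed-up chain, whose stationary distribution and gap are read
  from the data. The rows of \<open>M\<close> and \<open>MC\<close> differ by a multiple of
  \<open>\<eta>\<close>, so no division by \<open>\<mu>m\<close> occurs.\<close>

lemma rev_ph_close:
  assumes M: "stochastic_mat d M" and p: "stat_dist d M p"
    and peel: "peel_ok d M n (2 * \<tau>\<^sup>2 * real d) x"
    and g: "0 < g" "g = abs_gap_hat d \<alpha> n x" and small: "192 / g * \<Lambda> * \<eta> < 1" and i: "i < d"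
  shows "\<bar>ph i - p i\<bar> \<le> 6 * (\<Lambda> * \<eta> / g)"
proof -
  have g1: "g \<le> 1" using abs_gap_hat_range g by simp
  note rb = rev_base[OF g(1) g1 small]
  have n: "1 \<le> n" by (rule rb(4))
  have xn: "x n < d" using range n by auto
  interpret W: weighted_chain d MC \<nu>0 by (rule weighted_chain_MC[OF n])
  have \<nu>00: "\<nu>0 i = \<nu> i" if "i < d" for i using that by (simp add: \<nu>0_def)
  define v where "v = 1 / D"
  have v0: "0 < v" using D_pos by (simp add: v_def)
  have "\<eta> * g \<le> 1 * 1" using rb(2) g(1) g1 \<eta>_pos by (intro mult_mono) auto
  then have v1: "v \<le> 1 / 10000" using rb(3) by (simp add: v_def)
  have vg: "v \<le> g / 2560000"
  proof -
    have "\<eta> * g \<le> 1 / 256 * g" using rb(2) g(1) by (intro mult_right_mono) auto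
    then show ?thesis using rb(3) by (simp add: v_def)
  qed
  have F: "op_bound d (conj_mat d ph (err MC)) (2 * v)"
  proof (rule op_bound_err[OF MC_row_error[OF n] \<mu>m_pos \<mu>m_le])
    have "(\<Sum>i<d. ph i * (if i = x n then 2 / Nt i else 0)\<^sup>2) = (\<Sum>i<d. if i = x n then ph i * (2 / Nt i)\<^sup>2 else 0)"
      by (intro sum.cong) auto
    also have "\<dots> = ph (x n) * (2 / Nt (x n))\<^sup>2" using xn by simp
    also have "\<dots> = 4 / (Z * Nt (x n))" using Nt_pos[of "x n"] by (simp add: ph_eq power2_eq_square)
    also have "\<dots> \<le> 4 / (Z * D)" using D_le[OF xn] D_pos Z_pos Nt_pos by (intro divide_left_mono mult_left_mono mult_pos_pos) auto
    also have "\<dots> = \<mu>m * (2 * v)\<^sup>2" using D_pos by (simp add: \<mu>m_def v_def power2_eq_square)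
    finally show "(\<Sum>i<d. ph i * (if i = x n then 2 / Nt i else 0)\<^sup>2) \<le> \<mu>m * (2 * v)\<^sup>2" .
  qed (use v0 in auto)
  let ?C = "Matrix.mat d d (\<lambda>(i, j). conj_mat d ph MH $$ (i, j) - conj_mat d \<nu>0 MC $$ (i, j))"
  have "op_bound d ?C (9 / 4 * v + 2 * v)"
  proof (rule conj_mat_perturb[OF W.pos ph_pos _ _ _ W.op_bound_conj_mat _ F])
    fix i assume i: "i < d"
    have "\<bar>ph i - \<nu> i\<bar> \<le> 1 / Z" using \<nu>_ph_diff[OF n, of i] by simp
    also have "1 / Z = v * \<mu>m" using D_pos by (simp add: v_def \<mu>m_def)
    also have "\<dots> \<le> v * \<nu> i" using \<mu>m_le[OF i] ph_le_\<nu>[OF n, of i] v0 by (intro mult_left_mono) auto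
    finally show "\<bar>ph i - \<nu>0 i\<bar> \<le> v * \<nu>0 i" by (simp add: \<nu>00[OF i])
  qed (use v0 v1 in \<open>auto simp: err_def\<close>)
  then have C: "op_bound d ?C (5 * v)" by (rule op_bound_mono) (use v0 in simp)
  let ?l = "eigvals (sym_part d (conj_mat d \<nu>0 MC)) ! 1"
  have "?l \<le> eigvals (sym_part d (conj_mat d ph MH)) ! 1 + 5 * v"
  proof (rule second_eigval_perturb_le[OF sym_part_sym_mat sym_part_sym_mat d])
    fix z
    have "ip d z (mv d ?C z) = ip d z (mv d (conj_mat d ph MH) z) - ip d z (mv d (conj_mat d \<nu>0 MC) z)"
      unfolding ip_linear(4)[symmetric] by (intro ip_cong) (auto simp: mv_def left_diff_distrib sum_subtractf)
    then show "\<bar>ip d z (mv d (sym_part d (conj_mat d \<nu>0 MC)) z) - ip d z (mv d (sym_part d (conj_mat d ph MH)) z)\<bar> \<le> 5 * v * ip d z z"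
      unfolding sym_part_quadratic using op_bound_quadratic[OF C, of z] by (simp add: abs_minus_commute)
  qed
  moreover have "eigvals (sym_part d (conj_mat d ph MH)) ! 1 \<le> 1 - g"
    unfolding g(2) abs_gap_hat_eq abs_spectral_gap_def by simp
  ultimately have gl: "99 / 100 * g \<le> 1 - ?l" using vg g(1) by linarith
  \<comment> \<open>Closing up moves the second eigenvalue by at most \<open>5 / D\<close>, which is
    less than one percent of \<open>g\<close>.\<close>
  define g' where "g' = 99 / 100 * g"
  have g': "0 < g'" "g' \<le> 1" using g(1) g1 by (auto simp: g'_def)
  \<comment> \<open>Laziness halves the gap, hence \<open>4 * \<Lambda>\<close> for a decay down to
    \<open>exp (- 2 * \<Lambda>)\<close>.\<close>
  define j where "j = nat \<lceil>4 * \<Lambda> / g'\<rceil>"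
  have j: "4 * \<Lambda> \<le> g' * real j" "real j \<le> 4 * \<Lambda> / g' + 1"
  proof -
    have p: "0 \<le> 4 * \<Lambda> / g'" using \<Lambda>_ge g' by simp
    have rj: "real j = real_of_int \<lceil>4 * \<Lambda> / g'\<rceil>" using p by (simp add: j_def)
    have "4 * \<Lambda> / g' \<le> real j" unfolding rj by (rule le_of_int_ceiling)
    then show "4 * \<Lambda> \<le> g' * real j" using g' by (simp add: pos_divide_le_eq mult.commute)
    show "real j \<le> 4 * \<Lambda> / g' + 1" unfolding rj by (rule of_int_ceiling_le_add_one)
  qed
  interpret LZ: weighted_chain d W.lazy \<nu>0 by (rule W.weighted_chain_lazy)
  have con: "contr d (W.lazy ^\<^sub>m j) (1 / 2)"
  proof (rule LZ.contr_of_wsq_contract)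
    fix f assume f: "ip d \<nu>0 f = 0"
    have "wsq d \<nu>0 (mv d W.lazy f) \<le> (1 - (1 - ?l) / 2) * wsq d \<nu>0 f" by (rule W.wsq_lazy_contract[OF f])
    also have "\<dots> \<le> (1 - g' / 2) * wsq d \<nu>0 f"
      using gl wsq_nonneg[of d \<nu>0 f, OF W.pos] by (intro mult_right_mono) (auto simp: g'_def)
    finally show "wsq d \<nu>0 (mv d W.lazy f) \<le> (1 - g' / 2) * wsq d \<nu>0 f" .
  next
    show "0 \<le> 1 - g' / 2" using g' by simp
    show "\<mu>m \<le> \<nu>0 i" if "i < d" for i using \<mu>m_le[OF that] ph_le_\<nu>[OF n, of i] \<nu>00[OF that] by simp
    show "0 < \<mu>m" by (rule \<mu>m_pos)
    have "(1 - g' / 2) ^ j \<le> exp (- (g' / 2)) ^ j"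
      using g' exp_ge_add_one_self[of "- (g' / 2)"] by (intro power_mono) auto
    also have "\<dots> = exp (real j * (- (g' / 2)))" by (rule exp_of_nat_mult[symmetric])
    also have "\<dots> \<le> exp (- (2 * \<Lambda>))"
    proof -
      have "real j * (- (g' / 2)) = - (g' * real j) / 2" by simp
      then have "real j * (- (g' / 2)) \<le> - (2 * \<Lambda>)" using j(1) by linarith
      then show ?thesis by simp
    qed
    also have "\<dots> = \<mu>m / 8" by (rule \<Lambda>_exp)
    finally show "4 * (1 - g' / 2) ^ j \<le> \<mu>m" using \<mu>m_pos by simp
  qed
  have h: "(\<Sum>j<d. \<bar>M $$ (i, j) - MC $$ (i, j)\<bar>) \<le> 21 / 10 * \<eta>" if i: "i < d" for i
  proof -
    have "(\<Sum>j<d. \<bar>M $$ (i, j) - MC $$ (i, j)\<bar>) \<le> (\<Sum>j<d. \<bar>MH $$ (i, j) - M $$ (i, j)\<bar> + \<bar>MH $$ (i, j) - MC $$ (i, j)\<bar>)"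
      by (intro sum_mono) auto
    also have "\<dots> \<le> 2 * \<eta> + (if i = x n then 2 / Nt i else 0)"
      unfolding sum.distrib by (intro add_mono peel_row_error[OF M peel i] MC_row_error[OF n i])
    also have "(if i = x n then 2 / Nt i else 0) \<le> 2 * v"
    proof -
      have "2 / Nt i \<le> 2 / D" using D_le[OF i] D_pos Nt_pos by (intro divide_left_mono mult_pos_pos) auto
      then show ?thesis using v0 by (auto simp: v_def)
    qed
    also have "2 * \<eta> + 2 * v \<le> 21 / 10 * \<eta>"
    proof -
      have "\<eta> * g \<le> \<eta> * 1" using g1 \<eta>_pos by (intro mult_left_mono) auto
      then show ?thesis using rb(3)[folded v_def] \<eta>_pos by linarith
    qed
    finally show ?thesis by simp
  qed
  have "\<bar>p i - \<nu>0 i\<bar> \<le> real j * (21 / 40 * \<eta>) / (1 - 1 / 2)"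
  proof (rule near_stationary_bound(2)[OF LZ.stoch con _ _ _ i, of "\<lambda>i. p i - \<nu>0 i"])
    show "(\<Sum>i<d. p i - \<nu>0 i) = 0" using p W.sum_p by (simp add: sum_subtractf stat_dist_def distribution_def)
    fix f w assume f: "osc_le d f w"
    have w: "0 \<le> w" using osc_le_nonneg[OF f] d by simp
    have "ip d p (mv d W.lazy f) = ip d p (\<lambda>i. (1 / 2) * (f i + mv d MC f i))"
      by (intro ip_cong) (auto simp: W.mv_lazy)
    also have "\<dots> = (ip d p f + ip d p (mv d MC f)) / 2" by (simp only: ip_linear)
    finally have "ip d p f - ip d p (mv d W.lazy f) = (ip d p (mv d M f) - ip d p (mv d MC f)) / 2"
      by (simp add: ip_stat[OF p] field_simps)
    moreover have "\<bar>ip d p (mv d M f) - ip d p (mv d MC f)\<bar> \<le> 21 / 10 * \<eta> * w / 2"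
    proof -
      have "ip d p (mv d M f) - ip d p (mv d MC f) = (\<Sum>i<d. p i * (mv d M f i - mv d MC f i))"
        by (simp add: ip_def right_diff_distrib sum_subtractf)
      also have "\<bar>\<dots>\<bar> \<le> (\<Sum>i<d. p i * (21 / 10 * \<eta> * w / 2))"
      proof (rule order_trans[OF sum_abs], rule sum_mono)
        fix i assume "i \<in> {..<d}"
        then have i: "i < d" and pi: "0 \<le> p i" using p by (auto simp: stat_dist_def distribution_def)
        show "\<bar>p i * (mv d M f i - mv d MC f i)\<bar> \<le> p i * (21 / 10 * \<eta> * w / 2)"
          unfolding abs_mult abs_of_nonneg[OF pi]
          by (rule mult_left_mono[OF row_error_mv[OF M W.stoch i h[OF i] f w] pi])
      qed
      also have "\<dots> = 21 / 10 * \<eta> * w / 2"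
        using p by (simp only: sum_distrib_right[symmetric]) (simp add: stat_dist_def distribution_def)
      finally show ?thesis .
    qed
    moreover have "\<bar>y\<bar> \<le> e / 2" if "y = z / 2" "\<bar>z\<bar> \<le> e" for y z e :: real using that by simp
    ultimately have "\<bar>ip d p f - ip d p (mv d W.lazy f)\<bar> \<le> 21 / 10 * \<eta> * w / 2 / 2" by blast
    then show "\<bar>ip d (\<lambda>i. p i - \<nu>0 i) f - ip d (\<lambda>i. p i - \<nu>0 i) (mv d W.lazy f)\<bar> \<le> 21 / 40 * \<eta> * w"
      by (simp add: ip_linear ip_stat[OF LZ.stat])
  qed simp
  also have "\<dots> = 21 / 20 * (real j * \<eta>)" by simp
  also have "\<dots> \<le> 21 / 20 * (5 * (\<Lambda> * \<eta> / g))"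
  proof -
    have "real j \<le> 5 * \<Lambda> / g"
    proof -
      have "1 \<le> 1 / g" using g(1) g1 by simp
      then have "4 * \<Lambda> / g' + 1 \<le> 400 / 99 * (\<Lambda> / g) + 1 / g" by (simp add: g'_def)
      also have "\<dots> \<le> 400 / 99 * (\<Lambda> / g) + 3 / 4 * \<Lambda> / g"
        using g(1) \<Lambda>_ge by (intro add_left_mono divide_right_mono) auto
      also have "\<dots> \<le> 5 * \<Lambda> / g"
      proof -
        have "0 \<le> \<Lambda> / g" using g(1) \<Lambda>_ge by simp
        then show ?thesis by simp
      qed
      finally show ?thesis using j(2) by linarith
    qed
    then have "real j * \<eta> \<le> 5 * \<Lambda> / g * \<eta>" using \<eta>_pos by (intro mult_right_mono) auto
    then show ?thesis by simp
  qed
  finally have 1: "\<bar>p i - \<nu> i\<bar> \<le> 21 / 20 * (5 * (\<Lambda> * \<eta> / g))" by (simp only: \<nu>00[OF i])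
  have 2: "\<bar>\<nu> i - ph i\<bar> \<le> 1 / Z" by (rule \<nu>_ph_diff[OF n])
  have 3: "1 / Z \<le> 1 / 10 * (\<Lambda> * \<eta> / g)"
  proof -
    have "D * 1 \<le> real d * D" using d D_pos by simp
    then have "D \<le> Z" using dD_le by linarith
    then have "1 / Z \<le> v" unfolding v_def using D_pos Z_pos by (intro divide_left_mono) auto
    also have "v \<le> \<eta> / 10"
    proof -
      have "\<eta> * g \<le> \<eta> * 1" using g1 \<eta>_pos by (intro mult_left_mono) auto
      then show ?thesis using rb(3)[folded v_def] \<eta>_pos by linarith
    qed
    also have "\<eta> \<le> \<Lambda> * \<eta> / g"
    proof -
      have "1 * 1 \<le> \<Lambda> * (1 / g)" using \<Lambda>_ge g(1) g1 by (intro mult_mono) auto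
      then have "1 * \<eta> \<le> \<Lambda> * (1 / g) * \<eta>" using \<eta>_pos by (intro mult_right_mono) auto
      then show ?thesis by simp
    qed
    finally show ?thesis by simp
  qed
  have "0 \<le> \<Lambda> * \<eta> / g" using \<Lambda>_ge \<eta>_pos g(1) by simp
  then show ?thesis using 1 2 3 by linarith
qed

text \<open>The second and the last eigenvalue move by at most the norm of the perturbation, so
  there is no quadratic term; the coefficients add up to \<open>9 / 4 * 7 + 2\<close>.\<close>

lemma rev_gap_close:
  assumes W: "weighted_chain d M p"
    and peel: "peel_ok d M n (2 * \<tau>\<^sup>2 * real d) x"
    and g: "0 < g" "g = abs_gap_hat d \<alpha> n x" and small: "192 / g * \<Lambda> * \<eta> / \<mu>m < 2"
    and rev: "\<And>i j. i < d \<Longrightarrow> j < d \<Longrightarrow> p i * M $$ (i, j) = p j * M $$ (j, i)"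
  shows "\<bar>abs_gap_hat d \<alpha> n x - abs_spectral_gap M\<bar> \<le> 192 / g * \<Lambda> * \<eta> / \<mu>m"
proof -
  interpret W: weighted_chain d M p by (rule W)
  have g1: "g \<le> 1" using abs_gap_hat_range g by simp
  define u where "u = \<Lambda> * \<eta> / g"
  have u0: "0 < u" using \<Lambda>_ge \<eta>_pos g(1) by (simp add: u_def)
  have b: "192 / g * \<Lambda> * \<eta> = 192 * u" by (simp add: u_def)
  have us: "192 * u < 2 * \<mu>m" using small \<mu>m_pos unfolding b by (simp add: pos_divide_less_eq)
  then have s1: "192 / g * \<Lambda> * \<eta> < 1" unfolding b using \<mu>m_half by linarith
  have cl: "\<bar>ph i - p i\<bar> \<le> 6 * u" if "i < d" for i
    unfolding u_def by (rule rev_ph_close[OF W.stoch W.stat peel g s1 that])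
  have pp: "7 / 8 * \<mu>m \<le> p i" if "i < d" for i using cl[OF that] \<mu>m_le[OF that] us by linarith
  have \<eta>u: "\<eta> \<le> 3 / 4 * u"
  proof -
    have "4 / 3 * 1 \<le> \<Lambda> * (1 / g)" using \<Lambda>_ge g(1) g1 by (intro mult_mono) auto
    then have "4 / 3 * \<eta> \<le> \<Lambda> * (1 / g) * \<eta>" using \<eta>_pos by (intro mult_right_mono) auto
    moreover have "\<Lambda> * (1 / g) * \<eta> = u" by (simp add: u_def)
    ultimately show ?thesis by linarith
  qed
  have F: "op_bound d (conj_mat d ph (err M)) (2 * \<eta> / \<mu>m)"
  proof (rule op_bound_err[OF peel_row_error[OF W.stoch peel] \<mu>m_pos \<mu>m_le])
    show "0 \<le> 2 * \<eta> / \<mu>m" using \<eta>_pos \<mu>m_pos by simp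
    have "(\<Sum>i<d. ph i * (2 * \<eta>)\<^sup>2) = (\<Sum>i<d. ph i) * (2 * \<eta>)\<^sup>2" by (simp add: sum_distrib_right)
    also have "\<dots> \<le> 1 * (2 * \<eta>)\<^sup>2" by (intro mult_right_mono sum_ph_le) auto
    also have "\<dots> \<le> (1 / \<mu>m) * (2 * \<eta>)\<^sup>2" using \<mu>m_pos \<mu>m_half by (intro mult_right_mono) auto
    also have "\<dots> = \<mu>m * (2 * \<eta> / \<mu>m)\<^sup>2" using \<mu>m_pos by (simp add: power_divide) (simp add: power2_eq_square)
    finally show "(\<Sum>i<d. ph i * (2 * \<eta>)\<^sup>2) \<le> \<mu>m * (2 * \<eta> / \<mu>m)\<^sup>2" .
  qed
  let ?C = "Matrix.mat d d (\<lambda>(i, j). conj_mat d ph MH $$ (i, j) - conj_mat d p M $$ (i, j))"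
  have C: "op_bound d ?C (9 / 4 * (7 * (u / \<mu>m)) + 2 * \<eta> / \<mu>m)"
  proof (rule conj_mat_close[OF W _ pp _ _ _ F])
    show "0 < 7 / 8 * \<mu>m" using \<mu>m_pos by simp
    show "\<bar>ph i - p i\<bar> \<le> 7 * (u / \<mu>m) * (7 / 8 * \<mu>m)" if "i < d" for i
    proof -
      have "7 * (u / \<mu>m) * (7 / 8 * \<mu>m) = 49 / 8 * u" using \<mu>m_pos by simp
      then show ?thesis using cl[OF that] u0 by linarith
    qed
    show "0 \<le> 7 * (u / \<mu>m)" using u0 \<mu>m_pos by simp
    show "7 * (u / \<mu>m) \<le> 1 / 4" using us u0 \<mu>m_pos by (simp add: pos_divide_le_eq)
  qed
  have M: "abs_spectral_gap M = abs_spectral_gap (sym_part d (conj_mat d p M))"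
    by (rule W.abs_spectral_gap_reversible[OF rev])
  have "\<bar>abs_spectral_gap (sym_part d (conj_mat d ph MH)) - abs_spectral_gap (sym_part d (conj_mat d p M))\<bar>
     \<le> 9 / 4 * (7 * (u / \<mu>m)) + 2 * \<eta> / \<mu>m"
  proof (rule abs_spectral_gap_perturb[OF sym_part_sym_mat sym_part_sym_mat d])
    fix z
    have "ip d z (mv d ?C z) = ip d z (mv d (conj_mat d ph MH) z) - ip d z (mv d (conj_mat d p M) z)"
      unfolding ip_linear(4)[symmetric] by (intro ip_cong) (auto simp: mv_def left_diff_distrib sum_subtractf)
    then show "\<bar>ip d z (mv d (sym_part d (conj_mat d ph MH)) z) - ip d z (mv d (sym_part d (conj_mat d p M)) z)\<bar>
       \<le> (9 / 4 * (7 * (u / \<mu>m)) + 2 * \<eta> / \<mu>m) * ip d z z"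
      unfolding sym_part_quadratic using op_bound_quadratic[OF C, of z] by simp
  qed
  also have "\<dots> \<le> 9 / 4 * (7 * (u / \<mu>m)) + 2 * (u / \<mu>m)"
    using \<eta>u u0 \<mu>m_pos by (intro add_left_mono) (simp add: divide_right_mono)
  also have "\<dots> \<le> 192 * (u / \<mu>m)"
  proof -
    have *: "9 / 4 * (7 * z) + 2 * z \<le> 192 * z" if "0 \<le> z" for z :: real using that by simp
    show ?thesis by (rule *) (use u0 \<mu>m_pos in simp)
  qed
  also have "\<dots> = 192 / g * \<Lambda> * \<eta> / \<mu>m" by (simp add: u_def)
  finally show ?thesis unfolding abs_gap_hat_eq M .
qed

end

section \<open>Confidence intervals\<close>

text \<open>A term beyond \<open>K\<close> is at most \<open>1 / K\<close>, and the maximum plus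
  \<open>E\<close> is nonnegative, so the claimed bound covers that term as well.\<close>

lemma Max_near_SUP:
  fixes a h :: "nat \<Rightarrow> real"
  assumes K: "1 \<le> K" and e: "\<And>k. 1 \<le> k \<Longrightarrow> k \<le> K \<Longrightarrow> \<bar>a k - h k\<bar> \<le> E"
    and h: "\<And>k. 1 \<le> k \<Longrightarrow> 0 \<le> h k" "\<And>k. 1 \<le> k \<Longrightarrow> h k \<le> 1 / real k"
    and b: "bdd_above (h ` {1..})"
  shows "\<bar>Max (a ` {1..K}) - (SUP k\<in>{1..}. h k)\<bar> \<le> 1 / real K + E"
proof -
  have ne: "finite (a ` {1..K})" "a ` {1..K} \<noteq> {}" using K by auto
  have mx: "a k \<le> Max (a ` {1..K})" if "1 \<le> k" "k \<le> K" for k using that ne by (intro Max_ge) auto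
  have "Max (a ` {1..K}) \<le> (SUP k\<in>{1..}. h k) + E"
  proof (rule Max.boundedI[OF ne])
    fix y assume "y \<in> a ` {1..K}"
    then obtain k where k: "1 \<le> k" "k \<le> K" "y = a k" by auto
    have "h k \<le> (SUP k\<in>{1..}. h k)" using k by (intro cSUP_upper b) auto
    then show "y \<le> (SUP k\<in>{1..}. h k) + E" using e[OF k(1,2)] k(3) by linarith
  qed
  moreover have "(SUP k\<in>{1..}. h k) \<le> 1 / real K + (Max (a ` {1..K}) + E)"
  proof (rule cSUP_least)
    fix k :: nat assume "k \<in> {1..}"
    then have k: "1 \<le> k" by simp
    have K0: "0 \<le> 1 / real K" by simp
    show "h k \<le> 1 / real K + (Max (a ` {1..K}) + E)"
    proof (cases "k \<le> K")
      case True
      then show ?thesis using e[OF k True] mx[OF k True] K0 by linarith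
    next
      case False
      then have "1 / real k \<le> 1 / real K" using K by (intro divide_left_mono) auto
      moreover have "0 \<le> Max (a ` {1..K}) + E" using e[of 1] mx[of 1] h(1)[of 1] K by linarith
      ultimately show ?thesis using h(2)[OF k] by linarith
    qed
  qed simp
  moreover have "0 \<le> 1 / real K" by simp
  ultimately show ?thesis by linarith
qed

lemma sublen_ge:
  assumes "r < k" shows "real n / real k - 2 \<le> real (sublen n k r)"
proof -
  have "n - r < k * (sublen n k r + 1)"
    unfolding sublen_def using assms dividend_less_times_div[of k "n - r"] by (simp add: algebra_simps)
  then have "n \<le> k * (sublen n k r + 2)" using assms by (simp add: algebra_simps)
  then have "real n \<le> real (k * (sublen n k r + 2))" by (simp only: of_nat_le_iff)
  then have "real n / real k \<le> real (sublen n k r) + 2" using assms by (simp add: field_simps)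
  then show ?thesis by simp
qed

lemma skipped_time_le:
  assumes "1 \<le> t" "t \<le> sublen n k r" "1 \<le> k" shows "r + t * k \<le> n" "1 \<le> r + t * k"
proof -
  have "t * k \<le> n - r" using assms(2,3) by (simp add: sublen_def less_eq_div_iff_mult_less_eq)
  moreover have "1 \<le> t * k" using assms by simp
  ultimately show "r + t * k \<le> n" "1 \<le> r + t * k" by linarith+
qed

lemma reversible_detailed_balance:
  assumes "ergodic d M" "2 \<le> d" "reversible M" "i < d" "j < d"
  shows "stationary M i * M $$ (i, j) = stationary M j * M $$ (j, i)"
proof -
  have d: "0 < d" using assms(2) by simp
  have dim: "dim_row M = d" using stochastic_matD(1)[OF ergodicD(1)[OF assms(1) d]] by simp
  have "M $$ (i, j) = time_reversal M $$ (i, j)" using assms(3) by (simp add: reversible_def)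
  also have "\<dots> = stationary M j * M $$ (j, i) / stationary M i" using assms by (simp add: time_reversal_def dim)
  finally show ?thesis using ergodicD(3)[OF assms(1) d assms(4)] by (simp add: field_simps)
qed

lemma (in traj) traj_skipped: "1 \<le> k \<Longrightarrow> traj d (sublen n k r) (skipped k r x) \<alpha>"
  unfolding traj_def skipped_def
  by (intro conjI d \<alpha> allI impI range) (rule skipped_time_le; assumption)+

context conf
begin

text \<open>A smallest smoothed count below 1 forces \<open>\<eta> \<ge> 6\<close>, and then the
  width is at least \<open>1536 * Z / D\<close>, while \<open>1\<close> and \<open>bd / D\<close>
  are both at most \<open>Z / D\<close>.\<close>

lemma crude_width:
  assumes D: "D < 1" and g: "0 < g" "g \<le> 1"
  shows "1 + bd / D \<le> 192 / g * \<Lambda> * \<eta> / \<mu>m"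
proof -
  have "real d \<le> real d / D" using D D_pos d by (simp add: pos_le_divide_eq)
  then have "1 \<le> sqrt (real d / D)" using d by simp
  then have "4 * (3 / 2) * 1 \<le> \<eta>1" unfolding \<eta>1_def using \<tau>_ge by (intro mult_mono) auto
  then have \<eta>: "6 \<le> \<eta>" using \<eta>2_pos by (simp add: \<eta>_def)
  have "1 \<le> 1 / g" using g by simp
  then have "192 * 1 * (4 / 3) * 6 \<le> 192 * (1 / g) * \<Lambda> * \<eta>"
    using \<Lambda>_ge \<eta> g(1) by (intro mult_mono) auto
  then have 1: "1536 * (1 / \<mu>m) \<le> 192 * (1 / g) * \<Lambda> * \<eta> * (1 / \<mu>m)"
    using \<mu>m_pos by (intro mult_right_mono) auto
  have "1 / \<mu>m = Z / D" by (simp add: \<mu>m_def)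
  moreover have "1 * D \<le> real d * D" using d D_pos by (intro mult_right_mono) auto
  then have "D \<le> Z" using dD_le by linarith
  then have "1 \<le> Z / D" using D_pos by simp
  moreover have "bd \<le> Z" unfolding bd_def Z_def using \<alpha> by (auto intro: add_increasing2)
  then have "bd / D \<le> Z / D" using D_pos by (intro divide_right_mono) auto
  ultimately have "1 + bd / D \<le> 1536 * (1 / \<mu>m)" by linarith
  then show ?thesis using 1 by simp
qed

text \<open>If \<open>D < 1\<close>, the estimate may lie outside \<open>[0,1]\<close>, but then the interval is wide.\<close>

lemma trivial_gap_close:
  assumes v: "0 \<le> v" "v \<le> 1" and D: "D < 1" and g: "g \<le> 1" and G: "G \<le> 1" "- (bd / D) \<le> G"
  shows "ereal \<bar>G - v\<bar> \<le> gap_width 192 g d \<alpha> \<delta> n 1 0 x"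
proof (cases "0 < g")
  case True
  have "0 \<le> bd / D" using D_pos by (simp add: bd_def)
  then have "\<bar>G - v\<bar> \<le> 1 + bd / D" using v G by linarith
  also have "\<dots> \<le> 192 / g * \<Lambda> * \<eta> / \<mu>m" by (rule crude_width[OF D True g])
  finally have "ereal \<bar>G - v\<bar> \<le> ereal (192 / g * \<Lambda> * \<eta> / \<mu>m)" by simp
  also have "\<dots> \<le> gap_width 192 g d \<alpha> \<delta> n 1 0 x" by (rule gap_width_ge[OF True]) simp
  finally show ?thesis .
qed (use gap_width_inf[of g 192] in simp)

lemma gap_width_nonneg: "0 \<le> gap_width 192 g d \<alpha> \<delta> n 1 0 x"
proof (cases "0 < g")
  case True
  then have "0 \<le> 192 / g * \<Lambda> * \<eta> / \<mu>m" using \<Lambda>_ge \<eta>_pos \<mu>m_pos by simp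
  then have "0 \<le> ereal (192 / g * \<Lambda> * \<eta> / \<mu>m)" by simp
  then show ?thesis using gap_width_ge[OF True, of 192] by (meson order_trans zero_le_numeral)
qed (use gap_width_inf[of g 192] in simp)

text \<open>If \<open>k\<close> times the bound at skip 1 is below 2,
  \<open>skipped_gap_close\<close> applies. Otherwise it covers every error up to 2, which is the
  maximum when the smallest smoothed count at \<open>(k, r)\<close> is at least 1. In the remaining
  case the width at \<open>(k, r)\<close> itself covers the error.\<close>

lemma gap_dagger_close:
  assumes W: "weighted_chain d M p" and k: "1 \<le> k" and r: "r < k"
    and base: "1 \<le> n \<Longrightarrow> flat_ok d M n (4 * \<tau> * sqrt (real d)) x"
    and flat: "1 \<le> sublen n k r \<Longrightarrow> flat_ok d (M ^\<^sub>m k) (sublen n k r) (4 * \<tau> * sqrt (real k * real d)) (skipped k r x)"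
    and g: "0 < g" "g = pseudo_gap MH"
  shows "ereal (\<bar>gap_dagger_hat d \<alpha> n k r x - gram_gap d p (M ^\<^sub>m k)\<bar> - real k * (192 / g * \<Lambda> * \<eta> / \<mu>m))
    \<le> gap_width 192 (pseudo_gap (M_hat d \<alpha> n k r x)) d \<alpha> \<delta> n k r x"
proof -
  interpret W: weighted_chain d M p by (rule W)
  interpret Wk: weighted_chain d "M ^\<^sub>m k" p by (rule W.weighted_chain_pow)
  interpret H: weighted_chain d MH "stationary MH" by (rule ergodic_weighted_chain[OF MH_ergodic d])
  have y: "traj d (sublen n k r) (skipped k r x) \<alpha>" by (rule traj_skipped[OF k])
  interpret Y: conf d "sublen n k r" "skipped k r x" \<alpha> \<delta>
    by (rule conf.intro[OF y]) (unfold_locales, (rule \<delta>)+)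
  interpret YH: weighted_chain d Y.MH "stationary Y.MH" by (rule ergodic_weighted_chain[OF Y.MH_ergodic d])
  have g1: "g \<le> 1" using H.pseudo_gap_bounds(2) g by simp
  let ?B = "192 / g * \<Lambda> * \<eta> / \<mu>m" and ?G = "gap_dagger_hat d \<alpha> n k r x" and ?v = "gram_gap d p (M ^\<^sub>m k)"
  let ?W = "gap_width 192 (pseudo_gap Y.MH) d \<alpha> \<delta> (sublen n k r) 1 0 (skipped k r x)"
  have B: "0 \<le> ?B" using \<Lambda>_ge \<eta>_pos \<mu>m_pos g by simp
  have G: "?G = gram_gap d Y.ph Y.MH"
    using gap_dagger_hat_skipped[of d \<alpha> n k r x] Y.gap_dagger_hat_eq by simp
  have W: "gap_width 192 (pseudo_gap (M_hat d \<alpha> n k r x)) d \<alpha> \<delta> n k r x = ?W"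
    using gap_width_skipped[of 192 _ d \<alpha> \<delta> n k r x] M_hat_skipped[of d \<alpha> n k r x] by (simp add: Y.MH_def)
  have w0: "0 \<le> ?W" by (rule Y.gap_width_nonneg)
  have v: "0 \<le> ?v" "?v \<le> 1" by (rule Wk.gram_gap_bounds)+
  show ?thesis
  proof (cases "?B * real k < 2")
    case True
    have "?B \<le> ?B * real k" using k B mult_left_mono[of 1 "real k" ?B] by simp
    then have small: "?B < 2" using True by linarith
    have n: "1 \<le> n" by (rule base_facts(11)[OF g(1) g1 k True])
    have nk: "real n / real k - 2 \<le> real (sublen n k r)" by (rule sublen_ge[OF r])
    have n1: "1 \<le> sublen n k r" by (rule skipped_aux(1)[OF g(1) g1 k True y nk])
    obtain T where T: "contr d (M ^\<^sub>m T) (3 / 4)" "real T \<le> 4 * \<Lambda> / g"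
      using base_contraction[OF W.stoch base[OF n] g small] by blast
    have "\<bar>?G - ?v\<bar> \<le> real k * ?B"
      unfolding G by (rule skipped_gap_close[OF g(1) g1 k True \<open>weighted_chain d M p\<close> T base[OF n] y nk flat[OF n1]])
    then have "ereal (\<bar>?G - ?v\<bar> - real k * ?B) \<le> 0" by simp
    then show ?thesis unfolding W using w0 by (rule order_trans)
  next
    case False
    then have kB: "2 \<le> real k * ?B" by (simp add: mult.commute)
    show ?thesis
    proof (cases "1 \<le> Y.D")
      case True
      have "Y.bd / Y.D \<le> 1" using True by (simp add: Y.bd_def)
      then have "\<bar>?G - ?v\<bar> \<le> 2" unfolding G using Y.gap_dagger_hat_bounds v by linarith
      then have "ereal (\<bar>?G - ?v\<bar> - real k * ?B) \<le> 0" using kB by simp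
      then show ?thesis unfolding W using w0 by (rule order_trans)
    next
      case False
      have "ereal \<bar>?G - ?v\<bar> \<le> ?W" unfolding G
        by (rule Y.trivial_gap_close[OF v]) (use False Y.gap_dagger_hat_bounds YH.pseudo_gap_bounds(2) in auto)
      moreover have "ereal (\<bar>?G - ?v\<bar> - real k * ?B) \<le> ereal \<bar>?G - ?v\<bar>" using kB by simp
      ultimately show ?thesis unfolding W by (rule order_trans[rotated])
    qed
  qed
qed

lemma ps_interval:
  assumes M: "ergodic d M" and K: "1 \<le> K"
    and flat: "\<And>k r. 1 \<le> k \<Longrightarrow> k \<le> K \<Longrightarrow> r < k \<Longrightarrow> 1 \<le> sublen n k r \<Longrightarrow>
      flat_ok d (M ^\<^sub>m k) (sublen n k r) (4 * \<tau> * sqrt (real k * real d)) (skipped k r x)"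
  shows "ereal \<bar>pseudo_gap_hat d \<alpha> n K x - pseudo_gap M\<bar> \<le> ps_gap_width 192 d \<alpha> \<delta> n K x"
proof -
  define g where "g = pseudo_gap MH"
  have W: "weighted_chain d M (stationary M)" by (rule ergodic_weighted_chain[OF M d])
  interpret W: weighted_chain d M "stationary M" by (rule W)
  define F where "F k r = gap_width 192 (pseudo_gap (M_hat d \<alpha> n k r x)) d \<alpha> \<delta> n k r x" for k r
  define V where "V k = ereal (1 / (real k)\<^sup>2) * (\<Sum>r<k. F k r)" for k
  define w where "w = Max (V ` {1..K})"
  have wd: "ps_gap_width 192 d \<alpha> \<delta> n K x = ereal (1 / real K) + 2 * w"
    unfolding ps_gap_width_def w_def V_def F_def by (rule refl)
  have Vw: "V k \<le> w" if "1 \<le> k" "k \<le> K" for k unfolding w_def using that by (intro Max_ge) auto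
  have F1: "V 1 = gap_width 192 g d \<alpha> \<delta> n 1 0 x" by (simp add: V_def F_def g_def MH_def)
  show ?thesis
  proof (cases "0 < g")
    case False
    then have "gap_width 192 g d \<alpha> \<delta> n 1 0 x = \<infinity>" by (intro gap_width_inf) auto
    then have "w = \<infinity>" using Vw[of 1] K unfolding F1 by simp
    then show ?thesis by (simp add: wd)
  next
    case True
    define B where "B = 192 / g * \<Lambda> * \<eta> / \<mu>m"
    have Bw: "ereal B \<le> w"
      using gap_width_ge[OF True, of 192] Vw[of 1] K unfolding F1 B_def by (auto intro: order_trans)
    define h where "h k = gram_gap d (stationary M) (M ^\<^sub>m k)" for k
    define e where "e k = (1 / (real k)\<^sup>2) * (\<Sum>r<k. \<bar>gap_dagger_hat d \<alpha> n k r x - h k\<bar>)" for k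
    have base: "flat_ok d M n (4 * \<tau> * sqrt (real d)) x" if "1 \<le> n"
      using flat[of 1 0] K that pow_mat_dim stochastic_matD(1)[OF W.stoch] by simp
    have ew: "ereal (e k) \<le> 2 * w" if k: "1 \<le> k" "k \<le> K" for k
    proof -
      have k2: "(real k)\<^sup>2 \<noteq> 0" using k by simp
      \<comment> \<open>Each of the \<open>k\<close> offsets is charged \<open>k * B\<close>;
        divided by \<open>k^2\<close> the charges add up to \<open>B\<close>.\<close>
      have "ereal (e k - B) = ereal (1 / (real k)\<^sup>2) * (\<Sum>r<k. ereal (\<bar>gap_dagger_hat d \<alpha> n k r x - h k\<bar> - real k * B))"
        using k k2 by (simp add: e_def sum_subtractf right_diff_distrib power2_eq_square)
      also have "\<dots> \<le> V k" unfolding V_def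
      proof (intro ereal_mult_left_mono sum_mono)
        fix r assume "r \<in> {..<k}"
        then have r: "r < k" by simp
        show "ereal (\<bar>gap_dagger_hat d \<alpha> n k r x - h k\<bar> - real k * B) \<le> F k r"
          unfolding F_def B_def h_def
          by (rule gap_dagger_close[OF W k(1) r base flat[OF k r] True g_def])
      qed simp
      also have "\<dots> \<le> w" by (rule Vw[OF k])
      \<comment> \<open>The factor 2 of the width is spent here: \<open>w\<close> dominates the
        average at skip \<open>k\<close> and, through \<open>k = 1\<close>, also
        \<open>B\<close>.\<close>
      finally have "ereal (e k - B) + ereal B \<le> w + w" using Bw by (rule add_mono)
      moreover have "w + w = 2 * w" by (cases w) auto
      ultimately show ?thesis by simp
    qed
    define E where "E = Max (e ` {1..K})"
    have "E \<in> e ` {1..K}" unfolding E_def using K by (intro Max_in) auto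
    then have Ew: "ereal E \<le> 2 * w" using ew by auto
    have "\<bar>pseudo_gap_hat d \<alpha> n K x - pseudo_gap M\<bar> \<le> 1 / real K + E"
      unfolding pseudo_gap_hat_def W.pseudo_gap_SUP[OF refl]
    proof (rule Max_near_SUP[OF K _ W.gram_gap_term_bounds W.bdd_above_gram_gaps])
      fix k assume k: "1 \<le> k" "k \<le> K"
      have "gap_dagger_avg d \<alpha> n k x / real k - h k / real k = (1 / (real k)\<^sup>2) * (\<Sum>r<k. gap_dagger_hat d \<alpha> n k r x - h k)"
        using k by (simp add: gap_dagger_avg_def sum_subtractf field_simps power2_eq_square)
      also have "\<bar>\<dots>\<bar> \<le> e k" unfolding e_def abs_mult by (intro mult_mono sum_abs) auto
      also have "e k \<le> E" unfolding E_def using k by (intro Max_ge) auto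
      finally show "\<bar>gap_dagger_avg d \<alpha> n k x / real k - gram_gap d (stationary M) (M ^\<^sub>m k) / real k\<bar> \<le> E"
        by (simp add: h_def)
    qed
    then have "ereal \<bar>pseudo_gap_hat d \<alpha> n K x - pseudo_gap M\<bar> \<le> ereal (1 / real K) + ereal E" by simp
    also have "\<dots> \<le> ereal (1 / real K) + 2 * w" using Ew by (rule add_left_mono)
    finally show ?thesis by (simp add: wd)
  qed
qed

text \<open>The trivial case is a width of at least 2 for the gap, but already
  \<open>b \<ge> 1\<close> for \<open>pi_star\<close>, since frequencies lie in the unit interval.
  The second claim rests on \<open>rev_ph_close\<close>, the first on
  \<open>rev_gap_close\<close>.\<close>

lemma rev_interval:
  assumes M: "ergodic d M" and rev: "reversible M"
    and peel: "1 \<le> n \<Longrightarrow> peel_ok d M n (2 * \<tau>\<^sup>2 * real d) x"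
    and gM: "0 \<le> abs_spectral_gap M" "abs_spectral_gap M \<le> 1"
  shows "ereal \<bar>abs_gap_hat d \<alpha> n x - abs_spectral_gap M\<bar> \<le> rev_gap_width 192 d \<alpha> \<delta> n x"
    and "ereal \<bar>pi_star_hat d \<alpha> n x - pi_star M\<bar> \<le> rev_b_width 192 d \<alpha> \<delta> n x"
proof -
  define g where "g = abs_gap_hat d \<alpha> n x"
  have W: "weighted_chain d M (stationary M)" by (rule ergodic_weighted_chain[OF M d])
  interpret W: weighted_chain d M "stationary M" by (rule W)
  have dim: "dim_row M = d" using stochastic_matD(1)[OF W.stoch] by simp
  note rv = reversible_detailed_balance[OF M d rev]
  have g1: "g \<le> 1" using abs_gap_hat_range by (simp add: g_def)
  have ne: "finite (f ` {..<d})" "f ` {..<d} \<noteq> {}" for f :: "nat \<Rightarrow> real" using d by (auto simp: lessThan_empty_iff)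
  have gl: "- (bd / D) \<le> g"
  proof -
    have "0 \<le> bd / D" using D_pos by (simp add: bd_def)
    moreover have "sqrt (1 + bd / D) \<le> sqrt ((1 + bd / D)\<^sup>2)"
    proof (rule real_sqrt_le_mono)
      have "y \<le> y\<^sup>2" if "1 \<le> y" for y :: real using that self_le_power[of y 2] by simp
      then show "1 + bd / D \<le> (1 + bd / D)\<^sup>2" using calculation by simp
    qed
    ultimately show ?thesis using abs_gap_hat_range(2) by (simp add: g_def)
  qed
  show "ereal \<bar>abs_gap_hat d \<alpha> n x - abs_spectral_gap M\<bar> \<le> rev_gap_width 192 d \<alpha> \<delta> n x"
    unfolding rev_gap_width_def g_def[symmetric]
  proof (cases "0 < g")
    case True
    let ?B = "192 / g * \<Lambda> * \<eta> / \<mu>m"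
    have w: "ereal ?B \<le> gap_width 192 g d \<alpha> \<delta> n 1 0 x" by (rule gap_width_ge[OF True]) simp
    show "ereal \<bar>g - abs_spectral_gap M\<bar> \<le> gap_width 192 g d \<alpha> \<delta> n 1 0 x"
    proof (cases "?B < 2")
      case small: True
      have n: "1 \<le> n" by (rule base_facts(11)[OF True g1, of 1]) (use small in auto)
      have "\<bar>g - abs_spectral_gap M\<bar> \<le> ?B" unfolding g_def
        by (rule rev_gap_close[OF W peel[OF n] True[unfolded g_def] refl small[unfolded g_def] rv])
      then show ?thesis using w by (meson ereal_less_eq(3) order_trans)
    next
      case False
      show ?thesis
      proof (cases "1 \<le> D")
        case True
        have "bd / D \<le> 1" using True by (simp add: bd_def)
        then have "\<bar>g - abs_spectral_gap M\<bar> \<le> ?B" using False gl g1 gM by linarith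
        then show ?thesis using w by (meson ereal_less_eq(3) order_trans)
      next
        case False
        then show ?thesis using trivial_gap_close[OF gM _ g1 g1 gl] by simp
      qed
    qed
  qed (use gap_width_inf[of g 192] in simp)
  have ph1: "ph i \<le> 1" if "i < d" for i
  proof -
    have "ph i \<le> (\<Sum>i<d. ph i)" using that less_imp_le[OF ph_pos] by (intro member_le_sum) auto
    then show ?thesis using sum_ph_le by linarith
  qed
  have p1: "stationary M i \<le> 1" if "i < d" for i
  proof -
    have "stationary M i \<le> (\<Sum>i<d. stationary M i)" using that less_imp_le[OF W.pos] by (intro member_le_sum) auto
    then show ?thesis using W.sum_p by linarith
  qed
  have close: "\<bar>pi_star_hat d \<alpha> n x - pi_star M\<bar> \<le> e" if e: "\<And>i. i < d \<Longrightarrow> \<bar>ph i - stationary M i\<bar> \<le> e" for e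
  proof -
    obtain i where i: "i < d" "ph i = Min (ph ` {..<d})" using Min_in[OF ne[of ph]] by auto
    obtain j where j: "j < d" "stationary M j = Min (stationary M ` {..<d})" using Min_in[OF ne[of "stationary M"]] by auto
    have "ph i \<le> ph j" using j(1) i(2) ne[of ph] by (simp add: Min_le)
    moreover have "stationary M j \<le> stationary M i" using i(1) j(2) ne[of "stationary M"] by (simp add: Min_le)
    ultimately show ?thesis using e[OF i(1)] e[OF j(1)] i(2) j(2)
      unfolding pi_star_hat_def pi_star_def dim ph_def by linarith
  qed
  show "ereal \<bar>pi_star_hat d \<alpha> n x - pi_star M\<bar> \<le> rev_b_width 192 d \<alpha> \<delta> n x"
    unfolding rev_b_width_def g_def[symmetric]
  proof (cases "0 < g")
    case True
    let ?b = "192 / g * \<Lambda> * \<eta>"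
    have "\<bar>pi_star_hat d \<alpha> n x - pi_star M\<bar> \<le> ?b"
    proof (cases "?b < 1")
      case small: True
      have n: "1 \<le> n" by (rule rev_base(4)[OF True g1 small])
      have "\<bar>ph i - stationary M i\<bar> \<le> 6 * (\<Lambda> * \<eta> / g)" if "i < d" for i unfolding g_def
        by (rule rev_ph_close[OF W.stoch W.stat peel[OF n] True[unfolded g_def] refl small[unfolded g_def] that])
      then have "\<bar>pi_star_hat d \<alpha> n x - pi_star M\<bar> \<le> 6 * (\<Lambda> * \<eta> / g)" by (rule close)
      also have "\<dots> \<le> 192 * (\<Lambda> * \<eta> / g)" using \<Lambda>_ge \<eta>_pos True by (intro mult_right_mono) auto
      finally show ?thesis by simp
    next
      case False
      have "\<bar>pi_star_hat d \<alpha> n x - pi_star M\<bar> \<le> 1"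
      proof (rule close)
        fix i assume i: "i < d"
        show "\<bar>ph i - stationary M i\<bar> \<le> 1" using ph1[OF i] p1[OF i] ph_pos[of i] W.pos[OF i] by linarith
      qed
      then show ?thesis using False by linarith
    qed
    then show "ereal \<bar>pi_star_hat d \<alpha> n x - pi_star M\<bar> \<le> b_width 192 g d \<alpha> \<delta> n 1 0 x"
      unfolding b_width_pos[OF True] by simp
  qed (use b_width_inf[of g 192] in simp)
qed

end

lemma counts_depend:
  assumes "\<And>t. 1 \<le> t \<Longrightarrow> t \<le> m \<Longrightarrow> x t = y t"
  shows "visits m k r x = visits m k r y" "transitions m k r x = transitions m k r y"
proof -
  have s: "skipped k r x t = skipped k r y t" if "1 \<le> t" "t \<le> sublen m k r" for t
  proof (cases "1 \<le> k")
    case True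
    then show ?thesis unfolding skipped_def by (intro assms skipped_time_le[OF that True])
  next
    case False
    \<comment> \<open>Division by 0 makes \<open>sublen\<close> 0, so there is no such time
      \<open>t\<close>.\<close>
    then have "k = 0" by simp
    then show ?thesis using that by (simp add: sublen_def)
  qed
  show "visits m k r x = visits m k r y"
    by (rule ext, unfold visits_def, rule arg_cong[where f = card]) (use s in \<open>auto intro: Collect_cong\<close>)
  show "transitions m k r x = transitions m k r y"
    by (intro ext, unfold transitions_def, rule arg_cong[where f = card]) (use s in \<open>auto intro: Collect_cong\<close>)
qed

lemmas estimator_defs = pseudo_gap_hat_def gap_dagger_avg_def gap_dagger_hat_def L_hat_def M_hat_def
  pi_star_hat_def abs_gap_hat_def visits_min_def visits_max_def d_width_def a_width_def b_width_def c_width_def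
  gap_width_def ps_gap_width_def rev_b_width_def rev_gap_width_def

lemma depends_ps_interval: "depends_upto m (\<lambda>x. ereal \<bar>pseudo_gap_hat d \<alpha> m K x - v\<bar> \<le> ps_gap_width C d \<alpha> \<delta> m K x)"
  unfolding depends_upto_def
proof (intro allI impI)
  fix x y :: "nat \<Rightarrow> nat" assume "\<forall>t\<in>{1..m}. x t = y t"
  then have *: "visits m k r x = visits m k r y" "transitions m k r x = transitions m k r y" for k r
    using counts_depend[of m x y] by auto
  then have "pi_hat d \<alpha> m k r x = pi_hat d \<alpha> m k r y" for k r by (simp add: pi_hat_def fun_eq_iff)
  then show "(ereal \<bar>pseudo_gap_hat d \<alpha> m K x - v\<bar> \<le> ps_gap_width C d \<alpha> \<delta> m K x) =
    (ereal \<bar>pseudo_gap_hat d \<alpha> m K y - v\<bar> \<le> ps_gap_width C d \<alpha> \<delta> m K y)"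
    by (simp only: estimator_defs *)
qed

lemma depends_rev_interval: "depends_upto m (\<lambda>x. ereal \<bar>abs_gap_hat d \<alpha> m x - v\<bar> \<le> rev_gap_width C d \<alpha> \<delta> m x \<and>
    ereal \<bar>pi_star_hat d \<alpha> m x - v'\<bar> \<le> rev_b_width C d \<alpha> \<delta> m x)"
  unfolding depends_upto_def
proof (intro allI impI)
  fix x y :: "nat \<Rightarrow> nat" assume "\<forall>t\<in>{1..m}. x t = y t"
  then have *: "visits m k r x = visits m k r y" "transitions m k r x = transitions m k r y" for k r
    using counts_depend[of m x y] by auto
  then have "pi_hat d \<alpha> m k r x = pi_hat d \<alpha> m k r y" for k r by (simp add: pi_hat_def fun_eq_iff)
  then show "(ereal \<bar>abs_gap_hat d \<alpha> m x - v\<bar> \<le> rev_gap_width C d \<alpha> \<delta> m x \<and>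
      ereal \<bar>pi_star_hat d \<alpha> m x - v'\<bar> \<le> rev_b_width C d \<alpha> \<delta> m x) =
    (ereal \<bar>abs_gap_hat d \<alpha> m y - v\<bar> \<le> rev_gap_width C d \<alpha> \<delta> m y \<and>
      ereal \<bar>pi_star_hat d \<alpha> m y - v'\<bar> \<le> rev_b_width C d \<alpha> \<delta> m y)"
    by (simp only: estimator_defs *)
qed

text \<open>Total failure probability, in units of \<open>\<delta>\<close>, of the \<open>k\<close>
  offsets at all skips; the terms are at most \<open>2^(-k)\<close>.\<close>

lemma sum_k_over_9_pow: "(\<Sum>k=1..K. real k * (1 / 9) ^ k) \<le> 1"
proof -
  have t: "real k * (1 / 9) ^ k \<le> (1 / 2) ^ k" for k
  proof -
    have "real k * (1 / 9) ^ k \<le> 2 ^ k * (1 / 4) ^ k"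
      using less_exp[of k] by (intro mult_mono power_mono) (auto simp: of_nat_less_two_power less_imp_le)
    also have "\<dots> = (1 / 2 :: real) ^ k" unfolding power_mult_distrib[symmetric] by simp
    finally show ?thesis .
  qed
  have "(\<Sum>k=1..K. real k * (1 / 9) ^ k) \<le> (\<Sum>k=1..K. (1 / 2 :: real) ^ k)" by (intro sum_mono t)
  also have "\<dots> = 1 - (1 / 2) ^ K" by (induction K) auto
  finally show ?thesis by (simp add: order_trans)
qed

text \<open>The exponent is \<open>t^2 * k * d\<close>, at least \<open>t * (1 + k * d)\<close>. One
  factor \<open>exp (- t)\<close> supplies \<open>\<delta>\<close> and cancels \<open>d + 1\<close>.
  The other \<open>k * d\<close> factors are at most \<open>1 / 6\<close> each; they absorb the
  \<open>2^d\<close> sign vectors and, as \<open>d \<ge> 2\<close>, leave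
  \<open>9^(-k)\<close>.\<close>

lemma flat_failure_bound:
  fixes d k :: nat and n :: nat
  assumes \<delta>: "0 < \<delta>" "\<delta> < 1" and d: "2 \<le> d" and k: "1 \<le> k"
  defines "t \<equiv> tau d (\<delta> / real d) n"
  shows "(real d + 1) * 2 ^ d * exp (- ((4 * t * sqrt (real k * real d))\<^sup>2 / 16)) \<le> \<delta> * (1 / 9) ^ k"
proof -
  have t: "3 / 2 \<le> t" and E: "exp (- t) \<le> \<delta> / (real d * (real d + 1))"
    using tau_basic[OF \<delta> d] by (auto simp: t_def)
  have kd: "2 \<le> real k * real d" using k d mult_mono[of 1 "real k" 2 "real d"] by simp
  have "6 \<le> real d * (real d + 1)" using d mult_mono[of 2 "real d" 3 "real d + 1"] by simp
  then have "\<delta> / (real d * (real d + 1)) \<le> 1 / 6" using \<delta> by (intro frac_le) auto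
  then have E6: "exp (- t) \<le> 1 / 6" using E by linarith
  have "t * (1 + real k * real d) \<le> t * (t * (real k * real d))"
  proof (intro mult_left_mono)
    have "3 / 2 * (real k * real d) \<le> t * (real k * real d)" using t kd by (intro mult_right_mono) auto
    then show "1 + real k * real d \<le> t * (real k * real d)" using kd by linarith
  qed (use t in simp)
  moreover have "(4 * t * sqrt (real k * real d))\<^sup>2 / 16 = t * (t * (real k * real d))"
    unfolding power_mult_distrib by (simp add: power2_eq_square)
  ultimately have "exp (- ((4 * t * sqrt (real k * real d))\<^sup>2 / 16)) \<le> exp (- (t * (1 + real k * real d)))"
    by simp
  also have "\<dots> = exp (- t) * exp (- t) ^ (k * d)"
    by (simp add: exp_add[symmetric] exp_of_nat_mult[symmetric] algebra_simps)
  also have "\<dots> \<le> \<delta> / (real d * (real d + 1)) * (1 / 6) ^ (k * d)"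
    using E E6 by (intro mult_mono power_mono) (use \<delta> in auto)
  finally have "(real d + 1) * 2 ^ d * exp (- ((4 * t * sqrt (real k * real d))\<^sup>2 / 16))
      \<le> (real d + 1) * 2 ^ d * (\<delta> / (real d * (real d + 1)) * (1 / 6) ^ (k * d))"
    by (intro mult_left_mono) auto
  also have "\<dots> = \<delta> / real d * (2 ^ d * (1 / 6) ^ (k * d))"
  proof -
    have "c * z * (\<delta> / (y * c) * u) = \<delta> / y * (z * u)" if "c \<noteq> 0" for c y z u :: real using that by simp
    then show ?thesis using d by simp
  qed
  also have "\<dots> \<le> \<delta> / 1 * (1 / 9) ^ k"
  proof (intro mult_mono divide_left_mono)
    have "(2::real) ^ d * (1 / 6) ^ (k * d) \<le> 2 ^ (k * d) * (1 / 6) ^ (k * d)"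
      using k d by (intro mult_right_mono power_increasing) auto
    also have "\<dots> = (1 / 3) ^ (k * d)" unfolding power_mult_distrib[symmetric] by simp
    also have "\<dots> \<le> (1 / 3) ^ (k * 2)" using d by (intro power_decreasing) auto
    also have "\<dots> = (1 / 9) ^ k" by (simp add: power_mult power_even_eq power2_eq_square mult.commute[of k] power_divide)
    finally show "(2::real) ^ d * (1 / 6) ^ (k * d) \<le> (1 / 9) ^ k" .
  qed (use \<delta> d in auto)
  finally show ?thesis by simp
qed

text \<open>The number of dyadic scales is at most \<open>(1 + L) * (2 + 3 / 2 * t)\<close>. The
  exponent \<open>2 * t^2 * d\<close> is at least \<open>t * (d + 4)\<close>: here
  \<open>exp (- t)\<close> absorbs \<open>1 + L\<close> by the choice of \<open>tau\<close>,
  \<open>exp (- 3 * t)\<close> absorbs the second factor, and \<open>exp (- t) ^ d\<close> absorbs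
  the sign vectors.\<close>

lemma peel_failure_bound:
  fixes d n :: nat
  assumes \<delta>: "0 < \<delta>" "\<delta> < 1" and d: "2 \<le> d" and n: "1 \<le> n"
  defines "t \<equiv> tau d (\<delta> / real d) n"
  obtains J where "n \<le> 2 ^ J" "real d * 2 ^ d * (real J + 1) * exp (- (2 * t\<^sup>2 * real d)) \<le> \<delta>"
proof
  define J where "J = nat \<lceil>log 2 (real n)\<rceil>"
  define L where "L = max (ln (2 * real n / t)) 0"
  have t: "3 / 2 \<le> t" and E: "(1 + L) * exp (- t) \<le> \<delta> / (real d * (real d + 1))"
    using tau_basic[OF \<delta> d] by (auto simp: t_def L_def)
  have L0: "0 \<le> L" by (simp add: L_def)
  have "log 2 (real n) \<le> real J" unfolding J_def by (rule real_nat_ceiling_ge)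
  then have "2 powr log 2 (real n) \<le> 2 powr real J" by simp
  then have "real n \<le> 2 ^ J" using n by (simp add: powr_realpow)
  then show "n \<le> 2 ^ J" by (metis of_nat_le_iff of_nat_numeral of_nat_power)
  have ln2: "2 / 3 \<le> ln (2::real)" by (rule ln2_ge_two_thirds)
  have l0: "0 \<le> ln (real n)" using n by simp
  have "ln (real n) / ln 2 \<le> ln (real n) / (2 / 3)" using ln2 l0 by (intro divide_left_mono) auto
  moreover have "real J \<le> log 2 (real n) + 1" unfolding J_def using l0 ln2 by (simp add: log_def)
  moreover have "ln (real n) / (2 / 3) = 3 / 2 * ln (real n)" by simp
  moreover have "j + 1 \<le> 2 + c" if "a \<le> b" "j \<le> a + 1" "b = c" for a b c j :: real using that by linarith
  ultimately have J: "real J + 1 \<le> 2 + 3 / 2 * ln (real n)" unfolding log_def by blast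
  have "ln (real n) = ln (2 * real n / t) + ln t - ln 2" using n t by (simp add: ln_div ln_mult)
  also have "\<dots> \<le> L + t" using ln_le_minus_one[of t] t ln2 unfolding L_def by linarith
  finally have "2 + 3 / 2 * ln (real n) \<le> 2 + 3 / 2 * (L + t)" by (intro add_left_mono mult_left_mono) auto
  with J have "real J + 1 \<le> 2 + 3 / 2 * (L + t)" by (rule order_trans)
  also have "\<dots> \<le> (1 + L) * (2 + 3 / 2 * t)" 
  proof -
    have *: "2 + 3 / 2 * (a + b) \<le> (1 + a) * (2 + 3 / 2 * b)" if "0 \<le> a" "0 \<le> b" for a b :: real
    proof -
      have "(1 + a) * (2 + 3 / 2 * b) = 2 + 3 / 2 * (a + b) + (a / 2 + 3 / 2 * (a * b))" by (simp add: field_simps)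
      moreover have "0 \<le> a / 2 + 3 / 2 * (a * b)" using that by simp
      ultimately show ?thesis by linarith
    qed
    show ?thesis by (rule *) (use L0 t in auto)
  qed
  finally have J': "real J + 1 \<le> (1 + L) * (2 + 3 / 2 * t)" .
  have e3: "(2 + 3 / 2 * t) * exp (- (3 * t)) \<le> 1"
  proof -
    have "2 + 3 / 2 * t \<le> exp (3 * t)" using exp_ge_add_one_self[of "3 * t"] t by linarith
    then show ?thesis by (simp add: exp_minus field_simps)
  qed
  have "exp (- t) \<le> 1 / 2"
  proof -
    have "2 \<le> exp t" using exp_ge_add_one_self[of t] t by linarith
    then show ?thesis by (simp add: exp_minus field_simps)
  qed
  then have ed: "2 ^ d * exp (- t) ^ d \<le> 1" unfolding power_mult_distrib[symmetric] by (intro power_le_one) auto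
  have "t * (real d + 3 + 1) \<le> 2 * t\<^sup>2 * real d"
  proof -
    have "3 * real d \<le> 2 * t * real d" using t by (intro mult_right_mono) auto
    then have "real d + 3 + 1 \<le> 2 * t * real d" using d by linarith
    then have "t * (real d + 3 + 1) \<le> t * (2 * t * real d)" using t by (intro mult_left_mono) auto
    then show ?thesis by (simp add: power2_eq_square algebra_simps)
  qed
  then have "exp (- (2 * t\<^sup>2 * real d)) \<le> exp (- (t * (real d + 3 + 1)))" by simp
  also have "\<dots> = exp (- t) * exp (- (3 * t)) * exp (- t) ^ d"
    by (simp add: exp_add[symmetric] exp_of_nat_mult[symmetric] algebra_simps)
  finally have "real d * 2 ^ d * (real J + 1) * exp (- (2 * t\<^sup>2 * real d))
      \<le> real d * 2 ^ d * ((1 + L) * (2 + 3 / 2 * t)) * (exp (- t) * exp (- (3 * t)) * exp (- t) ^ d)"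
    using J' L0 t by (intro mult_mono) auto
  also have "\<dots> = (real d * ((1 + L) * exp (- t))) * (((2 + 3 / 2 * t) * exp (- (3 * t))) * (2 ^ d * exp (- t) ^ d))"
    by (simp add: mult_ac)
  also have "\<dots> \<le> (real d * (\<delta> / (real d * (real d + 1)))) * (1 * 1)"
    using E e3 ed t L0 \<delta> by (intro mult_mono mult_left_mono) auto
  also have "\<dots> \<le> \<delta>"
  proof -
    have "real d * (\<delta> / (real d * (real d + 1))) = \<delta> / (real d + 1)" using d by simp
    also have "\<dots> \<le> \<delta> / 1" using \<delta> d by (intro divide_left_mono) auto
    finally show ?thesis by simp
  qed
  finally show "real d * 2 ^ d * (real J + 1) * exp (- (2 * t\<^sup>2 * real d)) \<le> \<delta>" .
qed

lemma (in weighted_chain) abs_spectral_gap_bounds: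
  assumes "\<And>i j. i < d \<Longrightarrow> j < d \<Longrightarrow> p i * A $$ (i, j) = p j * A $$ (j, i)"
  shows "0 \<le> abs_spectral_gap A" "abs_spectral_gap A \<le> 1"
proof -
  have q: "\<bar>ip d x (mv d (sym_part d (conj_mat d p A)) x)\<bar> \<le> 1 * ip d x x" for x
    unfolding sym_part_quadratic by (rule op_bound_quadratic[OF op_bound_conj_mat])
  have "abs_spectral_gap A = abs_spectral_gap (sym_part d (conj_mat d p A))"
    by (rule abs_spectral_gap_reversible) (rule assms)
  then show "0 \<le> abs_spectral_gap A" "abs_spectral_gap A \<le> 1"
    using abs_spectral_gap_range[OF sym_part_sym_mat d q] by auto
qed

context chain
begin

lemma prob_ge_of_failure:
  assumes Q: "depends_upto m Q" and F: "{\<omega> \<in> space P. F \<omega>} \<in> events" "prob {\<omega> \<in> space P. F \<omega>} \<le> \<epsilon>"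
    and QF: "\<And>\<omega>. (\<And>t. 1 \<le> t \<Longrightarrow> X t \<omega> < d) \<Longrightarrow> \<not> F \<omega> \<Longrightarrow> \<omega> \<in> space P \<Longrightarrow> Q (\<lambda>t. X t \<omega>)"
  shows "1 - \<epsilon> \<le> prob {\<omega> \<in> space P. Q (\<lambda>t. X t \<omega>)}"
proof -
  have "1 - \<epsilon> \<le> prob (space P - {\<omega> \<in> space P. F \<omega>})" using F by (simp add: prob_compl)
  also have "\<dots> \<le> prob {\<omega> \<in> space P. Q (\<lambda>t. X t \<omega>)}"
  proof (rule finite_measure_mono_AE[OF _ sets_depends_upto[OF Q]])
    show "AE \<omega> in P. \<omega> \<in> space P - {\<omega> \<in> space P. F \<omega>} \<longrightarrow> \<omega> \<in> {\<omega> \<in> space P. Q (\<lambda>t. X t \<omega>)}"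
      using AE_range by eventually_elim (use QF in auto)
  qed
  finally show ?thesis .
qed

lemma ps_coverage:
  assumes M: "ergodic d M" and d: "2 \<le> d" and \<delta>: "0 < \<delta>" "\<delta> < 1" and \<alpha>: "0 < \<alpha>" and K: "1 \<le> K"
  shows "1 - \<delta> \<le> prob {\<omega> \<in> space P. ereal \<bar>pseudo_gap_hat d \<alpha> m K (\<lambda>t. X t \<omega>) - pseudo_gap M\<bar>
    \<le> ps_gap_width 192 d \<alpha> \<delta> m K (\<lambda>t. X t \<omega>)}"
proof -
  define s where "s k = 4 * tau d (\<delta> / real d) m * sqrt (real k * real d)" for k :: nat
  \<comment> \<open>Only nonempty skipped trajectories count as failures, since the tail bound
    requires length at least 1; \<open>ps_interval\<close> asks for flatness of these alone.\<close>
  define F where "F k r \<omega> \<longleftrightarrow> 1 \<le> sublen m k r \<and> \<not> flat_ok d (M ^\<^sub>m k) (sublen m k r) (s k) (skipped k r (\<lambda>t. X t \<omega>))" for k r \<omega>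
  have s0: "0 \<le> s k" for k using tau_basic(1)[OF \<delta> d, of m] by (simp add: s_def)
  have F: "{\<omega> \<in> space P. F k r \<omega>} \<in> events \<and> prob {\<omega> \<in> space P. F k r \<omega>} \<le> \<delta> * (1 / 9) ^ k" if k: "1 \<le> k" for k r
  proof (cases "1 \<le> sublen m k r")
    case True
    obtain \<mu>' where "chain d P (\<lambda>t. X (r + t * k)) (M ^\<^sub>m k) \<mu>'" by (rule chain_skipped[OF k])
    then interpret Y: chain d P "\<lambda>t. X (r + t * k)" "M ^\<^sub>m k" \<mu>' .
    have sk: "skipped k r (\<lambda>t. X t \<omega>) = (\<lambda>t. X (r + t * k) \<omega>)" for \<omega> by (simp add: skipped_def fun_eq_iff)
    have "{\<omega> \<in> space P. F k r \<omega>} = space P - {\<omega> \<in> space P. flat_ok d (M ^\<^sub>m k) (sublen m k r) (s k) (\<lambda>t. X (r + t * k) \<omega>)}"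
      using True by (auto simp: F_def sk)
    moreover have "\<dots> \<in> events" using Y.sets_depends_upto[OF depends_flat_ok] by auto
    moreover have "prob {\<omega> \<in> space P. F k r \<omega>} \<le> \<delta> * (1 / 9) ^ k"
      using Y.prob_not_flat_ok[OF True s0[of k]] flat_failure_bound[OF \<delta> d k, of m] True
      unfolding F_def sk s_def by simp
    ultimately show ?thesis by simp
  next
    case False
    then show ?thesis using \<delta> by (simp add: F_def)
  qed
  define I where "I = (SIGMA k:{1..K}. {..<k})"
  have I: "finite I" by (simp add: I_def)
  have U: "{\<omega> \<in> space P. \<exists>(k, r)\<in>I. F k r \<omega>} = (\<Union>(k, r)\<in>I. {\<omega> \<in> space P. F k r \<omega>})" by auto
  show ?thesis
  proof (rule prob_ge_of_failure[OF depends_ps_interval])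
    show "{\<omega> \<in> space P. \<exists>(k, r)\<in>I. F k r \<omega>} \<in> events" unfolding U using I F by (intro sets.finite_UN) (auto simp: I_def)
    have "prob (\<Union>(k, r)\<in>I. {\<omega> \<in> space P. F k r \<omega>}) \<le> (\<Sum>(k, r)\<in>I. prob {\<omega> \<in> space P. F k r \<omega>})"
      using finite_measure_subadditive_finite[OF I, of "\<lambda>(k, r). {\<omega> \<in> space P. F k r \<omega>}"] F
      by (auto simp: I_def case_prod_beta image_subset_iff)
    also have "\<dots> \<le> (\<Sum>(k, r)\<in>I. \<delta> * (1 / 9) ^ k)" using F by (intro sum_mono) (auto simp: I_def)
    also have "\<dots> = \<delta> * (\<Sum>k=1..K. real k * (1 / 9) ^ k)"
      unfolding I_def by (simp add: sum.Sigma[symmetric] sum_distrib_left mult_ac)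
    also have "\<dots> \<le> \<delta> * 1" using \<delta> sum_k_over_9_pow by (intro mult_left_mono) auto
    finally show "prob {\<omega> \<in> space P. \<exists>(k, r)\<in>I. F k r \<omega>} \<le> \<delta>" unfolding U by simp
    fix \<omega> assume r: "\<And>t. 1 \<le> t \<Longrightarrow> X t \<omega> < d" and nF: "\<not> (\<exists>(k, r)\<in>I. F k r \<omega>)"
    interpret C: conf d m "\<lambda>t. X t \<omega>" \<alpha> \<delta> by unfold_locales (use d \<alpha> r \<delta> in auto)
    show "ereal \<bar>pseudo_gap_hat d \<alpha> m K (\<lambda>t. X t \<omega>) - pseudo_gap M\<bar> \<le> ps_gap_width 192 d \<alpha> \<delta> m K (\<lambda>t. X t \<omega>)"
    proof (rule C.ps_interval[OF M K])
      fix k r assume "1 \<le> k" "k \<le> K" "r < k" "1 \<le> sublen m k r"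
      then show "flat_ok d (M ^\<^sub>m k) (sublen m k r) (4 * C.\<tau> * sqrt (real k * real d)) (skipped k r (\<lambda>t. X t \<omega>))"
        using nF by (auto simp: I_def F_def s_def C.\<tau>_def)
    qed
  qed
qed

lemma rev_coverage:
  assumes M: "ergodic d M" and d: "2 \<le> d" and \<delta>: "0 < \<delta>" "\<delta> < 1" and \<alpha>: "0 < \<alpha>" and rev: "reversible M" and m: "1 \<le> m"
  shows "1 - \<delta> \<le> prob {\<omega> \<in> space P. ereal \<bar>abs_gap_hat d \<alpha> m (\<lambda>t. X t \<omega>) - abs_spectral_gap M\<bar>
        \<le> rev_gap_width 192 d \<alpha> \<delta> m (\<lambda>t. X t \<omega>) \<and>
      ereal \<bar>pi_star_hat d \<alpha> m (\<lambda>t. X t \<omega>) - pi_star M\<bar> \<le> rev_b_width 192 d \<alpha> \<delta> m (\<lambda>t. X t \<omega>)}"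
proof -
  define t where "t = tau d (\<delta> / real d) m"
  interpret W: weighted_chain d M "stationary M" by (rule ergodic_weighted_chain[OF M d])
  note ab = W.abs_spectral_gap_bounds[OF reversible_detailed_balance[OF M d rev]]
  obtain J where J: "m \<le> 2 ^ J" "real d * 2 ^ d * (real J + 1) * exp (- (2 * t\<^sup>2 * real d)) \<le> \<delta>"
    unfolding t_def by (rule peel_failure_bound[OF \<delta> d m])
  show ?thesis
  proof (rule prob_ge_of_failure[OF depends_rev_interval])
    have "{\<omega> \<in> space P. \<not> peel_ok d M m (2 * t\<^sup>2 * real d) (\<lambda>t. X t \<omega>)}
      = space P - {\<omega> \<in> space P. peel_ok d M m (2 * t\<^sup>2 * real d) (\<lambda>t. X t \<omega>)}" by auto
    then show "{\<omega> \<in> space P. \<not> peel_ok d M m (2 * t\<^sup>2 * real d) (\<lambda>t. X t \<omega>)} \<in> events"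
      using sets_depends_upto[OF depends_peel_ok] by auto
    show "prob {\<omega> \<in> space P. \<not> peel_ok d M m (2 * t\<^sup>2 * real d) (\<lambda>t. X t \<omega>)} \<le> \<delta>"
      by (rule order_trans[OF prob_not_peel_ok[OF m _ J(1)] J(2)]) simp
    fix \<omega> assume r: "\<And>t. 1 \<le> t \<Longrightarrow> X t \<omega> < d" and pk: "\<not> \<not> peel_ok d M m (2 * t\<^sup>2 * real d) (\<lambda>t. X t \<omega>)"
    interpret C: conf d m "\<lambda>t. X t \<omega>" \<alpha> \<delta> by unfold_locales (use d \<alpha> r \<delta> in auto)
    have "peel_ok d M m (2 * C.\<tau>\<^sup>2 * real d) (\<lambda>t. X t \<omega>)" using pk by (simp add: C.\<tau>_def t_def)
    then show "ereal \<bar>abs_gap_hat d \<alpha> m (\<lambda>t. X t \<omega>) - abs_spectral_gap M\<bar> \<le> rev_gap_width 192 d \<alpha> \<delta> m (\<lambda>t. X t \<omega>) \<and>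
      ereal \<bar>pi_star_hat d \<alpha> m (\<lambda>t. X t \<omega>) - pi_star M\<bar> \<le> rev_b_width 192 d \<alpha> \<delta> m (\<lambda>t. X t \<omega>)"
      using C.rev_interval[OF M rev _ ab] by blast
  qed
qed

end

section \<open>Asymptotic widths\<close>

context conf
begin

lemma visits_max_le:
  assumes "\<And>i. i < d \<Longrightarrow> Nt i \<le> N * D"
  shows "(real (visits_max d n 1 0 x) + real d * \<alpha>) / D \<le> N"
proof -
  have ne: "visits n 1 0 x ` {..<d} \<noteq> {}" using d by (auto simp: lessThan_empty_iff)
  obtain i where i: "i < d" "visits n 1 0 x i = visits_max d n 1 0 x"
    using Max_in[OF _ ne] unfolding visits_max_def by auto
  have "real (visits_max d n 1 0 x) + real d * \<alpha> = Nt i" using i by (simp add: Nt_def vis_def)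
  then show ?thesis using assms[OF i(1)] D_pos by (simp add: pos_divide_le_eq)
qed

text \<open>With \<open>b \<le> \<mu>m / 2\<close> all denominators are at least
  \<open>\<mu>m / 2\<close>, so the truncation at 0 is inactive.\<close>

lemma c_width_le:
  assumes b: "0 \<le> b" "b \<le> \<mu>m / 2"
  shows "c_width (ereal b) d \<alpha> n 1 0 x \<le> ereal (b / \<mu>m)"
proof -
  have ne: "{..<d} \<noteq> {}" using d by (auto simp: lessThan_empty_iff)
  have "Max ((\<lambda>i. max (ereal b / ereal (ph i)) (ereal b / max (ereal (ph i) - ereal b) 0)) ` {..<d}) \<le> ereal (b / (\<mu>m / 2))"
  proof (intro Max.boundedI)
    fix e assume "e \<in> (\<lambda>i. max (ereal b / ereal (ph i)) (ereal b / max (ereal (ph i) - ereal b) 0)) ` {..<d}"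
    then obtain i where i: "i < d" and e: "e = max (ereal b / ereal (ph i)) (ereal b / max (ereal (ph i) - ereal b) 0)" by auto
    have h: "\<mu>m / 2 \<le> ph i - b" "\<mu>m / 2 \<le> ph i" using \<mu>m_le[OF i] b \<mu>m_pos by auto
    then have pos: "0 < ph i - b" "0 < ph i" using \<mu>m_pos by linarith+
    have "max (ereal (ph i) - ereal b) 0 = ereal (ph i - b)" using pos by (simp add: max_def)
    then have "e = ereal (max (b / ph i) (b / (ph i - b)))" unfolding e using pos by (simp add: max_def)
    moreover have "b / y \<le> b / (\<mu>m / 2)" if "\<mu>m / 2 \<le> y" "0 < y" for y
      by (rule divide_left_mono[OF that(1) b(1)]) (use that \<mu>m_pos in simp)
    then have "b / ph i \<le> b / (\<mu>m / 2)" "b / (ph i - b) \<le> b / (\<mu>m / 2)"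
      using h pos by blast+
    ultimately show "e \<le> ereal (b / (\<mu>m / 2))" by simp
  qed (use ne in auto)
  then have "c_width (ereal b) d \<alpha> n 1 0 x \<le> ereal (1 / 2) * ereal (b / (\<mu>m / 2))"
    unfolding c_width_def ph_def by (rule ereal_mult_left_mono) simp
  then show ?thesis by simp
qed

text \<open>A nonasymptotic form of the soft-O bounds, for a trajectory whose frequencies are within
  constant factors of their limits and whose gap estimate is at least \<open>\<gamma> / 2\<close>.
  \<open>l\<close> collects the logarithms that are free of \<open>m\<close>, and \<open>L\<close>
  is the order of \<open>tau\<close>. The constants are products of
  \<open>768 = 192 * 2 * 2\<close>, from \<open>g \<ge> \<gamma> / 2\<close> and
  \<open>\<Lambda> \<le> 2 * l\<close>, and \<open>256 = 2 * 4 * 16 * 2\<close>, from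
  \<open>\<eta> \<le> 2 * \<eta>1\<close>; in the gap width 768 becomes 4608.\<close>

lemma width_bounds:
  assumes near: "\<And>i. i < d \<Longrightarrow> 3 / 4 * p i \<le> ph i" "\<And>i. i < d \<Longrightarrow> ph i \<le> 5 / 4 * p i"
    and pst: "0 < pst" "\<And>i. i < d \<Longrightarrow> pst \<le> p i" "pst \<le> 1 / real d"
    and N: "\<And>i j. i < d \<Longrightarrow> j < d \<Longrightarrow> p i / p j \<le> N"
    and \<gamma>: "0 < \<gamma>" "\<gamma> \<le> 1" "\<gamma> / 2 \<le> g"
    and DD: "\<alpha>\<^sup>2 * real d \<le> D" and n: "3 \<le> n" "n \<le> m" "real m \<le> 2 * real k * real n"
  defines "l \<equiv> ln (real d / (\<delta> * pst * \<gamma>))" and "L \<equiv> ln (real d * ln (real m) / \<delta>)"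
    and "R \<equiv> sqrt (real d / (pst * real m))"
  shows "b_width 192 g d \<alpha> \<delta> n 1 0 x \<le> ereal (196608 * (l * L) * (sqrt (real k) * R / \<gamma>))"
    and "196608 * (l * L) * (sqrt (real k) * R / \<gamma>) \<le> pst / 4 \<Longrightarrow>
      gap_width 192 g d \<alpha> \<delta> n 1 0 x
        \<le> ereal (1179648 * (l * L) * (sqrt (real k) * R * (sqrt (real d) * N + 1 / (\<gamma> * pst))))"
proof -
  have g: "0 < g" using \<gamma> by linarith
  have p_pos: "0 < p i" if "i < d" for i using pst(1) pst(2)[OF that] by linarith
  obtain i0 where i0: "i0 < d" "D = Nt i0" by (rule D_attained)
  have \<mu>ph: "\<mu>m = ph i0" using i0 by (simp add: \<mu>m_def ph_eq)
  have \<mu>: "3 / 4 * pst \<le> \<mu>m" using near(1)[OF i0(1)] pst(2)[OF i0(1)] unfolding \<mu>ph by linarith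
  have m0: "0 < real m" "0 < real n" "0 < real k" using n by (auto intro: gr0I)
  have D: "pst * real m / (4 * real k) \<le> D"
  proof -
    have "pst * real m \<le> pst * (2 * real k * real n)" using n pst by (intro mult_left_mono) auto
    then have "pst * real m / (4 * real k) \<le> pst * (2 * real k * real n) / (4 * real k)"
      using m0 by (intro divide_right_mono) auto
    also have "\<dots> = 1 / 2 * pst * real n" using m0 by simp
    also have "\<dots> \<le> \<mu>m * Z" using \<mu> pst \<alpha> by (intro mult_mono) (auto simp: Z_def)
    also have "\<dots> = D" using Z_pos by (simp add: \<mu>m_def)
    finally show ?thesis .
  qed
  have dD: "sqrt (real d / D) \<le> 2 * sqrt (real k) * R"
  proof -
    have "real d / D \<le> real d / (pst * real m / (4 * real k))"
      using D m0 pst D_pos by (intro divide_left_mono) auto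
    also have "\<dots> = 4 * real k * (real d / (pst * real m))" using m0 pst by (simp add: field_simps)
    finally have "sqrt (real d / D) \<le> sqrt (4 * real k * (real d / (pst * real m)))" by simp
    also have "\<dots> = 2 * sqrt (real k) * R" unfolding R_def real_sqrt_mult by simp
    finally show ?thesis .
  qed
  have lnm: "1 \<le> ln (real m)"
  proof -
    have "3 \<le> m" using n by simp
    then have "3 \<le> real m" by simp
    with exp_le have "exp 1 \<le> real m" by (rule order_trans)
    then show ?thesis using m0 by (simp add: ln_ge_iff)
  qed
  \<comment> \<open>\<open>\<tau>\<close> is taken at confidence \<open>\<delta> / d\<close>;
    squaring the argument of the logarithm absorbs the additional \<open>d\<close> and doubles the 8
    of \<open>tau_upper\<close>.\<close>
  have \<tau>L: "\<tau> \<le> 16 * L"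
  proof -
    have "\<delta> / real d < 1" using \<delta> d by simp
    then have "\<tau> \<le> 8 * ln (real d * ln (real n) / (\<delta> / real d))"
      unfolding \<tau>_def using \<delta> d n by (intro tau_upper) auto
    also have "ln (real d * ln (real n) / (\<delta> / real d)) \<le> ln ((real d * ln (real m) / \<delta>)\<^sup>2)"
    proof (rule ln_mono)
      have "ln (real n) * \<delta> \<le> ln (real m) * ln (real m)"
        using n \<delta> lnm by (intro mult_mono) auto
      then have "(real d)\<^sup>2 * (ln (real n) * \<delta>) / \<delta>\<^sup>2 \<le> (real d)\<^sup>2 * (ln (real m) * ln (real m)) / \<delta>\<^sup>2"
        by (intro divide_right_mono mult_left_mono) auto
      moreover have "(real d)\<^sup>2 * (ln (real n) * \<delta>) / \<delta>\<^sup>2 = real d * ln (real n) / (\<delta> / real d)"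
        using \<delta> by (simp add: power2_eq_square)
      moreover have "(real d)\<^sup>2 * (ln (real m) * ln (real m)) / \<delta>\<^sup>2 = (real d * ln (real m) / \<delta>)\<^sup>2"
        by (simp add: power2_eq_square)
      ultimately show "real d * ln (real n) / (\<delta> / real d) \<le> (real d * ln (real m) / \<delta>)\<^sup>2" by argo
      show "0 < real d * ln (real n) / (\<delta> / real d)" using d \<delta> n by simp
    qed
    also have "\<dots> = 2 * L" unfolding L_def using d \<delta> lnm by (simp add: ln_realpow)
    finally show ?thesis by simp
  qed
  have L0: "0 < L" using \<tau>L \<tau>_ge by linarith
  have R0: "0 \<le> R" unfolding R_def using pst m0 by (intro real_sqrt_ge_zero divide_nonneg_pos mult_pos_pos) auto
  have k0: "0 \<le> sqrt (real k)" by simp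
  \<comment> \<open>Smoothing contributes at order \<open>1 / D\<close> and deviations at order
    \<open>1 / sqrt D\<close>, so the latter dominate once
    \<open>D \<ge> \<alpha>^2 * d\<close>.\<close>
  have \<eta>12: "\<eta>2 \<le> \<eta>1"
  proof -
    define q where "q = sqrt (real d / D)"
    have q: "0 < q" "q * q = real d / D" using d D_pos by (auto simp: q_def)
    have "(\<alpha> * q)\<^sup>2 = \<alpha>\<^sup>2 * (q * q)" by (simp add: power2_eq_square mult_ac)
    also have "\<dots> \<le> 1\<^sup>2" unfolding q(2) using DD D_pos by simp
    finally have "\<alpha> * q \<le> 1" by (rule power2_le_imp_le) simp
    then have "2 * (\<alpha> * q) * q \<le> 4 * \<tau> * q" using q \<tau>_ge by (intro mult_right_mono) auto
    moreover have "2 * (\<alpha> * q) * q = 2 * \<alpha> * (q * q)" by (simp only: mult_ac)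
    then have "\<eta>2 = 2 * (\<alpha> * q) * q" unfolding \<eta>2_def q(2) by simp
    ultimately show ?thesis by (simp add: \<eta>1_def q_def)
  qed
  have \<eta>: "\<eta> \<le> 256 * (L * (sqrt (real k) * R))"
  proof -
    have "\<eta>1 \<le> 4 * (16 * L) * (2 * sqrt (real k) * R)"
      unfolding \<eta>1_def using \<tau>L \<tau>_ge dD L0 d D_pos by (intro mult_mono) auto
    then show ?thesis using \<eta>12 by (simp add: \<eta>_def)
  qed
  have l_ge: "2 * ln 2 \<le> l" "ln (1 / pst) \<le> l"
  proof -
    have "\<delta> * pst * \<gamma> \<le> 1 * pst * 1" using \<delta> pst \<gamma> by (intro mult_mono) auto
    then have "real d / pst \<le> real d / (\<delta> * pst * \<gamma>)" using \<delta> pst \<gamma> by (intro divide_left_mono) auto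
    moreover have "1 / pst \<le> real d / pst" using d pst by (intro divide_right_mono) auto
    ultimately have 1: "1 / pst \<le> real d / (\<delta> * pst * \<gamma>)" by linarith
    then show "ln (1 / pst) \<le> l" unfolding l_def using pst by (intro ln_mono) auto
    have "real d / (1 / real d) \<le> real d / pst" using d pst by (intro divide_left_mono) auto
    then have "real d * real d \<le> real d / (\<delta> * pst * \<gamma>)"
      using \<open>real d / pst \<le> real d / (\<delta> * pst * \<gamma>)\<close> by simp
    moreover have "2 * 2 \<le> real d * real d" using d by (intro mult_mono) auto
    ultimately have "2\<^sup>2 \<le> real d / (\<delta> * pst * \<gamma>)" by simp
    then have "ln (2\<^sup>2) \<le> l" unfolding l_def by (intro ln_mono) auto
    then show "2 * ln 2 \<le> l" using ln_realpow[of "2::real" 2] by simp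
  qed
  have l1: "1 \<le> l" using l_ge(1) ln2_ge_two_thirds by linarith
  have \<Lambda>l: "\<Lambda> \<le> 2 * l"
  proof -
    have "- (2 * \<Lambda>) = ln (\<mu>m / 8)" using arg_cong[OF \<Lambda>_exp, of ln] by simp
    also have "\<dots> = ln \<mu>m - ln 8" using \<mu>m_pos by (simp add: ln_div)
    also have "ln (8::real) = 3 * ln 2" using ln_realpow[of "2::real" 3] by simp
    finally have "2 * \<Lambda> = 3 * ln 2 - ln \<mu>m" by simp
    moreover have "ln (pst / 2) \<le> ln \<mu>m" using \<mu> pst by (intro ln_mono) auto
    moreover have "ln (pst / 2) = - ln (1 / pst) - ln 2" using pst by (simp add: ln_div)
    ultimately have "2 * \<Lambda> \<le> 4 * ln 2 + ln (1 / pst)" by linarith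
    then show ?thesis using l_ge l1 by linarith
  qed
  define b where "b = 192 / g * \<Lambda> * \<eta>"
  define Q where "Q = sqrt (real k) * R"
  have Q0: "0 \<le> Q" using R0 by (simp add: Q_def)
  have b0: "0 \<le> b" using g \<Lambda>_ge \<eta>_pos by (simp add: b_def)
  have b\<eta>: "b \<le> 768 * l / \<gamma> * \<eta>"
  proof -
    have "192 / g \<le> 192 / (\<gamma> / 2)" using \<gamma> g by (intro divide_left_mono) auto
    then have "192 / g * \<Lambda> \<le> 384 / \<gamma> * (2 * l)" using \<Lambda>l \<Lambda>_ge g \<gamma> by (intro mult_mono) auto
    then have "192 / g * \<Lambda> * \<eta> \<le> 384 / \<gamma> * (2 * l) * \<eta>" using \<eta>_pos by (intro mult_right_mono) auto
    then show ?thesis by (simp add: b_def mult_ac)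
  qed
  also have "768 * l / \<gamma> * \<eta> \<le> 768 * l / \<gamma> * (256 * (L * Q))"
    using \<eta> l1 \<gamma> by (intro mult_left_mono) (auto simp: Q_def)
  also have "\<dots> = 196608 * (l * L) * (Q / \<gamma>)" by simp
  finally have bb: "b \<le> 196608 * (l * L) * (Q / \<gamma>)" .
  then show "b_width 192 g d \<alpha> \<delta> n 1 0 x \<le> ereal (196608 * (l * L) * (sqrt (real k) * R / \<gamma>))"
    unfolding b_width_pos[OF g] by (simp add: b_def Q_def)
  assume "196608 * (l * L) * (sqrt (real k) * R / \<gamma>) \<le> pst / 4"
  then have bs: "b \<le> pst / 4" using bb by (simp add: Q_def)
  have bm: "b \<le> \<mu>m / 2" using bs \<mu> pst by linarith
  define c where "c = b / \<mu>m"
  have c0: "0 \<le> c" "c \<le> 1" using b0 bm \<mu>m_pos by (auto simp: c_def)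
  have cb: "c \<le> 4 / 3 * (b / pst)"
  proof -
    have "b / \<mu>m \<le> b / (3 / 4 * pst)" using b0 \<mu> pst \<mu>m_pos by (intro divide_left_mono) auto
    then show ?thesis by (simp add: c_def)
  qed
  define a where "a = a_width d \<alpha> \<delta> n 1 0 x"
  have NtD: "Nt i \<le> 5 / 3 * N * D" if i: "i < d" for i
  proof -
    have "ph i \<le> 5 / 3 * N * \<mu>m"
    proof -
      have "p i \<le> N * p i0" using N[OF i i0(1)] p_pos[OF i0(1)] by (simp add: pos_divide_le_eq)
      moreover have "0 \<le> N" using N[OF i i0(1)] p_pos[OF i] p_pos[OF i0(1)] by (meson divide_pos_pos less_eq_real_def order_trans)
      then have "N * (3 / 4 * p i0) \<le> N * \<mu>m" using near(1)[OF i0(1)] unfolding \<mu>ph by (intro mult_left_mono)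
      ultimately show ?thesis using near(2)[OF i] by simp
    qed
    then have "ph i * Z \<le> 5 / 3 * N * \<mu>m * Z" using Z_pos by (intro mult_right_mono) auto
    then show ?thesis using Z_pos by (simp add: ph_eq \<mu>m_def)
  qed
  have N0: "0 \<le> N" using N[OF i0(1) i0(1)] p_pos[OF i0(1)] by simp
  have a: "a \<le> 5 / 3 * (sqrt (real d) * N) * \<eta>"
  proof -
    have "a = sqrt (real d) * ((real (visits_max d n 1 0 x) + real d * \<alpha>) / D) * \<eta>"
      unfolding a_def a_width_def d_width_eq D_def ..
    also have "\<dots> \<le> sqrt (real d) * (5 / 3 * N) * \<eta>"
      using visits_max_le[OF NtD] \<eta>_pos by (intro mult_right_mono mult_left_mono) auto
    finally show ?thesis by (simp add: mult_ac)
  qed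
  have "gap_width 192 g d \<alpha> \<delta> n 1 0 x \<le> ereal a + 2 * ereal c + (ereal c)\<^sup>2"
  proof -
    have cw: "c_width (b_width 192 g d \<alpha> \<delta> n 1 0 x) d \<alpha> n 1 0 x \<le> ereal c"
      unfolding b_width_pos[OF g] c_def b_def[symmetric] by (rule c_width_le[OF b0 bm])
    have "ereal (1 / 2) * (ereal b / ereal (ph i0)) \<le> c_width (ereal b) d \<alpha> n 1 0 x" by (rule c_width_ge[OF i0(1)])
    moreover have "0 \<le> ereal (1 / 2) * (ereal b / ereal (ph i0))" using b0 ph_pos[of i0] by simp
    ultimately have cw0: "0 \<le> c_width (b_width 192 g d \<alpha> \<delta> n 1 0 x) d \<alpha> n 1 0 x"
      unfolding b_width_pos[OF g] b_def[symmetric] by (rule order_trans[rotated])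
    show ?thesis unfolding gap_width_def Let_def a_def[symmetric]
      using cw cw0 c0(1) unfolding power2_eq_square by (intro add_mono ereal_mult_left_mono ereal_mult_mono) auto
  qed
  also have "\<dots> = ereal (a + 2 * c + c\<^sup>2)" by (simp add: power2_eq_square)
  also have "a + 2 * c + c\<^sup>2 \<le> a + 3 * c" using c0 mult_left_mono[of c 1 c] by (simp add: power2_eq_square)
  also have "\<dots> \<le> 5 / 3 * (sqrt (real d) * N) * \<eta> + 4 * (b / pst)" using a cb by linarith
  also have "\<dots> \<le> 5 / 3 * (sqrt (real d) * N) * \<eta> + 4 * (768 * l / \<gamma> * \<eta> / pst)"
    using b\<eta> pst by (intro add_left_mono mult_left_mono divide_right_mono) auto
  also have "\<dots> \<le> 4608 * l * \<eta> * (sqrt (real d) * N) + 4608 * l * \<eta> * (1 / (\<gamma> * pst))"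
  proof (intro add_mono)
    have "5 / 3 * (sqrt (real d) * N * \<eta>) \<le> 4608 * l * (sqrt (real d) * N * \<eta>)"
      using l1 N0 \<eta>_pos by (intro mult_right_mono) auto
    then show "5 / 3 * (sqrt (real d) * N) * \<eta> \<le> 4608 * l * \<eta> * (sqrt (real d) * N)" by (simp add: mult_ac)
    have "0 \<le> l * \<eta> / (\<gamma> * pst)" using l1 \<eta>_pos \<gamma> pst by simp
    then have "3072 * (l * \<eta> / (\<gamma> * pst)) \<le> 4608 * (l * \<eta> / (\<gamma> * pst))" by (intro mult_right_mono) auto
    then show "4 * (768 * l / \<gamma> * \<eta> / pst) \<le> 4608 * l * \<eta> * (1 / (\<gamma> * pst))" by (simp add: mult.assoc)
  qed
  also have "\<dots> = 4608 * l * \<eta> * (sqrt (real d) * N + 1 / (\<gamma> * pst))" by (simp add: distrib_left)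
  also have "\<dots> \<le> 4608 * l * (256 * (L * Q)) * (sqrt (real d) * N + 1 / (\<gamma> * pst))"
    using \<eta> l1 N0 \<gamma> pst by (intro mult_right_mono mult_left_mono) (auto simp: Q_def)
  also have "\<dots> = 1179648 * (l * L) * (sqrt (real k) * R * (sqrt (real d) * N + 1 / (\<gamma> * pst)))" by (simp add: Q_def mult_ac)
  finally show "gap_width 192 g d \<alpha> \<delta> n 1 0 x
        \<le> ereal (1179648 * (l * L) * (sqrt (real k) * R * (sqrt (real d) * N + 1 / (\<gamma> * pst))))" by simp
qed

end

section \<open>Continuity of the gaps in the weights and in the matrix\<close>

lemma conj_mat_diff_tendsto:
  assumes W: "weighted_chain d B p"
    and q: "\<And>i. i < d \<Longrightarrow> (\<lambda>n. q n i) \<longlonglongrightarrow> p i"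
    and A: "\<And>i j. i < d \<Longrightarrow> j < d \<Longrightarrow> (\<lambda>n. A n $$ (i, j)) \<longlonglongrightarrow> B $$ (i, j)"
  obtains e where "e \<longlonglongrightarrow> 0"
    "\<And>n. op_bound d (Matrix.mat d d (\<lambda>(i, j). conj_mat d (q n) (A n) $$ (i, j) - conj_mat d p B $$ (i, j))) (e n)"
proof
  interpret W: weighted_chain d B p by (rule W)
  let ?C = "\<lambda>n. Matrix.mat d d (\<lambda>(i, j). conj_mat d (q n) (A n) $$ (i, j) - conj_mat d p B $$ (i, j))"
  let ?e = "\<lambda>n. sqrt (\<Sum>i<d. \<Sum>j<d. (?C n $$ (i, j))\<^sup>2)"
  have "(\<lambda>n. ?C n $$ (i, j)) \<longlonglongrightarrow> 0" if ij: "i < d" "j < d" for i j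
  proof -
    have "(\<lambda>n. sqrt (q n i) * A n $$ (i, j) / sqrt (q n j) - sqrt (p i) * B $$ (i, j) / sqrt (p j))
        \<longlonglongrightarrow> sqrt (p i) * B $$ (i, j) / sqrt (p j) - sqrt (p i) * B $$ (i, j) / sqrt (p j)"
      using W.pos[OF ij(2)] by (intro tendsto_intros q A ij) auto
    then show ?thesis using ij by (simp add: conj_mat_index)
  qed
  then have "?e \<longlonglongrightarrow> sqrt (\<Sum>i<d. \<Sum>j<d. 0\<^sup>2)" by (intro tendsto_intros) auto
  then show "?e \<longlonglongrightarrow> 0" by simp
  show "op_bound d (?C n) (?e n)" for n
  proof (rule op_bound_frobenius)
    have "0 \<le> (\<Sum>i<d. \<Sum>j<d. (?C n $$ (i, j))\<^sup>2)" by (intro sum_nonneg) auto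
    then show "0 \<le> ?e n" "(\<Sum>i<d. \<Sum>j<d. (?C n $$ (i, j))\<^sup>2) \<le> (?e n)\<^sup>2"
      by (rule real_sqrt_ge_zero, simp only: real_sqrt_pow2 order_refl)
  qed
qed

lemma gram_gap_tendsto:
  assumes W: "weighted_chain d B p"
    and q: "\<And>i. i < d \<Longrightarrow> (\<lambda>n. q n i) \<longlonglongrightarrow> p i"
    and A: "\<And>i j. i < d \<Longrightarrow> j < d \<Longrightarrow> (\<lambda>n. A n $$ (i, j)) \<longlonglongrightarrow> B $$ (i, j)"
  shows "(\<lambda>n. gram_gap d (q n) (A n)) \<longlonglongrightarrow> gram_gap d p B"
proof -
  interpret W: weighted_chain d B p by (rule W)
  obtain e where e: "e \<longlonglongrightarrow> 0"
    "\<And>n. op_bound d (Matrix.mat d d (\<lambda>(i, j). conj_mat d (q n) (A n) $$ (i, j) - conj_mat d p B $$ (i, j))) (e n)"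
    using conj_mat_diff_tendsto[of d B p q A, OF W q A] by blast
  have "(\<lambda>n. gram_gap d (q n) (A n) - gram_gap d p B) \<longlonglongrightarrow> 0"
  proof (rule tendsto_rabs_zero_cancel, rule tendsto_sandwich[OF _ _ tendsto_const])
    show "\<forall>\<^sub>F n in sequentially. \<bar>gram_gap d (q n) (A n) - gram_gap d p B\<bar> \<le> 2 * e n + (e n)\<^sup>2"
      unfolding gram_gap_def
      by (intro always_eventually allI spectral_gap_gram_perturb[OF _ _ W.d e(2) _ W.op_bound_conj_mat]) auto
    have "(\<lambda>n. 2 * e n + (e n)\<^sup>2) \<longlonglongrightarrow> 2 * 0 + 0\<^sup>2" by (intro tendsto_intros e)
    then show "(\<lambda>n. 2 * e n + (e n)\<^sup>2) \<longlonglongrightarrow> 0" by simp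
  qed simp
  then show ?thesis by (rule LIM_zero_cancel)
qed

lemma abs_gap_tendsto:
  assumes W: "weighted_chain d B p"
    and q: "\<And>i. i < d \<Longrightarrow> (\<lambda>n. q n i) \<longlonglongrightarrow> p i"
    and A: "\<And>i j. i < d \<Longrightarrow> j < d \<Longrightarrow> (\<lambda>n. A n $$ (i, j)) \<longlonglongrightarrow> B $$ (i, j)"
  shows "(\<lambda>n. abs_spectral_gap (sym_part d (conj_mat d (q n) (A n)))) \<longlonglongrightarrow> abs_spectral_gap (sym_part d (conj_mat d p B))"
proof -
  interpret W: weighted_chain d B p by (rule W)
  let ?C = "\<lambda>n. Matrix.mat d d (\<lambda>(i, j). conj_mat d (q n) (A n) $$ (i, j) - conj_mat d p B $$ (i, j))"
  obtain e where e: "e \<longlonglongrightarrow> 0" "\<And>n. op_bound d (?C n) (e n)"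
    using conj_mat_diff_tendsto[of d B p q A, OF W q A] by blast
  have b: "\<bar>abs_spectral_gap (sym_part d (conj_mat d (q n) (A n))) - abs_spectral_gap (sym_part d (conj_mat d p B))\<bar> \<le> e n" for n
  proof (rule abs_spectral_gap_perturb[OF sym_part_sym_mat sym_part_sym_mat W.d])
    fix z
    have "ip d z (mv d (?C n) z) = ip d z (mv d (conj_mat d (q n) (A n)) z) - ip d z (mv d (conj_mat d p B) z)"
      unfolding ip_linear(4)[symmetric] by (intro ip_cong) (auto simp: mv_def left_diff_distrib sum_subtractf)
    then show "\<bar>ip d z (mv d (sym_part d (conj_mat d (q n) (A n))) z) - ip d z (mv d (sym_part d (conj_mat d p B)) z)\<bar> \<le> e n * ip d z z"
      unfolding sym_part_quadratic using op_bound_quadratic[OF e(2), of z n] by simp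
  qed
  have "(\<lambda>n. abs_spectral_gap (sym_part d (conj_mat d (q n) (A n))) - abs_spectral_gap (sym_part d (conj_mat d p B))) \<longlonglongrightarrow> 0"
    by (rule tendsto_rabs_zero_cancel, rule tendsto_sandwich[OF _ always_eventually tendsto_const e(1)]) (use b in auto)
  then show ?thesis by (rule LIM_zero_cancel)
qed

lemma pow_mat_tendsto:
  fixes A :: "nat \<Rightarrow> real mat"
  assumes A: "\<And>n. A n \<in> carrier_mat d d" and B: "B \<in> carrier_mat d d"
    and lim: "\<And>i j. i < d \<Longrightarrow> j < d \<Longrightarrow> (\<lambda>n. A n $$ (i, j)) \<longlonglongrightarrow> B $$ (i, j)"
    and ij: "i < d" "j < d"
  shows "(\<lambda>n. (A n ^\<^sub>m l) $$ (i, j)) \<longlonglongrightarrow> (B ^\<^sub>m l) $$ (i, j)"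
  using ij
proof (induction l arbitrary: i j)
  case 0
  then show ?case using carrier_matD(1)[OF A] carrier_matD(1)[OF B] by simp
next
  case (Suc l)
  have "(\<lambda>n. \<Sum>k<d. (A n ^\<^sub>m l) $$ (i, k) * A n $$ (k, j)) \<longlonglongrightarrow> (\<Sum>k<d. (B ^\<^sub>m l) $$ (i, k) * B $$ (k, j))"
    by (rule tendsto_sum, rule tendsto_mult) (use Suc.prems in \<open>auto intro: Suc.IH lim\<close>)
  then show ?case
    using Suc.prems mult_mat_index[OF pow_mat_carrier[OF A] A] mult_mat_index[OF pow_mat_carrier[OF B] B] by simp
qed

text \<open>Deviations of order \<open>n^(3/4)\<close>, written with nested roots, against the
  normalization \<open>n + c\<close>.\<close>

lemma n34_tendsto:
  fixes a b c :: real
  assumes c: "0 \<le> c"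
  shows "(\<lambda>n. (a * (sqrt (sqrt (real n)) * sqrt (real n)) + b) / (real n + c)) \<longlonglongrightarrow> 0"
proof -
  have lim: "(\<lambda>n. \<bar>a\<bar> * inverse (sqrt (sqrt (real n))) + \<bar>b\<bar> * inverse (real n)) \<longlonglongrightarrow> \<bar>a\<bar> * 0 + \<bar>b\<bar> * 0"
  proof (intro tendsto_intros)
    have "filterlim (\<lambda>n. sqrt (sqrt (real n))) at_top sequentially"
      by (intro filterlim_compose[OF sqrt_at_top] filterlim_real_sequentially)
    then show "(\<lambda>n. inverse (sqrt (sqrt (real n)))) \<longlonglongrightarrow> 0" by (rule tendsto_inverse_0_at_top)
    show "(\<lambda>n. inverse (real n)) \<longlonglongrightarrow> 0" by (rule lim_inverse_n)
  qed
  show ?thesis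
  proof (rule tendsto_rabs_zero_cancel, rule tendsto_sandwich[OF _ _ tendsto_const lim[simplified]])
    show "\<forall>\<^sub>F n in sequentially. \<bar>(a * (sqrt (sqrt (real n)) * sqrt (real n)) + b) / (real n + c)\<bar>
      \<le> \<bar>a\<bar> * inverse (sqrt (sqrt (real n))) + \<bar>b\<bar> * inverse (real n)"
    proof (rule eventually_sequentiallyI[of 1])
      fix n :: nat assume n: "1 \<le> n"
      define r where "r = sqrt (sqrt (real n))"
      have r: "0 < r" "sqrt (real n) = r * r" "real n = (r * r) * (r * r)" using n by (auto simp: r_def)
      have "\<bar>(a * (r * (r * r)) + b) / (real n + c)\<bar> = \<bar>a * (r * (r * r)) + b\<bar> / (real n + c)"
        using c by (simp add: abs_divide)
      also have "\<dots> \<le> (\<bar>a\<bar> * (r * (r * r)) + \<bar>b\<bar>) / real n"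
      proof (rule frac_le)
        have "\<bar>a * (r * (r * r))\<bar> = \<bar>a\<bar> * (r * (r * r))" using r(1) by (simp add: abs_mult)
        then show "\<bar>a * (r * (r * r)) + b\<bar> \<le> \<bar>a\<bar> * (r * (r * r)) + \<bar>b\<bar>" using abs_triangle_ineq[of "a * (r * (r * r))" b] by simp
        show "0 \<le> \<bar>a\<bar> * (r * (r * r)) + \<bar>b\<bar>" using r(1) by simp
      qed (use n c in auto)
      also have "\<dots> = \<bar>a\<bar> * inverse r + \<bar>b\<bar> * inverse (real n)"
      proof -
        have "(u * (r * (r * r)) + v) / ((r * r) * (r * r)) = u * inverse r + v * inverse ((r * r) * (r * r))" for u v :: real
          using r(1) by (simp add: divide_simps)
        then show ?thesis unfolding r(3) .
      qed
      finally show "\<bar>(a * (sqrt (sqrt (real n)) * sqrt (real n)) + b) / (real n + c)\<bar>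
        \<le> \<bar>a\<bar> * inverse (sqrt (sqrt (real n))) + \<bar>b\<bar> * inverse (real n)"
        unfolding r_def[symmetric] unfolding r(2) .
    qed
  qed simp
qed

text \<open>By Borel--Cantelli, the deviations of almost every trajectory are eventually at most
  \<open>n powr (3 / 4)\<close>; this makes all estimators consistent.\<close>

locale typical = weighted_chain +
  fixes y :: "nat \<Rightarrow> nat" and \<alpha> :: real and T :: nat
  assumes \<alpha>: "0 < \<alpha>" and range: "\<And>t. 1 \<le> t \<Longrightarrow> y t < d" and contr: "contr d (A ^\<^sub>m T) (3 / 4)"
    and flat: "\<forall>\<^sub>F n in sequentially. flat_ok d A n (sqrt (sqrt (real n))) y"
    and stat_eq: "stationary A = p"
begin

lemma traj: "traj d n y \<alpha>" by unfold_locales (use d \<alpha> range in auto)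

abbreviation "phn n \<equiv> traj.ph d n y \<alpha>"
abbreviation "Mn n \<equiv> traj.MH d n y \<alpha>"

lemma ph_tendsto:
  assumes i: "i < d" shows "(\<lambda>n. phn n i) \<longlonglongrightarrow> p i"
proof -
  let ?s = "\<lambda>n. sqrt (sqrt (real n)) * sqrt (real n)"
  have lim: "(\<lambda>n. (2 * real T * ?s n + (4 * real T * (1 + (real d)\<^sup>2 * \<alpha>) + 1)) / (real n + (real d)\<^sup>2 * \<alpha>)) \<longlonglongrightarrow> 0"
    by (rule n34_tendsto) (use \<alpha> in simp)
  have "(\<lambda>n. phn n i - p i) \<longlonglongrightarrow> 0"
  proof (rule tendsto_rabs_zero_cancel, rule tendsto_sandwich[OF _ _ tendsto_const lim])
    show "\<forall>\<^sub>F n in sequentially. \<bar>phn n i - p i\<bar> \<le>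
        (2 * real T * ?s n + (4 * real T * (1 + (real d)\<^sup>2 * \<alpha>) + 1)) / (real n + (real d)\<^sup>2 * \<alpha>)"
      using flat eventually_ge_at_top[of "1::nat"]
    proof eventually_elim
      fix n assume f: "flat_ok d A n (sqrt (sqrt (real n))) y" and n: "1 \<le> n"
      interpret traj d n y \<alpha> by (rule traj)
      have "\<bar>ph i - p i\<bar> \<le> 4 * real T * ((?s n / 2 + 1 + (real d)\<^sup>2 * \<alpha>) / Z) + 1 / Z"
        by (rule ph_near_stationary[OF n stoch stat contr _ i]) (use f in \<open>auto simp: flat_ok_def\<close>)
      also have "\<dots> = (2 * real T * ?s n + (4 * real T * (1 + (real d)\<^sup>2 * \<alpha>) + 1)) / Z"
        using Z_pos by (simp add: field_simps)
      finally show "\<bar>ph i - p i\<bar> \<le> (2 * real T * ?s n + (4 * real T * (1 + (real d)\<^sup>2 * \<alpha>) + 1)) / (real n + (real d)\<^sup>2 * \<alpha>)"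
        by (simp only: Z_def)
    qed
  qed simp
  then show ?thesis by (rule LIM_zero_cancel)
qed

lemma M_tendsto:
  assumes i: "i < d" and j: "j < d" shows "(\<lambda>n. Mn n $$ (i, j)) \<longlonglongrightarrow> A $$ (i, j)"
proof -
  let ?s = "\<lambda>n. sqrt (sqrt (real n)) * sqrt (real n)"
  have "(\<lambda>n. (1 * ?s n + 2 * real d * \<alpha>) / (real n + (real d)\<^sup>2 * \<alpha>) / phn n i) \<longlonglongrightarrow> 0 / p i"
    using pos[OF i] \<alpha> by (intro tendsto_divide n34_tendsto ph_tendsto i) auto
  then have lim: "(\<lambda>n. (?s n + 2 * real d * \<alpha>) / (real n + (real d)\<^sup>2 * \<alpha>) / phn n i) \<longlonglongrightarrow> 0" by simp
  have "(\<lambda>n. Mn n $$ (i, j) - A $$ (i, j)) \<longlonglongrightarrow> 0"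
  proof (rule tendsto_rabs_zero_cancel, rule tendsto_sandwich[OF _ _ tendsto_const lim])
    show "\<forall>\<^sub>F n in sequentially. \<bar>Mn n $$ (i, j) - A $$ (i, j)\<bar> \<le> (?s n + 2 * real d * \<alpha>) / (real n + (real d)\<^sup>2 * \<alpha>) / phn n i"
      using flat
    proof eventually_elim
      fix n assume f: "flat_ok d A n (sqrt (sqrt (real n))) y"
      interpret traj d n y \<alpha> by (rule traj)
      have "\<bar>MH $$ (i, j) - A $$ (i, j)\<bar> \<le> (\<Sum>j<d. \<bar>MH $$ (i, j) - A $$ (i, j)\<bar>)"
        using j by (intro member_le_sum) auto
      also have "\<dots> \<le> ((\<Sum>j<d. \<bar>dev A n y i j\<bar>) + 2 * real d * \<alpha>) / Nt i" by (rule row_error[OF stoch i])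
      also have "\<dots> \<le> (?s n + 2 * real d * \<alpha>) / Nt i"
        using f i Nt_pos[of i] by (intro divide_right_mono add_right_mono) (auto simp: flat_ok_def)
      also have "\<dots> = (?s n + 2 * real d * \<alpha>) / Z / ph i" using Z_pos by (simp add: ph_eq)
      finally show "\<bar>MH $$ (i, j) - A $$ (i, j)\<bar> \<le> (?s n + 2 * real d * \<alpha>) / (real n + (real d)\<^sup>2 * \<alpha>) / ph i"
        by (simp only: Z_def)
    qed
  qed simp
  then show ?thesis by (rule LIM_zero_cancel)
qed

text \<open>The contraction used is that of the limit \<open>A\<close>, for which the stationary
  distribution of \<open>Mn n\<close> is nearly stationary; thus a single \<open>T\<close> serves
  all \<open>n\<close>.\<close>

lemma stationary_tendsto:
  assumes i: "i < d" shows "(\<lambda>n. stationary (Mn n) i) \<longlonglongrightarrow> p i"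
proof -
  let ?h = "\<lambda>n. \<Sum>i<d. \<Sum>j<d. \<bar>A $$ (i, j) - Mn n $$ (i, j)\<bar>"
  have "(\<lambda>n. real T * (?h n / 2) / (1 - 3 / 4)) \<longlonglongrightarrow> real T * ((\<Sum>i<d. \<Sum>j<d. \<bar>A $$ (i, j) - A $$ (i, j)\<bar>) / 2) / (1 - 3 / 4)"
    by (intro tendsto_intros M_tendsto) auto
  then have lim: "(\<lambda>n. real T * (?h n / 2) / (1 - 3 / 4)) \<longlonglongrightarrow> 0" by simp
  have "(\<lambda>n. p i - stationary (Mn n) i) \<longlonglongrightarrow> 0"
  proof (rule tendsto_rabs_zero_cancel, rule tendsto_sandwich[OF _ always_eventually tendsto_const lim], simp, intro allI)
    fix n
    interpret traj d n y \<alpha> by (rule traj)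
    interpret H: weighted_chain d MH "stationary MH" by (rule ergodic_weighted_chain[OF MH_ergodic d])
    have tot: "(\<Sum>i<d. stationary MH i * c) = c" for c by (simp add: sum_distrib_right[symmetric] H.sum_p)
    show "\<bar>p i - stationary MH i\<bar> \<le> real T * (?h n / 2) / (1 - 3 / 4)"
    proof (rule near_stationary_bound(2)[OF stoch contr _ _ _ i, where \<nu> = "\<lambda>i. p i - stationary MH i"])
      show "(\<Sum>i<d. p i - stationary MH i) = 0" by (simp add: sum_subtractf sum_p H.sum_p)
      fix f w assume f: "osc_le d f w"
      have w: "0 \<le> w" using osc_le_nonneg[OF f] d by simp
      have row: "(\<Sum>j<d. \<bar>A $$ (i, j) - MH $$ (i, j)\<bar>) \<le> ?h n" if "i < d" for i
        using that by (intro member_le_sum[where f = "\<lambda>i. \<Sum>j<d. \<bar>A $$ (i, j) - MH $$ (i, j)\<bar>"]) (auto intro: sum_nonneg)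
      have "ip d (\<lambda>i. p i - stationary MH i) f - ip d (\<lambda>i. p i - stationary MH i) (mv d A f)
          = ip d (stationary MH) (mv d A f) - ip d (stationary MH) (mv d MH f)"
        by (simp add: ip_linear ip_stat[OF stat] ip_stat[OF H.stat])
      then have eq: "ip d (\<lambda>i. p i - stationary MH i) f - ip d (\<lambda>i. p i - stationary MH i) (mv d A f)
          = (\<Sum>i<d. stationary MH i * (mv d A f i - mv d MH f i))"
        by (simp add: ip_def right_diff_distrib sum_subtractf)
      have "\<bar>\<Sum>i<d. stationary MH i * (mv d A f i - mv d MH f i)\<bar> \<le> (\<Sum>i<d. stationary MH i * (?h n * w / 2))"
      proof (rule order_trans[OF sum_abs], rule sum_mono)
        fix i assume "i \<in> {..<d}"
        then have i: "i < d" and pi: "0 \<le> stationary MH i" using H.pos[of i] by auto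
        show "\<bar>stationary MH i * (mv d A f i - mv d MH f i)\<bar> \<le> stationary MH i * (?h n * w / 2)"
          unfolding abs_mult abs_of_nonneg[OF pi]
          by (rule mult_left_mono[OF row_error_mv[OF stoch MH_stoch i row[OF i] f w] pi])
      qed
      then show "\<bar>ip d (\<lambda>i. p i - stationary MH i) f - ip d (\<lambda>i. p i - stationary MH i) (mv d A f)\<bar> \<le> ?h n / 2 * w"
        unfolding eq tot by simp
    qed simp
  qed
  then have "(\<lambda>n. p i - (p i - stationary (Mn n) i)) \<longlonglongrightarrow> p i - 0" by (intro tendsto_intros)
  then show ?thesis by simp
qed

text \<open>Lower semicontinuity is what the widths call for, since the gap stands in the
  denominator. It follows from the continuity of one term that nearly attains the supremum.\<close>

lemma eventually_pseudo_gap: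
  assumes c: "c < pseudo_gap A"
  shows "\<forall>\<^sub>F n in sequentially. c < pseudo_gap (Mn n)"
proof -
  obtain l where l: "1 \<le> l" "c < gram_gap d p (A ^\<^sub>m l) / real l" using pseudo_gap_approx[OF stat_eq c] by blast
  have Mc: "Mn n \<in> carrier_mat d d" for n by (rule traj.MH_carrier[OF traj])
  have "(\<lambda>n. gram_gap d (stationary (Mn n)) (Mn n ^\<^sub>m l) / real l) \<longlonglongrightarrow> gram_gap d p (A ^\<^sub>m l) / real l"
    using l(1) by (intro tendsto_intros gram_gap_tendsto[OF weighted_chain_pow] stationary_tendsto
      pow_mat_tendsto[OF Mc stochastic_matD(1)[OF stoch]] M_tendsto) auto
  from order_tendstoD(1)[OF this l(2)] show ?thesis
  proof eventually_elim
    fix n assume "c < gram_gap d (stationary (Mn n)) (Mn n ^\<^sub>m l) / real l"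
    moreover interpret H: weighted_chain d "Mn n" "stationary (Mn n)"
      by (rule ergodic_weighted_chain[OF traj.MH_ergodic[OF traj] d])
    have "gram_gap d (stationary (Mn n)) (Mn n ^\<^sub>m l) / real l \<le> pseudo_gap (Mn n)" by (rule H.pseudo_gap_upper[OF refl l(1)])
    ultimately show "c < pseudo_gap (Mn n)" by linarith
  qed
qed

lemma abs_gap_hat_tendsto:
  assumes "\<And>i j. i < d \<Longrightarrow> j < d \<Longrightarrow> p i * A $$ (i, j) = p j * A $$ (j, i)"
  shows "(\<lambda>n. abs_gap_hat d \<alpha> n y) \<longlonglongrightarrow> abs_spectral_gap A"
proof -
  have "abs_gap_hat d \<alpha> n y = abs_spectral_gap (sym_part d (conj_mat d (phn n) (Mn n)))" for n
    by (rule traj.abs_gap_hat_eq[OF traj])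
  moreover have "abs_spectral_gap A = abs_spectral_gap (sym_part d (conj_mat d p A))"
    by (rule abs_spectral_gap_reversible) (rule assms)
  moreover have "weighted_chain d A p" by unfold_locales
  ultimately show ?thesis by (simp only:) (intro abs_gap_tendsto ph_tendsto M_tendsto)
qed

lemma eventually_near:
  "\<forall>\<^sub>F n in sequentially. \<forall>i<d. 3 / 4 * p i \<le> phn n i \<and> phn n i \<le> 5 / 4 * p i"
proof -
  have "\<forall>\<^sub>F n in sequentially. \<forall>i\<in>{..<d}. 3 / 4 * p i < phn n i \<and> phn n i < 5 / 4 * p i"
  proof (intro eventually_ball_finite ballI eventually_conj)
    fix i assume "i \<in> {..<d}"
    then have i: "i < d" by simp
    show "\<forall>\<^sub>F n in sequentially. 3 / 4 * p i < phn n i" "\<forall>\<^sub>F n in sequentially. phn n i < 5 / 4 * p i"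
      by (rule order_tendstoD[OF ph_tendsto[OF i]], use pos[OF i] in simp)+
  qed simp
  then show ?thesis by eventually_elim (auto intro: less_imp_le)
qed

end

text \<open>\<open>A^T\<close> multiplies the oscillation of \<open>f\<close> by the
  \<open>T\<close>-th power of the modulus of \<open>l\<close>, which is at least 1, and by at most
  \<open>3 / 4\<close>; hence the oscillation is 0.\<close>

lemma eigenfunction_constant:
  assumes A: "stochastic_mat d A" and c: "contr d (A ^\<^sub>m T) (3 / 4)"
    and f: "\<And>i. i < d \<Longrightarrow> mv d A f i = l * f i" and l: "1 \<le> \<bar>l\<bar>" and ij: "i < d" "j < d"
  shows "f i = f j"
proof -
  have pw: "mv d (A ^\<^sub>m t) f i = l ^ t * f i" if "i < d" for t i
    using that
  proof (induction t arbitrary: i)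
    case 0
    then show ?case by (simp add: mv_pow_0[OF stochastic_matD(1)[OF A]] del: pow_mat.simps)
  next
    case (Suc t)
    have "mv d (A ^\<^sub>m Suc t) f i = mv d A (mv d (A ^\<^sub>m t) f) i"
      by (rule mv_pow_Suc[OF stochastic_matD(1)[OF A] Suc.prems])
    also have "mv d A (mv d (A ^\<^sub>m t) f) = mv d A (\<lambda>i. l ^ t * f i)" by (rule mv_cong) (rule Suc.IH)
    finally show ?case unfolding mv_scale f[OF Suc.prems] by simp
  qed
  have ne: "f ` {..<d} \<noteq> {}" using ij by auto
  obtain a where a: "a < d" "f a = Max (f ` {..<d})" using Max_in[OF _ ne] by auto
  obtain b where b: "b < d" "f b = Min (f ` {..<d})" using Min_in[OF _ ne] by auto
  define w where "w = f a - f b"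
  have ab: "f b \<le> f i" "f i \<le> f a" if "i < d" for i using that a b by auto
  have w0: "0 \<le> w" using ab[OF a(1)] by (simp add: w_def)
  have "osc_le d f w" unfolding osc_le_def w_def using ab by (meson diff_mono)
  then have "osc_le d (mv d (A ^\<^sub>m T) f) (3 / 4 * w)" using c by (simp add: contr_def)
  from osc_leD[OF this a(1) b(1)] osc_leD[OF this b(1) a(1)]
  have "l ^ T * w \<le> 3 / 4 * w" "- (l ^ T * w) \<le> 3 / 4 * w" by (simp_all add: pw a b w_def algebra_simps)
  then have "\<bar>l ^ T * w\<bar> \<le> 3 / 4 * w" by linarith
  then have "\<bar>l\<bar> ^ T * w \<le> 3 / 4 * w" using w0 by (simp add: abs_mult power_abs)
  moreover have "1 * w \<le> \<bar>l\<bar> ^ T * w" using l w0 by (intro mult_right_mono one_le_power) auto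
  ultimately have "w = 0" using w0 by simp
  then show ?thesis using ab[OF ij(1)] ab[OF ij(2)] by (simp add: w_def)
qed

context weighted_chain
begin

text \<open>The reverse of \<open>contr_of_wsq_contract\<close>: contraction of oscillations yields
  contraction of the weighted norm, again at the cost of \<open>1 / pm\<close>, which a high power
  beats. A single positive term of the supremum is enough.\<close>

lemma pseudo_gap_pos:
  assumes s: "stationary A = p" and c: "contr d (A ^\<^sub>m T) (3 / 4)"
  shows "0 < pseudo_gap A"
proof -
  have ne: "p ` {..<d} \<noteq> {}" using d by (auto simp: lessThan_empty_iff)
  define pm where "pm = Min (p ` {..<d})"
  have "pm \<in> p ` {..<d}" unfolding pm_def using ne by (intro Min_in) auto
  then have pm0: "0 < pm" using pos by auto
  have pm: "pm \<le> p i" if "i < d" for i unfolding pm_def using that by (intro Min_le) auto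
  obtain j where j: "(9 / 16 :: real) ^ j < pm / 8" using real_arch_pow_inv[of "pm / 8" "9 / 16"] pm0 by auto
  \<comment> \<open>The added 1 keeps \<open>k\<close> positive even if \<open>T\<close> or
    \<open>j\<close> is 0.\<close>
  define k where "k = T * j + 1"
  have "contr d ((A ^\<^sub>m T) ^\<^sub>m j) ((3 / 4) ^ j)" by (rule contr_pow[OF pow_mat_carrier[OF stochastic_matD(1)[OF stoch]] c])
  then have "contr d (A ^\<^sub>m (T * j)) ((3 / 4) ^ j)" by (simp add: pow_mat_mult[OF stochastic_matD(1)[OF stoch]])
  then have ck: "contr d (A ^\<^sub>m k) ((3 / 4) ^ j)" by (rule contr_pow_mono[OF stoch]) (simp add: k_def)
  interpret Wk: weighted_chain d "A ^\<^sub>m k" p by (rule weighted_chain_pow)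
  have "1 - 1 / 2 \<le> gram_gap d p (A ^\<^sub>m k)"
  proof (rule Wk.gram_gap_ge)
    fix f assume f: "ip d p f = 0"
    define F where "F = sqrt (wsq d p f / pm)"
    have wn: "0 \<le> wsq d p f" by (rule wsq_nonneg) (rule pos)
    have F: "\<bar>f i\<bar> \<le> F" if i: "i < d" for i
    proof -
      have "pm * (f i)\<^sup>2 \<le> p i * (f i)\<^sup>2" using pm[OF i] by (intro mult_right_mono) auto
      also have "\<dots> \<le> wsq d p f" unfolding wsq_def using i pos by (intro member_le_sum) (auto intro!: mult_nonneg_nonneg less_imp_le[OF pos])
      finally have "(f i)\<^sup>2 \<le> wsq d p f / pm" using pm0 by (simp add: pos_le_divide_eq mult.commute)
      then show ?thesis unfolding F_def by (rule real_le_rsqrt[of "\<bar>f i\<bar>", simplified])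
    qed
    have "osc_le d f (2 * F)" unfolding osc_le_def
    proof (intro allI impI)
      fix i i' assume "i < d" "i' < d"
      then show "f i - f i' \<le> 2 * F" using F[of i] F[of i'] by (simp add: abs_le_iff)
    qed
    then have o: "osc_le d (mv d (A ^\<^sub>m k) f) ((3 / 4) ^ j * (2 * F))" using ck by (simp add: contr_def)
    define g where "g = mv d (A ^\<^sub>m k) f"
    define w where "w = (3 / 4) ^ j * (2 * F)"
    have g0: "ip d p g = 0" unfolding g_def using f ip_stat[OF Wk.stat] by simp
    have gw: "\<bar>g i\<bar> \<le> w" if i: "i < d" for i
    proof -
      have "(\<Sum>j<d. p j * (g i - g j)) = g i"
        using g0 by (simp add: ip_def right_diff_distrib sum_subtractf sum_distrib_right[symmetric] sum_p)
      moreover have "\<bar>\<Sum>j<d. p j * (g i - g j)\<bar> \<le> (\<Sum>j<d. p j * w)"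
      proof (rule order_trans[OF sum_abs], rule sum_mono)
        fix j assume "j \<in> {..<d}"
        then have j: "j < d" "0 \<le> p j" using pos[of j] by auto
        have "\<bar>g i - g j\<bar> \<le> w" using osc_leD[OF o i j(1)] osc_leD[OF o j(1) i] by (simp add: g_def w_def abs_le_iff)
        then show "\<bar>p j * (g i - g j)\<bar> \<le> p j * w" using j(2) by (simp add: abs_mult mult_left_mono)
      qed
      moreover have "(\<Sum>j<d. p j * w) = w" by (simp add: sum_distrib_right[symmetric] sum_p)
      ultimately show ?thesis by simp
    qed
    have "wsq d p g \<le> (\<Sum>i<d. p i * w\<^sup>2)" unfolding wsq_def
    proof (rule sum_mono, rule mult_left_mono)
      fix i assume "i \<in> {..<d}"
      then show "(g i)\<^sup>2 \<le> w\<^sup>2" "0 \<le> p i" using gw[of i] pos[of i] power_mono[of "\<bar>g i\<bar>" w 2] by auto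
    qed
    also have "\<dots> = w\<^sup>2" by (simp add: sum_distrib_right[symmetric] sum_p)
    also have "\<dots> = 4 * ((9 / 16) ^ j) * F\<^sup>2"
      unfolding w_def by (simp add: power_mult_distrib power_mult[symmetric] mult.commute[of j]) (simp add: power_mult power2_eq_square)
    also have "F\<^sup>2 = wsq d p f / pm" unfolding F_def using wn pm0 by simp
    also have "4 * (9 / 16) ^ j * (wsq d p f / pm) \<le> 4 * (pm / 8) * (wsq d p f / pm)"
      using j wn pm0 by (intro mult_right_mono mult_left_mono) auto
    also have "\<dots> = 1 / 2 * wsq d p f" using pm0 by simp
    finally show "wsq d p (mv d (A ^\<^sub>m k) f) \<le> 1 / 2 * wsq d p f" by (simp add: g_def)
  qed
  then have "0 < gram_gap d p (A ^\<^sub>m k)" by simp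
  moreover have "0 < k" by (simp add: k_def)
  then have "0 < real k" by simp
  ultimately have "0 < gram_gap d p (A ^\<^sub>m k) / real k" by (rule divide_pos_pos)
  also have "\<dots> \<le> pseudo_gap A" by (rule pseudo_gap_upper[OF s]) (simp add: k_def)
  finally show ?thesis .
qed

text \<open>By \<open>eigenfunction_constant\<close>, an eigenvector of \<open>S\<close> whose
  eigenvalue has modulus at least 1 is a multiple of \<open>sqrt p\<close>, and its eigenvalue is 1.
  Two orthogonal such vectors cannot exist, so the second eigenvalue is below 1; the last one is
  below 1 too and hence has modulus below 1.\<close>

lemma abs_spectral_gap_pos:
  assumes rev: "\<And>i j. i < d \<Longrightarrow> j < d \<Longrightarrow> p i * A $$ (i, j) = p j * A $$ (j, i)"
    and c: "contr d (A ^\<^sub>m T) (3 / 4)"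
  shows "0 < abs_spectral_gap A"
proof -
  define S where "S = sym_part d (conj_mat d p A)"
  have S: "sym_mat d S" unfolding S_def by (rule sym_part_sym_mat)
  have SA: "mv d S (\<lambda>j. sqrt (p j) * f j) i = sqrt (p i) * mv d A f i" if i: "i < d" for f i
  proof -
    have "S $$ (i, j) = conj_mat d p A $$ (i, j)" if j: "j < d" for j
      unfolding S_def by (rule sym_part_conj_mat[OF i j rev[OF i j]])
    then have "mv d S (\<lambda>j. sqrt (p j) * f j) i = mv d (conj_mat d p A) (\<lambda>j. sqrt (p j) * f j) i"
      unfolding mv_def by (intro sum.cong) auto
    also have "\<dots> = sqrt (p i) * mv d A f i" by (rule mv_conj_mat[OF pos i])
    finally show ?thesis .
  qed
  obtain v where v: "orthonormal_upto d d v" and len: "length (eigvals S) = d"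
    and ev: "\<And>i a. i < d \<Longrightarrow> a < d \<Longrightarrow> mv d S (v i) a = eigvals S ! i * v i a"
    and dec: "\<And>i j. i \<le> j \<Longrightarrow> j < d \<Longrightarrow> eigvals S ! j \<le> eigvals S ! i"
    by (rule sym_mat_eigvals[OF S]) blast
  have const: "\<exists>t. (\<forall>a<d. v i a = sqrt (p a) * t) \<and> t = eigvals S ! i * t" if i: "i < d" and l: "1 \<le> \<bar>eigvals S ! i\<bar>" for i
  proof -
    obtain f where f: "\<And>a. a < d \<Longrightarrow> v i a = sqrt (p a) * f a" by (rule weight_sqrt_decomp[of "v i"]) blast
    have A: "mv d A f a = eigvals S ! i * f a" if a: "a < d" for a
    proof -
      have "sqrt (p a) * mv d A f a = mv d S (v i) a" unfolding SA[OF a, symmetric] by (rule fun_cong[OF mv_cong]) (simp add: f)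
      also have "\<dots> = sqrt (p a) * (eigvals S ! i * f a)" using ev[OF i a] f[OF a] by simp
      finally show ?thesis using pos[OF a] by simp
    qed
    have fc: "f a = f 0" if "a < d" for a
    proof (rule eigenfunction_constant[OF stoch c _ l that])
      show "mv d A f a = eigvals S ! i * f a" if "a < d" for a by (rule A[OF that])
    qed (use d in simp)
    have "mv d A f 0 = mv d A (\<lambda>_. f 0) 0" by (rule fun_cong[OF mv_cong]) (rule fc)
    also have "\<dots> = f 0" using mv_const[OF stoch] d by simp
    finally have "f 0 = eigvals S ! i * f 0" using A[of 0] d by simp
    moreover have "v i a = sqrt (p a) * f 0" if a: "a < d" for a
      unfolding f[OF a] fc[OF a] by (rule refl)
    ultimately show ?thesis by blast
  qed
  have ip_v: "ip d u u' = s * t"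
    if "\<And>a. a < d \<Longrightarrow> u a = sqrt (p a) * s" "\<And>a. a < d \<Longrightarrow> u' a = sqrt (p a) * t" for u u' s t
  proof -
    have "ip d u u' = ip d (\<lambda>a. sqrt (p a) * s) (\<lambda>a. sqrt (p a) * t)" by (rule ip_cong) (rule that, assumption)+
    then show ?thesis unfolding ip_sqrt by (simp add: sum_distrib_right[symmetric] sum_p)
  qed
  have on: "ip d (v i) (v j) = (if i = j then 1 else 0)" if "i < d" "j < d" for i j
    using v that by (simp add: orthonormal_upto_def)
  have 1: "eigvals S ! 1 < 1"
  proof (rule ccontr)
    assume "\<not> eigvals S ! 1 < 1"
    then have l: "1 \<le> \<bar>eigvals S ! 0\<bar>" "1 \<le> \<bar>eigvals S ! 1\<bar>" using dec[of 0 1] d by auto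
    obtain s where s: "\<And>a. a < d \<Longrightarrow> v 0 a = sqrt (p a) * s" using const[OF _ l(1)] d by auto
    obtain t where t: "\<And>a. a < d \<Longrightarrow> v 1 a = sqrt (p a) * t" using const[OF _ l(2)] d by auto
    have "ip d (v 0) (v 1) = s * t" by (rule ip_v[OF s t])
    moreover have "ip d (v 0) (v 0) = s * s" by (rule ip_v[OF s s])
    moreover have "ip d (v 1) (v 1) = t * t" by (rule ip_v[OF t t])
    ultimately show False using on[of 0 1] on[of 0 0] on[of 1 1] d by auto
  qed
  have 2: "\<bar>eigvals S ! (d - 1)\<bar> < 1"
  proof (rule ccontr)
    assume l: "\<not> \<bar>eigvals S ! (d - 1)\<bar> < 1"
    then obtain t where t: "\<And>a. a < d \<Longrightarrow> v (d - 1) a = sqrt (p a) * t" "t = eigvals S ! (d - 1) * t"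
      using const[of "d - 1"] d by auto
    have "1 \<le> d - 1" "d - 1 < d" using d by linarith+
    then have "eigvals S ! (d - 1) < 1" using dec[of 1 "d - 1"] 1 by linarith
    then have "t = 0" using t(2) by auto
    have "ip d (v (d - 1)) (v (d - 1)) = t * t" by (rule ip_v[OF t(1) t(1)])
    then show False using on[of "d - 1" "d - 1"] d \<open>t = 0\<close> by simp
  qed
  have "eigvals S \<noteq> []" using len d by auto
  then have "last (eigvals S) = eigvals S ! (d - 1)" by (simp add: last_conv_nth len)
  then have "0 < abs_spectral_gap S" using 1 2 by (simp add: abs_spectral_gap_def)
  moreover have "abs_spectral_gap A = abs_spectral_gap S"
    unfolding S_def by (rule abs_spectral_gap_reversible) (rule rev)
  ultimately show ?thesis by simp
qed

end

section \<open>Almost sure regularity of trajectories\<close>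

context chain
begin

text \<open>With threshold \<open>n^(1/4)\<close> the failure probability is a constant times
  \<open>exp (- sqrt n / 16)\<close>, which is summable by comparison with
  \<open>1 / n^2\<close>.\<close>

lemma AE_flat: "AE \<omega> in P. \<forall>\<^sub>F n in sequentially. flat_ok d M n (sqrt (sqrt (real n))) (\<lambda>t. X t \<omega>)"
proof -
  define B where "B n = {\<omega> \<in> space P. \<not> flat_ok d M n (sqrt (sqrt (real n))) (\<lambda>t. X t \<omega>)}" for n
  have B: "B n \<in> events" for n
  proof -
    have "B n = space P - {\<omega> \<in> space P. flat_ok d M n (sqrt (sqrt (real n))) (\<lambda>t. X t \<omega>)}" by (auto simp: B_def)
    then show ?thesis using sets_depends_upto[OF depends_flat_ok] by auto
  qed
  have "summable (\<lambda>n. prob (B n))"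
  proof (rule summable_comparison_test'[of _ 1])
    show "summable (\<lambda>n. (real d + 1) * 2 ^ d * (64 ^ 4 * inverse (real n ^ 2)))"
      by (intro summable_mult inverse_power_summable) auto
    fix n :: nat assume n: "1 \<le> n"
    define r where "r = sqrt (real n)"
    have r: "0 < r" "r ^ 4 = real n ^ 2" using n by (auto simp: r_def power2_eq_square power4_eq_xxxx)
    have "r / 64 \<le> exp (r / 64)" using exp_ge_add_one_self[of "r / 64"] by linarith
    then have "(r / 64) ^ 4 \<le> exp (r / 64) ^ 4" using r(1) by (intro power_mono) auto
    also have "\<dots> = exp (r / 16)" by (simp add: exp_of_nat_mult[symmetric])
    finally have "inverse (exp (r / 16)) \<le> inverse ((r / 64) ^ 4)" using r(1) by (intro le_imp_inverse_le) auto
    moreover have "inverse ((r / 64) ^ 4) = 64 ^ 4 * inverse (real n ^ 2)" unfolding power_divide r(2) inverse_divide by (rule divide_inverse)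
    ultimately have e: "exp (- (r / 16)) \<le> 64 ^ 4 * inverse (real n ^ 2)" by (simp only: exp_minus)
    have "prob (B n) \<le> (real d + 1) * 2 ^ d * exp (- ((sqrt (sqrt (real n)))\<^sup>2 / 16))"
      unfolding B_def by (rule prob_not_flat_ok[OF n]) simp
    also have "(sqrt (sqrt (real n)))\<^sup>2 / 16 = r / 16" by (simp add: r_def)
    also have "(real d + 1) * 2 ^ d * exp (- (r / 16)) \<le> (real d + 1) * 2 ^ d * (64 ^ 4 * inverse (real n ^ 2))"
      by (intro mult_left_mono e) auto
    finally show "norm (prob (B n)) \<le> (real d + 1) * 2 ^ d * (64 ^ 4 * inverse (real n ^ 2))" by simp
  qed
  then have "AE \<omega> in P. \<forall>\<^sub>F n in sequentially. \<omega> \<in> space P - B n"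
    by (rule borel_cantelli_AE1[OF B, rotated]) (simp add: less_top[symmetric])
  then show ?thesis
  proof eventually_elim
    fix \<omega> assume "\<forall>\<^sub>F n in sequentially. \<omega> \<in> space P - B n"
    then show "\<forall>\<^sub>F n in sequentially. flat_ok d M n (sqrt (sqrt (real n))) (\<lambda>t. X t \<omega>)"
      by eventually_elim (auto simp: B_def)
  qed
qed

end

lemma ergodic_contr:
  assumes M: "ergodic d M" and d: "0 < d"
  obtains T where "contr d (M ^\<^sub>m T) (3 / 4)"
proof -
  obtain t q where q: "q < 1" "0 \<le> q" "contr d (M ^\<^sub>m t) q" using ergodicD(4)[OF M d] by auto
  have C: "M \<in> carrier_mat d d" by (rule stochastic_matD(1)[OF ergodicD(1)[OF M d]])
  obtain j where j: "q ^ j < 3 / 4" using real_arch_pow_inv[of "3 / 4" q] q by auto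
  have "contr d ((M ^\<^sub>m t) ^\<^sub>m j) (q ^ j)" by (rule contr_pow[OF pow_mat_carrier[OF C] q(3)])
  then have "contr d (M ^\<^sub>m (t * j)) (3 / 4)" using j contr_mono by (auto simp: pow_mat_mult[OF C])
  then show thesis by (rule that)
qed

lemma (in chain) AE_typical:
  assumes M: "ergodic d M" and d: "2 \<le> d" and k: "1 \<le> k" and \<alpha>: "0 < \<alpha>"
  obtains T where "AE \<omega> in P. typical d (M ^\<^sub>m k) (stationary M) (skipped k r (\<lambda>t. X t \<omega>)) \<alpha> T"
proof -
  have d0: "0 < d" using d by simp
  note Mk = ergodic_pow[OF M d0 k]
  obtain T where T: "contr d ((M ^\<^sub>m k) ^\<^sub>m T) (3 / 4)" by (rule ergodic_contr[OF Mk(1) d0])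
  have W: "weighted_chain d (M ^\<^sub>m k) (stationary M)" using ergodic_weighted_chain[OF Mk(1) d] by (simp only: Mk(2))
  obtain \<mu>' where "chain d P (\<lambda>t. X (r + t * k)) (M ^\<^sub>m k) \<mu>'" by (rule chain_skipped[OF k])
  then interpret Y: chain d P "\<lambda>t. X (r + t * k)" "M ^\<^sub>m k" \<mu>' .
  have sk: "skipped k r (\<lambda>t. X t \<omega>) = (\<lambda>t. X (r + t * k) \<omega>)" for \<omega> by (simp add: skipped_def fun_eq_iff)
  have "AE \<omega> in P. typical d (M ^\<^sub>m k) (stationary M) (skipped k r (\<lambda>t. X t \<omega>)) \<alpha> T"
    using Y.AE_range Y.AE_flat
  proof eventually_elim
    fix \<omega>
    assume "\<forall>t\<ge>1. X (r + t * k) \<omega> < d"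
      "\<forall>\<^sub>F n in sequentially. flat_ok d (M ^\<^sub>m k) n (sqrt (sqrt (real n))) (\<lambda>t. X (r + t * k) \<omega>)"
    then show "typical d (M ^\<^sub>m k) (stationary M) (skipped k r (\<lambda>t. X t \<omega>)) \<alpha> T"
      unfolding sk by (intro typical.intro[OF W] typical_axioms.intro \<alpha> T Mk(2)) auto
  qed
  then show thesis by (rule that)
qed

text \<open>With \<open>r = m^(1/4)\<close> one has \<open>ln m = 4 * ln r \<le> 4 * r\<close>, so
  the product is of order \<open>1 / r\<close>.\<close>

lemma log_over_sqrt_tendsto:
  assumes "0 < a" "0 \<le> b"
  shows "(\<lambda>m. ln (a * ln (real m)) * sqrt (b / real m)) \<longlonglongrightarrow> 0"
proof -
  have "filterlim (\<lambda>m. sqrt (sqrt (real m))) at_top sequentially"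
    by (intro filterlim_compose[OF sqrt_at_top] filterlim_real_sequentially)
  then have "(\<lambda>m. inverse (sqrt (sqrt (real m)))) \<longlonglongrightarrow> 0" by (rule tendsto_inverse_0_at_top)
  then have lim: "(\<lambda>m. 4 * a * sqrt b * inverse (sqrt (sqrt (real m)))) \<longlonglongrightarrow> 4 * a * sqrt b * 0" by (intro tendsto_intros)
  have fl: "filterlim (\<lambda>m. ln (real m)) at_top sequentially"
    by (rule filterlim_compose[OF ln_at_top filterlim_real_sequentially])
  have "\<forall>\<^sub>F m in sequentially. 1 / a \<le> ln (real m)" using fl by (simp add: filterlim_at_top)
  then have ev: "\<forall>\<^sub>F m in sequentially. 1 \<le> m \<and> 1 / a \<le> ln (real m)"
    by (intro eventually_conj eventually_ge_at_top)
  show ?thesis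
  proof (rule tendsto_sandwich[OF _ _ tendsto_const lim[simplified]])
    show "\<forall>\<^sub>F m in sequentially. 0 \<le> ln (a * ln (real m)) * sqrt (b / real m)"
      using ev
    proof eventually_elim
      fix m :: nat assume "1 \<le> m \<and> 1 / a \<le> ln (real m)"
      then have "1 \<le> a * ln (real m)" using assms by (simp add: field_simps)
      then show "0 \<le> ln (a * ln (real m)) * sqrt (b / real m)" using assms by simp
    qed
    show "\<forall>\<^sub>F m in sequentially. ln (a * ln (real m)) * sqrt (b / real m) \<le> 4 * a * sqrt b * inverse (sqrt (sqrt (real m)))"
      using ev
    proof eventually_elim
      fix m :: nat assume m: "1 \<le> m \<and> 1 / a \<le> ln (real m)"
      define r where "r = sqrt (sqrt (real m))"
      have r: "0 < r" "sqrt (real m) = r * r" using m by (auto simp: r_def)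
      have "0 < 1 / a" using assms by simp
      then have lp: "0 < ln (real m)" using m by linarith
      have e: "ln (real m) = 4 * ln r" using m by (simp add: r_def ln_sqrt)
      have "ln (a * ln (real m)) \<le> a * ln (real m)" using assms lp ln_le_minus_one[of "a * ln (real m)"] by simp
      also have "\<dots> \<le> a * (4 * r)" unfolding e using ln_le_minus_one[OF r(1)] assms by simp
      finally have "ln (a * ln (real m)) \<le> 4 * a * r" by (simp only: mult_ac)
      then have "ln (a * ln (real m)) * sqrt (b / real m) \<le> 4 * a * r * sqrt (b / real m)"
        using assms by (intro mult_right_mono) auto
      also have "\<dots> = 4 * a * r * (sqrt b / (r * r))" by (simp only: real_sqrt_divide r(2))
      also have "\<dots> = 4 * a * sqrt b * inverse r" using r(1) by (simp add: field_simps)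
      finally show "ln (a * ln (real m)) * sqrt (b / real m) \<le> 4 * a * sqrt b * inverse (sqrt (sqrt (real m)))"
        by (simp only: r_def)
    qed
  qed
qed

section \<open>Eventual bounds on the widths\<close>

lemma filterlim_sublen:
  assumes k: "1 \<le> k" shows "filterlim (\<lambda>m. sublen m k r) at_top sequentially"
  unfolding filterlim_at_top
proof
  fix Z :: nat
  show "\<forall>\<^sub>F m in sequentially. Z \<le> sublen m k r"
  proof (rule eventually_sequentiallyI)
    fix m assume "Z * k + r \<le> m"
    then show "Z \<le> sublen m k r" using k by (simp add: sublen_def less_eq_div_iff_mult_less_eq)
  qed
qed

lemma eventually_sublen_bounds:
  assumes r: "r < k"
  shows "\<forall>\<^sub>F m in sequentially. sublen m k r \<le> m \<and> real m \<le> 2 * real k * real (sublen m k r)"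
proof (rule eventually_sequentiallyI)
  fix m assume m: "4 * k \<le> m"
  have k: "0 < real k" using r by simp
  have "real m / real k - 2 \<le> real (sublen m k r)" by (rule sublen_ge[OF r])
  then have "real m - 2 * real k \<le> real k * real (sublen m k r)" using k by (simp add: field_simps)
  moreover have "4 * real k \<le> real m" using of_nat_mono[OF m, where 'a = real] by simp
  moreover have "sublen m k r \<le> m" unfolding sublen_def by (meson diff_le_self div_le_dividend order_trans)
  ultimately show "sublen m k r \<le> m \<and> real m \<le> 2 * real k * real (sublen m k r)" by simp
qed

text \<open>Collects the conditions of \<open>width_bounds\<close> that hold from some length on and
  transports them from the skipped length to \<open>m\<close>. The gap estimate is an arbitrary
  sequence \<open>G\<close>, which covers both the pseudo-spectral and the absolute gap.\<close>

lemma (in typical) eventually_widths: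
  assumes \<delta>: "0 < \<delta>" "\<delta> < 1" and \<gamma>: "0 < \<gamma>" "\<gamma> \<le> 1" "\<forall>\<^sub>F n in sequentially. \<gamma> / 2 \<le> G n"
    and r: "r < k"
    and pst0: "0 < pst" "\<forall>i<d. pst \<le> p i" and N0: "\<forall>i<d. \<forall>j<d. p i / p j \<le> N"
  defines "l \<equiv> ln (real d / (\<delta> * pst * \<gamma>))" and "L \<equiv> \<lambda>m. ln (real d * ln (real m) / \<delta>)"
    and "R \<equiv> \<lambda>m. sqrt (real d / (pst * real m))"
  shows "\<forall>\<^sub>F m in sequentially.
    b_width 192 (G (sublen m k r)) d \<alpha> \<delta> (sublen m k r) 1 0 y \<le> ereal (196608 * (l * L m) * (sqrt (real k) * R m / \<gamma>)) \<and>
    gap_width 192 (G (sublen m k r)) d \<alpha> \<delta> (sublen m k r) 1 0 y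
      \<le> ereal (1179648 * (l * L m) * (sqrt (real k) * R m * (sqrt (real d) * N + 1 / (\<gamma> * pst))))"
proof -
  have pst: "0 < pst" "\<And>i. i < d \<Longrightarrow> pst \<le> p i" and N: "\<And>i j. i < d \<Longrightarrow> j < d \<Longrightarrow> p i / p j \<le> N"
    using pst0 N0 by auto
  have k: "1 \<le> k" using r by simp
  have pd: "pst \<le> 1 / real d"
  proof -
    have "(\<Sum>i<d. pst) \<le> (\<Sum>i<d. p i)" using pst by (intro sum_mono) auto
    then show ?thesis using d by (simp add: sum_p field_simps)
  qed
  \<comment> \<open>From length \<open>n0\<close> on, \<open>D \<ge> \<alpha>^2 * d\<close>, so that
    deviations dominate the smoothing bias.\<close>
  obtain n0 :: nat where n0: "\<alpha>\<^sup>2 * real d / (3 / 4 * pst) \<le> real n0" using real_arch_simple by blast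
  have lim: "(\<lambda>m. 196608 * l * sqrt (real k) / \<gamma> * (L m * R m)) \<longlonglongrightarrow> 196608 * l * sqrt (real k) / \<gamma> * 0"
  proof (intro tendsto_intros)
    have "(\<lambda>m. ln (real d / \<delta> * ln (real m)) * sqrt (real d / pst / real m)) \<longlonglongrightarrow> 0"
      by (rule log_over_sqrt_tendsto) (use d \<delta> pst in auto)
    then show "(\<lambda>m. L m * R m) \<longlonglongrightarrow> 0" by (simp add: L_def R_def)
  qed
  have small: "\<forall>\<^sub>F m in sequentially. 196608 * l * sqrt (real k) / \<gamma> * (L m * R m) < pst / 4"
    by (rule order_tendstoD(2)[OF lim]) (use pst in simp)
  have "\<forall>\<^sub>F n in sequentially. \<gamma> / 2 \<le> G n \<and> (\<forall>i<d. 3 / 4 * p i \<le> phn n i \<and> phn n i \<le> 5 / 4 * p i) \<and> n0 \<le> n \<and> 3 \<le> n"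
    by (intro eventually_conj \<gamma>(3) eventually_near eventually_ge_at_top)
  then have "\<forall>\<^sub>F m in sequentially. \<gamma> / 2 \<le> G (sublen m k r) \<and>
      (\<forall>i<d. 3 / 4 * p i \<le> phn (sublen m k r) i \<and> phn (sublen m k r) i \<le> 5 / 4 * p i) \<and> n0 \<le> sublen m k r \<and> 3 \<le> sublen m k r"
    by (rule eventually_compose_filterlim[OF _ filterlim_sublen[OF k]])
  then show ?thesis using small eventually_sublen_bounds[OF r]
  proof eventually_elim
    fix m
    define n where "n = sublen m k r"
    assume "\<gamma> / 2 \<le> G (sublen m k r) \<and>
      (\<forall>i<d. 3 / 4 * p i \<le> phn (sublen m k r) i \<and> phn (sublen m k r) i \<le> 5 / 4 * p i) \<and> n0 \<le> sublen m k r \<and> 3 \<le> sublen m k r"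
      and sm: "196608 * l * sqrt (real k) / \<gamma> * (L m * R m) < pst / 4"
      and "sublen m k r \<le> m \<and> real m \<le> 2 * real k * real (sublen m k r)"
    then have g: "\<gamma> / 2 \<le> G n" and near: "\<And>i. i < d \<Longrightarrow> 3 / 4 * p i \<le> phn n i" "\<And>i. i < d \<Longrightarrow> phn n i \<le> 5 / 4 * p i"
      and n: "n0 \<le> n" "3 \<le> n" "n \<le> m" "real m \<le> 2 * real k * real n" by (auto simp: n_def)
    interpret C: conf d n y \<alpha> \<delta> by (rule conf.intro[OF traj]) (unfold_locales, (rule \<delta>)+)
    have D: "\<alpha>\<^sup>2 * real d \<le> C.D"
    proof -
      obtain i where i: "i < d" "C.D = C.Nt i" by (rule C.D_attained)
      have "\<alpha>\<^sup>2 * real d \<le> 3 / 4 * pst * real n0" using n0 pst by (simp add: field_simps)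
      also have "\<dots> \<le> C.ph i * C.Z"
      proof (rule mult_mono)
        show "3 / 4 * pst \<le> C.ph i" using near(1)[OF i(1)] pst(2)[OF i(1)] by simp
        have "real n0 \<le> real n" using n(1) by simp
        then show "real n0 \<le> C.Z" unfolding C.Z_def using \<alpha> by (simp add: add_increasing2)
      qed (use C.ph_pos[of i] in auto)
      also have "\<dots> = C.D" using C.Z_pos by (simp add: C.ph_eq i(2))
      finally show ?thesis .
    qed
    have sm': "196608 * (l * L m) * (sqrt (real k) * R m / \<gamma>) \<le> pst / 4" using sm by (simp add: mult_ac)
    note wb = C.width_bounds[where p = p and k = k, OF near pst pd N \<gamma>(1,2) g D n(2,3,4), folded l_def]
    show "b_width 192 (G (sublen m k r)) d \<alpha> \<delta> (sublen m k r) 1 0 y \<le> ereal (196608 * (l * L m) * (sqrt (real k) * R m / \<gamma>)) \<and>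
      gap_width 192 (G (sublen m k r)) d \<alpha> \<delta> (sublen m k r) 1 0 y
        \<le> ereal (1179648 * (l * L m) * (sqrt (real k) * R m * (sqrt (real d) * N + 1 / (\<gamma> * pst))))"
      using wb(1) wb(2) sm' unfolding n_def[symmetric] L_def R_def by blast
  qed
qed

lemma log_factor_bounds:
  assumes "2 \<le> d" "0 < \<delta>" "\<delta> < 1" "0 < pst" "pst \<le> 1" "0 < \<gamma>" "\<gamma> \<le> 1" "3 \<le> m"
  shows "0 \<le> ln (real d / (\<delta> * pst * \<gamma>)) * ln (real d * ln (real m) / \<delta>)"
proof (intro mult_nonneg_nonneg ln_ge_zero)
  have "\<delta> * pst * \<gamma> \<le> 1 * 1 * 1" using assms by (intro mult_mono) auto
  then show "1 \<le> real d / (\<delta> * pst * \<gamma>)" using assms by simp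
  have "3 \<le> real m" using assms by simp
  with exp_le have "exp 1 \<le> real m" by (rule order_trans)
  then have "1 \<le> ln (real m)" using assms by (simp add: ln_ge_iff)
  then have "1 * 1 \<le> real d * ln (real m)" using assms by (intro mult_mono) auto
  then show "1 \<le> real d * ln (real m) / \<delta>" using assms by simp
qed

lemma ergodic_parameters:
  assumes M: "ergodic d M" and d: "2 \<le> d"
  shows "0 < pi_star M" "\<forall>i<d. pi_star M \<le> stationary M i" "pi_star M \<le> 1"
    "\<forall>i<d. \<forall>j<d. stationary M i / stationary M j \<le> norm_pi M" "0 \<le> norm_pi M"
proof -
  interpret W: weighted_chain d M "stationary M" by (rule ergodic_weighted_chain[OF M d])
  have dim: "dim_row M = d" using stochastic_matD(1)[OF W.stoch] by simp
  have ne: "stationary M ` {..<d} \<noteq> {}" using d by (auto simp: lessThan_empty_iff)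
  have "pi_star M \<in> stationary M ` {..<d}" unfolding pi_star_def dim using ne by (intro Min_in) auto
  then show "0 < pi_star M" using W.pos by auto
  have le: "pi_star M \<le> stationary M i" if "i < d" for i unfolding pi_star_def dim using that by (intro Min_le) auto
  then show "\<forall>i<d. pi_star M \<le> stationary M i" by blast
  have "stationary M 0 \<le> (\<Sum>i<d. stationary M i)" using d less_imp_le[OF W.pos] by (intro member_le_sum) auto
  then show "pi_star M \<le> 1" using le[of 0] d W.sum_p by simp
  have n: "stationary M i / stationary M j \<le> norm_pi M" if "i < d" "j < d" for i j
    unfolding norm_pi_def dim by (rule Max_ge) (use that in force)+
  then show "\<forall>i<d. \<forall>j<d. stationary M i / stationary M j \<le> norm_pi M" by blast
  show "0 \<le> norm_pi M" using n[of 0 0] W.pos[of 0] d by simp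
qed

lemma (in typical) typical_pseudo_gap:
  assumes c: "0 < c" "c \<le> pseudo_gap A"
  shows "\<forall>\<^sub>F n in sequentially. c / 2 \<le> pseudo_gap (M_hat d \<alpha> n 1 0 y)"
proof -
  have "\<forall>\<^sub>F n in sequentially. c / 2 < pseudo_gap (Mn n)" by (rule eventually_pseudo_gap) (use c in simp)
  then show ?thesis unfolding traj.MH_def[OF traj] by eventually_elim simp
qed

context chain
begin

lemma ps_b_width_asymptotics:
  assumes M: "ergodic d M" and d: "2 \<le> d" and \<delta>: "0 < \<delta>" "\<delta> < 1" and \<alpha>: "0 < \<alpha>" and c: "196608 \<le> c"
  shows "AE \<omega> in P. \<forall>\<^sub>F m in sequentially. ps_b_width 192 d \<alpha> \<delta> m 1 0 (\<lambda>t. X t \<omega>)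
    \<le> ereal (c * log_factor 1 d \<delta> (pi_star M) (pseudo_gap M) m * (sqrt (real d) / (pseudo_gap M * sqrt (pi_star M * real m))))"
proof -
  note E = ergodic_parameters[OF M d]
  interpret W: weighted_chain d M "stationary M" by (rule ergodic_weighted_chain[OF M d])
  obtain T where "AE \<omega> in P. typical d (M ^\<^sub>m 1) (stationary M) (skipped 1 0 (\<lambda>t. X t \<omega>)) \<alpha> T"
    by (rule AE_typical[OF M d order_refl \<alpha>])
  then show ?thesis
  proof eventually_elim
    fix \<omega> assume "typical d (M ^\<^sub>m 1) (stationary M) (skipped 1 0 (\<lambda>t. X t \<omega>)) \<alpha> T"
    then interpret typical d M "stationary M" "\<lambda>t. X t \<omega>" \<alpha> T using stochastic_matD(1)[OF W.stoch] by simp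
    have g: "0 < pseudo_gap M" "pseudo_gap M \<le> 1" using W.pseudo_gap_pos[OF refl contr] W.pseudo_gap_bounds[OF refl] by auto
    have r01: "(0::nat) < 1" by simp
    from eventually_widths[OF \<delta> g typical_pseudo_gap[OF g(1) order_refl] r01 E(1,2,4)]
    have "\<forall>\<^sub>F m in sequentially. b_width 192 (pseudo_gap (M_hat d \<alpha> m 1 0 (\<lambda>t. X t \<omega>))) d \<alpha> \<delta> m 1 0 (\<lambda>t. X t \<omega>)
      \<le> ereal (196608 * (ln (real d / (\<delta> * pi_star M * pseudo_gap M)) * ln (real d * ln (real m) / \<delta>)) * (sqrt (real d / (pi_star M * real m)) / pseudo_gap M))"
      by (rule eventually_mono) simp
    then show "\<forall>\<^sub>F m in sequentially. ps_b_width 192 d \<alpha> \<delta> m 1 0 (\<lambda>t. X t \<omega>)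
      \<le> ereal (c * log_factor 1 d \<delta> (pi_star M) (pseudo_gap M) m * (sqrt (real d) / (pseudo_gap M * sqrt (pi_star M * real m))))"
      using eventually_ge_at_top[of 3]
    proof eventually_elim
      fix m :: nat
      assume w: "b_width 192 (pseudo_gap (M_hat d \<alpha> m 1 0 (\<lambda>t. X t \<omega>))) d \<alpha> \<delta> m 1 0 (\<lambda>t. X t \<omega>)
        \<le> ereal (196608 * (ln (real d / (\<delta> * pi_star M * pseudo_gap M)) * ln (real d * ln (real m) / \<delta>)) * (sqrt (real d / (pi_star M * real m)) / pseudo_gap M))"
        and m: "3 \<le> m"
      have "196608 * (ln (real d / (\<delta> * pi_star M * pseudo_gap M)) * ln (real d * ln (real m) / \<delta>)) * (sqrt (real d / (pi_star M * real m)) / pseudo_gap M)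
        \<le> c * (ln (real d / (\<delta> * pi_star M * pseudo_gap M)) * ln (real d * ln (real m) / \<delta>)) * (sqrt (real d / (pi_star M * real m)) / pseudo_gap M)"
        by (rule mult_right_mono[OF mult_right_mono[OF c log_factor_bounds[OF d \<delta> E(1,3) g m]]]) (use E(1) g in simp)
      also have "\<dots> = c * log_factor 1 d \<delta> (pi_star M) (pseudo_gap M) m * (sqrt (real d) / (pseudo_gap M * sqrt (pi_star M * real m)))"
        by (simp add: log_factor_def real_sqrt_divide real_sqrt_mult mult_ac)
      finally show "ps_b_width 192 d \<alpha> \<delta> m 1 0 (\<lambda>t. X t \<omega>)
        \<le> ereal (c * log_factor 1 d \<delta> (pi_star M) (pseudo_gap M) m * (sqrt (real d) / (pseudo_gap M * sqrt (pi_star M * real m))))"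
        using w unfolding ps_b_width_def by (meson ereal_less_eq(3) order_trans)
    qed
  qed
qed

lemma ps_gap_width_asymptotics:
  assumes M: "ergodic d M" and d: "2 \<le> d" and \<delta>: "0 < \<delta>" "\<delta> < 1" and \<alpha>: "0 < \<alpha>" and K: "1 \<le> K"
  shows "AE \<omega> in P. \<forall>\<^sub>F m in sequentially. ps_gap_width 192 d \<alpha> \<delta> m K (\<lambda>t. X t \<omega>)
    \<le> ereal (1 / real K + 2359296 * log_factor 1 d \<delta> (pi_star M) (pseudo_gap M) m *
        (sqrt (real d / (pi_star M * real m)) * (sqrt (real d) * norm_pi M + 1 / (pseudo_gap M * pi_star M))))"
proof -
  note E = ergodic_parameters[OF M d]
  interpret W: weighted_chain d M "stationary M" by (rule ergodic_weighted_chain[OF M d])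
  obtain T where T: "contr d (M ^\<^sub>m T) (3 / 4)" using ergodic_contr[OF M] d by auto
  have g: "0 < pseudo_gap M" "pseudo_gap M \<le> 1" using W.pseudo_gap_pos[OF refl T] W.pseudo_gap_bounds[OF refl] by auto
  define Y where "Y m = log_factor 1 d \<delta> (pi_star M) (pseudo_gap M) m *
    (sqrt (real d / (pi_star M * real m)) * (sqrt (real d) * norm_pi M + 1 / (pseudo_gap M * pi_star M)))" for m
  define I where "I = (SIGMA k:{1..K}. {..<k})"
  have I: "finite I" by (simp add: I_def)
  define F where "F \<omega> m k r = gap_width 192 (pseudo_gap (M_hat d \<alpha> m k r (\<lambda>t. X t \<omega>))) d \<alpha> \<delta> m k r (\<lambda>t. X t \<omega>)" for \<omega> m k r
  have one: "AE \<omega> in P. \<forall>\<^sub>F m in sequentially. F \<omega> m (fst i) (snd i) \<le> ereal (1179648 * sqrt (real (fst i)) * Y m)" if i: "i \<in> I" for i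
  proof -
    obtain k r where kr: "i = (k, r)" "1 \<le> k" "r < k" using i by (auto simp: I_def)
    obtain T where "AE \<omega> in P. typical d (M ^\<^sub>m k) (stationary M) (skipped k r (\<lambda>t. X t \<omega>)) \<alpha> T"
      by (rule AE_typical[OF M d kr(2) \<alpha>])
    then have "AE \<omega> in P. \<forall>\<^sub>F m in sequentially. F \<omega> m k r \<le> ereal (1179648 * sqrt (real k) * Y m)"
    proof eventually_elim
      fix \<omega> assume "typical d (M ^\<^sub>m k) (stationary M) (skipped k r (\<lambda>t. X t \<omega>)) \<alpha> T"
      then interpret typical d "M ^\<^sub>m k" "stationary M" "skipped k r (\<lambda>t. X t \<omega>)" \<alpha> T .
      \<comment> \<open>The gap estimates at skip \<open>k\<close> approach at least
        \<open>pseudo_gap (M^k)\<close>; this bound lets one gap, that of \<open>M\<close>, appear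
        for all skips.\<close>
      have gk: "pseudo_gap M \<le> pseudo_gap (M ^\<^sub>m k)" by (rule W.pseudo_gap_pow_ge[OF refl stat_eq kr(2)])
      from eventually_widths[OF \<delta> g typical_pseudo_gap[OF g(1) gk] kr(3) E(1,2,4)]
      show "\<forall>\<^sub>F m in sequentially. F \<omega> m k r \<le> ereal (1179648 * sqrt (real k) * Y m)"
      proof eventually_elim
        case (elim m)
        have eq: "F \<omega> m k r = gap_width 192 (pseudo_gap (M_hat d \<alpha> (sublen m k r) 1 0 (skipped k r (\<lambda>t. X t \<omega>)))) d \<alpha> \<delta> (sublen m k r) 1 0 (skipped k r (\<lambda>t. X t \<omega>))"
          unfolding F_def M_hat_skipped[of d \<alpha> m k r "\<lambda>t. X t \<omega>"] by (rule gap_width_skipped)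
        show ?case unfolding eq using conjunct2[OF elim] by (simp add: Y_def log_factor_def mult_ac)
      qed
    qed
    then show ?thesis by (simp add: kr(1))
  qed
  have "AE \<omega> in P. \<forall>i\<in>I. \<forall>\<^sub>F m in sequentially. F \<omega> m (fst i) (snd i) \<le> ereal (1179648 * sqrt (real (fst i)) * Y m)"
    by (rule AE_finite_allI[OF I one])
  then show ?thesis
  proof eventually_elim
    fix \<omega> assume "\<forall>i\<in>I. \<forall>\<^sub>F m in sequentially. F \<omega> m (fst i) (snd i) \<le> ereal (1179648 * sqrt (real (fst i)) * Y m)"
    then have "\<forall>\<^sub>F m in sequentially. \<forall>i\<in>I. F \<omega> m (fst i) (snd i) \<le> ereal (1179648 * sqrt (real (fst i)) * Y m)"
      using I by (simp add: eventually_ball_finite)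
    then show "\<forall>\<^sub>F m in sequentially. ps_gap_width 192 d \<alpha> \<delta> m K (\<lambda>t. X t \<omega>)
      \<le> ereal (1 / real K + 2359296 * log_factor 1 d \<delta> (pi_star M) (pseudo_gap M) m *
        (sqrt (real d / (pi_star M * real m)) * (sqrt (real d) * norm_pi M + 1 / (pseudo_gap M * pi_star M))))"
      using eventually_ge_at_top[of 3]
    proof eventually_elim
      fix m :: nat
      assume F: "\<forall>i\<in>I. F \<omega> m (fst i) (snd i) \<le> ereal (1179648 * sqrt (real (fst i)) * Y m)" and m: "3 \<le> m"
      have Y0: "0 \<le> Y m" unfolding Y_def log_factor_def power_one_right
        by (rule mult_nonneg_nonneg[OF log_factor_bounds[OF d \<delta> E(1,3) g m]]) (use E(1,5) g in simp)
      have "Max ((\<lambda>k. ereal (1 / (real k)\<^sup>2) * (\<Sum>r<k. F \<omega> m k r)) ` {1..K}) \<le> ereal (1179648 * Y m)"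
      proof (intro Max.boundedI)
        fix e assume "e \<in> (\<lambda>k. ereal (1 / (real k)\<^sup>2) * (\<Sum>r<k. F \<omega> m k r)) ` {1..K}"
        then obtain k where k: "1 \<le> k" "k \<le> K" "e = ereal (1 / (real k)\<^sup>2) * (\<Sum>r<k. F \<omega> m k r)" by auto
        have "(\<Sum>r<k. F \<omega> m k r) \<le> (\<Sum>r<k. ereal (1179648 * sqrt (real k) * Y m))"
          using F k(1,2) by (intro sum_mono) (force simp: I_def)
        also have "\<dots> = ereal (real k * (1179648 * sqrt (real k) * Y m))" by simp
        finally have "e \<le> ereal (1 / (real k)\<^sup>2) * ereal (real k * (1179648 * sqrt (real k) * Y m))"
          unfolding k(3) by (rule ereal_mult_left_mono) simp
        \<comment> \<open>The \<open>sqrt k\<close> due to shorter trajectories is dominated by the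
          division by \<open>k\<close> that remains after averaging over the offsets.\<close>
        also have "\<dots> = ereal (1179648 * Y m * (sqrt (real k) / real k))"
          using k(1) by (simp add: power2_eq_square)
        also have "\<dots> \<le> ereal (1179648 * Y m * 1)"
        proof -
          have "sqrt (real k) \<le> real k" using k(1) by (intro real_le_lsqrt) (auto simp: power2_eq_square)
          then have "sqrt (real k) / real k \<le> 1" using k(1) by simp
          then have "1179648 * Y m * (sqrt (real k) / real k) \<le> 1179648 * Y m * 1"
            using Y0 by (intro mult_left_mono) auto
          then show ?thesis by (simp only: ereal_less_eq(3))
        qed
        finally show "e \<le> ereal (1179648 * Y m)" by simp
      qed (use K in auto)
      then have "2 * Max ((\<lambda>k. ereal (1 / (real k)\<^sup>2) * (\<Sum>r<k. F \<omega> m k r)) ` {1..K}) \<le> 2 * ereal (1179648 * Y m)"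
        by (rule ereal_mult_left_mono) simp
      then have "ps_gap_width 192 d \<alpha> \<delta> m K (\<lambda>t. X t \<omega>) \<le> ereal (1 / real K) + 2 * ereal (1179648 * Y m)"
        unfolding ps_gap_width_def F_def by (rule add_left_mono)
      also have "\<dots> = ereal (1 / real K + 2359296 * Y m)" by simp
      finally show "ps_gap_width 192 d \<alpha> \<delta> m K (\<lambda>t. X t \<omega>)
        \<le> ereal (1 / real K + 2359296 * log_factor 1 d \<delta> (pi_star M) (pseudo_gap M) m *
          (sqrt (real d / (pi_star M * real m)) * (sqrt (real d) * norm_pi M + 1 / (pseudo_gap M * pi_star M))))"
        by (simp only: Y_def mult.assoc)
    qed
  qed
qed

lemma rev_asymptotics:
  assumes M: "ergodic d M" and d: "2 \<le> d" and \<delta>: "0 < \<delta>" "\<delta> < 1" and \<alpha>: "0 < \<alpha>" and rev: "reversible M" and c: "1179648 \<le> c"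
  shows "AE \<omega> in P. \<forall>\<^sub>F m in sequentially.
      rev_b_width 192 d \<alpha> \<delta> m (\<lambda>t. X t \<omega>) \<le> ereal (c * log_factor 1 d \<delta> (pi_star M) (abs_spectral_gap M) m *
        (sqrt (real d) / (abs_spectral_gap M * sqrt (pi_star M * real m)))) \<and>
      rev_gap_width 192 d \<alpha> \<delta> m (\<lambda>t. X t \<omega>) \<le> ereal (c * log_factor 1 d \<delta> (pi_star M) (abs_spectral_gap M) m *
        (sqrt (real d / (pi_star M * real m)) * (sqrt (real d) * norm_pi M + 1 / (abs_spectral_gap M * pi_star M))))"
proof -
  note E = ergodic_parameters[OF M d] and bal = reversible_detailed_balance[OF M d rev]
  interpret W: weighted_chain d M "stationary M" by (rule ergodic_weighted_chain[OF M d])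
  define g where "g = abs_spectral_gap M"
  obtain T where "AE \<omega> in P. typical d (M ^\<^sub>m 1) (stationary M) (skipped 1 0 (\<lambda>t. X t \<omega>)) \<alpha> T"
    by (rule AE_typical[OF M d order_refl \<alpha>])
  then show ?thesis unfolding g_def[symmetric]
  proof eventually_elim
    fix \<omega> assume "typical d (M ^\<^sub>m 1) (stationary M) (skipped 1 0 (\<lambda>t. X t \<omega>)) \<alpha> T"
    then interpret typical d M "stationary M" "\<lambda>t. X t \<omega>" \<alpha> T using stochastic_matD(1)[OF W.stoch] by simp
    have g0: "0 < g" unfolding g_def by (rule W.abs_spectral_gap_pos[OF bal contr])
    have g1: "g \<le> 1" unfolding g_def by (rule W.abs_spectral_gap_bounds(2)[OF bal])
    have "\<forall>\<^sub>F n in sequentially. g / 2 < abs_gap_hat d \<alpha> n (\<lambda>t. X t \<omega>)"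
      by (rule order_tendstoD(1)[OF abs_gap_hat_tendsto[OF bal]]) (use g0 in \<open>auto simp: g_def\<close>)
    then have ev: "\<forall>\<^sub>F n in sequentially. g / 2 \<le> abs_gap_hat d \<alpha> n (\<lambda>t. X t \<omega>)" by eventually_elim simp
    have r01: "(0::nat) < 1" by simp
    from eventually_widths[OF \<delta> g0 g1 ev r01 E(1,2,4)]
    have "\<forall>\<^sub>F m in sequentially. rev_b_width 192 d \<alpha> \<delta> m (\<lambda>t. X t \<omega>)
        \<le> ereal (196608 * (ln (real d / (\<delta> * pi_star M * g)) * ln (real d * ln (real m) / \<delta>)) * (sqrt (real d / (pi_star M * real m)) / g)) \<and>
      rev_gap_width 192 d \<alpha> \<delta> m (\<lambda>t. X t \<omega>)
        \<le> ereal (1179648 * (ln (real d / (\<delta> * pi_star M * g)) * ln (real d * ln (real m) / \<delta>)) *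
            (sqrt (real d / (pi_star M * real m)) * (sqrt (real d) * norm_pi M + 1 / (g * pi_star M))))"
      unfolding rev_b_width_def rev_gap_width_def by simp
    then show "\<forall>\<^sub>F m in sequentially.
      rev_b_width 192 d \<alpha> \<delta> m (\<lambda>t. X t \<omega>) \<le> ereal (c * log_factor 1 d \<delta> (pi_star M) g m * (sqrt (real d) / (g * sqrt (pi_star M * real m)))) \<and>
      rev_gap_width 192 d \<alpha> \<delta> m (\<lambda>t. X t \<omega>) \<le> ereal (c * log_factor 1 d \<delta> (pi_star M) g m *
        (sqrt (real d / (pi_star M * real m)) * (sqrt (real d) * norm_pi M + 1 / (g * pi_star M))))"
      using eventually_ge_at_top[of 3]
    proof eventually_elim
      fix m :: nat
      let ?l = "ln (real d / (\<delta> * pi_star M * g)) * ln (real d * ln (real m) / \<delta>)"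
      assume w: "rev_b_width 192 d \<alpha> \<delta> m (\<lambda>t. X t \<omega>) \<le> ereal (196608 * ?l * (sqrt (real d / (pi_star M * real m)) / g)) \<and>
        rev_gap_width 192 d \<alpha> \<delta> m (\<lambda>t. X t \<omega>) \<le> ereal (1179648 * ?l *
            (sqrt (real d / (pi_star M * real m)) * (sqrt (real d) * norm_pi M + 1 / (g * pi_star M))))"
        and m: "3 \<le> m"
      have l0: "0 \<le> ?l" by (rule log_factor_bounds[OF d \<delta> E(1,3) g0 g1 m])
      have "196608 * ?l * (sqrt (real d / (pi_star M * real m)) / g) \<le> c * ?l * (sqrt (real d / (pi_star M * real m)) / g)"
        by (rule mult_right_mono[OF mult_right_mono[OF _ l0]]) (use c E(1) g0 in auto)
      also have "\<dots> = c * log_factor 1 d \<delta> (pi_star M) g m * (sqrt (real d) / (g * sqrt (pi_star M * real m)))"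
        by (simp add: log_factor_def real_sqrt_divide real_sqrt_mult mult_ac)
      finally have 1: "ereal (196608 * ?l * (sqrt (real d / (pi_star M * real m)) / g))
        \<le> ereal (c * log_factor 1 d \<delta> (pi_star M) g m * (sqrt (real d) / (g * sqrt (pi_star M * real m))))" by simp
      have "1179648 * ?l * (sqrt (real d / (pi_star M * real m)) * (sqrt (real d) * norm_pi M + 1 / (g * pi_star M)))
        \<le> c * ?l * (sqrt (real d / (pi_star M * real m)) * (sqrt (real d) * norm_pi M + 1 / (g * pi_star M)))"
        by (rule mult_right_mono[OF mult_right_mono[OF c l0]]) (use E(1,5) g0 in simp)
      then have 2: "ereal (1179648 * ?l * (sqrt (real d / (pi_star M * real m)) * (sqrt (real d) * norm_pi M + 1 / (g * pi_star M))))
        \<le> ereal (c * log_factor 1 d \<delta> (pi_star M) g m * (sqrt (real d / (pi_star M * real m)) * (sqrt (real d) * norm_pi M + 1 / (g * pi_star M))))"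
        by (simp add: log_factor_def)
      show "rev_b_width 192 d \<alpha> \<delta> m (\<lambda>t. X t \<omega>) \<le> ereal (c * log_factor 1 d \<delta> (pi_star M) g m * (sqrt (real d) / (g * sqrt (pi_star M * real m)))) \<and>
        rev_gap_width 192 d \<alpha> \<delta> m (\<lambda>t. X t \<omega>) \<le> ereal (c * log_factor 1 d \<delta> (pi_star M) g m *
          (sqrt (real d / (pi_star M * real m)) * (sqrt (real d) * norm_pi M + 1 / (g * pi_star M))))"
        using order_trans[OF conjunct1[OF w] 1] order_trans[OF conjunct2[OF w] 2] by (rule conjI)
    qed
  qed
qed

end

theorem theoremB1:
  shows "\<exists>C::real. 0 < C \<and> C \<le> 192 \<and>
    (\<exists>c0::real. c0 > 0 \<and> (\<forall>(d::nat) (m::nat) (\<delta>::real). d \<ge> 2 \<and> m \<ge> 3 \<and> 0 < \<delta> \<and> \<delta> < 1 \<longrightarrow>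
       tau d \<delta> m \<le> c0 * ln (real d * ln (real m) / \<delta>))) \<and>
    (\<exists>(c::real) (p::nat). c > 0 \<and>
      (\<forall>(d::nat) (M::real mat) (\<mu>::nat \<Rightarrow> real) (P::(nat \<Rightarrow> nat) measure)
         (X::nat \<Rightarrow> (nat \<Rightarrow> nat) \<Rightarrow> nat) (\<delta>::real) (\<alpha>::real) (K::nat).
         d \<ge> 2 \<and> ergodic d M \<and> distribution d \<mu> \<and> markov_chain P X M \<mu> \<and>
         0 < \<delta> \<and> \<delta> < 1 \<and> 0 < \<alpha> \<and> 1 \<le> K \<longrightarrow>
         (\<forall>m\<ge>1. measure P {\<omega> \<in> space P.
            ereal \<bar>pseudo_gap_hat d \<alpha> m K (\<lambda>t. X t \<omega>) - pseudo_gap M\<bar>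
              \<le> ps_gap_width C d \<alpha> \<delta> m K (\<lambda>t. X t \<omega>)} \<ge> 1 - \<delta>) \<and>
         (AE \<omega> in P. \<forall>\<^sub>F m in sequentially.
            ps_b_width C d \<alpha> \<delta> m 1 0 (\<lambda>t. X t \<omega>)
              \<le> ereal (c * log_factor p d \<delta> (pi_star M) (pseudo_gap M) m *
                   (sqrt (real d) / (pseudo_gap M * sqrt (pi_star M * real m))))) \<and>
         (AE \<omega> in P. \<forall>\<^sub>F m in sequentially.
            ps_gap_width C d \<alpha> \<delta> m K (\<lambda>t. X t \<omega>)
              \<le> ereal (1 / real K + c * log_factor p d \<delta> (pi_star M) (pseudo_gap M) m *
                   (sqrt (real d / (pi_star M * real m)) *
                    (sqrt (real d) * norm_pi M + 1 / (pseudo_gap M * pi_star M))))) \<and>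
         (reversible M \<longrightarrow>
           (\<forall>m\<ge>1. measure P {\<omega> \<in> space P.
              ereal \<bar>abs_gap_hat d \<alpha> m (\<lambda>t. X t \<omega>) - abs_spectral_gap M\<bar>
                \<le> rev_gap_width C d \<alpha> \<delta> m (\<lambda>t. X t \<omega>) \<and>
              ereal \<bar>pi_star_hat d \<alpha> m (\<lambda>t. X t \<omega>) - pi_star M\<bar>
                \<le> rev_b_width C d \<alpha> \<delta> m (\<lambda>t. X t \<omega>)} \<ge> 1 - \<delta>) \<and>
           (AE \<omega> in P. \<forall>\<^sub>F m in sequentially.
              rev_b_width C d \<alpha> \<delta> m (\<lambda>t. X t \<omega>)
                \<le> ereal (c * log_factor p d \<delta> (pi_star M) (abs_spectral_gap M) m *
                     (sqrt (real d) / (abs_spectral_gap M * sqrt (pi_star M * real m))))) \<and>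
           (AE \<omega> in P. \<forall>\<^sub>F m in sequentially.
              rev_gap_width C d \<alpha> \<delta> m (\<lambda>t. X t \<omega>)
                \<le> ereal (c * log_factor p d \<delta> (pi_star M) (abs_spectral_gap M) m *
                     (sqrt (real d / (pi_star M * real m)) *
                      (sqrt (real d) * norm_pi M + 1 / (abs_spectral_gap M * pi_star M))))))))"
proof (rule exI[of _ 192], rule conjI, simp, rule conjI, simp, rule conjI, rule exI[of _ 8], use tau_upper in force,
    rule exI[of _ 2359296], rule exI[of _ 1], intro conjI allI impI)
  fix d K :: nat and M :: "real mat" and \<mu> :: "nat \<Rightarrow> real" and P :: "(nat \<Rightarrow> nat) measure" and X :: "nat \<Rightarrow> (nat \<Rightarrow> nat) \<Rightarrow> nat" and \<delta> \<alpha> :: real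
  assume *: "d \<ge> 2 \<and> ergodic d M \<and> distribution d \<mu> \<and> markov_chain P X M \<mu> \<and>
    0 < \<delta> \<and> \<delta> < 1 \<and> 0 < \<alpha> \<and> 1 \<le> K"
  then have d: "2 \<le> d" and M: "ergodic d M" and \<delta>: "0 < \<delta>" "\<delta> < 1" and \<alpha>: "0 < \<alpha>" and K: "1 \<le> K" by auto
  interpret chain d P X M \<mu> by unfold_locales (use * ergodicD(1)[OF M] in auto)
  {
    fix m :: nat
    show "measure P {\<omega> \<in> space P. ereal \<bar>pseudo_gap_hat d \<alpha> m K (\<lambda>t. X t \<omega>) - pseudo_gap M\<bar>
        \<le> ps_gap_width 192 d \<alpha> \<delta> m K (\<lambda>t. X t \<omega>)} \<ge> 1 - \<delta>"
      by (rule ps_coverage[OF M d \<delta> \<alpha> K])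
  }
  \<comment> \<open>The constant is \<open>2 * 1179648\<close>, with the factor 2 from the maximum
    in the width for the pseudo-spectral gap; it also serves for the other three widths.\<close>
  show "AE \<omega> in P. \<forall>\<^sub>F m in sequentially. ps_b_width 192 d \<alpha> \<delta> m 1 0 (\<lambda>t. X t \<omega>)
      \<le> ereal (2359296 * log_factor 1 d \<delta> (pi_star M) (pseudo_gap M) m *
          (sqrt (real d) / (pseudo_gap M * sqrt (pi_star M * real m))))"
    by (rule ps_b_width_asymptotics[OF M d \<delta> \<alpha>]) simp
  show "AE \<omega> in P. \<forall>\<^sub>F m in sequentially. ps_gap_width 192 d \<alpha> \<delta> m K (\<lambda>t. X t \<omega>)
      \<le> ereal (1 / real K + 2359296 * log_factor 1 d \<delta> (pi_star M) (pseudo_gap M) m *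
          (sqrt (real d / (pi_star M * real m)) * (sqrt (real d) * norm_pi M + 1 / (pseudo_gap M * pi_star M))))"
    by (rule ps_gap_width_asymptotics[OF M d \<delta> \<alpha> K])
  assume rev: "reversible M"
  {
    fix m :: nat assume "1 \<le> m"
    then show "measure P {\<omega> \<in> space P. ereal \<bar>abs_gap_hat d \<alpha> m (\<lambda>t. X t \<omega>) - abs_spectral_gap M\<bar>
          \<le> rev_gap_width 192 d \<alpha> \<delta> m (\<lambda>t. X t \<omega>) \<and>
        ereal \<bar>pi_star_hat d \<alpha> m (\<lambda>t. X t \<omega>) - pi_star M\<bar> \<le> rev_b_width 192 d \<alpha> \<delta> m (\<lambda>t. X t \<omega>)} \<ge> 1 - \<delta>"
      by (rule rev_coverage[OF M d \<delta> \<alpha> rev])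
  }
  note asym = rev_asymptotics[OF M d \<delta> \<alpha> rev, of 2359296]
  show "AE \<omega> in P. \<forall>\<^sub>F m in sequentially. rev_b_width 192 d \<alpha> \<delta> m (\<lambda>t. X t \<omega>)
      \<le> ereal (2359296 * log_factor 1 d \<delta> (pi_star M) (abs_spectral_gap M) m *
          (sqrt (real d) / (abs_spectral_gap M * sqrt (pi_star M * real m))))"
    by (rule AE_mp[OF asym]) (auto elim: eventually_mono)
  show "AE \<omega> in P. \<forall>\<^sub>F m in sequentially. rev_gap_width 192 d \<alpha> \<delta> m (\<lambda>t. X t \<omega>)
      \<le> ereal (2359296 * log_factor 1 d \<delta> (pi_star M) (abs_spectral_gap M) m *
          (sqrt (real d / (pi_star M * real m)) * (sqrt (real d) * norm_pi M + 1 / (abs_spectral_gap M * pi_star M))))"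
    by (rule AE_mp[OF asym]) (auto elim: eventually_mono)
qed simp

end
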